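(* If $n\geq 5$ and $b=0$, then the problem $$\begin{cases} -\Delta u = n(n-2)|u|^{\frac{4}{n-2}}u &\text{in } \mathbb{R}^n_+,\\ \frac{\partial u}{\partial x_n} = -b|u|^{\frac{2}{n-2}}u &\text{on }\partial\mathbb{R}^n_+,\end{cases}$$ (i.e. with homogeneous Neumann boundary condition $\frac{\partial u}{\partial x_n}=0$ on $\partial\mathbb{R}^n_+$) has infinitely many sign-changing solutions.
   Context: $\mathbb{R}^n_+:=\{(x_1,\ldots,x_n)\in\mathbb{R}^n: x_n>0\}$. Let $p:=\frac{2n}{n-2}$, $q:=\frac{2(n-1)}{n-2}$, $a_n:=n(n-2)$ and $D^{1,2}(\mathbb{R}^n_+):=\{u\in L^p(\mathbb{R}^n_+):\nabla u\in L^2(\mathbb{R}^n_+,\mathbb{R}^n)\}$. A solution of the problem is a (weak) solution $u\in D^{1,2}(\mathbb{R}^n_+)$, i.e. a critical point of the functional $J_b(u)=\frac12\int_{\mathbb{R}^n_+}|\nabla u|^2-\frac{a_n}{p}\int_{\mathbb{R}^n_+}|u|^p-\frac{b}{q}\int_{\partial\mathbb{R}^n_+}|u|^q$ on $D^{1,2}(\mathbb{R}^n_+)$; equivalently, $\int_{\mathbb{R}^n_+}\nabla u\cdot\nabla v=a_n\int_{\mathbb{R}^n_+}|u|^{p-2}uv+b\int_{\partial\mathbb{R}^n_+}|u|^{q-2}uv$ for all $v\in D^{1,2}(\mathbb{R}^n_+)$ (boundary integrals are of traces). A solution is sign-changing if both its positive part and its negative part are nontrivial. *)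

theory Defs
  imports "HOL-Analysis.Analysis"
begin

text \<open>
  \<open>R\<^sup>n\<close> is split as \<open>R\<^sup>n\<^sup>-\<^sup>1 \<times> R\<close>, the second component being the distinguished coordinate
  \<open>x\<^sub>n\<close>; the norm and inner product of the product type are the Euclidean ones. Thus
  \<open>n = DIM((real ^ 'm) \<times> real) = CARD('m) + 1\<close>, and the boundary of the half-space is
  \<open>R\<^sup>n\<^sup>-\<^sup>1 \<times> {0}\<close>, with surface measure the Lebesgue measure of \<open>real ^ 'm\<close>.

  Elements of Lebesgue and Sobolev spaces are represented by total functions; only their values on
  the half-space matter, and only up to null sets.
\<close>

type_synonym 'm rn = "(real ^ 'm) \<times> real"

definition half_space :: "('m::finite) rn set" where
  "half_space = {x. snd x > 0}"

definition p_exp :: "nat \<Rightarrow> real" where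
  "p_exp n = 2 * real n / (real n - 2)"

definition q_exp :: "nat \<Rightarrow> real" where
  "q_exp n = 2 * (real n - 1) / (real n - 2)"

definition a_const :: "nat \<Rightarrow> real" where
  "a_const n = real n * (real n - 2)"

text \<open>The space \<open>L\<^sup>r(S)\<close>, for real \<open>r > 0\<close>.\<close>

definition Lr :: "real \<Rightarrow> 'a::euclidean_space set \<Rightarrow> ('a \<Rightarrow> 'b::euclidean_space) set" where
  "Lr r S = {u \<in> borel_measurable (lebesgue_on S).
               integrable (lebesgue_on S) (\<lambda>x. norm (u x) powr r)}"

definition locally_integrable_on ::
    "('a::euclidean_space \<Rightarrow> 'b::euclidean_space) \<Rightarrow> 'a set \<Rightarrow> bool" where
  "locally_integrable_on u S \<longleftrightarrow> (\<forall>K. compact K \<and> K \<subseteq> S \<longrightarrow> integrable (lebesgue_on K) u)"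

primrec C_k :: "nat \<Rightarrow> ('a::euclidean_space \<Rightarrow> real) \<Rightarrow> bool" where
  "C_k 0 f \<longleftrightarrow> continuous_on UNIV f"
| "C_k (Suc k) f \<longleftrightarrow>
     f differentiable_on UNIV \<and> (\<forall>e\<in>Basis. C_k k (\<lambda>x. frechet_derivative f (at x) e))"

text \<open>\<open>C\<^sub>c\<^sup>\<infinity>(S)\<close>; its elements are extended by zero outside \<open>S\<close>.\<close>

definition test_functions :: "'a::euclidean_space set \<Rightarrow> ('a \<Rightarrow> real) set" where
  "test_functions S =
     {\<phi>. (\<forall>k. C_k k \<phi>) \<and> (\<exists>K. compact K \<and> K \<subseteq> S \<and> (\<forall>x. x \<notin> K \<longrightarrow> \<phi> x = 0))}"

definition grad :: "('a::euclidean_space \<Rightarrow> real) \<Rightarrow> 'a \<Rightarrow> 'a" where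
  "grad f x = (\<Sum>e\<in>Basis. frechet_derivative f (at x) e *\<^sub>R e)"

definition is_weak_gradient ::
    "'a::euclidean_space set \<Rightarrow> ('a \<Rightarrow> real) \<Rightarrow> ('a \<Rightarrow> 'a) \<Rightarrow> bool" where
  "is_weak_gradient S u G \<longleftrightarrow>
     locally_integrable_on u S \<and> locally_integrable_on G S \<and>
     (\<forall>\<phi>\<in>test_functions S. \<forall>e\<in>Basis.
        (\<integral>x. u x * (grad \<phi> x \<bullet> e) \<partial>lebesgue_on S) = - (\<integral>x. (G x \<bullet> e) * \<phi> x \<partial>lebesgue_on S))"

definition D12 :: "(('m::finite) rn \<Rightarrow> real) set" where
  "D12 = {u \<in> Lr (p_exp DIM('m rn)) half_space.
            \<exists>G \<in> Lr 2 half_space. is_weak_gradient half_space u G}"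

text \<open>Weak gradients are unique almost everywhere, so for \<open>u\<close> in \<open>D12\<close> the choice is immaterial.\<close>

definition weak_grad :: "(('m::finite) rn \<Rightarrow> real) \<Rightarrow> 'm rn \<Rightarrow> 'm rn" where
  "weak_grad u = (SOME G. is_weak_gradient half_space u G)"

text \<open>
  The trace operator \<open>D\<^sup>1\<^sup>,\<^sup>2 \<rightarrow> L\<^sup>q\<close> is the continuous extension of the restriction to the boundary
  of functions in \<open>C\<^sub>c\<^sup>\<infinity>(R\<^sup>n)\<close>, whose restrictions to the half-space are dense in \<open>D12\<close> for \<open>n \<ge> 3\<close>.
  By the trace inequality \<open>g\<close> exists for every \<open>u\<close> in \<open>D12\<close> and is unique almost everywhere.
\<close>

definition is_trace :: "(('m::finite) rn \<Rightarrow> real) \<Rightarrow> (real ^ 'm \<Rightarrow> real) \<Rightarrow> bool" where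
  "is_trace u g \<longleftrightarrow>
     g \<in> Lr (q_exp DIM('m rn)) UNIV \<and>
     (\<exists>\<phi>. (\<forall>k::nat. \<phi> k \<in> test_functions UNIV) \<and>
        (\<lambda>k. \<integral>x. \<bar>\<phi> k x - u x\<bar> powr p_exp DIM('m rn) \<partial>lebesgue_on half_space) \<longlonglongrightarrow> 0 \<and>
        (\<lambda>k. \<integral>x. (norm (grad (\<phi> k) x - weak_grad u x))\<^sup>2 \<partial>lebesgue_on half_space) \<longlonglongrightarrow> 0 \<and>
        (\<lambda>k. \<integral>y. \<bar>\<phi> k (y, 0) - g y\<bar> powr q_exp DIM('m rn) \<partial>lebesgue) \<longlonglongrightarrow> 0)"

definition trace_bd :: "(('m::finite) rn \<Rightarrow> real) \<Rightarrow> real ^ 'm \<Rightarrow> real" where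
  "trace_bd u = (SOME g. is_trace u g)"

text \<open>
  Weak solutions of \<open>-\<Delta>u = n(n-2) |u|\<^bsup>4/(n-2)\<^esup> u\<close> in the half-space,
  \<open>\<partial>u/\<partial>x\<^sub>n = -b |u|\<^bsup>2/(n-2)\<^esup> u\<close> on its boundary; here \<open>p - 2 = 4/(n-2)\<close> and
  \<open>q - 2 = 2/(n-2)\<close>.
\<close>

definition is_solution :: "real \<Rightarrow> (('m::finite) rn \<Rightarrow> real) \<Rightarrow> bool" where
  "is_solution b u \<longleftrightarrow>
     u \<in> D12 \<and>
     (\<forall>v\<in>D12.
        (\<integral>x. weak_grad u x \<bullet> weak_grad v x \<partial>lebesgue_on half_space) =
          a_const DIM('m rn) *
            (\<integral>x. \<bar>u x\<bar> powr (p_exp DIM('m rn) - 2) * u x * v x \<partial>lebesgue_on half_space)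
        + b * (\<integral>y. \<bar>trace_bd u y\<bar> powr (q_exp DIM('m rn) - 2) * trace_bd u y * trace_bd v y
                 \<partial>lebesgue))"

definition sign_changing :: "(('m::finite) rn \<Rightarrow> real) \<Rightarrow> bool" where
  "sign_changing u \<longleftrightarrow>
     \<not> (AE x in lebesgue_on half_space. max (u x) 0 = 0) \<and>
     \<not> (AE x in lebesgue_on half_space. min (u x) 0 = 0)"

definition ae_equal :: "((('m::finite) rn \<Rightarrow> real) \<times> ('m rn \<Rightarrow> real)) set" where
  "ae_equal = {(u, v). AE x in lebesgue_on half_space. u x = v x}"

end

theory Submission
  imports Defs "HOL-Complex_Analysis.Great_Picard" "HOL-Computational_Algebra.Polynomial"
begin

text \<open>
  Write \<open>D = 1 + |x - a|\<^sup>2\<close> for a boundary point \<open>a\<close>, and let \<open>Q\<close> be the sum of the squares of three tangential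
  coordinates of \<open>x - a\<close>. Under stereographic projection \<open>\<sigma> = 4Q/D\<^sup>2\<close> becomes the squared length of three
  coordinates on the sphere, so functions \<open>u = D powr (-(n-2)/2) * f \<sigma>\<close> solve the equation iff \<open>f\<close> solves
  \<open>4s(1-s)f'' + (6-2(n+1)s)f' = n(n-2)/4 * (f - |f| powr (p-2) * f)\<close> on \<open>(0,1)\<close>; being even in \<open>x\<^sub>n\<close>, they
  satisfy the Neumann condition. A change of variables turns this into \<open>w'' = - V |w| powr (p-2) * w\<close> with
  \<open>w\<close> vanishing at both end points, where a nodal solution arises by gluing a positive and a negative
  ground state at the point which makes the total energy minimal. Since the solutions decay away from \<open>a\<close>, moving \<open>a\<close>
  along the boundary to infinity gives infinitely many distinct ones.
\<close>

subsection \<open>Dirichlet energy through partitions\<close>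

text \<open>The exponent \<open>p\<close> is critical, so minimising sequences for the full problem
  may concentrate. The profiles are invariant under rotations of three coordinates and of the
  remaining \<open>n - 2\<close> coordinates of the sphere in dimension \<open>n + 1\<close>; no
  orbit is a single point, and the compactness gained appears as the number
  \<open>\<delta> > 0\<close> in \<open>bvp_weight\<close>. Three coordinates are taken because a
  radial function \<open>f\<close> in three dimensions turns into \<open>z * f\<close>, whose
  equation has no singular first order term at 0. For \<open>n \<ge> 5\<close> the exponent
  \<open>\<nu> = (n - 4) / 2\<close> of the fundamental solutions is positive, so their quotient can
  serve as a new variable. The one-dimensional variational problem is treated without Sobolev
  spaces: energies are suprema of sums of squared increments over lengths, test functions are
  piecewise linear, and convexity replaces the differentiation of the nonlinear functional. The
  minimisers give \<open>f\<close> only on the open interval, and the profile equation is singular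
  at both ends; bounds for \<open>f\<close> and \<open>f'\<close> there have to be proved before
  \<open>U f\<close> can be tested against all of \<open>D12\<close>.\<close>

text \<open>Repeated partition points contribute \<open>0\<close>, since \<open>0 / 0 = 0\<close>.\<close>

definition esum :: "(real \<Rightarrow> real) \<Rightarrow> (nat \<Rightarrow> real) \<Rightarrow> nat \<Rightarrow> real" where
  "esum f x n = (\<Sum>i<n. (f (x (Suc i)) - f (x i))\<^sup>2 / (x (Suc i) - x i))"

text \<open>The supremum of these sums is the integral of f'^2 if \<open>f\<close> belongs to the
  Sobolev space W^{1,2}, and infinite otherwise (a criterion of F. Riesz). Only upper bounds are
  recorded. Partitions are monotone rather than strictly increasing sequences, so that clipping one
  at a point by \<open>min\<close> or \<open>max\<close> gives a partition again.\<close>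

definition energy_le :: "(real \<Rightarrow> real) \<Rightarrow> real \<Rightarrow> real \<Rightarrow> real \<Rightarrow> bool" where
  "energy_le f a b C \<longleftrightarrow> (\<forall>x n. mono x \<and> x 0 = a \<and> x n = b \<longrightarrow> esum f x n \<le> C)"

lemma energy_leI:
  assumes "\<And>x n. mono x \<Longrightarrow> x 0 = a \<Longrightarrow> x n = b \<Longrightarrow> esum f x n \<le> C"
  shows "energy_le f a b C"
  using assms unfolding energy_le_def by blast

lemma energy_leD: "energy_le f a b C \<Longrightarrow> mono x \<Longrightarrow> x 0 = a \<Longrightarrow> x n = b \<Longrightarrow> esum f x n \<le> C"
  unfolding energy_le_def by blast

lemma energy_le_mono: "energy_le f a b C \<Longrightarrow> C \<le> C' \<Longrightarrow> energy_le f a b C'"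
  unfolding energy_le_def by fastforce

lemma esum_nonneg: "mono x \<Longrightarrow> esum f x n \<ge> 0"
  unfolding esum_def by (intro sum_nonneg divide_nonneg_nonneg) (auto simp: mono_iff_le_Suc)

lemma monoI_Suc: "(\<And>i. x i \<le> x (Suc i)) \<Longrightarrow> mono (x :: nat \<Rightarrow> real)"
  by (simp add: mono_iff_le_Suc)

text \<open>The partition without interior points already contains the Cauchy-Schwarz inequality
  behind the Hoelder bounds below.\<close>

lemma energy_le_chord:
  assumes "energy_le f a b C" "a \<le> b"
  shows "(f b - f a)\<^sup>2 \<le> C * (b - a)" "(f b - f a)\<^sup>2 / (b - a) \<le> C" "C \<ge> 0"
proof -
  define x where "x i = (if i = 0 then a else b)" for i :: nat
  have "mono x" using assms(2) by (intro monoI_Suc) (auto simp: x_def)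
  then have "esum f x 1 \<le> C" by (intro energy_leD[OF assms(1)]) (auto simp: x_def)
  then show 1: "(f b - f a)\<^sup>2 / (b - a) \<le> C" by (simp add: esum_def x_def)
  show "C \<ge> 0" using 1 assms(2) by (meson diff_ge_0_iff_ge dual_order.trans divide_nonneg_nonneg zero_le_power2)
  show "(f b - f a)\<^sup>2 \<le> C * (b - a)"
    using 1 assms(2) by (cases "a = b") (auto simp: divide_le_eq)
qed

text \<open>The difference of the two sides is a perfect square over a positive number. In terms of
  partitions: inserting a point does not decrease the sum.\<close>

lemma square_add_over_le:
  fixes a b p q :: real
  assumes "p > 0" "q > 0"
  shows "(a + b)\<^sup>2 / (p + q) \<le> a\<^sup>2 / p + b\<^sup>2 / q"
proof -
  have "a\<^sup>2 / p + b\<^sup>2 / q - (a + b)\<^sup>2 / (p + q) = (a * q - b * p)\<^sup>2 / (p * q * (p + q))"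
    using assms by (simp add: divide_simps add_pos_pos) (simp add: algebra_simps power2_eq_square)
  also have "\<dots> \<ge> 0" using assms by simp
  finally show ?thesis by simp
qed

text \<open>A partition of the whole interval need not contain \<open>b\<close>. Clipping it at
  \<open>b\<close> from both sides gives partitions of the two halves, and only the step that
  crosses \<open>b\<close> needs \<open>square_add_over_le\<close>.\<close>

lemma energy_le_join:
  assumes 1: "energy_le f a b C1" and 2: "energy_le f b c C2" and ab: "a \<le> b" "b \<le> c"
  shows "energy_le f a c (C1 + C2)"
proof (rule energy_leI)
  fix x :: "nat \<Rightarrow> real" and n assume x: "mono x" "x 0 = a" "x n = c"
  define y where "y i = min (x i) b" for i
  define z where "z i = max (x i) b" for i
  have le: "x i \<le> x (Suc i)" for i using x(1) by (simp add: mono_iff_le_Suc)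
  have my: "mono y" and mz: "mono z"
    unfolding y_def z_def by (intro monoI_Suc min.mono max.mono le order_refl)+
  have y: "esum f y n \<le> C1"
    by (rule energy_leD[OF 1 my]) (use x ab in \<open>auto simp: y_def\<close>)
  have z: "esum f z n \<le> C2"
    by (rule energy_leD[OF 2 mz]) (use x ab in \<open>auto simp: z_def\<close>)
  have "(f (x (Suc i)) - f (x i))\<^sup>2 / (x (Suc i) - x i)
      \<le> (f (y (Suc i)) - f (y i))\<^sup>2 / (y (Suc i) - y i) + (f (z (Suc i)) - f (z i))\<^sup>2 / (z (Suc i) - z i)" for i
  proof -
    consider "x (Suc i) \<le> b" | "b \<le> x i" | "x i < b" "b < x (Suc i)" by linarith
    then show ?thesis
    proof cases
      case 1 then show ?thesis using le[of i] by (simp add: y_def z_def)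
    next
      case 2 then show ?thesis using le[of i] by (simp add: y_def z_def)
    next
      case 3
      then show ?thesis
        using square_add_over_le[of "b - x i" "x (Suc i) - b" "f b - f (x i)" "f (x (Suc i)) - f b"]
        by (simp add: y_def z_def)
    qed
  qed
  then have "esum f x n \<le> esum f y n + esum f z n"
    unfolding esum_def sum.distrib[symmetric] by (intro sum_mono) 
  then show "esum f x n \<le> C1 + C2" using y z by linarith
qed

lemma esum_concat:
  assumes "mono y" "mono z" "y n = z 0"
  obtains x where "mono x" "x 0 = y 0" "x (n + m) = z m" "esum f x (n + m) = esum f y n + esum f z m"
proof -
  define x where "x i = (if i \<le> n then y i else z (i - n))" for i
  have my: "y i \<le> y j" if "i \<le> j" for i j using assms(1) that by (simp add: monoD)
  have mz: "z i \<le> z j" if "i \<le> j" for i j using assms(2) that by (simp add: monoD)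
  have "mono x"
  proof (rule monoI_Suc)
    fix i
    consider "i < n" | "i = n" | "i > n" by linarith
    then show "x i \<le> x (Suc i)"
    proof cases
      case 1 then show ?thesis by (simp add: x_def my)
    next
      case 2 then show ?thesis using mz[of 0 1] assms(3) by (simp add: x_def)
    next
      case 3 then show ?thesis by (simp add: x_def mz)
    qed
  qed
  moreover have "x 0 = y 0" by (simp add: x_def)
  moreover have "x (n + m) = z m" using assms(3) by (cases m) (auto simp: x_def)
  moreover have "esum f x (n + m) = esum f y n + esum f z m"
  proof -
    have "esum f x (n + m) = esum f x n + (\<Sum>i<m. (f (x (Suc (n + i))) - f (x (n + i)))\<^sup>2 / (x (Suc (n + i)) - x (n + i)))"
      unfolding esum_def by (induction m) (auto simp: algebra_simps)
    also have "esum f x n = esum f y n" unfolding esum_def by (intro sum.cong) (auto simp: x_def)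
    also have "x (n + i) = z i" for i using assms(3) by (cases i) (auto simp: x_def)
    then have "(\<Sum>i<m. (f (x (Suc (n + i))) - f (x (n + i)))\<^sup>2 / (x (Suc (n + i)) - x (n + i))) = esum f z m"
      unfolding esum_def by (metis add_Suc_right)
    finally show ?thesis .
  qed
  ultimately show ?thesis using that by blast
qed

text \<open>The left share is the exact supremum over the left half, so whatever remains of
  \<open>C\<close> bounds every partition of the right half. The shares add up to exactly
  \<open>C\<close>; the variations below change the energy piece by piece and could not afford a
  loss.\<close>

lemma energy_le_split:
  assumes "energy_le f a c C" "a \<le> b" "b \<le> c"
  obtains C1 C2 where "C1 + C2 = C" "energy_le f a b C1" "energy_le f b c C2"
proof -
  define S where "S = {esum f y n | y n. mono y \<and> y 0 = a \<and> y n = b}"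
  define t where "t i = (if i = 0 then b else c)" for i :: nat
  define s where "s i = (if i = 0 then a else b)" for i :: nat
  have key: "esum f y n + esum f z m \<le> C"
    if yz: "mono y" "y 0 = a" "y n = b" "mono z" "z 0 = b" "z m = c" for y z n m
  proof -
    obtain x where "mono x" "x 0 = y 0" "x (n + m) = z m" "esum f x (n + m) = esum f y n + esum f z m"
      using esum_concat[OF yz(1,4), where n=n and f=f and m=m] yz by auto
    then show ?thesis using energy_leD[OF assms(1), of x "n+m"] yz by simp
  qed
  have tm: "mono t" "t 0 = b" "t 1 = c" using assms by (auto intro!: monoI_Suc simp: t_def)
  have sm: "mono s" "s 0 = a" "s 1 = b" using assms by (auto intro!: monoI_Suc simp: s_def)
  have bdd: "v \<le> C" if v: "v \<in> S" for v
  proof -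
    obtain y n where "v = esum f y n" "mono y" "y 0 = a" "y n = b" using v unfolding S_def by auto
    then show ?thesis using key[OF _ _ _ tm, of y n] esum_nonneg[OF tm(1), of f 1] by linarith
  qed
  then have "bdd_above S" by (meson bdd_above.I)
  have ne: "S \<noteq> {}" using sm unfolding S_def by blast
  have "energy_le f a b (Sup S)"
    by (rule energy_leI, rule cSup_upper[OF _ \<open>bdd_above S\<close>]) (auto simp: S_def)
  moreover have "energy_le f b c (C - Sup S)"
  proof (rule energy_leI)
    fix z :: "nat \<Rightarrow> real" and m assume z: "mono z" "z 0 = b" "z m = c"
    have "Sup S \<le> C - esum f z m"
    proof (rule cSup_least[OF ne])
      fix v assume "v \<in> S"
      then obtain y n where "v = esum f y n" "mono y" "y 0 = a" "y n = b" unfolding S_def by auto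
      then show "v \<le> C - esum f z m" using key[OF _ _ _ z, of y n] by linarith
    qed
    then show "esum f z m \<le> C - Sup S" by linarith
  qed
  ultimately show ?thesis using that[of "Sup S" "C - Sup S"] by simp
qed

lemma mono_partition_bounds:
  fixes x :: "nat \<Rightarrow> real"
  assumes "mono x" "x 0 = a" "x n = b" "i \<le> n"
  shows "a \<le> x i" "x i \<le> b"
  using monoD[OF assms(1), of 0 i, OF le0] monoD[OF assms(1), of i n] assms(2-) by (simp_all add: le0)

lemma energy_le_cong:
  assumes "energy_le f a b C" "\<And>x. a \<le> x \<Longrightarrow> x \<le> b \<Longrightarrow> g x = f x"
  shows "energy_le g a b C"
proof (rule energy_leI)
  fix x :: "nat \<Rightarrow> real" and n assume x: "mono x" "x 0 = a" "x n = b"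
  have "esum g x n = esum f x n"
    unfolding esum_def using assms(2) mono_partition_bounds[OF x] by (intro sum.cong) auto
  then show "esum g x n \<le> C" using energy_leD[OF assms(1) x] by simp
qed

text \<open>The cross terms telescope, so an affine perturbation shifts the energy bound by an
  amount that depends on \<open>f\<close> only through its end values. No derivative of
  \<open>f\<close> enters.\<close>

lemma energy_le_add_linear:
  assumes "energy_le f a b C" "a \<le> b"
  shows "energy_le (\<lambda>x. f x + m * x + k) a b (C + 2 * m * (f b - f a) + m\<^sup>2 * (b - a))"
proof (rule energy_leI)
  fix x :: "nat \<Rightarrow> real" and n assume x: "mono x" "x 0 = a" "x n = b"
  have eq: "(f (x (Suc i)) + m * x (Suc i) + k - (f (x i) + m * x i + k))\<^sup>2 / (x (Suc i) - x i)
     = (f (x (Suc i)) - f (x i))\<^sup>2 / (x (Suc i) - x i) + (2 * m * (f (x (Suc i)) - f (x i)) + m\<^sup>2 * (x (Suc i) - x i))" for i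
    by (cases "x (Suc i) = x i") (auto simp: field_simps power2_eq_square)
  have "esum (\<lambda>x. f x + m * x + k) x n = esum f x n + (\<Sum>i<n. 2 * m * (f (x (Suc i)) - f (x i)) + m\<^sup>2 * (x (Suc i) - x i))"
    unfolding esum_def eq sum.distrib by simp
  also have "(\<Sum>i<n. 2 * m * (f (x (Suc i)) - f (x i)) + m\<^sup>2 * (x (Suc i) - x i)) = 2 * m * (f (x n) - f (x 0)) + m\<^sup>2 * (x n - x 0)"
    using sum_lessThan_telescope[of "\<lambda>i. f (x i)" n] sum_lessThan_telescope[of x n]
    by (simp add: sum.distrib sum_distrib_left[symmetric])
  finally show "esum (\<lambda>x. f x + m * x + k) x n \<le> C + 2 * m * (f b - f a) + m\<^sup>2 * (b - a)"
    using energy_leD[OF assms(1) x] x by simp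
qed

lemma energy_le_const: "energy_le (\<lambda>x. 0) a b 0"
  by (rule energy_leI) (simp add: esum_def)

lemma energy_le_scale:
  assumes "energy_le f a b C"
  shows "energy_le (\<lambda>x. c * f x) a b (c\<^sup>2 * C)"
proof (rule energy_leI)
  fix x :: "nat \<Rightarrow> real" and n assume x: "mono x" "x 0 = a" "x n = b"
  have "esum (\<lambda>x. c * f x) x n = c\<^sup>2 * esum f x n"
    unfolding esum_def sum_distrib_left
    by (intro sum.cong) (auto simp: right_diff_distrib[symmetric] power_mult_distrib)
  then show "esum (\<lambda>x. c * f x) x n \<le> c\<^sup>2 * C" using energy_leD[OF assms x] by (simp add: mult_left_mono)
qed

lemma energy_le_abs:
  assumes "energy_le f a b C"
  shows "energy_le (\<lambda>x. \<bar>f x\<bar>) a b C"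
proof (rule energy_leI)
  fix x :: "nat \<Rightarrow> real" and n assume x: "mono x" "x 0 = a" "x n = b"
  have "esum (\<lambda>x. \<bar>f x\<bar>) x n \<le> esum f x n"
    unfolding esum_def
  proof (intro sum_mono divide_right_mono)
    fix i
    show "(\<bar>f (x (Suc i))\<bar> - \<bar>f (x i)\<bar>)\<^sup>2 \<le> (f (x (Suc i)) - f (x i))\<^sup>2"
      by (rule iffD1[OF abs_le_square_iff abs_triangle_ineq3])
    show "0 \<le> x (Suc i) - x i" using x(1) by (simp add: mono_iff_le_Suc)
  qed
  then show "esum (\<lambda>x. \<bar>f x\<bar>) x n \<le> C" using energy_leD[OF assms x] by linarith
qed

lemma energy_le_reflect:
  assumes "energy_le f a b C"
  shows "energy_le (\<lambda>x. f (1 - x)) (1 - b) (1 - a) C"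
proof (rule energy_leI)
  fix x :: "nat \<Rightarrow> real" and n assume x: "mono x" "x 0 = 1 - b" "x n = 1 - a"
  define y where "y i = 1 - x (n - i)" for i
  have "mono y" using x(1) by (auto intro!: monoI_Suc simp: y_def monoD)
  then have "esum f y n \<le> C" by (rule energy_leD[OF assms]) (use x in \<open>auto simp: y_def\<close>)
  also have "esum f y n = (\<Sum>i<n. (f (1 - x (Suc (n - Suc i))) - f (1 - x (n - Suc i)))\<^sup>2 / (x (Suc (n - Suc i)) - x (n - Suc i)))"
    unfolding esum_def
  proof (intro sum.cong refl)
    fix i assume "i \<in> {..<n}"
    then have "n - i = Suc (n - Suc i)" by auto
    then have "y (Suc i) = 1 - x (n - Suc i)" "y i = 1 - x (Suc (n - Suc i))" by (simp_all add: y_def)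
    then show "(f (y (Suc i)) - f (y i))\<^sup>2 / (y (Suc i) - y i) = (f (1 - x (Suc (n - Suc i))) - f (1 - x (n - Suc i)))\<^sup>2 / (x (Suc (n - Suc i)) - x (n - Suc i))"
      using power2_commute[of "f (1 - x (n - Suc i))"] by simp
  qed
  also have "\<dots> = esum (\<lambda>x. f (1 - x)) x n"
    unfolding esum_def by (rule sum.nat_diff_reindex)
  finally show "esum (\<lambda>x. f (1 - x)) x n \<le> C" .
qed

text \<open>Lower semicontinuity of the energy. Each sum has finitely many terms, so pointwise
  convergence is enough.\<close>

lemma energy_le_limit:
  assumes "\<And>k. energy_le (f k) a b (C k)" "\<And>x. a \<le> x \<Longrightarrow> x \<le> b \<Longrightarrow> (\<lambda>k. f k x) \<longlonglongrightarrow> g x" "C \<longlonglongrightarrow> D"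
  shows "energy_le g a b D"
proof (rule energy_leI)
  fix x :: "nat \<Rightarrow> real" and n assume x: "mono x" "x 0 = a" "x n = b"
  have "(\<lambda>k. esum (f k) x n) \<longlonglongrightarrow> esum g x n"
    unfolding esum_def
  proof (rule tendsto_sum)
    fix i assume "i \<in> {..<n}"
    then have 1: "(\<lambda>k. f k (x (Suc i))) \<longlonglongrightarrow> g (x (Suc i))" "(\<lambda>k. f k (x i)) \<longlonglongrightarrow> g (x i)"
      using mono_partition_bounds[OF x] by (auto intro!: assms(2))
    show "(\<lambda>k. (f k (x (Suc i)) - f k (x i))\<^sup>2 / (x (Suc i) - x i)) \<longlonglongrightarrow> (g (x (Suc i)) - g (x i))\<^sup>2 / (x (Suc i) - x i)"
      unfolding divide_inverse by (rule tendsto_mult[OF tendsto_power[OF tendsto_diff[OF 1]] tendsto_const])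
  qed
  then show "esum g x n \<le> D"
    by (rule LIMSEQ_le[OF _ assms(3)]) (use energy_leD[OF assms(1) x] in auto)
qed

section \<open>Piecewise linear perturbations and convexity of powers\<close>

definition hat :: "real \<Rightarrow> real \<Rightarrow> real \<Rightarrow> real \<Rightarrow> real" where
  "hat a u b x = (if x \<le> a \<or> x \<ge> b then 0 else if x \<le> u then (x - a) / (u - a) else (b - x) / (b - u))"

text \<open>On each leg the hat is affine, so \<open>energy_le_add_linear\<close> applies to the two
  legs separately. The term linear in \<open>c\<close> is twice the drop of the chord slopes of
  \<open>f\<close> at \<open>u\<close>, a discrete version of -f''.\<close>

lemma energy_le_add_hat:
  assumes E: "energy_le f l r C" and o: "l \<le> a" "a < u" "u < b" "b \<le> r"
  shows "energy_le (\<lambda>x. f x + c * hat a u b x) l r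
     (C + 2 * c * ((f u - f a) / (u - a) - (f b - f u) / (b - u)) + c\<^sup>2 * (1 / (u - a) + 1 / (b - u)))"
proof -
  obtain C1 C' where 1: "C1 + C' = C" "energy_le f l a C1" "energy_le f a r C'"
    using energy_le_split[OF E, of a] o by auto
  obtain C2 C'' where 2: "C2 + C'' = C'" "energy_le f a u C2" "energy_le f u r C''"
    using energy_le_split[OF 1(3), of u] o by auto
  obtain C3 C4 where 3: "C3 + C4 = C''" "energy_le f u b C3" "energy_le f b r C4"
    using energy_le_split[OF 2(3), of b] o by auto
  define h where "h = (\<lambda>x. f x + c * hat a u b x)"
  have h1: "energy_le h l a C1" by (rule energy_le_cong[OF 1(2)]) (auto simp: h_def hat_def)
  have h4: "energy_le h b r C4" by (rule energy_le_cong[OF 3(3)]) (auto simp: h_def hat_def)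
  define m where "m = c / (u - a)"
  have h2': "h x = f x + m * x + (- m * a)" if "a \<le> x" "x \<le> u" for x
    using o that by (cases "x = a") (simp_all add: h_def hat_def m_def right_diff_distrib diff_divide_distrib)
  have h2: "energy_le h a u (C2 + 2 * m * (f u - f a) + m\<^sup>2 * (u - a))"
    by (rule energy_le_cong[OF energy_le_add_linear[OF 2(2), of m "- m * a"]])
       (use h2' o in auto)
  define m' where "m' = - c / (b - u)"
  have h3': "h x = f x + m' * x + (- m' * b)" if "u \<le> x" "x \<le> b" for x
    using o that by (cases "x = b"; cases "x = u") (simp_all add: h_def hat_def m'_def divide_simps, simp_all add: algebra_simps)
  have h3: "energy_le h u b (C3 + 2 * m' * (f b - f u) + m'\<^sup>2 * (b - u))"
    by (rule energy_le_cong[OF energy_le_add_linear[OF 3(2), of m' "- m' * b"]])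
       (use h3' o in auto)
  have "energy_le h l r (C1 + ((C2 + 2 * m * (f u - f a) + m\<^sup>2 * (u - a)) + ((C3 + 2 * m' * (f b - f u) + m'\<^sup>2 * (b - u)) + C4)))"
    by (intro energy_le_join[OF h1] energy_le_join[OF h2] energy_le_join[OF h3] h4) (use o in auto)
  moreover have "m\<^sup>2 * (u - a) = c\<^sup>2 * (1 / (u - a))" "m'\<^sup>2 * (b - u) = c\<^sup>2 * (1 / (b - u))"
    using o by (simp_all add: m_def m'_def power2_eq_square)
  moreover have "C1 + ((C2 + 2 * m * (f u - f a) + M) + ((C3 + 2 * m' * (f b - f u) + M') + C4)) =
     C + 2 * c * ((f u - f a) / (u - a) - (f b - f u) / (b - u)) + (M + M')" for M M'
    using 1(1) 2(1) 3(1) by (simp add: m_def m'_def algebra_simps diff_divide_distrib)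
  ultimately show ?thesis unfolding h_def by (simp add: distrib_left)
qed

text \<open>Serves the variation that moves the node to the right: the piece of the right-hand
  function before the new node is dropped at no cost.\<close>

lemma energy_le_zero_out:
  assumes E: "energy_le f l r C" and o: "l \<le> a" "a \<le> b" "b \<le> r" and z: "f a = 0" "f b = 0"
  shows "energy_le (\<lambda>x. if a \<le> x \<and> x \<le> b then 0 else f x) l r C"
proof -
  obtain C1 C' where 1: "C1 + C' = C" "energy_le f l a C1" "energy_le f a r C'"
    using energy_le_split[OF E, of a] o by auto
  obtain C2 C3 where 2: "C2 + C3 = C'" "energy_le f a b C2" "energy_le f b r C3"
    using energy_le_split[OF 1(3), of b] o by auto
  define h where "h = (\<lambda>x. if a \<le> x \<and> x \<le> b then 0 else f x)"
  have h1: "energy_le h l a C1" by (rule energy_le_cong[OF 1(2)]) (auto simp: h_def z)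
  have h2: "energy_le h a b 0" by (rule energy_le_cong[OF energy_le_const]) (auto simp: h_def z)
  have h3: "energy_le h b r C3" by (rule energy_le_cong[OF 2(3)]) (auto simp: h_def z)
  have "energy_le h l r (C1 + (0 + C3))"
    by (intro energy_le_join[OF h1] energy_le_join[OF h2] h3) (use o in auto)
  then show ?thesis unfolding h_def[symmetric]
  proof (rule energy_le_mono)
    have "C2 \<ge> 0" using energy_le_chord(3)[OF 2(2)] o by simp
    then show "C1 + (0 + C3) \<le> C" using 1(1) 2(1) by linarith
  qed
qed

text \<open>The graph of a convex function lies above its tangent. Scaling by \<open>a\<close>
  reduces this to \<open>1 + p * (t - 1) \<le> t powr p\<close>, which is Young's inequality for the
  numbers \<open>t powr p\<close> and 1.\<close>

lemma powr_tangent_le: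
  fixes a b p :: real
  assumes "a \<ge> 0" "p > 1"
  shows "a powr p + p * a powr (p - 1) * b \<le> \<bar>a + b\<bar> powr p"
proof (cases "a = 0")
  case False
  then have a: "a > 0" using assms by simp
  define t where "t = \<bar>a + b\<bar> / a"
  have t: "t \<ge> 0" using a by (simp add: t_def)
  have "t \<le> t powr p / p + (1 - 1/p)"
  proof (cases "t = 0")
    case False
    have "(t powr p) powr (1/p) * 1 powr (1 - 1/p) \<le> 1/p * (t powr p) + (1 - 1/p) * 1"
      using assms False t by (intro Youngs_inequality_0) auto
    then show ?thesis using t assms by (simp add: powr_powr)
  qed (use assms in simp)
  then have "p * t \<le> p * (t powr p / p + (1 - 1/p))" using assms by (intro mult_left_mono) auto
  then have "1 + p * (t - 1) \<le> t powr p" using assms by (simp add: right_diff_distrib distrib_left)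
  moreover have "t - 1 \<ge> b / a" using a unfolding t_def by (simp add: field_simps)
  ultimately have "1 + p * (b / a) \<le> t powr p"
    using mult_left_mono[of "b / a" "t - 1" p] assms by linarith
  then have "a powr p * (1 + p * (b / a)) \<le> a powr p * t powr p"
    by (intro mult_left_mono) auto
  also have "a powr p * t powr p = \<bar>a + b\<bar> powr p"
    using a by (simp add: t_def powr_divide)
  also have "a powr p * (1 + p * (b / a)) = a powr p + p * (a powr p / a) * b"
    by (simp add: algebra_simps)
  also have "a powr p / a = a powr (p - 1)" using a by (simp add: powr_diff)
  finally show ?thesis .
qed (use assms in simp)

lemma powr_mult_le_add:
  fixes a b p :: real
  assumes "a \<ge> 0" "b \<ge> 0" "p \<ge> 1"
  shows "a powr (p - 1) * b \<le> a powr p + b powr p"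
proof (cases "max a b = 0")
  case False
  define m where "m = max a b"
  have m: "m > 0" using False assms by (auto simp: m_def)
  have "a powr (p - 1) * b \<le> m powr (p - 1) * m"
    using assms by (intro mult_mono powr_mono2) (auto simp: m_def)
  also have "\<dots> = m powr p" using m by (simp add: powr_diff)
  also have "\<dots> \<le> a powr p + b powr p" by (auto simp: m_def max_def)
  finally show ?thesis .
qed (use assms in \<open>auto simp: max_def split: if_splits\<close>)

section \<open>Functions of finite energy on the unit interval\<close>

definition adm :: "real \<Rightarrow> real \<Rightarrow> (real \<Rightarrow> real) \<Rightarrow> real \<Rightarrow> bool" where
  "adm a b f C \<longleftrightarrow> 0 \<le> a \<and> b \<le> 1 \<and> (\<forall>x. x \<le> a \<or> b \<le> x \<longrightarrow> f x = 0) \<and> energy_le f 0 1 C"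

lemma adm_nonneg: "adm a b f C \<Longrightarrow> C \<ge> 0"
  unfolding adm_def using energy_le_chord(3)[of f 0 1 C] by simp

lemma adm_square_diff_le:
  assumes "adm a b f C"
  shows "(f x - f y)\<^sup>2 \<le> C * \<bar>x - y\<bar>"
proof -
  have *: "(f v - f u)\<^sup>2 \<le> C * (v - u)" if uv: "0 \<le> u" "u \<le> v" "v \<le> 1" for u v
  proof -
    obtain C1 C' where 1: "C1 + C' = C" "energy_le f 0 u C1" "energy_le f u 1 C'"
      using energy_le_split[of f 0 1 C u] assms uv unfolding adm_def by auto
    obtain C2 C3 where 2: "C2 + C3 = C'" "energy_le f u v C2" "energy_le f v 1 C3"
      using energy_le_split[OF 1(3), of v] uv by auto
    have "C1 \<ge> 0" "C3 \<ge> 0" using energy_le_chord(3)[OF 1(2)] energy_le_chord(3)[OF 2(3)] uv by auto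
    then have "C2 * (v - u) \<le> C * (v - u)" using uv 1(1) 2(1) by (intro mult_right_mono) auto
    then show ?thesis using energy_le_chord(1)[OF 2(2)] uv by linarith
  qed
  \<comment> \<open>Clamping to the unit interval does not increase distances and leaves the values
    of \<open>f\<close> unchanged, because \<open>f\<close> vanishes outside; this extends the bound
    to all real arguments.\<close>
  define k where "k t = max 0 (min 1 t)" for t :: real
  have f0: "f t = 0" if "t \<le> 0 \<or> 1 \<le> t" for t
    using assms that unfolding adm_def by (meson order_trans)
  have fk: "f (k t) = f t" for t
    using f0[of t] f0[of 0] f0[of 1] by (auto simp: k_def max_def min_def)
  have k01: "0 \<le> k t" "k t \<le> 1" for t by (auto simp: k_def)
  have "(f (k x) - f (k y))\<^sup>2 \<le> C * \<bar>k x - k y\<bar>"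
  proof (cases "k x \<le> k y")
    case True
    then have "\<bar>k x - k y\<bar> = k y - k x" by simp
    then show ?thesis using *[OF k01(1) True k01(2)] power2_commute[of "f (k x)" "f (k y)"] by simp
  next
    case False
    then have "k y \<le> k x" "\<bar>k x - k y\<bar> = k x - k y" by simp_all
    then show ?thesis using *[OF k01(1) _ k01(2), of y x] by simp
  qed
  also have "\<dots> \<le> C * \<bar>x - y\<bar>"
  proof (rule mult_left_mono)
    show "\<bar>k x - k y\<bar> \<le> \<bar>x - y\<bar>" unfolding k_def by (simp add: max_def min_def abs_if)
  qed (rule adm_nonneg[OF assms])
  finally show ?thesis unfolding fk .
qed

lemma adm_diff_le:
  assumes "adm a b f C"
  shows "\<bar>f x - f y\<bar> \<le> sqrt C * sqrt \<bar>x - y\<bar>"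
  using real_sqrt_le_mono[OF adm_square_diff_le[OF assms, of x y]] by (simp add: real_sqrt_mult)

lemma adm_continuous:
  assumes "adm a b f C"
  shows "continuous_on UNIV f"
proof -
  have "isCont f y" for y
  proof -
    have "((\<lambda>x. sqrt C * sqrt \<bar>x - y\<bar>) \<longlongrightarrow> sqrt C * sqrt \<bar>y - y\<bar>) (at y)"
      by (intro tendsto_intros)
    then have l: "((\<lambda>x. sqrt C * sqrt \<bar>x - y\<bar>) \<longlongrightarrow> 0) (at y)" by simp
    have "((\<lambda>x. f x - f y) \<longlongrightarrow> 0) (at y)"
    proof (rule Lim_null_comparison[OF always_eventually l], rule allI)
      show "norm (f x - f y) \<le> sqrt C * sqrt \<bar>x - y\<bar>" for x
        unfolding real_norm_def by (rule adm_diff_le[OF assms])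
    qed
    then show ?thesis unfolding isCont_def by (simp add: LIM_zero_iff)
  qed
  then show ?thesis by (simp add: continuous_at_imp_continuous_on)
qed

text \<open>Combines the Hoelder bounds from both end points, using that twice
  \<open>x * (1 - x)\<close> dominates the smaller of \<open>x\<close> and \<open>1 - x\<close>. The
  product form matches the shape of the weight in \<open>V_le\<close>.\<close>

lemma adm_square_le:
  assumes "adm a b f C" "0 \<le> x" "x \<le> 1"
  shows "(f x)\<^sup>2 \<le> 2 * C * (x * (1 - x))"
proof -
  have f0: "f 0 = 0" "f 1 = 0" using assms unfolding adm_def by auto
  have 1: "(f x)\<^sup>2 \<le> C * x" using adm_square_diff_le[OF assms(1), of x 0] f0 assms by simp
  have 2: "(f x)\<^sup>2 \<le> C * (1 - x)" using adm_square_diff_le[OF assms(1), of x 1] f0 assms by simp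
  have C: "C \<ge> 0" by (rule adm_nonneg[OF assms(1)])
  have "x * (1 - x) * 2 \<ge> x \<or> x * (1 - x) * 2 \<ge> 1 - x"
  proof (cases "x \<le> 1/2")
    case True
    then have "x * 1 \<le> x * (2 * (1 - x))" using assms by (intro mult_left_mono) auto
    then show ?thesis by (simp add: algebra_simps)
  next
    case False
    then have "1 * (1 - x) \<le> (2 * x) * (1 - x)" using assms by (intro mult_right_mono) auto
    then show ?thesis by (simp add: algebra_simps)
  qed
  then show ?thesis
  proof
    assume "x * (1 - x) * 2 \<ge> x"
    then have "C * x \<le> C * (x * (1 - x) * 2)" using C by (intro mult_left_mono)
    then show ?thesis using 1 by simp
  next
    assume "x * (1 - x) * 2 \<ge> 1 - x"
    then have "C * (1 - x) \<le> C * (x * (1 - x) * 2)" using C by (intro mult_left_mono)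
    then show ?thesis using 2 by simp
  qed
qed

lemma adm_powr_le:
  assumes "adm a b f C" "0 \<le> x" "x \<le> 1" "p \<ge> 0" "C \<le> M"
  shows "\<bar>f x\<bar> powr p \<le> (2 * M) powr (p/2) * (x * (1 - x)) powr (p/2)"
proof -
  have C: "C \<ge> 0" by (rule adm_nonneg[OF assms(1)])
  have "\<bar>f x\<bar> powr p = ((f x)\<^sup>2) powr (p/2)"
    using powr_powr[of "\<bar>f x\<bar>" 2 "p/2"] by (cases "f x = 0") simp_all
  also have "\<dots> \<le> (2 * M * (x * (1 - x))) powr (p/2)"
  proof (intro powr_mono2)
    have "2 * C * (x * (1 - x)) \<le> 2 * M * (x * (1 - x))"
      using assms by (intro mult_right_mono) auto
    then show "(f x)\<^sup>2 \<le> 2 * M * (x * (1 - x))" using adm_square_le[OF assms(1-3)] by linarith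
  qed (use assms in auto)
  also have "\<dots> = (2 * M) powr (p/2) * (x * (1 - x)) powr (p/2)"
    by (rule powr_mult)
  finally show ?thesis .
qed

lemma adm_scale: "adm a b f C \<Longrightarrow> adm a b (\<lambda>x. c * f x) (c\<^sup>2 * C)"
  unfolding adm_def using energy_le_scale by auto

lemma adm_abs: "adm a b f C \<Longrightarrow> adm a b (\<lambda>x. \<bar>f x\<bar>) C"
  unfolding adm_def using energy_le_abs by auto

lemma adm_reflect: "adm a b f C \<Longrightarrow> adm (1 - b) (1 - a) (\<lambda>x. f (1 - x)) C"
  unfolding adm_def using energy_le_reflect[of f 0 1 C] by auto

lemma adm_hat:
  assumes "0 \<le> a" "a < u" "u < b" "b \<le> 1"
  shows "adm a b (hat a u b) (1 / (u - a) + 1 / (b - u))"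
  using energy_le_add_hat[OF energy_le_const, of 0 a u b 1 1] assms
  unfolding adm_def by (auto simp: hat_def[abs_def])

section \<open>The weighted functional and the existence of an optimal pair\<close>

locale bvp_weight =
  fixes V :: "real \<Rightarrow> real" and p K \<delta> :: real
  assumes p: "p > 2" and \<delta>: "\<delta> > 0"
    and V_cont: "continuous_on {0<..<1} V"
    and V_pos: "\<And>x. 0 < x \<Longrightarrow> x < 1 \<Longrightarrow> V x > 0"
    and V_le: "\<And>x. 0 < x \<Longrightarrow> x < 1 \<Longrightarrow> V x \<le> K * (x * (1 - x)) powr (\<delta> - 1 - p/2)"
begin

definition W :: "real \<Rightarrow> real" where "W x = (if 0 < x \<and> x < 1 then V x else 0)"

definition F :: "(real \<Rightarrow> real) \<Rightarrow> real" where "F f = (\<integral>x. W x * \<bar>f x\<bar> powr p \<partial>lborel)"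

lemma W_nonneg: "W x \<ge> 0" using V_pos[of x] by (auto simp: W_def)

lemma W_measurable [measurable]: "W \<in> borel_measurable borel"
proof -
  have "(\<lambda>x. indicator {0<..<1} x *\<^sub>R V x) \<in> borel_measurable borel"
    by (intro borel_measurable_continuous_on_indicator V_cont) auto
  also have "(\<lambda>x. indicator {0<..<1} x *\<^sub>R V x) = W" by (auto simp: W_def indicator_def)
  finally show ?thesis .
qed

definition dom :: "real \<Rightarrow> real" where
  "dom x = indicator {0..1} x * (x powr (\<delta> - 1) * (1 - x) powr (\<delta> - 1))"

lemma dom_integrable: "integrable lborel dom"
  using integrable_Beta[OF \<delta> \<delta>] unfolding set_integrable_def dom_def by simp

lemma K_pos: "K > 0"
  using V_pos[of "1/2"] V_le[of "1/2"] by (smt (verit) mult_nonpos_nonneg powr_ge_zero half_gt_zero_iff field_sum_of_halves)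

text \<open>The power \<open>p/2\<close> of \<open>x * (1 - x)\<close> gained from the energy bound
  cancels the worst part of the singularity of \<open>V\<close> and leaves the exponent
  \<open>\<delta> - 1\<close>. The result is a Beta density, integrable because
  \<open>\<delta> > 0\<close>; it depends on \<open>f\<close> only through the energy bound.\<close>

lemma W_adm_le:
  assumes "adm a b f C" "C \<le> M"
  shows "W x * \<bar>f x\<bar> powr p \<le> K * (2 * M) powr (p/2) * dom x"
proof (cases "0 < x \<and> x < 1")
  case True
  have "W x * \<bar>f x\<bar> powr p \<le> (K * (x * (1 - x)) powr (\<delta> - 1 - p/2)) * ((2 * M) powr (p/2) * (x * (1 - x)) powr (p/2))"
    using adm_powr_le[OF assms(1), of x p M] V_le[of x] V_pos[of x] True p assms(2) K_pos
    by (intro mult_mono) (auto simp: W_def)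
  also have "\<dots> = K * (2 * M) powr (p/2) * ((x * (1 - x)) powr (\<delta> - 1 - p/2) * (x * (1 - x)) powr (p/2))"
    by simp
  also have "(x * (1 - x)) powr (\<delta> - 1 - p/2) * (x * (1 - x)) powr (p/2) = (x * (1 - x)) powr (\<delta> - 1)"
    by (simp flip: powr_add)
  also have "\<dots> = dom x" using True by (simp add: dom_def powr_mult)
  finally show ?thesis .
next
  case False
  then have "W x = 0" by (auto simp: W_def)
  then show ?thesis using K_pos by (simp add: dom_def)
qed

lemma adm_measurable: "adm a b f C \<Longrightarrow> f \<in> borel_measurable borel"
  by (intro borel_measurable_continuous_onI adm_continuous)

lemma F_integrable:
  assumes "adm a b f C"
  shows "integrable lborel (\<lambda>x. W x * \<bar>f x\<bar> powr p)"
proof (rule Bochner_Integration.integrable_bound)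
  show "integrable lborel (\<lambda>x. K * (2 * C) powr (p/2) * dom x)"
    using dom_integrable by simp
  show "(\<lambda>x. W x * \<bar>f x\<bar> powr p) \<in> borel_measurable lborel"
    using adm_measurable[OF assms] by measurable
  show "AE x in lborel. norm (W x * \<bar>f x\<bar> powr p) \<le> norm (K * (2 * C) powr (p/2) * dom x)"
    using W_adm_le[OF assms order_refl] W_nonneg by (intro AE_I2) (smt (verit) real_norm_def mult_nonneg_nonneg powr_ge_zero)
qed

lemma F_nonneg: "F f \<ge> 0"
  unfolding F_def by (intro integral_nonneg_AE AE_I2 mult_nonneg_nonneg W_nonneg) auto

text \<open>This is the compactness of the problem: under a common energy bound the majorant from
  \<open>W_adm_le\<close> is the same for all \<open>k\<close>, so the constraint
  \<open>F f = 1\<close> survives pointwise limits.\<close>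

lemma F_tendsto:
  assumes "\<And>k. adm (a k) (b k) (f k) (C k)" "\<And>k. C k \<le> M" "\<And>x. (\<lambda>k. f k x) \<longlonglongrightarrow> g x"
  shows "(\<lambda>k. F (f k)) \<longlonglongrightarrow> F g"
  unfolding F_def
proof (rule integral_dominated_convergence)
  have m: "f k \<in> borel_measurable borel" for k by (rule adm_measurable[OF assms(1)])
  then have mg: "g \<in> borel_measurable borel" by (rule borel_measurable_LIMSEQ_real[OF assms(3)])
  show "(\<lambda>x. W x * \<bar>g x\<bar> powr p) \<in> borel_measurable lborel" using mg by measurable
  show "(\<lambda>x. W x * \<bar>f k x\<bar> powr p) \<in> borel_measurable lborel" for k using m[of k] by measurable
  show "integrable lborel (\<lambda>x. K * (2 * M) powr (p/2) * dom x)" using dom_integrable by simp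
  show "AE x in lborel. (\<lambda>k. W x * \<bar>f k x\<bar> powr p) \<longlonglongrightarrow> W x * \<bar>g x\<bar> powr p"
    using p by (intro AE_I2 tendsto_mult tendsto_const tendsto_powr2 tendsto_rabs assms(3)) auto
  show "AE x in lborel. norm (W x * \<bar>f k x\<bar> powr p) \<le> K * (2 * M) powr (p/2) * dom x" for k
    using W_adm_le[OF assms(1,2)] W_nonneg by (intro AE_I2) (auto simp: abs_mult)
qed

lemma F_scale: "F (\<lambda>x. c * f x) = \<bar>c\<bar> powr p * F f"
  unfolding F_def by (simp add: abs_mult powr_mult algebra_simps flip: integral_mult_right_zero)

lemma F_abs: "F (\<lambda>x. \<bar>f x\<bar>) = F f" unfolding F_def by simp

text \<open>If the integral vanished, the set where \<open>f\<close> is nonzero would be null, but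
  by continuity it is open and it is not empty.\<close>

lemma F_pos:
  assumes "adm a b f C" "0 < x" "x < 1" "f x \<noteq> 0"
  shows "F f > 0"
proof (rule ccontr)
  assume "\<not> F f > 0"
  then have "F f = 0" using F_nonneg[of f] by simp
  then have "AE x in lborel. W x * \<bar>f x\<bar> powr p = 0"
    unfolding F_def using F_integrable[OF assms(1)] W_nonneg
    by (subst (asm) integral_nonneg_eq_0_iff_AE) auto
  then have "AE x in lebesgue. W x * \<bar>f x\<bar> powr p = 0" by (rule AE_completion)
  then have "AE x in lebesgue. x \<notin> {0<..<1} \<inter> f -` (- {0})"
  proof eventually_elim
    case (elim x)
    then show ?case using V_pos[of x] by (auto simp: W_def split: if_splits)
  qed
  then obtain N where N: "N \<in> null_sets lebesgue" "{x. x < 1 \<and> 0 < x \<and> f x \<noteq> 0} \<subseteq> N"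
    unfolding eventually_ae_filter by auto
  have "{0<..<1} \<inter> f -` (- {0}) \<subseteq> N"
  proof
    fix x assume "x \<in> {0<..<1} \<inter> f -` (- {0})"
    then have "x \<in> {x. x < 1 \<and> 0 < x \<and> f x \<noteq> 0}" by simp
    then show "x \<in> N" using N(2) by (rule subsetD[rotated])
  qed
  then have "negligible ({0<..<1} \<inter> f -` (- {0}))"
    using negligible_subset[of N] N(1) by (simp add: negligible_iff_null_sets)
  moreover have "open ({0<..<1} \<inter> f -` (- {0}))"
    using adm_continuous[OF assms(1)] by (intro open_Int open_vimage) auto
  moreover have "x \<in> {0<..<1} \<inter> f -` (- {0})" using assms by simp
  ultimately show False using open_not_negligible by fastforce
qed

lemma F_zero: "(\<And>x. f x = 0) \<Longrightarrow> F f = 0" using p unfolding F_def by simp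

end

text \<open>The intervals may move with \<open>k\<close>. A point \<open>x \<le> a'\<close> is the
  limit of the points \<open>min x (a k)\<close>, at which \<open>f k\<close> vanishes, and the
  uniform Hoelder bound carries these zeros to the limit function.\<close>

lemma adm_limit:
  assumes "\<And>k. adm (a k) (b k) (f k) (C k)" "\<And>x. (\<lambda>k. f k x) \<longlonglongrightarrow> g x"
    "a \<longlonglongrightarrow> a'" "b \<longlonglongrightarrow> b'" "C \<longlonglongrightarrow> C'"
  shows "adm a' b' g C'"
proof -
  have z: "f k x = 0" if "x \<le> a k \<or> b k \<le> x" for k x using assms(1)[of k] that unfolding adm_def by blast
  have *: "g x = 0" if y: "\<And>k. f k (y k) = 0" "y \<longlonglongrightarrow> x" for x y
  proof -
    have "(\<lambda>k. sqrt (C k) * sqrt \<bar>x - y k\<bar>) \<longlonglongrightarrow> sqrt C' * sqrt \<bar>x - x\<bar>"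
      by (intro tendsto_intros assms(5) y(2))
    then have l: "(\<lambda>k. sqrt (C k) * sqrt \<bar>x - y k\<bar>) \<longlonglongrightarrow> 0" by simp
    have "(\<lambda>k. f k x) \<longlonglongrightarrow> 0"
    proof (rule Lim_null_comparison[OF always_eventually l], rule allI)
      show "norm (f k x) \<le> sqrt (C k) * sqrt \<bar>x - y k\<bar>" for k
        using adm_diff_le[OF assms(1), of k x "y k"] y(1)[of k] by simp
    qed
    then show ?thesis using assms(2)[of x] LIMSEQ_unique by blast
  qed
  have "g x = 0" if x: "x \<le> a'" for x
  proof (rule *)
    show "f k (min x (a k)) = 0" for k by (intro z) auto
    have "(\<lambda>k. min x (a k)) \<longlonglongrightarrow> min x a'" by (intro tendsto_intros assms(3))
    then show "(\<lambda>k. min x (a k)) \<longlonglongrightarrow> x" using x by (simp add: min_absorb1)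
  qed
  moreover have "g x = 0" if x: "b' \<le> x" for x
  proof (rule *)
    show "f k (max x (b k)) = 0" for k by (intro z) auto
    have "(\<lambda>k. max x (b k)) \<longlonglongrightarrow> max x b'" by (intro tendsto_intros assms(4))
    then show "(\<lambda>k. max x (b k)) \<longlonglongrightarrow> x" using x by (simp add: max_absorb1)
  qed
  moreover have "energy_le g 0 1 C'"
    using assms(1) by (intro energy_le_limit[OF _ assms(2) assms(5)]) (auto simp: adm_def)
  moreover have "0 \<le> a'" "b' \<le> 1"
    using assms(1) by (auto intro!: LIMSEQ_le_const[OF assms(3)] LIMSEQ_le_const2[OF assms(4)] simp: adm_def)
  ultimately show ?thesis unfolding adm_def by blast
qed

text \<open>Arzela-Ascoli on the unit interval: a common energy bound is a common modulus of
  continuity, and outside the interval all the functions are zero.\<close>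

lemma adm_subseq:
  assumes "\<And>k. adm (a k) (b k) (f k) (C k)" "\<And>k. C k \<le> M"
  obtains r g where "strict_mono (r :: nat \<Rightarrow> nat)" "\<And>x. (\<lambda>k. f (r k) x) \<longlonglongrightarrow> g x"
proof -
  have M: "M \<ge> 0" using adm_nonneg[OF assms(1)] assms(2) order_trans by blast
  have hol: "\<bar>f k x - f k y\<bar> \<le> sqrt M * sqrt \<bar>x - y\<bar>" for k x y
  proof -
    have "sqrt (C k) * sqrt \<bar>x - y\<bar> \<le> sqrt M * sqrt \<bar>x - y\<bar>"
      using assms(2)[of k] by (intro mult_right_mono) auto
    then show ?thesis using adm_diff_le[OF assms(1), of k x y] by linarith
  qed
  have out: "f k x = 0" if "x \<le> 0 \<or> 1 \<le> x" for k x
    using assms(1)[of k] that unfolding adm_def by (meson order_trans)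
  have bd: "norm (f k x) \<le> sqrt M" if "x \<in> {0..1}" for k x
  proof -
    have "sqrt M * sqrt \<bar>x - 0\<bar> \<le> sqrt M * 1" using that M by (intro mult_left_mono) auto
    then show ?thesis using hol[of k x 0] out[of 0 k] by simp
  qed
  have eq: "\<exists>d. 0 < d \<and> (\<forall>n y. y \<in> {0..1} \<and> norm (x - y) < d \<longrightarrow> norm (f n x - f n y) < e)" if "e > 0" for x e
  proof (intro exI conjI allI impI)
    define d where "d = (e / (sqrt M + 1))\<^sup>2"
    have s: "sqrt M + 1 > 0" using M by (simp add: add_nonneg_pos)
    then show "d > 0" using that by (simp add: d_def)
    fix n y assume "y \<in> {0..1} \<and> norm (x - y) < d"
    then have "sqrt \<bar>x - y\<bar> < sqrt d" by simp
    also have "sqrt d = e / (sqrt M + 1)" unfolding d_def using s that by (simp add: real_sqrt_abs)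
    finally have "(sqrt M + 1) * sqrt \<bar>x - y\<bar> < e" using s by (simp add: pos_less_divide_eq mult.commute)
    moreover have "sqrt M * sqrt \<bar>x - y\<bar> \<le> (sqrt M + 1) * sqrt \<bar>x - y\<bar>" by (intro mult_right_mono) auto
    ultimately show "norm (f n x - f n y) < e" using hol[of n x y] by simp
  qed
  obtain g r where gr: "strict_mono (r :: nat \<Rightarrow> nat)"
    "\<And>e. 0 < e \<Longrightarrow> \<exists>N. \<forall>n x. n \<ge> N \<and> x \<in> {0..1} \<longrightarrow> norm (f (r n) x - g x) < e"
    using Arzela_Ascoli[of "{0..1}" f "sqrt M"] bd eq by (metis compact_Icc)
  define g' where "g' x = (if x \<in> {0..1} then g x else 0)" for x
  have "(\<lambda>k. f (r k) x) \<longlonglongrightarrow> g' x" for x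
  proof (cases "x \<in> {0..1}")
    case True
    then show ?thesis using gr(2) unfolding LIMSEQ_iff g'_def by (metis (full_types))
  next
    case False
    then have "f (r k) x = 0" for k by (intro out) auto
    moreover have "g' x = 0" using False by (auto simp: g'_def)
    ultimately show ?thesis by simp
  qed
  then show ?thesis using that gr(1) by blast
qed

context bvp_weight
begin

text \<open>If \<open>f\<close> has \<open>F f = 1\<close> and least energy \<open>C\<close>, then
  \<open>C powr (1 / (p - 2))\<close> times \<open>f\<close> solves the equation without multiplier
  and has energy \<open>C powr (p / (p - 2))\<close>. Minimising the sum of two such powers is
  therefore minimising the energy of the glued solution.\<close>

definition q where "q = p / (p - 2)"

lemma q: "q > 1" using p by (simp add: q_def field_simps)

definition admpair where
  "admpair \<tau> f g C1 C2 \<longleftrightarrow> 0 < \<tau> \<and> \<tau> < 1 \<and> adm 0 \<tau> f C1 \<and> adm \<tau> 1 g C2 \<and> F f = 1 \<and> F g = 1"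

text \<open>The energy is homogeneous of degree 2 and \<open>F\<close> of degree \<open>p\<close>,
  so the new energy bound is the Rayleigh quotient.\<close>

lemma normalize:
  assumes "adm a b f C" "F f > 0"
  obtains c where "adm a b (\<lambda>x. c * f x) (C / F f powr (2/p))" "F (\<lambda>x. c * f x) = 1"
proof -
  define c where "c = F f powr (-1/p)"
  have "c\<^sup>2 = F f powr (-2/p)"
    using assms(2) powr_powr[of "F f" "-1/p" 2] by (simp add: c_def)
  then have "c\<^sup>2 * C = C / F f powr (2/p)" by (simp add: powr_minus_divide)
  moreover have "\<bar>c\<bar> powr p = F f powr (-1)" using p assms(2) by (simp add: c_def powr_powr)
  then have "\<bar>c\<bar> powr p * F f = 1" using assms(2) by (simp add: powr_minus_divide)
  ultimately show ?thesis using that[of c] adm_scale[OF assms(1), of c] F_scale[of c f] by simp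
qed

text \<open>Direct method with the node \<open>\<tau>\<close> as a further unknown. The node cannot
  drift to an end point: one of the two limit functions would then vanish identically, against
  \<open>F = 1\<close>. Passing to absolute values costs no energy and makes both functions
  nonnegative.\<close>

lemma exists_minimizer:
  obtains \<tau> f g C1 C2 where "admpair \<tau> f g C1 C2" "\<And>x. f x \<ge> 0" "\<And>x. g x \<ge> 0"
    "\<And>\<tau>' f' g' C1' C2'. admpair \<tau>' f' g' C1' C2' \<Longrightarrow> C1 powr q + C2 powr q \<le> C1' powr q + C2' powr q"
proof -
  define S where "S = {C1 powr q + C2 powr q | \<tau> f g C1 C2. admpair \<tau> f g C1 C2}"
  have "S \<noteq> {}"
  proof -
    have 1: "adm 0 (1/2) (hat 0 (1/4) (1/2)) (1 / (1/4 - 0) + 1 / (1/2 - 1/4))"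
      and 2: "adm (1/2) 1 (hat (1/2) (3/4) 1) (1 / (3/4 - 1/2) + 1 / (1 - 3/4))" by (intro adm_hat; simp)+
    have "F (hat 0 (1/4) (1/2)) > 0" by (rule F_pos[OF 1, of "1/4"]) (auto simp: hat_def)
    moreover have "F (hat (1/2) (3/4) 1) > 0" by (rule F_pos[OF 2, of "3/4"]) (auto simp: hat_def)
    ultimately have "\<exists>f g C1 C2. admpair (1/2) f g C1 C2"
      using normalize[OF 1] normalize[OF 2] unfolding admpair_def by (smt (verit) half_gt_zero_iff field_sum_of_halves)
    then show ?thesis unfolding S_def by blast
  qed
  have bdd: "bdd_below S" by (rule bdd_belowI[of _ 0]) (auto simp: S_def)
  define m where "m = Inf S"
  have ex: "\<exists>z. (case z of (\<tau>, f, g, C1, C2) \<Rightarrow> admpair \<tau> f g C1 C2 \<and> C1 powr q + C2 powr q < m + 1 / real (Suc k))" for k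
  proof -
    have "Inf S < m + 1 / real (Suc k)" by (simp add: m_def)
    then obtain s where "s \<in> S" "s < m + 1 / real (Suc k)" using cInf_lessD[OF \<open>S \<noteq> {}\<close>] by blast
    then obtain \<tau> f g C1 C2 where "admpair \<tau> f g C1 C2" "C1 powr q + C2 powr q < m + 1 / real (Suc k)"
      unfolding S_def by auto
    then show ?thesis by (intro exI[of _ "(\<tau>, f, g, C1, C2)"]) simp
  qed
  obtain z where z: "\<And>k. case z k of (\<tau>, f, g, C1, C2) \<Rightarrow> admpair \<tau> f g C1 C2 \<and> C1 powr q + C2 powr q < m + 1 / real (Suc k)"
  proof -
    have "\<forall>k. \<exists>z. (case z of (\<tau>, f, g, C1, C2) \<Rightarrow> admpair \<tau> f g C1 C2 \<and> C1 powr q + C2 powr q < m + 1 / real (Suc k))"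
      using ex by blast
    from choice[OF this] show thesis using that by blast
  qed
  define T f g A B where "T k = fst (z k)" and "f k = fst (snd (z k))" and "g k = fst (snd (snd (z k)))"
    and "A k = fst (snd (snd (snd (z k))))" and "B k = snd (snd (snd (snd (z k))))" for k
  have pr: "admpair (T k) (f k) (g k) (A k) (B k)" and lt: "A k powr q + B k powr q < m + 1 / real (Suc k)" for k
    using z[of k] by (auto simp: T_def f_def g_def A_def B_def split: prod.splits)
  have A0: "A k \<ge> 0" and B0: "B k \<ge> 0" for k
    using pr[of k] adm_nonneg unfolding admpair_def by blast+
  \<comment> \<open>Each of the two energies is bounded along the minimising sequence, because the
    other summand is nonnegative and the excess over the infimum is at most 1.\<close>
  define M where "M = (m + 1) powr (1/q)"
  have le: "x \<le> M" if "x \<ge> 0" "x powr q + y powr q < m + 1 / real (Suc k)" for x y k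
  proof -
    have "1 / real (Suc k) \<le> 1" by simp
    then have "x powr q \<le> m + 1" using that(2) powr_ge_zero[of y q] by linarith
    then have "(x powr q) powr (1/q) \<le> M" unfolding M_def using q by (intro powr_mono2) auto
    then show ?thesis using that(1) q by (simp add: powr_powr)
  qed
  have AM: "A k \<le> M" and BM: "B k \<le> M" for k
    using le[OF A0 lt] le[OF B0, of k "A k" k] lt[of k] by (auto simp: add.commute)
  obtain r1 f' where r1: "strict_mono r1" "\<And>x. (\<lambda>k. f (r1 k) x) \<longlonglongrightarrow> f' x"
    using adm_subseq[of "\<lambda>_. 0" T f A M] pr AM unfolding admpair_def by metis
  obtain r2 g' where r2: "strict_mono r2" "\<And>x. (\<lambda>k. g (r1 (r2 k)) x) \<longlonglongrightarrow> g' x"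
    using adm_subseq[of "\<lambda>k. T (r1 k)" "\<lambda>_. 1" "\<lambda>k. g (r1 k)" "\<lambda>k. B (r1 k)" M] pr BM unfolding admpair_def by metis
  have "compact ({0..1} \<times> {0..M} \<times> {0..M} :: (real \<times> real \<times> real) set)"
    by (intro compact_Times compact_Icc)
  then have "seq_compact ({0..1} \<times> {0..M} \<times> {0..M} :: (real \<times> real \<times> real) set)"
    by (rule compact_imp_seq_compact)
  moreover have "\<forall>k. (T (r1 (r2 k)), A (r1 (r2 k)), B (r1 (r2 k))) \<in> {0..1} \<times> {0..M} \<times> {0..M}"
    using pr A0 B0 AM BM unfolding admpair_def by (auto intro: less_imp_le)
  ultimately obtain l r3 where r3: "strict_mono r3" "((\<lambda>k. (T (r1 (r2 k)), A (r1 (r2 k)), B (r1 (r2 k)))) \<circ> r3) \<longlonglongrightarrow> l"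
    by (rule seq_compactE)
  obtain \<tau> a b where l: "l = (\<tau>, a, b)" by (metis prod_cases3)
  define r where "r k = r1 (r2 (r3 k))" for k
  have r: "strict_mono r" using r1(1) r2(1) r3(1) unfolding r_def strict_mono_def by blast
  have T: "(\<lambda>k. T (r k)) \<longlonglongrightarrow> \<tau>" and A: "(\<lambda>k. A (r k)) \<longlonglongrightarrow> a" and B: "(\<lambda>k. B (r k)) \<longlonglongrightarrow> b"
    using tendsto_fst[OF r3(2)] tendsto_fst[OF tendsto_snd[OF r3(2)]] tendsto_snd[OF tendsto_snd[OF r3(2)]]
    by (simp_all add: l r_def o_def)
  have r23: "strict_mono (\<lambda>k. r2 (r3 k))" using r2(1) r3(1) unfolding strict_mono_def by blast
  have f': "(\<lambda>k. f (r k) x) \<longlonglongrightarrow> f' x" for x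
    using LIMSEQ_subseq_LIMSEQ[OF r1(2) r23, of x] by (simp add: r_def o_def)
  have g': "(\<lambda>k. g (r k) x) \<longlonglongrightarrow> g' x" for x
    using LIMSEQ_subseq_LIMSEQ[OF r2(2) r3(1), of x] by (simp add: r_def o_def)
  have pf: "adm 0 (T (r k)) (f (r k)) (A (r k))" and pg: "adm (T (r k)) 1 (g (r k)) (B (r k))"
    and Ff: "F (f (r k)) = 1" and Fg: "F (g (r k)) = 1" for k
    using pr[of "r k"] unfolding admpair_def by auto
  have af: "adm 0 \<tau> f' a" by (rule adm_limit[OF pf f' tendsto_const T A])
  have ag: "adm \<tau> 1 g' b" by (rule adm_limit[OF pg g' T tendsto_const B])
  have Ff': "F f' = 1" using LIMSEQ_unique[OF F_tendsto[OF pf AM f']] Ff by (simp add: LIMSEQ_const_iff)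
  have Fg': "F g' = 1" using LIMSEQ_unique[OF F_tendsto[OF pg BM g']] Fg by (simp add: LIMSEQ_const_iff)
  have "\<tau> > 0"
  proof (rule ccontr)
    assume "\<not> \<tau> > 0"
    then have "f' x = 0" for x using af unfolding adm_def by (metis linear not_less order_trans)
    then show False using F_zero[of f'] Ff' by simp
  qed
  moreover have "\<tau> < 1"
  proof (rule ccontr)
    assume "\<not> \<tau> < 1"
    then have "g' x = 0" for x using ag unfolding adm_def by (metis linear not_less order_trans)
    then show False using F_zero[of g'] Fg' by simp
  qed
  ultimately have P: "admpair \<tau> (\<lambda>x. \<bar>f' x\<bar>) (\<lambda>x. \<bar>g' x\<bar>) a b"
    unfolding admpair_def using af ag Ff' Fg' by (simp add: adm_abs F_abs)
  have "(\<lambda>k. A (r k) powr q + B (r k) powr q) \<longlonglongrightarrow> a powr q + b powr q"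
    using q A0 B0 by (intro tendsto_add tendsto_powr2 A B tendsto_const) auto
  moreover have "(\<lambda>k. m + 1 / real (Suc (r k))) \<longlonglongrightarrow> m + 0"
    using LIMSEQ_subseq_LIMSEQ[OF LIMSEQ_Suc[OF lim_1_over_n] r] by (intro tendsto_intros) (simp add: o_def)
  ultimately have "a powr q + b powr q \<le> m"
    using lt by (intro LIMSEQ_le[of "\<lambda>k. A (r k) powr q + B (r k) powr q" _ "\<lambda>k. m + 1 / real (Suc (r k))"]) (auto intro: less_imp_le)
  moreover have "m \<le> C1' powr q + C2' powr q" if "admpair \<tau>' f'' g'' C1' C2'" for \<tau>' f'' g'' C1' C2'
  proof -
    have "C1' powr q + C2' powr q \<in> S" unfolding S_def using that by blast
    then show ?thesis unfolding m_def by (rule cInf_lower[OF _ bdd])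
  qed
  ultimately show ?thesis using that[OF P] by (meson abs_ge_zero order_trans)
qed

end

text \<open>Two integrations by parts. The second derivative of a hat consists of three point
  masses, so integrating -\<Phi>'' against it leaves the difference of two chord slopes of
  \<open>\<Phi>\<close>. On the left leg the antiderivative is
  \<open>- \<Phi>1 t * (t - x) + \<Phi> t\<close> divided by \<open>u - x\<close>.\<close>

lemma has_integral_mult_hat:
  assumes o: "x < u" "u < y"
    and d: "\<And>t. x \<le> t \<Longrightarrow> t \<le> y \<Longrightarrow> (\<Phi> has_real_derivative \<Phi>1 t) (at t)"
      "\<And>t. x \<le> t \<Longrightarrow> t \<le> y \<Longrightarrow> (\<Phi>1 has_real_derivative - k t) (at t)"
  shows "((\<lambda>t. k t * hat x u y t) has_integral ((\<Phi> u - \<Phi> x) / (u - x) - (\<Phi> y - \<Phi> u) / (y - u))) UNIV"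
proof -
  have 1: "((\<lambda>t. k t * hat x u y t) has_integral
      ((- \<Phi>1 u * (u - x) + \<Phi> u) / (u - x) - (- \<Phi>1 x * (x - x) + \<Phi> x) / (u - x))) {x..u}"
  proof (rule has_integral_eq)
    show "((\<lambda>t. k t * ((t - x) / (u - x))) has_integral
      ((- \<Phi>1 u * (u - x) + \<Phi> u) / (u - x) - (- \<Phi>1 x * (x - x) + \<Phi> x) / (u - x))) {x..u}"
    proof (rule fundamental_theorem_of_calculus)
      fix t assume t: "t \<in> {x..u}"
      have D: "(\<Phi> has_real_derivative \<Phi>1 t) (at t)" "(\<Phi>1 has_real_derivative - k t) (at t)"
        using d[of t] t o by auto
      have "((\<lambda>t. - \<Phi>1 t * (t - x) + \<Phi> t) has_real_derivative k t * (t - x)) (at t)"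
        by (auto intro!: derivative_eq_intros D)
      from DERIV_cdivide[OF this, of "u - x"]
      have "((\<lambda>t. (- \<Phi>1 t * (t - x) + \<Phi> t) / (u - x)) has_real_derivative k t * ((t - x) / (u - x))) (at t)"
        by simp
      then show "((\<lambda>t. (- \<Phi>1 t * (t - x) + \<Phi> t) / (u - x)) has_vector_derivative k t * ((t - x) / (u - x))) (at t within {x..u})"
        unfolding has_real_derivative_iff_has_vector_derivative by (rule has_vector_derivative_at_within)
    qed (use o in simp)
    show "k t * ((t - x) / (u - x)) = k t * hat x u y t" if "t \<in> {x..u}" for t
      using that o by (auto simp: hat_def)
  qed
  have 2: "((\<lambda>t. k t * hat x u y t) has_integral
      ((- \<Phi>1 y * (y - y) - \<Phi> y) / (y - u) - (- \<Phi>1 u * (y - u) - \<Phi> u) / (y - u))) {u..y}"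
  proof (rule has_integral_eq)
    show "((\<lambda>t. k t * ((y - t) / (y - u))) has_integral
      ((- \<Phi>1 y * (y - y) - \<Phi> y) / (y - u) - (- \<Phi>1 u * (y - u) - \<Phi> u) / (y - u))) {u..y}"
    proof (rule fundamental_theorem_of_calculus)
      fix t assume t: "t \<in> {u..y}"
      have D: "(\<Phi> has_real_derivative \<Phi>1 t) (at t)" "(\<Phi>1 has_real_derivative - k t) (at t)"
        using d[of t] t o by auto
      have "((\<lambda>t. - \<Phi>1 t * (y - t) - \<Phi> t) has_real_derivative k t * (y - t)) (at t)"
        by (auto intro!: derivative_eq_intros D)
      from DERIV_cdivide[OF this, of "y - u"]
      have "((\<lambda>t. (- \<Phi>1 t * (y - t) - \<Phi> t) / (y - u)) has_real_derivative k t * ((y - t) / (y - u))) (at t)"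
        by simp
      then show "((\<lambda>t. (- \<Phi>1 t * (y - t) - \<Phi> t) / (y - u)) has_vector_derivative k t * ((y - t) / (y - u))) (at t within {u..y})"
        unfolding has_real_derivative_iff_has_vector_derivative by (rule has_vector_derivative_at_within)
    qed (use o in simp)
    show "k t * ((y - t) / (y - u)) = k t * hat x u y t" if "t \<in> {u..y}" for t
    proof (cases "t = u")
      case True then show ?thesis using o by (simp add: hat_def)
    next
      case False then show ?thesis using that o by (auto simp: hat_def)
    qed
  qed
  have "((\<lambda>t. k t * hat x u y t) has_integral ((\<Phi> u - \<Phi> x) / (u - x) - (\<Phi> y - \<Phi> u) / (y - u))) {x..y}"
  proof -
    have "(- \<Phi>1 u * (u - x) + \<Phi> u) / (u - x) - (- \<Phi>1 x * (x - x) + \<Phi> x) / (u - x) +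
      ((- \<Phi>1 y * (y - y) - \<Phi> y) / (y - u) - (- \<Phi>1 u * (y - u) - \<Phi> u) / (y - u))
      = (\<Phi> u - \<Phi> x) / (u - x) - (\<Phi> y - \<Phi> u) / (y - u)"
      using o by (simp add: add_divide_distrib diff_divide_distrib)
    then show ?thesis using has_integral_combine[of x u y, OF _ _ 1 2] o by simp
  qed
  then show ?thesis
    by (rule has_integral_on_superset) (auto simp: hat_def)
qed

text \<open>A discrete form of D'' = 0. The set \<open>I\<close> is arbitrary; the line through two
  of its points is compared with any third point on either side or between them.\<close>

lemma affine_of_slopes:
  fixes D :: "real \<Rightarrow> real"
  assumes "\<And>x u y. x \<in> I \<Longrightarrow> u \<in> I \<Longrightarrow> y \<in> I \<Longrightarrow> x < u \<Longrightarrow> u < y \<Longrightarrow> (D u - D x) / (u - x) = (D y - D u) / (y - u)"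
    and I: "x0 \<in> I" "y0 \<in> I" "x0 < y0"
  obtains \<alpha> \<beta> where "\<And>u. u \<in> I \<Longrightarrow> D u = \<alpha> + \<beta> * u"
proof -
  have c: "D u * (y - x) = D y * (u - x) + D x * (y - u)"
    if "x \<in> I" "u \<in> I" "y \<in> I" "x < u" "u < y" for x u y
  proof -
    have "(D u - D x) * (y - u) = (D y - D u) * (u - x)"
      using assms(1)[OF that] that by (simp add: frac_eq_eq)
    then show ?thesis by (simp add: algebra_simps)
  qed
  define \<beta> where "\<beta> = (D y0 - D x0) / (y0 - x0)"
  have "D u = (D x0 - \<beta> * x0) + \<beta> * u" if u: "u \<in> I" for u
  proof -
    have "D u * (y0 - x0) = D y0 * (u - x0) + D x0 * (y0 - u)"
    proof -
      consider "u < x0" | "u = x0" | "x0 < u" "u < y0" | "u = y0" | "y0 < u" by linarith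
      then show ?thesis
      proof cases
        case 1 then show ?thesis using c[OF u I(1,2) 1 I(3)] by (simp add: algebra_simps)
      next
        case 3 then show ?thesis using c[OF I(1) u I(2)] by simp
      next
        case 5 then show ?thesis using c[OF I(1,2) u I(3) 5] by (simp add: algebra_simps)
      qed (simp_all add: algebra_simps)
    qed
    then have "D u = (D y0 * (u - x0) + D x0 * (y0 - u)) / (y0 - x0)" using I(3) by (simp add: eq_divide_eq)
    also have "D y0 * (u - x0) + D x0 * (y0 - u) = D x0 * (y0 - x0) + (D y0 - D x0) * (u - x0)"
      by (simp add: algebra_simps)
    also have "\<dots> / (y0 - x0) = D x0 + \<beta> * (u - x0)"
      using I(3) unfolding \<beta>_def by (simp add: add_divide_distrib)
    finally show ?thesis by (simp add: algebra_simps)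
  qed
  then show ?thesis using that by blast
qed

section \<open>The Euler-Lagrange equation of an optimal function\<close>

context bvp_weight
begin

text \<open>The tangent inequality integrates to a lower bound for \<open>F\<close> along a line
  which holds for every real \<open>c\<close>, of either sign. It takes the place of differentiating
  \<open>F\<close> under the integral.\<close>

lemma F_add_ge:
  assumes f: "adm a b f C" "\<And>x. f x \<ge> 0" and h: "adm a' b' h D" and fh: "adm a'' b'' (\<lambda>x. f x + c * h x) E"
  shows "integrable lborel (\<lambda>x. W x * (f x powr (p - 1) * h x))"
    "F f + p * c * (\<integral>x. W x * (f x powr (p - 1) * h x) \<partial>lborel) \<le> F (\<lambda>x. f x + c * h x)"
proof -
  have [measurable]: "f \<in> borel_measurable borel" "h \<in> borel_measurable borel"
    using adm_measurable f h by blast+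
  show i: "integrable lborel (\<lambda>x. W x * (f x powr (p - 1) * h x))"
  proof (rule Bochner_Integration.integrable_bound)
    show "integrable lborel (\<lambda>x. W x * \<bar>f x\<bar> powr p + W x * \<bar>h x\<bar> powr p)"
      using F_integrable[OF f(1)] F_integrable[OF h] by simp
    show "AE x in lborel. norm (W x * (f x powr (p - 1) * h x)) \<le> norm (W x * \<bar>f x\<bar> powr p + W x * \<bar>h x\<bar> powr p)"
    proof (intro AE_I2)
      fix x
      have "norm (W x * (f x powr (p - 1) * h x)) = W x * (f x powr (p - 1) * \<bar>h x\<bar>)"
        using W_nonneg[of x] by (simp add: abs_mult)
      also have "\<dots> \<le> W x * (f x powr p + \<bar>h x\<bar> powr p)"
        using p by (intro mult_left_mono powr_mult_le_add f(2) W_nonneg) auto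
      also have "\<dots> = norm (W x * \<bar>f x\<bar> powr p + W x * \<bar>h x\<bar> powr p)"
        using W_nonneg[of x] f(2)[of x] by (simp add: distrib_left)
      finally show "norm (W x * (f x powr (p - 1) * h x)) \<le> norm (W x * \<bar>f x\<bar> powr p + W x * \<bar>h x\<bar> powr p)" .
    qed
  qed simp
  have "F f + p * c * (\<integral>x. W x * (f x powr (p - 1) * h x) \<partial>lborel)
     = (\<integral>x. W x * \<bar>f x\<bar> powr p + p * c * (W x * (f x powr (p - 1) * h x)) \<partial>lborel)"
    unfolding F_def using F_integrable[OF f(1)] i by (subst Bochner_Integration.integral_add) auto
  also have "\<dots> \<le> F (\<lambda>x. f x + c * h x)"
    unfolding F_def
  proof (rule integral_mono)
    show "integrable lborel (\<lambda>x. W x * \<bar>f x\<bar> powr p + p * c * (W x * (f x powr (p - 1) * h x)))"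
      using F_integrable[OF f(1)] i by (intro Bochner_Integration.integrable_add) auto
    show "integrable lborel (\<lambda>x. W x * \<bar>f x + c * h x\<bar> powr p)" by (rule F_integrable[OF fh])
    fix x
    have "f x powr p + p * f x powr (p - 1) * (c * h x) \<le> \<bar>f x + c * h x\<bar> powr p"
      using p by (intro powr_tangent_le f(2)) auto
    then have "W x * (f x powr p + p * f x powr (p - 1) * (c * h x)) \<le> W x * \<bar>f x + c * h x\<bar> powr p"
      by (intro mult_left_mono W_nonneg)
    then show "W x * \<bar>f x\<bar> powr p + p * c * (W x * (f x powr (p - 1) * h x)) \<le> W x * \<bar>f x + c * h x\<bar> powr p"
      using f(2)[of x] by (simp add: algebra_simps)
  qed
  finally show "F f + p * c * (\<integral>x. W x * (f x powr (p - 1) * h x) \<partial>lborel) \<le> F (\<lambda>x. f x + c * h x)" .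
qed

text \<open>The minimality is stated in homogeneous form, so competitors need not be normalised, and
  \<open>F h = 0\<close> is no special case since \<open>0 powr (2/p) = 0\<close>.\<close>

definition optimal where
  "optimal a b f C \<longleftrightarrow> a < b \<and> adm a b f C \<and> (\<forall>x. f x \<ge> 0) \<and> F f = 1 \<and>
     (\<forall>h D. adm a b h D \<longrightarrow> C * F h powr (2/p) \<le> D)"

lemma adm_add_hat:
  assumes "adm a b f C" "a \<le> x" "x < u" "u < y" "y \<le> b"
  shows "adm a b (\<lambda>t. f t + c * hat x u y t)
     (C + 2 * c * ((f u - f x) / (u - x) - (f y - f u) / (y - u)) + c\<^sup>2 * (1 / (u - x) + 1 / (y - u)))"
  using energy_le_add_hat[of f 0 1 C x u y c] assms unfolding adm_def by (auto simp: hat_def)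

lemma optimal_pos:
  assumes "optimal a b f C"
  shows "C > 0"
proof (rule ccontr)
  assume "\<not> C > 0"
  then have "C = 0" using assms adm_nonneg unfolding optimal_def by fastforce
  then have "\<bar>f x - f 0\<bar> \<le> 0" for x
    using adm_diff_le[of a b f C x 0] assms unfolding optimal_def by simp
  moreover have "f 0 = 0" using assms unfolding optimal_def adm_def by auto
  ultimately have "F f = 0" by (intro F_zero) auto
  then show False using assms unfolding optimal_def by simp
qed

text \<open>The Euler-Lagrange equation tested with one hat. The multiplier is \<open>C\<close>
  itself, as one sees by comparing degrees of homogeneity.\<close>

lemma optimal_hat:
  assumes opt: "optimal a b f C" and o: "a \<le> x" "x < u" "u < y" "y \<le> b"
  shows "(f u - f x) / (u - x) - (f y - f u) / (y - u) = C * (\<integral>t. W t * (f t powr (p - 1) * hat x u y t) \<partial>lborel)"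
proof -
  define \<kappa> where "\<kappa> = (\<integral>t. W t * (f t powr (p - 1) * hat x u y t) \<partial>lborel)"
  define J where "J = (f u - f x) / (u - x) - (f y - f u) / (y - u)"
  define H where "H = 1 / (u - x) + 1 / (y - u)"
  have af: "adm a b f C" and f0: "\<And>x. f x \<ge> 0" and F1: "F f = 1" and
    min: "\<And>h D. adm a b h D \<Longrightarrow> C * F h powr (2/p) \<le> D"
    using opt unfolding optimal_def by auto
  have C: "C > 0" by (rule optimal_pos[OF opt])
  have ah: "adm x y (hat x u y) H" unfolding H_def using o af by (intro adm_hat) (auto simp: adm_def)
  \<comment> \<open>The first part bounds the energy along the line, the second is a lower bound for
    \<open>C\<close> times the power of \<open>F\<close>. Hence \<open>\<phi>\<close> is nonnegative
    near 0 with \<open>\<phi> 0 = 0\<close>, and it is explicitly differentiable although nothing is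
    known about differentiability of \<open>F\<close>.\<close>
  define \<phi> where "\<phi> c = C + 2 * c * J + c\<^sup>2 * H - C * (1 + p * c * \<kappa>) powr (2/p)" for c
  have "(\<phi> has_real_derivative 2 * J - C * (2/p * (p * \<kappa>))) (at 0)"
    unfolding \<phi>_def by (auto intro!: derivative_eq_intros)
  \<comment> \<open>For \<open>\<bar>c\<bar> < d\<close> the base
    \<open>1 + p * c * \<kappa>\<close> stays positive, so the power is monotone in it.\<close>
  moreover define d where "d = 1 / (p * (\<bar>\<kappa>\<bar> + 1))"
  have "d > 0" using p by (simp add: d_def add_nonneg_pos)
  moreover have "\<phi> 0 \<le> \<phi> c" if c: "\<bar>0 - c\<bar> < d" for c
  proof -
    have "\<bar>p * c * \<kappa>\<bar> = p * \<bar>\<kappa>\<bar> * \<bar>c\<bar>" using p by (simp add: abs_mult)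
    also have "\<dots> \<le> p * (\<bar>\<kappa>\<bar> + 1) * \<bar>c\<bar>" using p by (intro mult_right_mono mult_left_mono) auto
    also have "\<dots> < p * (\<bar>\<kappa>\<bar> + 1) * d" using p c by (intro mult_strict_left_mono) (auto simp: add_nonneg_pos)
    also have "\<dots> = 1" using p unfolding d_def by (simp add: add_nonneg_pos less_imp_neq[symmetric])
    finally have pos: "1 + p * c * \<kappa> > 0" by linarith
    have afh: "adm a b (\<lambda>t. f t + c * hat x u y t) (C + 2 * c * J + c\<^sup>2 * H)"
      unfolding J_def H_def by (rule adm_add_hat[OF af o])
    have "1 + p * c * \<kappa> \<le> F (\<lambda>t. f t + c * hat x u y t)"
      using F_add_ge(2)[OF af f0 ah afh] F1 by (simp add: \<kappa>_def)
    then have "C * (1 + p * c * \<kappa>) powr (2/p) \<le> C * F (\<lambda>t. f t + c * hat x u y t) powr (2/p)"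
      using pos C p by (intro mult_left_mono powr_mono2) auto
    also have "\<dots> \<le> C + 2 * c * J + c\<^sup>2 * H" by (rule min[OF afh])
    finally show ?thesis unfolding \<phi>_def by simp
  qed
  ultimately have "2 * J - C * (2/p * (p * \<kappa>)) = 0" by (intro DERIV_local_min[of \<phi> _ 0 d]) auto
  then have "J = C * \<kappa>" using p by simp
  then show ?thesis unfolding J_def \<kappa>_def .
qed

text \<open>Two successive antiderivatives of the right-hand side have the same chord slope
  differences as \<open>f\<close>, so the two differ by an affine function, which is absorbed. The
  function \<open>\<phi>\<close> lives on all of the open unit interval, also beyond
  \<open>a\<close> and \<open>b\<close>, and the last conclusion holds for hats that stick out of
  the interval; this extrapolation is what the variation of the node uses.\<close>

lemma optimal_repr:
  assumes opt: "optimal a b f C"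
  obtains \<phi> \<phi>1 where "\<And>t. 0 < t \<Longrightarrow> t < 1 \<Longrightarrow> (\<phi> has_real_derivative \<phi>1 t) (at t)"
    "\<And>t. 0 < t \<Longrightarrow> t < 1 \<Longrightarrow> (\<phi>1 has_real_derivative - (C * (V t * f t powr (p - 1)))) (at t)"
    "\<And>t. a \<le> t \<Longrightarrow> t \<le> b \<Longrightarrow> 0 < t \<Longrightarrow> t < 1 \<Longrightarrow> f t = \<phi> t"
    "\<And>x u y. 0 < x \<Longrightarrow> x < u \<Longrightarrow> u < y \<Longrightarrow> y < 1 \<Longrightarrow>
       C * (\<integral>t. W t * (f t powr (p - 1) * hat x u y t) \<partial>lborel) = (\<phi> u - \<phi> x) / (u - x) - (\<phi> y - \<phi> u) / (y - u)"
proof -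
  have af: "adm a b f C" and f0: "\<And>x. f x \<ge> 0" and ab: "a < b" "0 \<le> a" "b \<le> 1"
    using opt unfolding optimal_def adm_def by auto
  define k where "k t = C * (V t * f t powr (p - 1))" for t
  have cf: "continuous_on {0<..<1} f" using adm_continuous[OF af] continuous_on_subset by blast
  have "continuous_on {0<..<1} (\<lambda>t. f t powr (p - 1))"
    using p by (intro continuous_on_powr' cf continuous_on_const) (auto simp: f0)
  from continuous_on_mult[OF continuous_on_const continuous_on_mult[OF V_cont this]]
  have "continuous_on {0<..<1} k" unfolding k_def .
  then have ck: "isCont k t" if "0 < t" "t < 1" for t
    using that by (simp add: continuous_on_eq_continuous_at)
  have "\<exists>G. \<forall>t::real. ereal 0 < t \<longrightarrow> t < ereal 1 \<longrightarrow> (G has_vector_derivative - k t) (at t)"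
    by (rule einterval_antiderivative) (auto intro!: continuous_intros ck)
  then obtain \<Phi>1 where \<Phi>1: "\<And>t. 0 < t \<Longrightarrow> t < 1 \<Longrightarrow> (\<Phi>1 has_real_derivative - k t) (at t)"
    unfolding has_real_derivative_iff_has_vector_derivative by auto
  have "\<exists>G. \<forall>t::real. ereal 0 < t \<longrightarrow> t < ereal 1 \<longrightarrow> (G has_vector_derivative \<Phi>1 t) (at t)"
    by (rule einterval_antiderivative) (auto intro!: DERIV_isCont \<Phi>1)
  then obtain \<Phi> where \<Phi>: "\<And>t. 0 < t \<Longrightarrow> t < 1 \<Longrightarrow> (\<Phi> has_real_derivative \<Phi>1 t) (at t)"
    unfolding has_real_derivative_iff_has_vector_derivative by auto
  have J: "C * (\<integral>t. W t * (f t powr (p - 1) * hat x u y t) \<partial>lborel) = (\<Phi> u - \<Phi> x) / (u - x) - (\<Phi> y - \<Phi> u) / (y - u)"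
    if o: "0 < x" "x < u" "u < y" "y < 1" for x u y
  proof -
    have ah: "adm x y (hat x u y) (1 / (u - x) + 1 / (y - u))" using o by (intro adm_hat) auto
    \<comment> \<open>\<open>F_add_ge\<close> with coefficient 0: the perturbed function is then
      \<open>f\<close> itself, whose admissibility is known.\<close>
    have "integrable lborel (\<lambda>t. C * (W t * (f t powr (p - 1) * hat x u y t)))"
      using F_add_ge(1)[OF af f0 ah, of 0 1 0 0] p energy_le_const[of 0 1]
      using F_add_ge(1)[OF af f0 ah, of a b 0 C] af by simp
    then have "((\<lambda>t. C * (W t * (f t powr (p - 1) * hat x u y t))) has_integral (\<integral>t. C * (W t * (f t powr (p - 1) * hat x u y t)) \<partial>lborel)) UNIV"
      by (rule has_integral_integral_lborel)
    moreover have "(\<lambda>t. C * (W t * (f t powr (p - 1) * hat x u y t))) = (\<lambda>t. k t * hat x u y t)"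
      using o by (intro ext) (auto simp: W_def k_def hat_def)
    moreover have "((\<lambda>t. k t * hat x u y t) has_integral ((\<Phi> u - \<Phi> x) / (u - x) - (\<Phi> y - \<Phi> u) / (y - u))) UNIV"
      by (rule has_integral_mult_hat[of _ _ _ _ \<Phi>1]) (use o \<Phi> \<Phi>1 in auto)
    ultimately have "(\<integral>t. C * (W t * (f t powr (p - 1) * hat x u y t)) \<partial>lborel) = (\<Phi> u - \<Phi> x) / (u - x) - (\<Phi> y - \<Phi> u) / (y - u)"
      using has_integral_unique by metis
    then show ?thesis by simp
  qed
  define I where "I = {t. a \<le> t \<and> t \<le> b \<and> 0 < t \<and> t < 1}"
  define D where "D t = f t - \<Phi> t" for t
  have sl: "(D u - D x) / (u - x) = (D y - D u) / (y - u)" if "x \<in> I" "u \<in> I" "y \<in> I" "x < u" "u < y" for x u y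
  proof -
    have "(f u - f x) / (u - x) - (f y - f u) / (y - u) = (\<Phi> u - \<Phi> x) / (u - x) - (\<Phi> y - \<Phi> u) / (y - u)"
      using optimal_hat[OF opt, of x u y] J[of x u y] that by (simp add: I_def)
    then show ?thesis by (simp add: D_def diff_divide_distrib)
  qed
  have "a + (b - a) / 3 \<in> I" "a + (b - a) * 2 / 3 \<in> I" "a + (b - a) / 3 < a + (b - a) * 2 / 3"
    using ab by (auto simp: I_def field_simps)
  then obtain \<alpha> \<beta> where \<alpha>: "\<And>u. u \<in> I \<Longrightarrow> D u = \<alpha> + \<beta> * u"
    using affine_of_slopes[of I D] sl by (metis (no_types, lifting))
  show thesis
  proof (rule that)
    fix t :: real assume t: "0 < t" "t < 1"
    show "((\<lambda>t. \<Phi> t + (\<alpha> + \<beta> * t)) has_real_derivative (\<Phi>1 t + \<beta>)) (at t)"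
      by (auto intro!: derivative_eq_intros \<Phi> t)
    show "((\<lambda>t. \<Phi>1 t + \<beta>) has_real_derivative - (C * (V t * f t powr (p - 1)))) (at t)"
      using \<Phi>1[OF t] by (auto intro!: derivative_eq_intros simp: k_def)
    show "f t = \<Phi> t + (\<alpha> + \<beta> * t)" if "a \<le> t" "t \<le> b"
      using \<alpha>[of t] that t by (simp add: I_def D_def)
  next
    fix x u y :: real assume o: "0 < x" "x < u" "u < y" "y < 1"
    have "(\<Phi> u + (\<alpha> + \<beta> * u) - (\<Phi> x + (\<alpha> + \<beta> * x))) / (u - x) = (\<Phi> u - \<Phi> x) / (u - x) + \<beta>"
      "(\<Phi> y + (\<alpha> + \<beta> * y) - (\<Phi> u + (\<alpha> + \<beta> * u))) / (y - u) = (\<Phi> y - \<Phi> u) / (y - u) + \<beta>"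
      using o by (simp_all add: field_simps)
    then show "C * (\<integral>t. W t * (f t powr (p - 1) * hat x u y t) \<partial>lborel) =
      (\<Phi> u + (\<alpha> + \<beta> * u) - (\<Phi> x + (\<alpha> + \<beta> * x))) / (u - x) - (\<Phi> y + (\<alpha> + \<beta> * y) - (\<Phi> u + (\<alpha> + \<beta> * u))) / (y - u)"
      using J[OF o] by simp
  qed
qed

end

section \<open>First variation with respect to the node\<close>

context bvp_weight
begin

definition minpair where
  "minpair \<tau> f g C1 C2 \<longleftrightarrow> admpair \<tau> f g C1 C2 \<and> (\<forall>x. f x \<ge> 0) \<and> (\<forall>x. g x \<ge> 0) \<and>
     (\<forall>\<tau>' f' g' C1' C2'. admpair \<tau>' f' g' C1' C2' \<longrightarrow> C1 powr q + C2 powr q \<le> C1' powr q + C2' powr q)"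

text \<open>For the competitors of the first variation only lower bounds of \<open>F\<close> are
  known. Since the Rayleigh quotient decreases in the value of \<open>F\<close>, a lower bound may
  be put in its place.\<close>

lemma minpair_le:
  assumes m: "minpair \<tau> f g C1 C2" and t: "0 < \<tau>'" "\<tau>' < 1"
    and h1: "adm 0 \<tau>' h1 D1" "0 < L1" "L1 \<le> F h1" and h2: "adm \<tau>' 1 h2 D2" "0 < L2" "L2 \<le> F h2"
  shows "C1 powr q + C2 powr q \<le> (D1 / L1 powr (2/p)) powr q + (D2 / L2 powr (2/p)) powr q"
proof -
  have F12: "F h1 > 0" "F h2 > 0" using h1 h2 by linarith+
  obtain c1 where c1: "adm 0 \<tau>' (\<lambda>x. c1 * h1 x) (D1 / F h1 powr (2/p))" "F (\<lambda>x. c1 * h1 x) = 1"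
    by (rule normalize[OF h1(1) F12(1)])
  obtain c2 where c2: "adm \<tau>' 1 (\<lambda>x. c2 * h2 x) (D2 / F h2 powr (2/p))" "F (\<lambda>x. c2 * h2 x) = 1"
    by (rule normalize[OF h2(1) F12(2)])
  have "admpair \<tau>' (\<lambda>x. c1 * h1 x) (\<lambda>x. c2 * h2 x) (D1 / F h1 powr (2/p)) (D2 / F h2 powr (2/p))"
    unfolding admpair_def using t c1 c2 by simp
  then have "C1 powr q + C2 powr q \<le> (D1 / F h1 powr (2/p)) powr q + (D2 / F h2 powr (2/p)) powr q"
    using m unfolding minpair_def by blast
  moreover have mono: "(D / F h powr (2/p)) powr q \<le> (D / L powr (2/p)) powr q" if "0 < L" "L \<le> F h" "D \<ge> 0" for D h L
    using that p q by (intro powr_mono2 divide_left_mono mult_pos_pos) auto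
  ultimately show ?thesis
    using mono[OF h1(2,3) adm_nonneg[OF h1(1)]] mono[OF h2(2,3) adm_nonneg[OF h2(1)]] by linarith
qed

text \<open>Freezing the node and one of the functions leaves a minimisation in the other; the power
  \<open>q\<close> is strictly increasing and can be cancelled.\<close>

lemma minpair_optimal:
  assumes m: "minpair \<tau> f g C1 C2"
  shows "optimal 0 \<tau> f C1" "optimal \<tau> 1 g C2"
proof -
  have P: "0 < \<tau>" "\<tau> < 1" "adm 0 \<tau> f C1" "adm \<tau> 1 g C2" "F f = 1" "F g = 1" "\<And>x. f x \<ge> 0" "\<And>x. g x \<ge> 0"
    using m unfolding minpair_def admpair_def by auto
  have C: "C1 \<ge> 0" "C2 \<ge> 0" using P adm_nonneg by blast+
  have le: "c * F h powr (2/p) \<le> D" if "c \<ge> 0" "D \<ge> 0" "F h > 0 \<Longrightarrow> c powr q \<le> (D / F h powr (2/p)) powr q" for c D h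
  proof (cases "F h > 0")
    case True
    have "c \<le> D / F h powr (2/p)"
    proof (rule ccontr)
      assume "\<not> c \<le> D / F h powr (2/p)"
      then have "(D / F h powr (2/p)) powr q < c powr q" using that(2) q by (intro powr_less_mono2) auto
      then show False using that(3)[OF True] by simp
    qed
    then show ?thesis using True by (simp add: le_divide_eq)
  next
    case False
    then have "F h = 0" using F_nonneg[of h] by simp
    then show ?thesis using that by simp
  qed
  have "C1 * F h powr (2/p) \<le> D" if "adm 0 \<tau> h D" for h D
    by (rule le[OF C(1) adm_nonneg[OF that]]) (use minpair_le[OF m P(1,2) that _ order_refl P(4), of 1] P(6) in simp)
  moreover have "C2 * F h powr (2/p) \<le> D" if "adm \<tau> 1 h D" for h D
    by (rule le[OF C(2) adm_nonneg[OF that]]) (use minpair_le[OF m P(1,2) P(3) _ _ that _ order_refl, of 1] P(5) in simp)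
  ultimately show "optimal 0 \<tau> f C1" "optimal \<tau> 1 g C2" unfolding optimal_def using P by auto
qed

text \<open>First variation under moving the node to the right: the bump on the left has slope \<open>a\<^sub>1\<close> beyond \<open>\<tau>\<close>,
  the right function is cut off; to first order the energies change by \<open>-a\<^sub>1\<^sup>2 \<epsilon>\<close> and \<open>a\<^sub>2\<^sup>2 \<epsilon>\<close>.\<close>

lemma minpair_slopes_le:
  assumes m: "minpair \<tau> f g C1 C2"
    and \<phi>: "\<And>t. 0 < t \<Longrightarrow> t < 1 \<Longrightarrow> (\<phi> has_real_derivative \<phi>1 t) (at t)"
      "\<And>t. 0 < t \<Longrightarrow> t \<le> \<tau> \<Longrightarrow> f t = \<phi> t"
      "\<And>x u y. 0 < x \<Longrightarrow> x < u \<Longrightarrow> u < y \<Longrightarrow> y < 1 \<Longrightarrow>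
       C1 * (\<integral>t. W t * (f t powr (p - 1) * hat x u y t) \<partial>lborel) = (\<phi> u - \<phi> x) / (u - x) - (\<phi> y - \<phi> u) / (y - u)"
    and \<gamma>: "\<And>t. 0 < t \<Longrightarrow> t < 1 \<Longrightarrow> (\<gamma> has_real_derivative \<gamma>1 t) (at t)"
      "\<And>t. 0 < t \<Longrightarrow> t < 1 \<Longrightarrow> isCont \<gamma>1 t"
      "\<And>t. \<tau> \<le> t \<Longrightarrow> t < 1 \<Longrightarrow> g t = \<gamma> t"
  shows "C1 powr (q - 1) * (\<phi>1 \<tau>)\<^sup>2 \<le> C2 powr (q - 1) * (\<gamma>1 \<tau>)\<^sup>2"
proof (rule ccontr)
  assume contra: "\<not> C1 powr (q - 1) * (\<phi>1 \<tau>)\<^sup>2 \<le> C2 powr (q - 1) * (\<gamma>1 \<tau>)\<^sup>2"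
  have P: "0 < \<tau>" "\<tau> < 1" "adm 0 \<tau> f C1" "adm \<tau> 1 g C2" "F f = 1" "F g = 1" "\<And>x. f x \<ge> 0" "\<And>x. g x \<ge> 0"
    using m unfolding minpair_def admpair_def by auto
  note opt = minpair_optimal[OF m]
  have C: "C1 > 0" "C2 > 0" using optimal_pos opt by blast+
  have f0: "f t = 0" if "t \<ge> \<tau>" for t using P(3) that unfolding adm_def by auto
  have g0: "g t = 0" if "t \<le> \<tau>" for t using P(4) that unfolding adm_def by auto
  define a1 where "a1 = - \<phi>1 \<tau>"
  define a2 where "a2 = \<gamma>1 \<tau>"
  define x where "x = \<tau> / 2"
  define y where "y = (\<tau> + 1) / 2"
  have xy: "0 < x" "x < \<tau>" "\<tau> < y" "y < 1" using P by (auto simp: x_def y_def)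
  define s where "s = (f \<tau> - f x) / (\<tau> - x)"
  define \<sigma> where "\<sigma> = g y / (y - \<tau>)"
  have \<phi>\<tau>: "\<phi> \<tau> = 0" using \<phi>(2)[of \<tau>] f0 P by simp
  have \<gamma>\<tau>: "\<gamma> \<tau> = 0" using \<gamma>(3)[of \<tau>] g0 P by simp
  define E where "E \<epsilon> = \<phi> (\<tau> + \<epsilon>)" for \<epsilon>
  define G where "G \<epsilon> = \<gamma> (\<tau> + \<epsilon>)" for \<epsilon>
  have E': "(E has_real_derivative - a1) (at 0 within {0..})"
    unfolding E_def a1_def using \<phi>(1)[of \<tau>] P DERIV_shift[of \<phi> "\<phi>1 \<tau>" 0 \<tau>]
    by (simp add: add.commute has_field_derivative_at_within)
  have G': "(G has_real_derivative a2) (at 0 within {0..})"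
    unfolding G_def a2_def using \<gamma>(1)[of \<tau>] P DERIV_shift[of \<gamma> "\<gamma>1 \<tau>" 0 \<tau>]
    by (simp add: add.commute has_field_derivative_at_within)
  have EG0: "E 0 = 0" "G 0 = 0" using \<phi>\<tau> \<gamma>\<tau> by (simp_all add: E_def G_def)

  \<comment> \<open>The competitor on the left adds a hat of height \<open>a1 * \<epsilon>\<close>
    that peaks at the old node and ends at the new one, so beyond the old node the function falls
    with slope \<open>- a1\<close>, the slope of \<open>\<phi>\<close> at \<open>\<tau>\<close>.
    \<open>A\<close> bounds its energy and \<open>L1\<close> bounds its value of \<open>F\<close>
    from below.\<close>
  define A where "A \<epsilon> = C1 + 2 * (a1 * \<epsilon>) * s + (a1 * \<epsilon>)\<^sup>2 / (\<tau> - x) + a1\<^sup>2 * \<epsilon>" for \<epsilon>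
  define L1 where "L1 \<epsilon> = 1 + p * a1 / C1 * (\<epsilon> * s - E \<epsilon>)" for \<epsilon>
  have left: "\<exists>h. adm 0 (\<tau> + \<epsilon>) h (A \<epsilon>) \<and> L1 \<epsilon> \<le> F h" if \<epsilon>: "0 < \<epsilon>" "\<epsilon> < 1 - \<tau>" for \<epsilon>
  proof -
    define c where "c = a1 * \<epsilon>"
    define h where "h = (\<lambda>t. f t + c * hat x \<tau> (\<tau> + \<epsilon>) t)"
    have f': "adm 0 (\<tau> + \<epsilon>) f C1" using P(3) \<epsilon> unfolding adm_def by auto
    have ah: "adm x (\<tau> + \<epsilon>) (hat x \<tau> (\<tau> + \<epsilon>)) (1 / (\<tau> - x) + 1 / (\<tau> + \<epsilon> - \<tau>))"
      using xy \<epsilon> by (intro adm_hat) auto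
    have 1: "adm 0 (\<tau> + \<epsilon>) h (C1 + 2 * c * ((f \<tau> - f x) / (\<tau> - x) - (f (\<tau> + \<epsilon>) - f \<tau>) / (\<tau> + \<epsilon> - \<tau>)) + c\<^sup>2 * (1 / (\<tau> - x) + 1 / (\<tau> + \<epsilon> - \<tau>)))"
      unfolding h_def using xy \<epsilon> by (intro adm_add_hat[OF f']) auto
    have "C1 + 2 * c * ((f \<tau> - f x) / (\<tau> - x) - (f (\<tau> + \<epsilon>) - f \<tau>) / (\<tau> + \<epsilon> - \<tau>)) + c\<^sup>2 * (1 / (\<tau> - x) + 1 / (\<tau> + \<epsilon> - \<tau>)) = A \<epsilon>"
      using \<epsilon> f0 unfolding A_def s_def c_def by (simp add: distrib_left power2_eq_square)
    then have A: "adm 0 (\<tau> + \<epsilon>) h (A \<epsilon>)" using 1 by simp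
    have \<kappa>: "(\<integral>t. W t * (f t powr (p - 1) * hat x \<tau> (\<tau> + \<epsilon>) t) \<partial>lborel) = (s - E \<epsilon> / \<epsilon>) / C1"
      using \<phi>(3)[of x \<tau> "\<tau> + \<epsilon>"] xy \<epsilon> C \<phi>\<tau> \<phi>(2)[of \<tau>] \<phi>(2)[of x] unfolding s_def E_def
      by (simp add: eq_divide_eq mult.commute)
    have "F f + p * c * ((s - E \<epsilon> / \<epsilon>) / C1) \<le> F h"
      using F_add_ge(2)[OF f' P(7) ah A[unfolded h_def]] unfolding \<kappa> h_def .
    also have "F f + p * c * ((s - E \<epsilon> / \<epsilon>) / C1) = 1 + p * a1 / C1 * (\<epsilon> * (s - E \<epsilon> / \<epsilon>))"
      using P(5) unfolding c_def by simp
    also have "\<epsilon> * (s - E \<epsilon> / \<epsilon>) = \<epsilon> * s - E \<epsilon>" using \<epsilon> by (simp add: right_diff_distrib)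
    also have "1 + p * a1 / C1 * (\<epsilon> * s - E \<epsilon>) = L1 \<epsilon>" by (simp add: L1_def)
    finally show ?thesis using A by blast
  qed

  \<comment> \<open>The competitor on the right subtracts a hat of height
    \<open>G \<epsilon>\<close> at the new node, so that the value there becomes 0, and is then set
    to 0 between the old and the new node. \<open>H\<close> is the energy of the chord that
    disappears, and \<open>B\<close> bounds the energy that is left.\<close>
  define H where "H \<epsilon> = (G \<epsilon>)\<^sup>2 / \<epsilon>" for \<epsilon>
  define B where "B \<epsilon> = C2 - H \<epsilon> + 2 * G \<epsilon> * (g y - G \<epsilon>) / (y - (\<tau> + \<epsilon>)) + (G \<epsilon>)\<^sup>2 / (y - (\<tau> + \<epsilon>))" for \<epsilon>
  have "compact {\<tau>..y}" "continuous_on {\<tau>..y} \<gamma>1"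
    using \<gamma>(2) xy P by (auto intro!: continuous_at_imp_continuous_on)
  then have "bounded (\<gamma>1 ` {\<tau>..y})" by (intro compact_imp_bounded compact_continuous_image)
  then obtain G1 where G1: "\<And>t. t \<in> {\<tau>..y} \<Longrightarrow> \<bar>\<gamma>1 t\<bar> \<le> G1" unfolding bounded_iff real_norm_def by blast
  have G1_nonneg: "G1 \<ge> 0" using G1[of \<tau>] xy by fastforce
  have \<gamma>le: "\<bar>\<gamma> t\<bar> \<le> G1 * (t - \<tau>)" if "t \<in> {\<tau>..y}" for t
  proof -
    have "norm (\<gamma> t - \<gamma> \<tau>) \<le> G1 * norm (t - \<tau>)"
    proof (rule field_differentiable_bound[of "{\<tau>..y}"])
      show "(\<gamma> has_field_derivative \<gamma>1 z) (at z within {\<tau>..y})" if "z \<in> {\<tau>..y}" for z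
        using \<gamma>(1)[of z] that xy P by (auto intro: has_field_derivative_at_within)
    qed (use G1 that xy in auto)
    then show ?thesis using that \<gamma>\<tau> by simp
  qed
  have "continuous_on {\<tau>..y} V" using V_cont by (rule continuous_on_subset) (use P xy in auto)
  then have "bounded (V ` {\<tau>..y})" by (intro compact_imp_bounded compact_continuous_image) auto
  then obtain Wm where Wm: "\<And>t. t \<in> {\<tau>..y} \<Longrightarrow> \<bar>V t\<bar> \<le> Wm" unfolding bounded_iff real_norm_def by blast
  have Wm_nonneg: "Wm \<ge> 0" using Wm[of \<tau>] xy by fastforce
  \<comment> \<open>Setting the function to 0 between the nodes lowers \<open>F\<close> only to
    second order: it is at most \<open>2 * G1 * \<epsilon>\<close> there, the power is estimated
    crudely by one factor \<open>\<epsilon>\<close>, and the length of the interval gives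
    another.\<close>
  define M where "M = Wm * (2 * G1) powr p"
  define L2 where "L2 \<epsilon> = 1 - p / C2 * (H \<epsilon> - G \<epsilon> * (g y - G \<epsilon>) / (y - (\<tau> + \<epsilon>))) - M * \<epsilon>\<^sup>2" for \<epsilon>
  have right: "\<exists>h. adm (\<tau> + \<epsilon>) 1 h (B \<epsilon>) \<and> L2 \<epsilon> \<le> F h" if \<epsilon>: "0 < \<epsilon>" "\<epsilon> < y - \<tau>" for \<epsilon>
  proof -
    define u where "u = \<tau> + \<epsilon>"
    have u: "\<tau> < u" "u < y" "u < 1" using \<epsilon> xy by (auto simp: u_def)
    have gu: "g u = G \<epsilon>" using \<gamma>(3)[of u] u by (simp add: G_def u_def)
    define c where "c = - G \<epsilon>"
    define h' where "h' = (\<lambda>t. g t + c * hat \<tau> u y t)"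
    define h where "h = (\<lambda>t. if \<tau> \<le> t \<and> t \<le> u then 0 else h' t)"
    define J where "J = (g u - g \<tau>) / (u - \<tau>) - (g y - g u) / (y - u)"
    have J: "J = G \<epsilon> / \<epsilon> - (g y - G \<epsilon>) / (y - u)" unfolding J_def gu using g0[of \<tau>] by (simp add: u_def)
    have ah: "adm \<tau> y (hat \<tau> u y) (1 / (u - \<tau>) + 1 / (y - u))" using xy u P by (intro adm_hat) auto
    have 1: "adm \<tau> 1 h' (C2 + 2 * c * J + c\<^sup>2 * (1 / (u - \<tau>) + 1 / (y - u)))"
      unfolding h'_def J_def using xy u by (intro adm_add_hat[OF P(4)]) auto
    have "C2 + 2 * c * J + c\<^sup>2 * (1 / (u - \<tau>) + 1 / (y - u)) = B \<epsilon>"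
      unfolding B_def J c_def H_def u_def[symmetric]
      by (simp add: u_def algebra_simps power2_eq_square add_divide_distrib diff_divide_distrib)
    then have 2: "adm \<tau> 1 h' (B \<epsilon>)" using 1 by simp
    have h'0: "h' \<tau> = 0" "h' u = 0" using g0[of \<tau>] gu u by (auto simp: h'_def hat_def c_def)
    have "energy_le h 0 1 (B \<epsilon>)"
      unfolding h_def using 2 u xy P h'0 by (intro energy_le_zero_out) (auto simp: adm_def)
    then have ahh: "adm u 1 h (B \<epsilon>)"
      using 2 u xy P unfolding adm_def h_def by auto
    have \<kappa>: "(\<integral>t. W t * (g t powr (p - 1) * hat \<tau> u y t) \<partial>lborel) = J / C2"
      using optimal_hat[OF opt(2), of \<tau> u y] xy u C unfolding J_def by (simp add: eq_divide_eq mult.commute)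
    have "F g + p * c * (J / C2) \<le> F h'"
      using F_add_ge(2)[OF P(4,8) ah 2[unfolded h'_def]] unfolding \<kappa> h'_def .
    moreover have "F h' \<le> F h + M * \<epsilon>\<^sup>2"
    proof -
      have ind: "integrable lborel (indicator {\<tau>..u} :: real \<Rightarrow> real)"
        by (rule integrable_real_indicator) (use u in \<open>auto simp: emeasure_lborel_Icc_eq\<close>)
      have "F h' \<le> (\<integral>t. W t * \<bar>h t\<bar> powr p + M * \<epsilon> * indicator {\<tau>..u} t \<partial>lborel)"
        unfolding F_def
      proof (rule integral_mono)
        show "integrable lborel (\<lambda>t. W t * \<bar>h' t\<bar> powr p)" by (rule F_integrable[OF 2])
        show "integrable lborel (\<lambda>t. W t * \<bar>h t\<bar> powr p + M * \<epsilon> * indicator {\<tau>..u} t)"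
          by (intro Bochner_Integration.integrable_add F_integrable[OF ahh] integrable_mult_right ind)
        fix t
        show "W t * \<bar>h' t\<bar> powr p \<le> W t * \<bar>h t\<bar> powr p + M * \<epsilon> * indicator {\<tau>..u} t"
        proof (cases "t \<in> {\<tau>..u}")
          case True
          have "\<bar>hat \<tau> u y t\<bar> \<le> 1" using True u by (auto simp: hat_def)
          then have "\<bar>c * hat \<tau> u y t\<bar> \<le> \<bar>c\<bar> * 1" unfolding abs_mult by (intro mult_left_mono) auto
          moreover have "\<bar>c\<bar> \<le> G1 * \<epsilon>" using \<gamma>le[of u] u unfolding c_def G_def by (simp add: u_def)
          moreover have "\<bar>g t\<bar> \<le> G1 * \<epsilon>"
          proof -
            have "g t = \<gamma> t" using \<gamma>(3)[of t] True u by simp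
            then have "\<bar>g t\<bar> \<le> G1 * (t - \<tau>)" using \<gamma>le[of t] True u by simp
            also have "\<dots> \<le> G1 * \<epsilon>" using True G1_nonneg by (intro mult_left_mono) (auto simp: u_def)
            finally show ?thesis .
          qed
          ultimately have "\<bar>h' t\<bar> \<le> (2 * G1) * \<epsilon>" unfolding h'_def by linarith
          then have "\<bar>h' t\<bar> powr p \<le> ((2 * G1) * \<epsilon>) powr p" using p by (intro powr_mono2) auto
          also have "\<dots> = (2 * G1) powr p * \<epsilon> powr p" by (rule powr_mult)
          also have "\<dots> \<le> (2 * G1) powr p * \<epsilon> powr 1"
            using \<epsilon> xy p P by (intro mult_left_mono powr_mono') auto
          finally have "\<bar>h' t\<bar> powr p \<le> (2 * G1) powr p * \<epsilon>" using \<epsilon> by simp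
          moreover have "W t \<le> Wm" "W t \<ge> 0" using Wm[of t] True u P W_nonneg[of t] by (auto simp: W_def)
          ultimately have "W t * \<bar>h' t\<bar> powr p \<le> Wm * ((2 * G1) powr p * \<epsilon>)"
            by (intro mult_mono) (auto simp: Wm_nonneg)
          then show ?thesis using True p by (simp add: h_def M_def mult.assoc)
        next
          case False
          then have "h t = h' t" "indicator {\<tau>..u} t = (0::real)" by (auto simp: h_def)
          then show ?thesis by simp
        qed
      qed
      also have "\<dots> = F h + M * \<epsilon> * (u - \<tau>)"
        unfolding F_def using F_integrable[OF ahh] u
        by (subst Bochner_Integration.integral_add) (auto intro!: integrable_mult_right ind)
      finally show ?thesis by (simp add: u_def power2_eq_square algebra_simps)
    qed
    moreover have "F g + p * c * (J / C2) - M * \<epsilon>\<^sup>2 = L2 \<epsilon>"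
      unfolding L2_def J c_def H_def u_def[symmetric] using P(6)
      by (simp add: u_def algebra_simps power2_eq_square add_divide_distrib diff_divide_distrib)
    ultimately have "L2 \<epsilon> \<le> F h" by linarith
    then show ?thesis using ahh unfolding u_def by blast
  qed

  \<comment> \<open>Since \<open>G 0 = 0\<close>, and \<open>H 0 = 0\<close> by division by zero,
    the difference quotient of \<open>H\<close> at 0 is the square of that of
    \<open>G\<close>.\<close>
  have H': "(H has_real_derivative a2\<^sup>2) (at 0 within {0..})"
  proof -
    have "((\<lambda>y. (G y - G 0) / (y - 0)) \<longlongrightarrow> a2) (at 0 within {0..})"
      using G' unfolding has_field_derivative_iff .
    then have "((\<lambda>y. ((G y - G 0) / (y - 0))\<^sup>2) \<longlongrightarrow> a2\<^sup>2) (at 0 within {0..})" by (rule tendsto_power)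
    moreover have "(\<lambda>y. ((G y - G 0) / (y - 0))\<^sup>2) = (\<lambda>y. (H y - H 0) / (y - 0))"
      by (auto simp: H_def EG0 power2_eq_square fun_eq_iff)
    ultimately show ?thesis unfolding has_field_derivative_iff by simp
  qed
  have H0: "H 0 = 0" by (simp add: H_def)
  define z where "z = y - \<tau>"
  have yt: "z \<noteq> 0" using xy by (simp add: z_def)
  have ye: "y - (\<tau> + \<epsilon>) = z - \<epsilon>" for \<epsilon> by (simp add: z_def)
  have \<sigma>z: "\<sigma> = g y / z" by (simp add: \<sigma>_def z_def)
  have A': "(A has_real_derivative 2 * a1 * s + a1\<^sup>2) (at 0 within {0..})"
    unfolding A_def using xy by (auto intro!: derivative_eq_intros)
  have L1': "(L1 has_real_derivative p * a1 / C1 * (s + a1)) (at 0 within {0..})"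
    unfolding L1_def using C by (auto intro!: derivative_eq_intros E')
  have B': "(B has_real_derivative - a2\<^sup>2 + 2 * a2 * \<sigma>) (at 0 within {0..})"
    unfolding B_def ye \<sigma>z using yt
    by (auto intro!: derivative_eq_intros H' G' simp: EG0)
  have L2': "(L2 has_real_derivative - (p / C2 * (a2\<^sup>2 - a2 * \<sigma>))) (at 0 within {0..})"
    unfolding L2_def ye \<sigma>z using yt C
    by (auto intro!: derivative_eq_intros H' G' simp: EG0)
  have AL0: "A 0 = C1" "L1 0 = 1" "B 0 = C2" "L2 0 = 1"
    by (simp_all add: A_def L1_def B_def L2_def EG0 H0)
  \<comment> \<open>\<open>R\<close> bounds the value of the competing pair. In its right derivative
    at 0 the chord slopes \<open>s\<close> and \<open>\<sigma>\<close> cancel, because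
    \<open>f\<close> and \<open>g\<close> are critical for a fixed node; what remains is \<open>q *
    (C2 powr (q - 1) * a2\<^sup>2 - C1 powr (q - 1) * a1\<^sup>2)\<close>, negative under the
    assumption to be refuted.\<close>
  define R where "R \<epsilon> = (A \<epsilon> / L1 \<epsilon> powr (2/p)) powr q + (B \<epsilon> / L2 \<epsilon> powr (2/p)) powr q" for \<epsilon>
  have quo: "((\<lambda>\<epsilon>. (X \<epsilon> / L \<epsilon> powr (2/p)) powr q) has_real_derivative q * c powr (q - 1) * (X' - c * (2/p) * l)) (at 0 within {0..})"
    if "(X has_real_derivative X') (at 0 within {0..})" "(L has_real_derivative l) (at 0 within {0..})" "X 0 = c" "L 0 = 1" "c > 0" for X L X' l c
    using that by (auto intro!: derivative_eq_intros simp: powr_diff field_simps)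
  have R1: "(R has_real_derivative q * C1 powr (q - 1) * (2 * a1 * s + a1\<^sup>2 - C1 * (2/p) * (p * a1 / C1 * (s + a1)))
      + q * C2 powr (q - 1) * (- a2\<^sup>2 + 2 * a2 * \<sigma> - C2 * (2/p) * (- (p / C2 * (a2\<^sup>2 - a2 * \<sigma>))))) (at 0 within {0..})"
    unfolding R_def by (intro DERIV_add quo A' L1' B' L2' AL0 C)
  have e1: "2 * a1 * s + a1\<^sup>2 - C1 * (2/p) * (p * a1 / C1 * (s + a1)) = - a1\<^sup>2"
    using C p by (simp add: field_simps power2_eq_square)
  have e2: "- a2\<^sup>2 + 2 * a2 * \<sigma> - C2 * (2/p) * (- (p / C2 * (a2\<^sup>2 - a2 * \<sigma>))) = a2\<^sup>2"
    using C p by (simp add: field_simps power2_eq_square)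
  have R': "(R has_real_derivative q * C1 powr (q - 1) * (- a1\<^sup>2) + q * C2 powr (q - 1) * a2\<^sup>2) (at 0 within {0..})"
    using R1 unfolding e1 e2 .
  have "q * (C2 powr (q - 1) * a2\<^sup>2 - C1 powr (q - 1) * a1\<^sup>2) < 0"
    using contra q by (intro mult_pos_neg) (auto simp: a1_def a2_def)
  then have neg: "q * C1 powr (q - 1) * (- a1\<^sup>2) + q * C2 powr (q - 1) * a2\<^sup>2 < 0" by (simp add: algebra_simps)
  obtain d where d: "d > 0" "\<And>h. 0 < h \<Longrightarrow> h < d \<Longrightarrow> R h < R 0"
    using has_real_derivative_neg_dec_right[OF R' neg] by auto
  have "continuous (at 0 within {0..}) L1" "continuous (at 0 within {0..}) L2"
    using L1' L2' DERIV_continuous by blast+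
  then have "\<forall>\<^sub>F \<epsilon> in at_right 0. L1 \<epsilon> > 0" "\<forall>\<^sub>F \<epsilon> in at_right 0. L2 \<epsilon> > 0"
    unfolding continuous_within AL0 at_within_Ici_at_right by (auto dest!: order_tendstoD(1)[of _ 1 _ 0])
  moreover have "\<forall>\<^sub>F \<epsilon> in at_right 0. \<epsilon> \<in> {0<..<min d (min (1 - \<tau>) (y - \<tau>))}"
    using d xy P by (intro eventually_at_right_real) auto
  ultimately have "\<forall>\<^sub>F \<epsilon> in at_right (0::real). False"
  proof eventually_elim
    case (elim \<epsilon>)
    then have \<epsilon>: "0 < \<epsilon>" "\<epsilon> < d" "\<epsilon> < 1 - \<tau>" "\<epsilon> < y - \<tau>" by auto
    obtain h1 where h1: "adm 0 (\<tau> + \<epsilon>) h1 (A \<epsilon>)" "L1 \<epsilon> \<le> F h1" using left \<epsilon> by blast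
    obtain h2 where h2: "adm (\<tau> + \<epsilon>) 1 h2 (B \<epsilon>)" "L2 \<epsilon> \<le> F h2" using right \<epsilon> by blast
    have "C1 powr q + C2 powr q \<le> R \<epsilon>"
      unfolding R_def by (rule minpair_le[OF m _ _ h1(1) elim(1) h1(2) h2(1) elim(2) h2(2)]) (use \<epsilon> P in auto)
    moreover have "R 0 = C1 powr q + C2 powr q" by (simp add: R_def AL0)
    ultimately show False using d(2)[of \<epsilon>] \<epsilon> by simp
  qed
  then show False by simp
qed

end

section \<open>Behaviour at the end points, and gluing\<close>

lemma right_derivative_unique:
  fixes f g :: "real \<Rightarrow> real"
  assumes "(f has_real_derivative a) (at x)" "(g has_real_derivative b) (at x)" "x < y"
    and eq: "\<And>t. x \<le> t \<Longrightarrow> t < y \<Longrightarrow> f t = g t"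
  shows "a = b"
proof -
  have 1: "((\<lambda>t. (f t - f x) / (t - x)) \<longlongrightarrow> a) (at_right x)"
    by (rule tendsto_mono[OF at_le[OF subset_UNIV] assms(1)[unfolded has_field_derivative_iff]])
  have 2: "((\<lambda>t. (g t - g x) / (t - x)) \<longlongrightarrow> b) (at_right x)"
    by (rule tendsto_mono[OF at_le[OF subset_UNIV] assms(2)[unfolded has_field_derivative_iff]])
  have "\<forall>\<^sub>F t in at_right x. t \<in> {x<..<y}" by (rule eventually_at_right_real[OF assms(3)])
  then have "\<forall>\<^sub>F t in at_right x. (f t - f x) / (t - x) = (g t - g x) / (t - x)"
    by eventually_elim (use eq assms(3) in auto)
  from Lim_transform_eventually[OF 1 this] show ?thesis
    using tendsto_unique[OF trivial_limit_at_right_real _ 2] by blast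
qed

text \<open>If \<open>v\<close> is concave with \<open>v(0+) = 0\<close> then \<open>h = v - t v'\<close> satisfies \<open>h' = t k\<close> and \<open>(v/t)' = - h / t\<^sup>2\<close>;
  the bound on \<open>k\<close> turns this into \<open>(v/t)' \<ge> - (K/\<delta>) t\<^bsup>\<delta>-1\<^esup> v/t\<close>, which is integrable at \<open>0\<close>.\<close>

lemma concave_linear_bound_at_zero:
  fixes v v1 k :: "real \<Rightarrow> real"
  assumes b: "b > 0" and \<delta>: "\<delta> > 0" and K: "K \<ge> 0"
    and v: "\<And>t. 0 < t \<Longrightarrow> t < b \<Longrightarrow> (v has_real_derivative v1 t) (at t)"
    and v1: "\<And>t. 0 < t \<Longrightarrow> t < b \<Longrightarrow> (v1 has_real_derivative - k t) (at t)"
    and k: "\<And>t. 0 < t \<Longrightarrow> t < b \<Longrightarrow> k t \<ge> 0" "\<And>t. 0 < t \<Longrightarrow> t < b \<Longrightarrow> k t \<le> K * t powr (\<delta> - 2) * v t"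
    and v0: "\<And>t. 0 < t \<Longrightarrow> t < b \<Longrightarrow> v t \<ge> 0" "(v \<longlongrightarrow> 0) (at_right 0)"
  obtains M t1 where "0 < t1" "t1 < b" "M \<ge> 0" "\<And>t. 0 < t \<Longrightarrow> t \<le> t1 \<Longrightarrow> v t \<le> M * t"
proof -
  have anti: "v1 t \<le> v1 s" if "0 < s" "s \<le> t" "t < b" for s t
  proof (rule DERIV_nonpos_imp_nonincreasing[OF that(2)])
    fix x assume "s \<le> x" "x \<le> t"
    then show "\<exists>y. (v1 has_real_derivative y) (at x) \<and> y \<le> 0"
      using v1[of x] k(1)[of x] that by (intro exI[of _ "- k x"]) auto
  qed
  have mvt: "\<exists>\<xi>. s < \<xi> \<and> \<xi> < t \<and> v t - v s = (t - s) * v1 \<xi>" if "0 < s" "s < t" "t < b" for s t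
  proof -
    have "\<exists>z. s < z \<and> z < t \<and> v t - v s = (t - s) * v1 z"
      by (rule MVT2[OF that(2)]) (use v that in auto)
    then show ?thesis .
  qed
  show thesis
  proof (cases "\<exists>t1. 0 < t1 \<and> t1 < b \<and> v1 t1 > 0")
    case False
    \<comment> \<open>Here \<open>v\<close> is nonincreasing, hence bounded by its limit 0 at the
      origin, and the slope \<open>M = 0\<close> will do.\<close>
    have "v t \<le> 0 * t" if t: "0 < t" "t \<le> b/2" for t
    proof -
      have "\<forall>\<^sub>F s in at_right 0. v t \<le> v s"
      proof (rule eventually_mono[OF eventually_at_right_real[OF t(1)]])
        fix s assume s: "s \<in> {0<..<t}"
        then obtain \<xi> where "s < \<xi>" "\<xi> < t" "v t - v s = (t - s) * v1 \<xi>" using mvt[of s t] t b by auto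
        moreover have "\<not> v1 \<xi> > 0" using False \<open>s < \<xi>\<close> \<open>\<xi> < t\<close> s t b by auto
        ultimately have "(t - s) * v1 \<xi> \<le> 0" using s by (intro mult_nonneg_nonpos) auto
        then show "v t \<le> v s" using \<open>v t - v s = (t - s) * v1 \<xi>\<close> by simp
      qed
      then have "v t \<le> 0" using tendsto_lowerbound[OF v0(2)] by (simp add: trivial_limit_at_right_real)
      then show ?thesis by simp
    qed
    then show thesis using that[of "b/2" 0] b by simp
  next
    case True
    then obtain t1 where t1: "0 < t1" "t1 < b" "v1 t1 > 0" by blast
    have pos: "v1 t > 0" if "0 < t" "t \<le> t1" for t using anti[of t t1] that t1 by simp
    have mono: "v s \<le> v t" if st: "0 < s" "s \<le> t" "t \<le> t1" for s t
    proof (cases "s = t")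
      case False
      then obtain \<xi> where \<xi>: "s < \<xi>" "\<xi> < t" "v t - v s = (t - s) * v1 \<xi>" using mvt[of s t] st t1 by auto
      then have "v t - v s > 0" using pos[of \<xi>] st t1 by simp
      then show ?thesis by simp
    qed simp
    define h where "h t = v t - t * v1 t" for t
    have h_le: "h t \<le> K * v t * t powr \<delta> / \<delta>" if t: "0 < t" "t \<le> t1" for t
    proof -
      \<comment> \<open>The subtracted term is an antiderivative of the bound for h' on
        \<open>{0<..t}\<close>, where \<open>v\<close> is at most \<open>v t\<close>. So
        \<open>j\<close> is nonincreasing, and it lies below \<open>v\<close>, which tends to
        0.\<close>
      define j where "j s = h s - K * v t * s powr \<delta> / \<delta>" for s
      have dec: "j t \<le> j s" if s: "0 < s" "s \<le> t" for s
      proof (rule DERIV_nonpos_imp_nonincreasing[OF s(2)])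
        fix x assume x: "s \<le> x" "x \<le> t"
        then have x0: "0 < x" "x < b" using s t t1 by auto
        have "(j has_real_derivative (x * k x - K * v t * x powr (\<delta> - 1))) (at x)"
          unfolding j_def h_def using x0 \<delta>
          by (auto intro!: derivative_eq_intros v v1 simp: powr_diff)
        moreover have "x * k x \<le> K * v t * x powr (\<delta> - 1)"
        proof -
          have "x * k x \<le> x * (K * x powr (\<delta> - 2) * v x)" using k(2) x0 by (intro mult_left_mono) auto
          also have "\<dots> \<le> x * (K * x powr (\<delta> - 2) * v t)"
            using mono[of x t] x x0 t K by (intro mult_left_mono) auto
          also have "\<dots> = K * v t * (x * x powr (\<delta> - 2))" by simp
          also have "x * x powr (\<delta> - 2) = x powr (\<delta> - 1)"
            using x0 powr_add[of x 1 "\<delta> - 2"] by simp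
          finally show ?thesis .
        qed
        ultimately show "\<exists>y. (j has_real_derivative y) (at x) \<and> y \<le> 0" by (intro exI[of _ "x * k x - K * v t * x powr (\<delta> - 1)"]) auto
      qed
      have up: "j s \<le> v s" if "0 < s" "s \<le> t" for s
      proof -
        have "s * v1 s \<ge> 0" using pos[of s] that t by simp
        moreover have "K * v t * s powr \<delta> / \<delta> \<ge> 0" using K v0(1)[of t] t t1 \<delta> by simp
        ultimately show ?thesis unfolding j_def h_def by linarith
      qed
      have "\<forall>\<^sub>F s in at_right 0. j t \<le> v s"
        by (rule eventually_mono[OF eventually_at_right_real[OF t(1)]]) (use dec up in \<open>force\<close>)
      then have "j t \<le> 0" using tendsto_lowerbound[OF v0(2)] by (simp add: trivial_limit_at_right_real)
      then show ?thesis by (simp add: j_def)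
    qed
    \<comment> \<open>The exponential is an integrating factor: the derivative of its exponent is
      \<open>K / \<delta> * x powr (\<delta> - 1)\<close>, exactly what compensates the possible
      decrease of \<open>v t / t\<close>.\<close>
    define w where "w t = v t / t * exp (K / \<delta>\<^sup>2 * t powr \<delta>)" for t
    have inc: "w t \<le> w t1" if t: "0 < t" "t \<le> t1" for t
    proof (rule DERIV_nonneg_imp_nondecreasing[OF t(2)])
      fix x assume x: "t \<le> x" "x \<le> t1"
      then have x0: "0 < x" "x < b" using t t1 by auto
      define e where "e = exp (K / \<delta>\<^sup>2 * x powr \<delta>)"
      have "(w has_real_derivative ((v1 x * x - v x) / (x * x) * e + v x / x * (e * (K / \<delta>\<^sup>2 * (\<delta> * x powr (\<delta> - 1)))))) (at x)"
      proof -
        have D1: "((\<lambda>t. v t / t) has_real_derivative (v1 x * x - v x) / (x * x)) (at x)"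
          using x0 by (auto intro!: derivative_eq_intros v)
        have "((\<lambda>t. K / \<delta>\<^sup>2 * t powr \<delta>) has_real_derivative K / \<delta>\<^sup>2 * (\<delta> * x powr (\<delta> - 1))) (at x)"
          using x0 by (intro DERIV_cmult has_real_derivative_powr) auto
        then have "((\<lambda>t. exp (K / \<delta>\<^sup>2 * t powr \<delta>)) has_real_derivative e * (K / \<delta>\<^sup>2 * (\<delta> * x powr (\<delta> - 1)))) (at x)"
          unfolding e_def by (rule DERIV_fun_exp)
        from DERIV_mult[OF D1 this] show ?thesis unfolding w_def e_def by (simp add: mult.commute)
      qed
      moreover have "(v1 x * x - v x) / (x * x) * e + v x / x * (e * (K / \<delta>\<^sup>2 * (\<delta> * x powr (\<delta> - 1))))
         = (e / (x * x)) * (K * v x * x powr \<delta> / \<delta> - h x)"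
        using x0 \<delta> by (simp add: h_def powr_diff field_simps power2_eq_square)
      moreover have "(e / (x * x)) * (K * v x * x powr \<delta> / \<delta> - h x) \<ge> 0"
        using h_le[of x] x x0 by (intro mult_nonneg_nonneg) (auto simp: e_def)
      ultimately show "\<exists>y. (w has_real_derivative y) (at x) \<and> y \<ge> 0" by metis
    qed
    have "v t \<le> w t1 * t" if t: "0 < t" "t \<le> t1" for t
    proof -
      have "v t / t * 1 \<le> w t"
        unfolding w_def using t t1 K v0(1)[of t] by (intro mult_left_mono) auto
      then have "v t / t \<le> w t1" using inc[OF t] by simp
      then show ?thesis using t by (simp add: divide_le_eq)
    qed
    moreover have "w t1 \<ge> 0" unfolding w_def using v0(1)[of t1] t1 by simp
    ultimately show thesis using that[of t1 "w t1"] t1 by blast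
  qed
qed

context bvp_weight
begin

lemma reflected: "bvp_weight (\<lambda>x. V (1 - x)) p K \<delta>"
proof
  show "continuous_on {0<..<1} (\<lambda>x. V (1 - x))"
    by (rule continuous_on_compose2[OF V_cont]) (auto intro!: continuous_intros)
  show "V (1 - x) \<le> K * (x * (1 - x)) powr (\<delta> - 1 - p/2)" if "0 < x" "x < 1" for x
    using V_le[of "1 - x"] that by (simp add: mult.commute)
qed (use p \<delta> V_pos in auto)

lemma minpair_reflect:
  assumes "minpair \<tau> f g C1 C2"
  shows "bvp_weight.minpair (\<lambda>x. V (1 - x)) p (1 - \<tau>) (\<lambda>x. g (1 - x)) (\<lambda>x. f (1 - x)) C2 C1"
proof -
  interpret R: bvp_weight "\<lambda>x. V (1 - x)" p K \<delta> by (rule reflected)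
  have W: "R.W x = W (1 - x)" for x unfolding R.W_def W_def by auto
  have F: "R.F h = F (\<lambda>x. h (1 - x))" for h
  proof -
    have "(\<integral>x. W (1 - x) * \<bar>h x\<bar> powr p \<partial>lborel) =
        \<bar>- 1\<bar> *\<^sub>R (\<integral>x. W (1 - (1 + - 1 * x)) * \<bar>h (1 + - 1 * x)\<bar> powr p \<partial>lborel)"
      by (rule lborel_integral_real_affine) simp
    also have "\<dots> = F (\<lambda>x. h (1 - x))" unfolding F_def by simp
    finally show ?thesis unfolding R.F_def W .
  qed

  have 1: "R.admpair (1 - \<tau>) (\<lambda>x. g (1 - x)) (\<lambda>x. f (1 - x)) C2 C1"
    if P: "admpair \<tau> f g C1 C2" for \<tau> f g C1 C2
  proof -
    have P': "0 < \<tau>" "\<tau> < 1" "adm 0 \<tau> f C1" "adm \<tau> 1 g C2" "F f = 1" "F g = 1"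
      using P unfolding admpair_def by auto
    have "adm (1 - \<tau>) 1 (\<lambda>x. f (1 - x)) C1" using adm_reflect[OF P'(3)] unfolding diff_zero .
    moreover have "adm 0 (1 - \<tau>) (\<lambda>x. g (1 - x)) C2" using adm_reflect[OF P'(4)] unfolding diff_self .
    moreover have "R.F (\<lambda>x. f (1 - x)) = 1" unfolding F by (simp add: P'(5))
    moreover have "R.F (\<lambda>x. g (1 - x)) = 1" unfolding F by (simp add: P'(6))
    ultimately show ?thesis unfolding R.admpair_def using P'(1,2) by simp
  qed
  have 2: "admpair (1 - \<tau>) (\<lambda>x. g (1 - x)) (\<lambda>x. f (1 - x)) C2 C1"
    if P: "R.admpair \<tau> f g C1 C2" for \<tau> f g C1 C2
  proof -
    have P': "0 < \<tau>" "\<tau> < 1" "adm 0 \<tau> f C1" "adm \<tau> 1 g C2" "R.F f = 1" "R.F g = 1"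
      using P unfolding R.admpair_def by auto
    have "adm (1 - \<tau>) 1 (\<lambda>x. f (1 - x)) C1" using adm_reflect[OF P'(3)] unfolding diff_zero .
    moreover have "adm 0 (1 - \<tau>) (\<lambda>x. g (1 - x)) C2" using adm_reflect[OF P'(4)] unfolding diff_self .
    ultimately show ?thesis unfolding admpair_def using P'(1,2) P'(5,6)[unfolded F] by simp
  qed
  show ?thesis
    unfolding R.minpair_def
  proof (intro conjI allI impI)
    show "R.admpair (1 - \<tau>) (\<lambda>x. g (1 - x)) (\<lambda>x. f (1 - x)) C2 C1"
      using 1 assms unfolding minpair_def by blast
    show "f (1 - x) \<ge> 0" "g (1 - x) \<ge> 0" for x using assms unfolding minpair_def by auto
    show "C2 powr R.q + C1 powr R.q \<le> C1' powr R.q + C2' powr R.q" if "R.admpair \<tau>' f' g' C1' C2'" for \<tau>' f' g' C1' C2'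
    proof -
      have "C1 powr q + C2 powr q \<le> C2' powr q + C1' powr q"
        using 2[OF that] assms unfolding minpair_def by blast
      then show ?thesis by linarith
    qed
  qed
qed

end

context bvp_weight
begin

text \<open>Moving the node to the left is moving it to the right after the reflection of the
  interval, which exchanges the two functions. The signs of the derivatives change, but only their
  squares occur.\<close>

lemma minpair_slopes_eq:
  assumes m: "minpair \<tau> f g C1 C2"
    and \<phi>: "\<And>t. 0 < t \<Longrightarrow> t < 1 \<Longrightarrow> (\<phi> has_real_derivative \<phi>1 t) (at t)"
      "\<And>t. 0 < t \<Longrightarrow> t \<le> \<tau> \<Longrightarrow> f t = \<phi> t"
      "\<And>x u y. 0 < x \<Longrightarrow> x < u \<Longrightarrow> u < y \<Longrightarrow> y < 1 \<Longrightarrow>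
       C1 * (\<integral>t. W t * (f t powr (p - 1) * hat x u y t) \<partial>lborel) = (\<phi> u - \<phi> x) / (u - x) - (\<phi> y - \<phi> u) / (y - u)"
    and \<gamma>: "\<And>t. 0 < t \<Longrightarrow> t < 1 \<Longrightarrow> (\<gamma> has_real_derivative \<gamma>1 t) (at t)"
      "\<And>t. 0 < t \<Longrightarrow> t < 1 \<Longrightarrow> isCont \<gamma>1 t"
      "\<And>t. \<tau> \<le> t \<Longrightarrow> t < 1 \<Longrightarrow> g t = \<gamma> t"
  shows "C1 powr (q - 1) * (\<phi>1 \<tau>)\<^sup>2 = C2 powr (q - 1) * (\<gamma>1 \<tau>)\<^sup>2"
proof (rule antisym)
  show "C1 powr (q - 1) * (\<phi>1 \<tau>)\<^sup>2 \<le> C2 powr (q - 1) * (\<gamma>1 \<tau>)\<^sup>2"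
    by (rule minpair_slopes_le[OF m \<phi> \<gamma>])
  have \<tau>: "0 < \<tau>" "\<tau> < 1" using m unfolding minpair_def admpair_def by auto
  interpret R: bvp_weight "\<lambda>x. V (1 - x)" p K \<delta> by (rule reflected)
  have Rm: "R.minpair (1 - \<tau>) (\<lambda>x. g (1 - x)) (\<lambda>x. f (1 - x)) C2 C1" by (rule minpair_reflect[OF m])
  obtain \<phi>' \<phi>1' where \<phi>': "\<And>t. 0 < t \<Longrightarrow> t < 1 \<Longrightarrow> (\<phi>' has_real_derivative \<phi>1' t) (at t)"
    "\<And>t. 0 < t \<Longrightarrow> t < 1 \<Longrightarrow> (\<phi>1' has_real_derivative - (C2 * (V (1 - t) * g (1 - t) powr (p - 1)))) (at t)"
    "\<And>t. 0 \<le> t \<Longrightarrow> t \<le> 1 - \<tau> \<Longrightarrow> 0 < t \<Longrightarrow> t < 1 \<Longrightarrow> g (1 - t) = \<phi>' t"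
    "\<And>x u y. 0 < x \<Longrightarrow> x < u \<Longrightarrow> u < y \<Longrightarrow> y < 1 \<Longrightarrow>
       C2 * (\<integral>t. R.W t * (g (1 - t) powr (p - 1) * hat x u y t) \<partial>lborel) = (\<phi>' u - \<phi>' x) / (u - x) - (\<phi>' y - \<phi>' u) / (y - u)"
  proof (rule R.optimal_repr[OF R.minpair_optimal(1)[OF Rm]], goal_cases)
    case (1 x y)
    from 1(2-) show ?case by (rule 1(1))
  qed
  obtain \<gamma>' \<gamma>1' where \<gamma>': "\<And>t. 0 < t \<Longrightarrow> t < 1 \<Longrightarrow> (\<gamma>' has_real_derivative \<gamma>1' t) (at t)"
    "\<And>t. 0 < t \<Longrightarrow> t < 1 \<Longrightarrow> (\<gamma>1' has_real_derivative - (C1 * (V (1 - t) * f (1 - t) powr (p - 1)))) (at t)"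
    "\<And>t. 1 - \<tau> \<le> t \<Longrightarrow> t \<le> 1 \<Longrightarrow> 0 < t \<Longrightarrow> t < 1 \<Longrightarrow> f (1 - t) = \<gamma>' t"
    "\<And>x u y. 0 < x \<Longrightarrow> x < u \<Longrightarrow> u < y \<Longrightarrow> y < 1 \<Longrightarrow>
       C1 * (\<integral>t. R.W t * (f (1 - t) powr (p - 1) * hat x u y t) \<partial>lborel) = (\<gamma>' u - \<gamma>' x) / (u - x) - (\<gamma>' y - \<gamma>' u) / (y - u)"
  proof (rule R.optimal_repr[OF R.minpair_optimal(2)[OF Rm]], goal_cases)
    case (1 x y)
    from 1(2-) show ?case by (rule 1(1))
  qed
  have le: "C2 powr (q - 1) * (\<phi>1' (1 - \<tau>))\<^sup>2 \<le> C1 powr (q - 1) * (\<gamma>1' (1 - \<tau>))\<^sup>2"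
  proof (rule R.minpair_slopes_le[OF Rm \<phi>'(1) _ \<phi>'(4) \<gamma>'(1)])
    show "g (1 - t) = \<phi>' t" if "0 < t" "t \<le> 1 - \<tau>" for t using \<phi>'(3)[of t] that \<tau> by simp
    show "isCont \<gamma>1' t" if "0 < t" "t < 1" for t using \<gamma>'(2)[OF that] by (rule DERIV_isCont)
    show "f (1 - t) = \<gamma>' t" if "1 - \<tau> \<le> t" "t < 1" for t using \<gamma>'(3)[of t] that \<tau> by simp
  qed
  \<comment> \<open>The representation obtained for the reflected problem need not be the reflection
    of the given one off the support. Both agree with \<open>g\<close> to the right of the node, and
    this determines the derivative at the node.\<close>
  have "\<gamma>1 \<tau> = - \<phi>1' (1 - \<tau>)"
  proof (rule right_derivative_unique[OF \<gamma>(1)[OF \<tau>] _ \<tau>(2)])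
    have D: "((\<lambda>t. 1 - t) has_real_derivative - 1) (at \<tau>)" by (auto intro!: derivative_eq_intros)
    show "((\<lambda>t. \<phi>' (1 - t)) has_real_derivative - \<phi>1' (1 - \<tau>)) (at \<tau>)"
      using DERIV_chain2[OF \<phi>'(1)[of "1 - \<tau>"] D] \<tau> by simp
    show "\<gamma> t = \<phi>' (1 - t)" if "\<tau> \<le> t" "t < 1" for t
      using \<gamma>(3)[of t] \<phi>'(3)[of "1 - t"] that \<tau> by simp
  qed
  moreover have "\<gamma>1' (1 - \<tau>) = - \<phi>1 \<tau>"
  proof (rule right_derivative_unique[of \<gamma>' _ "1 - \<tau>" "\<lambda>t. \<phi> (1 - t)" _ 1])
    have D: "((\<lambda>t. 1 - t) has_real_derivative - 1) (at (1 - \<tau>))" by (auto intro!: derivative_eq_intros)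
    show "((\<lambda>t. \<phi> (1 - t)) has_real_derivative - \<phi>1 \<tau>) (at (1 - \<tau>))"
      using DERIV_chain2[of \<phi> "\<phi>1 \<tau>" "\<lambda>t. 1 - t" "1 - \<tau>", OF _ D] \<phi>(1)[OF \<tau>] by simp
    show "(\<gamma>' has_real_derivative \<gamma>1' (1 - \<tau>)) (at (1 - \<tau>))" using \<gamma>'(1)[of "1 - \<tau>"] \<tau> by simp
    show "\<gamma>' t = \<phi> (1 - t)" if "1 - \<tau> \<le> t" "t < 1" for t
      using \<gamma>'(3)[of t] \<phi>(2)[of "1 - t"] that \<tau> by simp
  qed (use \<tau> in auto)
  ultimately show "C2 powr (q - 1) * (\<gamma>1 \<tau>)\<^sup>2 \<le> C1 powr (q - 1) * (\<phi>1 \<tau>)\<^sup>2" using le by simp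
qed

text \<open>Bounds near \<open>0\<close> for one half of the solution, stated for a general weight so that it also applies after
  reflection.\<close>

lemma optimal_linear_bound:
  assumes opt: "optimal 0 \<tau> f C" and \<tau>: "\<tau> < 1"
  obtains M t1 where "0 < t1" "t1 < \<tau>" "M \<ge> 0" "\<And>t. 0 < t \<Longrightarrow> t \<le> t1 \<Longrightarrow> f t \<le> M * t"
proof -
  have af: "adm 0 \<tau> f C" and f0: "\<And>x. f x \<ge> 0" and \<tau>0: "0 < \<tau>"
    using opt unfolding optimal_def by auto
  have C: "C > 0" by (rule optimal_pos[OF opt])
  obtain \<phi> \<phi>1 where \<phi>: "\<And>t. 0 < t \<Longrightarrow> t < 1 \<Longrightarrow> (\<phi> has_real_derivative \<phi>1 t) (at t)"
    "\<And>t. 0 < t \<Longrightarrow> t < 1 \<Longrightarrow> (\<phi>1 has_real_derivative - (C * (V t * f t powr (p - 1)))) (at t)"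
    "\<And>t. 0 \<le> t \<Longrightarrow> t \<le> \<tau> \<Longrightarrow> 0 < t \<Longrightarrow> t < 1 \<Longrightarrow> f t = \<phi> t"
    "\<And>x u y. 0 < x \<Longrightarrow> x < u \<Longrightarrow> u < y \<Longrightarrow> y < 1 \<Longrightarrow>
       C * (\<integral>t. W t * (f t powr (p - 1) * hat x u y t) \<partial>lborel) = (\<phi> u - \<phi> x) / (u - x) - (\<phi> y - \<phi> u) / (y - u)"
  proof (rule optimal_repr[OF opt], goal_cases)
    case (1 x y)
    from 1(2-) show ?case by (rule 1(1))
  qed
  have fz: "f 0 = 0" using af unfolding adm_def by auto
  \<comment> \<open>An upper bound for \<open>(1 - t) powr (\<delta> - 2)\<close> on the interval up
    to \<open>\<tau>\<close>, whichever sign the exponent has. The power of \<open>t\<close> left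
    over from the weight and the energy bound is
    \<open>\<delta> - 1 - p/2 + (p - 2)/2 = \<delta> - 2\<close>.\<close>
  define c where "c = max 1 ((1 - \<tau>) powr (\<delta> - 2))"
  define K' where "K' = C * (K * (2 * C) powr ((p - 2)/2) * c)"
  have K'0: "K' \<ge> 0" using C K_pos by (auto simp: K'_def c_def)
  have bound: "C * (V t * f t powr (p - 1)) \<le> K' * t powr (\<delta> - 2) * f t" if t: "0 < t" "t < \<tau>" for t
  proof (cases "f t = 0")
    case False
    have t1: "t < 1" using t \<tau> by simp
    have ft: "f t > 0" using False f0[of t] by simp
    have "f t powr (p - 2) \<le> (2 * C) powr ((p - 2)/2) * (t * (1 - t)) powr ((p - 2)/2)"
      using adm_powr_le[OF af, of t "p - 2" C] t t1 p ft by simp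
    then have "V t * f t powr (p - 2) \<le> (K * (t * (1 - t)) powr (\<delta> - 1 - p/2)) * ((2 * C) powr ((p - 2)/2) * (t * (1 - t)) powr ((p - 2)/2))"
      using V_le[of t] V_pos[of t] t t1 K_pos by (intro mult_mono) auto
    also have "\<dots> = K * (2 * C) powr ((p - 2)/2) * ((t * (1 - t)) powr (\<delta> - 1 - p/2) * (t * (1 - t)) powr ((p - 2)/2))"
      by simp
    also have "(t * (1 - t)) powr (\<delta> - 1 - p/2) * (t * (1 - t)) powr ((p - 2)/2) = (t * (1 - t)) powr (\<delta> - 2)"
    proof -
      have "\<delta> - 1 - p/2 + (p - 2)/2 = \<delta> - 2" by (simp add: diff_divide_distrib)
      then show ?thesis unfolding powr_add[symmetric] by (simp only:)
    qed
    also have "\<dots> = t powr (\<delta> - 2) * (1 - t) powr (\<delta> - 2)" by (rule powr_mult)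
    also have "(1 - t) powr (\<delta> - 2) \<le> c"
    proof (cases "\<delta> \<ge> 2")
      case True
      then have "(1 - t) powr (\<delta> - 2) \<le> 1 powr (\<delta> - 2)" using t t1 by (intro powr_mono2) auto
      then show ?thesis by (simp add: c_def)
    next
      case False
      then have "(1 - t) powr (\<delta> - 2) \<le> (1 - \<tau>) powr (\<delta> - 2)" using t \<tau> by (intro powr_mono2') auto
      then show ?thesis by (simp add: c_def)
    qed
    finally have "V t * f t powr (p - 2) \<le> K * (2 * C) powr ((p - 2)/2) * (t powr (\<delta> - 2) * c)"
      using K_pos by (simp add: mult_left_mono)
    then have "C * (V t * f t powr (p - 2)) * f t \<le> C * (K * (2 * C) powr ((p - 2)/2) * (t powr (\<delta> - 2) * c)) * f t"
      using C ft by (intro mult_right_mono mult_left_mono) auto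
    moreover have "f t powr (p - 1) = f t powr (p - 2) * f t"
      using ft powr_add[of "f t" "p - 2" 1] by simp
    ultimately show ?thesis by (simp add: K'_def mult_ac)
  qed (use p in simp)
  have lim: "(f \<longlongrightarrow> 0) (at_right 0)"
  proof -
    have "isCont f 0" using adm_continuous[OF af] by (simp add: continuous_on_eq_continuous_at)
    then show ?thesis unfolding isCont_def fz by (rule tendsto_mono[OF at_le[OF subset_UNIV]])
  qed
  have Df: "(f has_real_derivative \<phi>1 t) (at t)" if t: "0 < t" "t < \<tau>" for t
  proof (rule has_field_derivative_transform_within_open[of \<phi> _ _ "{0<..<\<tau>}"])
    show "(\<phi> has_real_derivative \<phi>1 t) (at t)" using \<phi>(1) t \<tau> by simp
    show "\<phi> x = f x" if "x \<in> {0<..<\<tau>}" for x using \<phi>(3)[of x] that \<tau> by simp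
  qed (use t in auto)
  show thesis
  proof (rule concave_linear_bound_at_zero[OF \<tau>0 \<delta> K'0 Df])
    show "(\<phi>1 has_real_derivative - (C * (V t * f t powr (p - 1)))) (at t)" if "0 < t" "t < \<tau>" for t
      using \<phi>(2) that \<tau> by simp
    show "C * (V t * f t powr (p - 1)) \<ge> 0" if "0 < t" "t < \<tau>" for t
      using C V_pos[of t] that \<tau> by simp
  qed (use bound f0 lim that in auto)
qed

text \<open>The solution is a positive multiple of \<open>f\<close> minus a positive multiple of
  \<open>g\<close>; the equality of weighted slopes at the node is exactly what makes it
  differentiable there. The bound by \<open>t * (1 - t)\<close> will become boundedness of the
  profile.\<close>

theorem exists_nodal:
  obtains u u1 M where
    "\<And>t. 0 < t \<Longrightarrow> t < 1 \<Longrightarrow> (u has_real_derivative u1 t) (at t)"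
    "\<And>t. 0 < t \<Longrightarrow> t < 1 \<Longrightarrow> (u1 has_real_derivative - (V t * (\<bar>u t\<bar> powr (p - 2) * u t))) (at t)"
    "\<And>t. 0 < t \<Longrightarrow> t < 1 \<Longrightarrow> \<bar>u t\<bar> \<le> M * (t * (1 - t))"
    "\<exists>t. 0 < t \<and> t < 1 \<and> u t > 0" "\<exists>t. 0 < t \<and> t < 1 \<and> u t < 0"
proof -
  obtain \<tau> f g C1 C2 where m: "minpair \<tau> f g C1 C2"
    using exists_minimizer unfolding minpair_def by metis
  have P: "0 < \<tau>" "\<tau> < 1" "adm 0 \<tau> f C1" "adm \<tau> 1 g C2" "F f = 1" "F g = 1" "\<And>x. f x \<ge> 0" "\<And>x. g x \<ge> 0"
    using m unfolding minpair_def admpair_def by auto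
  note opt = minpair_optimal[OF m]
  have C: "C1 > 0" "C2 > 0" using optimal_pos opt by blast+
  have fz: "f t = 0" if "t \<le> 0 \<or> \<tau> \<le> t" for t using P(3) that unfolding adm_def by auto
  have gz: "g t = 0" if "t \<le> \<tau> \<or> 1 \<le> t" for t using P(4) that unfolding adm_def by auto
  obtain \<phi> \<phi>1 where \<phi>: "\<And>t. 0 < t \<Longrightarrow> t < 1 \<Longrightarrow> (\<phi> has_real_derivative \<phi>1 t) (at t)"
    "\<And>t. 0 < t \<Longrightarrow> t < 1 \<Longrightarrow> (\<phi>1 has_real_derivative - (C1 * (V t * f t powr (p - 1)))) (at t)"
    "\<And>t. 0 \<le> t \<Longrightarrow> t \<le> \<tau> \<Longrightarrow> 0 < t \<Longrightarrow> t < 1 \<Longrightarrow> f t = \<phi> t"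
    "\<And>x u y. 0 < x \<Longrightarrow> x < u \<Longrightarrow> u < y \<Longrightarrow> y < 1 \<Longrightarrow>
       C1 * (\<integral>t. W t * (f t powr (p - 1) * hat x u y t) \<partial>lborel) = (\<phi> u - \<phi> x) / (u - x) - (\<phi> y - \<phi> u) / (y - u)"
  proof (rule optimal_repr[OF opt(1)], goal_cases)
    case (1 x y)
    from 1(2-) show ?case by (rule 1(1))
  qed
  obtain \<gamma> \<gamma>1 where \<gamma>: "\<And>t. 0 < t \<Longrightarrow> t < 1 \<Longrightarrow> (\<gamma> has_real_derivative \<gamma>1 t) (at t)"
    "\<And>t. 0 < t \<Longrightarrow> t < 1 \<Longrightarrow> (\<gamma>1 has_real_derivative - (C2 * (V t * g t powr (p - 1)))) (at t)"
    "\<And>t. \<tau> \<le> t \<Longrightarrow> t \<le> 1 \<Longrightarrow> 0 < t \<Longrightarrow> t < 1 \<Longrightarrow> g t = \<gamma> t"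
    "\<And>x u y. 0 < x \<Longrightarrow> x < u \<Longrightarrow> u < y \<Longrightarrow> y < 1 \<Longrightarrow>
       C2 * (\<integral>t. W t * (g t powr (p - 1) * hat x u y t) \<partial>lborel) = (\<gamma> u - \<gamma> x) / (u - x) - (\<gamma> y - \<gamma> u) / (y - u)"
  proof (rule optimal_repr[OF opt(2)], goal_cases)
    case (1 x y)
    from 1(2-) show ?case by (rule 1(1))
  qed
  have slopes: "C1 powr (q - 1) * (\<phi>1 \<tau>)\<^sup>2 = C2 powr (q - 1) * (\<gamma>1 \<tau>)\<^sup>2"
  proof (rule minpair_slopes_eq[OF m \<phi>(1) _ \<phi>(4) \<gamma>(1)])
    show "f t = \<phi> t" if "0 < t" "t \<le> \<tau>" for t using \<phi>(3)[of t] that P by simp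
    show "isCont \<gamma>1 t" if "0 < t" "t < 1" for t using \<gamma>(2)[OF that] by (rule DERIV_isCont)
    show "g t = \<gamma> t" if "\<tau> \<le> t" "t < 1" for t using \<gamma>(3)[of t] that P by simp
  qed
  have \<phi>\<tau>: "\<phi> \<tau> = 0" using \<phi>(3)[of \<tau>] fz[of \<tau>] P by simp
  have \<gamma>\<tau>: "\<gamma> \<tau> = 0" using \<gamma>(3)[of \<tau>] gz[of \<tau>] P by simp
  have \<phi>1: "\<phi>1 \<tau> \<le> 0"
  proof (rule ccontr)
    assume "\<not> \<phi>1 \<tau> \<le> 0"
    then obtain d where d: "d > 0" "\<And>h. h > 0 \<Longrightarrow> h < d \<Longrightarrow> \<phi> (\<tau> - h) < \<phi> \<tau>"
      using DERIV_pos_inc_left[OF \<phi>(1)[OF P(1,2)]] by force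
    obtain h where h: "h > 0" "h < d" "h < \<tau>" using dense[of 0 "min d \<tau>"] d(1) P(1) by auto
    have "\<phi> (\<tau> - h) \<ge> 0" using \<phi>(3)[of "\<tau> - h"] h P(1,2) P(7)[of "\<tau> - h"] by simp
    then show False using d(2)[OF h(1,2)] \<phi>\<tau> by simp
  qed
  have \<gamma>1: "\<gamma>1 \<tau> \<ge> 0"
  proof (rule ccontr)
    assume "\<not> \<gamma>1 \<tau> \<ge> 0"
    then obtain d where d: "d > 0" "\<And>h. h > 0 \<Longrightarrow> h < d \<Longrightarrow> \<gamma> (\<tau> + h) < \<gamma> \<tau>"
      using DERIV_neg_dec_right[OF \<gamma>(1)[OF P(1,2)]] by force
    obtain h where h: "h > 0" "h < d" "h < 1 - \<tau>" using dense[of 0 "min d (1 - \<tau>)"] d(1) P(2) by auto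
    have "\<gamma> (\<tau> + h) \<ge> 0" using \<gamma>(3)[of "\<tau> + h"] h P(1,2) P(8)[of "\<tau> + h"] by simp
    then show False using d(2)[OF h(1,2)] \<gamma>\<tau> by simp
  qed
  \<comment> \<open>The multiples that remove the multipliers: \<open>C1\<close> times
    \<open>\<alpha>\<close> must equal \<open>\<alpha> powr (p - 1)\<close>.\<close>
  define \<alpha> where "\<alpha> = C1 powr (1 / (p - 2))"
  define \<beta> where "\<beta> = C2 powr (1 / (p - 2))"
  have \<alpha>\<beta>: "\<alpha> > 0" "\<beta> > 0" using C by (auto simp: \<alpha>_def \<beta>_def)
  have \<alpha>p: "\<alpha> * C1 = \<alpha> powr (p - 1)" and \<beta>p: "\<beta> * C2 = \<beta> powr (p - 1)"
  proof -
    have "x powr (1 / (p - 2)) * x = (x powr (1 / (p - 2))) powr (p - 1)" if x: "x > 0" for x :: real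
    proof -
      have "1 / (p - 2) + 1 = 1 / (p - 2) * (p - 1)" using p by (simp add: field_simps)
      then show ?thesis using x powr_add[of x "1 / (p - 2)" 1] by (simp add: powr_powr)
    qed
    then show "\<alpha> * C1 = \<alpha> powr (p - 1)" "\<beta> * C2 = \<beta> powr (p - 1)" using C by (auto simp: \<alpha>_def \<beta>_def)
  qed
  \<comment> \<open>Since \<open>q - 1 = 2 / (p - 2)\<close>, the weights in the slope equation are
    \<open>\<alpha>\<^sup>2\<close> and \<open>\<beta>\<^sup>2\<close>. Nonnegativity of
    \<open>f\<close> and \<open>g\<close> fixes the signs of the slopes, so the roots can be
    taken.\<close>
  have match: "\<alpha> * \<phi>1 \<tau> = - (\<beta> * \<gamma>1 \<tau>)"
  proof -
    have "q - 1 = 1 / (p - 2) * 2" using p by (simp add: q_def field_simps)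
    then have "\<alpha>\<^sup>2 = C1 powr (q - 1)" "\<beta>\<^sup>2 = C2 powr (q - 1)"
      using C powr_powr[of C1 "1 / (p - 2)" 2] powr_powr[of C2 "1 / (p - 2)" 2] by (simp_all add: \<alpha>_def \<beta>_def)
    then have "(\<alpha> * - \<phi>1 \<tau>)\<^sup>2 = (\<beta> * \<gamma>1 \<tau>)\<^sup>2" using slopes by (simp add: power_mult_distrib)
    then have "\<alpha> * - \<phi>1 \<tau> = \<beta> * \<gamma>1 \<tau>"
    proof (rule power2_eq_imp_eq)
      show "0 \<le> \<alpha> * - \<phi>1 \<tau>" using \<phi>1 \<alpha>\<beta> by (intro mult_nonneg_nonneg) auto
      show "0 \<le> \<beta> * \<gamma>1 \<tau>" using \<gamma>1 \<alpha>\<beta> by (intro mult_nonneg_nonneg) auto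
    qed
    then show ?thesis by simp
  qed
  \<comment> \<open>Beyond the node the source term vanishes, so the extrapolated solution is the
    tangent line at the node.\<close>
  have aff: "\<psi> t = \<psi>1 \<tau> * (t - \<tau>)"
    if D: "\<And>t. 0 < t \<Longrightarrow> t < 1 \<Longrightarrow> (\<psi> has_real_derivative \<psi>1 t) (at t)"
      "\<And>t. t \<in> I \<Longrightarrow> (\<psi>1 has_real_derivative 0) (at t)"
      and I: "convex I" "I \<subseteq> {0<..<1}" "\<tau> \<in> I" "t \<in> I" and z: "\<psi> \<tau> = 0" for \<psi> \<psi>1 I t
  proof -
    have 1: "\<psi>1 s = \<psi>1 \<tau>" if "s \<in> I" for s
      using has_field_derivative_zero_constant[OF I(1), of \<psi>1] D(2) has_field_derivative_at_within I(3) that by metis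
    have "((\<lambda>t. \<psi> t - \<psi>1 \<tau> * (t - \<tau>)) has_real_derivative 0) (at s within I)" if "s \<in> I" for s
    proof -
      have "(\<psi> has_real_derivative \<psi>1 \<tau>) (at s within I)"
        using D(1)[of s] 1[OF that] I(2) that has_field_derivative_at_within by fastforce
      then show ?thesis by (auto intro!: derivative_eq_intros)
    qed
    then obtain c where "\<forall>s\<in>I. \<psi> s - \<psi>1 \<tau> * (s - \<tau>) = c"
      using has_field_derivative_zero_constant[OF I(1), of "\<lambda>t. \<psi> t - \<psi>1 \<tau> * (t - \<tau>)"] by blast
    then have "\<psi> t - \<psi>1 \<tau> * (t - \<tau>) = \<psi> \<tau> - \<psi>1 \<tau> * (\<tau> - \<tau>)" using I by metis
    then show ?thesis using z by simp
  qed
  have \<phi>_aff: "\<phi> t = \<phi>1 \<tau> * (t - \<tau>)" if "\<tau> \<le> t" "t < 1" for t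
  proof (rule aff[of \<phi> \<phi>1 "{\<tau>..<1}"])
    show "(\<phi>1 has_real_derivative 0) (at t)" if "t \<in> {\<tau>..<1}" for t
      using \<phi>(2)[of t] fz[of t] that P p by simp
  qed (use \<phi>(1) P that \<phi>\<tau> in auto)
  have \<gamma>_aff: "\<gamma> t = \<gamma>1 \<tau> * (t - \<tau>)" if "0 < t" "t \<le> \<tau>" for t
  proof (rule aff[of \<gamma> \<gamma>1 "{0<..\<tau>}"])
    show "(\<gamma>1 has_real_derivative 0) (at t)" if "t \<in> {0<..\<tau>}" for t
      using \<gamma>(2)[of t] gz[of t] that P p by simp
  qed (use \<gamma>(1) P that \<gamma>\<tau> in auto)
  \<comment> \<open>The added linear term cancels the tangent line of \<open>\<gamma>\<close> to the
    left of the node and, by \<open>match\<close>, that of \<open>\<alpha> * \<phi>\<close> to the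
    right. The glued function is thus given by one formula on the whole interval and its
    differentiability at the node needs no separate argument.\<close>
  define u where "u t = \<alpha> * \<phi> t - \<beta> * \<gamma> t + \<beta> * \<gamma>1 \<tau> * (t - \<tau>)" for t
  define u1 where "u1 t = \<alpha> * \<phi>1 t - \<beta> * \<gamma>1 t + \<beta> * \<gamma>1 \<tau>" for t
  have u: "u t = \<alpha> * f t - \<beta> * g t" if t: "0 < t" "t < 1" for t
  proof (cases "t \<le> \<tau>")
    case True
    then have "f t = \<phi> t" "g t = 0" "\<gamma> t = \<gamma>1 \<tau> * (t - \<tau>)"
      using \<phi>(3)[of t] gz[of t] \<gamma>_aff[of t] t by auto
    then show ?thesis by (simp add: u_def)
  next
    case False
    then have *: "f t = 0" "g t = \<gamma> t" "\<phi> t = \<phi>1 \<tau> * (t - \<tau>)"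
      using \<gamma>(3)[of t] fz[of t] \<phi>_aff[of t] t by auto
    have "\<alpha> * \<phi> t = - (\<beta> * \<gamma>1 \<tau>) * (t - \<tau>)" unfolding *(3) match[symmetric] by simp
    then show ?thesis unfolding u_def * by simp
  qed
  obtain M1 t1 where M1: "0 < t1" "t1 < \<tau>" "M1 \<ge> 0" "\<And>t. 0 < t \<Longrightarrow> t \<le> t1 \<Longrightarrow> f t \<le> M1 * t"
  proof (rule optimal_linear_bound[OF opt(1) P(2)], goal_cases)
    case (1 M t)
    from 1(2-5) show ?case by (rule 1(1))
  qed
  interpret R: bvp_weight "\<lambda>x. V (1 - x)" p K \<delta> by (rule reflected)
  have ropt: "R.optimal 0 (1 - \<tau>) (\<lambda>x. g (1 - x)) C2" by (rule R.minpair_optimal(1)[OF minpair_reflect[OF m]])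
  obtain M2 t2 where M2: "0 < t2" "t2 < 1 - \<tau>" "M2 \<ge> 0" "\<And>t. 0 < t \<Longrightarrow> t \<le> t2 \<Longrightarrow> g (1 - t) \<le> M2 * t"
  proof (rule R.optimal_linear_bound[OF ropt], goal_cases)
    case (2 M t)
    from 2(2-5) show ?case by (rule 2(1))
  qed (use P in auto)
  show thesis
  proof (rule that)
    fix t :: real assume t: "0 < t" "t < 1"
    show "(u has_real_derivative u1 t) (at t)"
      unfolding u_def u1_def by (auto intro!: derivative_eq_intros \<phi>(1) \<gamma>(1) t)
    have "(u1 has_real_derivative \<alpha> * - (C1 * (V t * f t powr (p - 1))) - \<beta> * - (C2 * (V t * g t powr (p - 1)))) (at t)"
      unfolding u1_def by (auto intro!: derivative_eq_intros \<phi>(2) \<gamma>(2) t)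
    moreover have "\<alpha> * - (C1 * (V t * f t powr (p - 1))) - \<beta> * - (C2 * (V t * g t powr (p - 1)))
       = - (V t * ((\<alpha> * C1) * f t powr (p - 1) - (\<beta> * C2) * g t powr (p - 1)))" by (simp add: algebra_simps)
    moreover have "(\<alpha> * C1) * f t powr (p - 1) - (\<beta> * C2) * g t powr (p - 1) = \<bar>u t\<bar> powr (p - 2) * u t"
    proof -
      have pw: "x powr (p - 1) = x powr (p - 2) * x" if "x \<ge> 0" for x :: real
        using that powr_add[of x "p - 2" 1] by (cases "x = 0") (use p in auto)
      show ?thesis
      proof (cases "t \<le> \<tau>")
        case True
        then have "g t = 0" using gz by simp
        then show ?thesis using u[OF t] \<alpha>\<beta> P(7)[of t] p
          by (simp add: \<alpha>p powr_mult[symmetric] pw abs_mult)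
      next
        case False
        then have "f t = 0" using fz by simp
        then show ?thesis using u[OF t] \<alpha>\<beta> P(8)[of t] p
          by (simp add: \<beta>p powr_mult[symmetric] pw abs_mult)
      qed
    qed
    ultimately show "(u1 has_real_derivative - (V t * (\<bar>u t\<bar> powr (p - 2) * u t))) (at t)" by simp
  next
    \<comment> \<open>One summand for each of the three regions: near 0, where only \<open>f\<close>
      is present, near 1, where only \<open>g\<close> is, and the middle, where
      \<open>t * (1 - t)\<close> is at least \<open>t1 * t2\<close>.\<close>
    define N where "N = \<alpha> * M1 / (1 - \<tau>) + \<beta> * M2 / \<tau> + (\<alpha> * sqrt C1 + \<beta> * sqrt C2) / (t1 * t2)"
    fix t :: real assume t: "0 < t" "t < 1"
    have sq: "0 \<le> sqrt C1" "0 \<le> sqrt C2" using C by auto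
    have N3: "0 \<le> \<alpha> * M1 / (1 - \<tau>)" "0 \<le> \<beta> * M2 / \<tau>" "0 \<le> (\<alpha> * sqrt C1 + \<beta> * sqrt C2) / (t1 * t2)"
      using \<alpha>\<beta> M1 M2 P sq by auto
    consider "t \<le> t1" | "1 - t \<le> t2" | "t1 < t" "t2 < 1 - t" by linarith
    then show "\<bar>u t\<bar> \<le> N * (t * (1 - t))"
    proof cases
      case 1
      then have "g t = 0" using gz M1 by simp
      then have "\<bar>u t\<bar> = \<alpha> * f t" using u[OF t] \<alpha>\<beta> P(7)[of t] by simp
      also have "\<dots> \<le> \<alpha> * (M1 * t)" using M1(4) t 1 \<alpha>\<beta> by (intro mult_left_mono) auto
      also have "\<dots> = (\<alpha> * M1 / (1 - \<tau>)) * (t * (1 - \<tau>))" using P by simp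
      also have "\<dots> \<le> (\<alpha> * M1 / (1 - \<tau>)) * (t * (1 - t))"
        using N3 1 M1 t by (intro mult_left_mono) auto
      also have "\<dots> \<le> N * (t * (1 - t))" using N3 t unfolding N_def by (intro mult_right_mono) auto
      finally show ?thesis .
    next
      case 2
      then have "f t = 0" using fz M2 by simp
      then have "\<bar>u t\<bar> = \<beta> * g t" using u[OF t] \<alpha>\<beta> P(8)[of t] by simp
      also have "\<dots> \<le> \<beta> * (M2 * (1 - t))" using M2(4)[of "1 - t"] t 2 \<alpha>\<beta> by (intro mult_left_mono) auto
      also have "\<dots> = (\<beta> * M2 / \<tau>) * (\<tau> * (1 - t))" using P by simp
      also have "\<dots> \<le> (\<beta> * M2 / \<tau>) * (t * (1 - t))"
        using N3 2 M2 t by (intro mult_left_mono mult_right_mono) auto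
      also have "\<dots> \<le> N * (t * (1 - t))" using N3 t unfolding N_def by (intro mult_right_mono) auto
      finally show ?thesis .
    next
      case 3
      have le: "\<bar>h t\<bar> \<le> sqrt c" if "adm a b h c" for a b h c
      proof -
        have "h 0 = 0" using that unfolding adm_def by auto
        then have "\<bar>h t\<bar> \<le> sqrt c * sqrt t" using adm_diff_le[OF that, of t 0] t by simp
        also have "\<dots> \<le> sqrt c * 1" using t adm_nonneg[OF that] by (intro mult_left_mono) auto
        finally show ?thesis by simp
      qed
      have "\<bar>u t\<bar> \<le> \<bar>\<alpha> * f t\<bar> + \<bar>\<beta> * g t\<bar>" unfolding u[OF t] by simp
      also have "\<dots> \<le> \<alpha> * sqrt C1 + \<beta> * sqrt C2"
        using le[OF P(3)] le[OF P(4)] \<alpha>\<beta> unfolding abs_mult by (intro add_mono mult_mono) auto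
      also have "\<dots> = ((\<alpha> * sqrt C1 + \<beta> * sqrt C2) / (t1 * t2)) * (t1 * t2)" using M1 M2 by simp
      also have "\<dots> \<le> ((\<alpha> * sqrt C1 + \<beta> * sqrt C2) / (t1 * t2)) * (t * (1 - t))"
        using N3 3 M1 M2 t by (intro mult_left_mono mult_mono) auto
      also have "\<dots> \<le> N * (t * (1 - t))" using N3 t unfolding N_def by (intro mult_right_mono) auto
      finally show ?thesis .
    qed
  next
    have "\<exists>t. f t \<noteq> 0" using F_zero[of f] P(5) by fastforce
    then obtain t where t: "f t \<noteq> 0" by blast
    then have "0 < t" "t < \<tau>" using fz[of t] by (meson not_le)+
    then show "\<exists>t. 0 < t \<and> t < 1 \<and> u t > 0"
      using u[of t] gz[of t] P(2) P(7)[of t] t \<alpha>\<beta> by (intro exI[of _ t]) auto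
    have "\<exists>t. g t \<noteq> 0" using F_zero[of g] P(6) by fastforce
    then obtain s where s: "g s \<noteq> 0" by blast
    then have "\<tau> < s" "s < 1" using gz[of s] by (meson not_le)+
    then show "\<exists>t. 0 < t \<and> t < 1 \<and> u t < 0"
      using u[of s] fz[of s] P(1) P(8)[of s] s \<alpha>\<beta> by (intro exI[of _ s]) auto
  qed
qed

end

subsection \<open>Smooth functions\<close>

definition smooth :: "('a::euclidean_space \<Rightarrow> real) \<Rightarrow> bool" where
  "smooth f \<longleftrightarrow> (\<forall>k. C_k k f)"

lemma C_k_SucI:
  assumes "\<And>x. (f has_derivative f' x) (at x)" "\<And>e. e \<in> Basis \<Longrightarrow> C_k k (\<lambda>x. f' x e)"
  shows "C_k (Suc k) f"
proof -
  have "frechet_derivative f (at x) = f' x" for x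
    using frechet_derivative_at[OF assms(1)[of x]] by simp
  then show ?thesis using assms by (auto simp: differentiable_on_def differentiable_def)
qed

lemma C_k_SucD:
  assumes "C_k (Suc k) f"
  shows "(f has_derivative frechet_derivative f (at x)) (at x)"
    "e \<in> Basis \<Longrightarrow> C_k k (\<lambda>x. frechet_derivative f (at x) e)"
  using assms by (auto simp: differentiable_on_def frechet_derivative_works)

lemma C_k_Suc_imp: "C_k (Suc k) f \<Longrightarrow> C_k k f"
proof (induction k arbitrary: f)
  case 0
  then show ?case
    using C_k_SucD(1)[OF 0] by (auto intro!: continuous_at_imp_continuous_on has_derivative_continuous)
next
  case (Suc k)
  show ?case
    by (rule C_k_SucI[OF C_k_SucD(1)[OF Suc.prems]]) (rule Suc.IH[OF C_k_SucD(2)[OF Suc.prems]])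
qed

lemma C_k_const: "C_k k (\<lambda>x. c)"
  by (induction k arbitrary: c) (auto intro!: C_k_SucI[of _ "\<lambda>x h. 0"])

lemma C_k_inner: "C_k k (\<lambda>x. x \<bullet> a)"
proof (cases k)
  case (Suc j)
  show ?thesis unfolding Suc
    by (rule C_k_SucI[of _ "\<lambda>x h. h \<bullet> a"]) (auto intro!: derivative_eq_intros C_k_const)
qed (auto intro!: continuous_intros)

lemma C_k_add: "C_k k f \<Longrightarrow> C_k k g \<Longrightarrow> C_k k (\<lambda>x. f x + g x)"
proof (induction k arbitrary: f g)
  case (Suc k)
  show ?case
    by (rule C_k_SucI[OF has_derivative_add[OF C_k_SucD(1)[OF Suc.prems(1)] C_k_SucD(1)[OF Suc.prems(2)]]])
       (rule Suc.IH[OF C_k_SucD(2)[OF Suc.prems(1)] C_k_SucD(2)[OF Suc.prems(2)]])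
qed (auto intro: continuous_on_add)

lemma C_k_mult: "C_k k f \<Longrightarrow> C_k k g \<Longrightarrow> C_k k (\<lambda>x. f x * g x)"
proof (induction k arbitrary: f g)
  case (Suc k)
  show ?case
    by (rule C_k_SucI[OF has_derivative_mult[OF C_k_SucD(1)[OF Suc.prems(1)] C_k_SucD(1)[OF Suc.prems(2)]]])
       (rule C_k_add[OF Suc.IH[OF C_k_Suc_imp[OF Suc.prems(1)] C_k_SucD(2)[OF Suc.prems(2)]]
          Suc.IH[OF C_k_SucD(2)[OF Suc.prems(1)] C_k_Suc_imp[OF Suc.prems(2)]]])
qed (auto intro: continuous_on_mult)

lemma C_k_powr: "C_k k f \<Longrightarrow> (\<And>x. f x > 0) \<Longrightarrow> C_k k (\<lambda>x. f x powr a)"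
proof (induction k arbitrary: a)
  case 0
  then show ?case by (auto intro!: continuous_on_powr continuous_on_const simp: less_imp_neq[symmetric])
next
  case (Suc k)
  have D: "((\<lambda>x. f x powr a) has_derivative (\<lambda>h. a * f x powr (a - 1) * frechet_derivative f (at x) h)) (at x)" for x
  proof -
    have "((\<lambda>y. y powr a) has_derivative (\<lambda>h. a * f x powr (a - 1) * h)) (at (f x))"
      using has_real_derivative_powr[OF Suc.prems(2)] by (simp add: has_field_derivative_def)
    from has_derivative_compose[OF C_k_SucD(1)[OF Suc.prems(1)] this] show ?thesis .
  qed
  show ?case
    by (rule C_k_SucI[OF D])
       (rule C_k_mult[OF C_k_mult[OF C_k_const Suc.IH[OF C_k_Suc_imp[OF Suc.prems(1)] Suc.prems(2)]]
          C_k_SucD(2)[OF Suc.prems(1)]])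
qed

lemma C_k_compose_real:
  fixes g :: "real \<Rightarrow> real"
  shows "C_k k g \<Longrightarrow> C_k k f \<Longrightarrow> C_k k (\<lambda>x. g (f x))"
proof (induction k arbitrary: g)
  case 0
  then show ?case by (auto intro: continuous_on_compose2)
next
  case (Suc k)
  have D: "((\<lambda>x. g (f x)) has_derivative (\<lambda>h. frechet_derivative g (at (f x)) 1 * frechet_derivative f (at x) h)) (at x)" for x
  proof -
    have lin: "frechet_derivative g (at (f x)) h = frechet_derivative g (at (f x)) 1 * h" for h
      using linear_cmul[OF has_derivative_linear[OF C_k_SucD(1)[OF Suc.prems(1)]], of "f x" h 1] by simp
    have "(g has_derivative (\<lambda>h. frechet_derivative g (at (f x)) 1 * h)) (at (f x))"
      using C_k_SucD(1)[OF Suc.prems(1), of "f x"] lin by (metis (no_types, lifting) ext)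
    from has_derivative_compose[OF C_k_SucD(1)[OF Suc.prems(2)] this] show ?thesis .
  qed
  have 1: "C_k k (\<lambda>x. frechet_derivative g (at x) 1)" using C_k_SucD(2)[OF Suc.prems(1), of 1] by simp
  show ?case
    by (rule C_k_SucI[OF D])
       (rule C_k_mult[OF Suc.IH[OF 1 C_k_Suc_imp[OF Suc.prems(2)]] C_k_SucD(2)[OF Suc.prems(2)]])
qed

lemma smooth_const [intro]: "smooth (\<lambda>x. c)"
  and smooth_inner [intro]: "smooth (\<lambda>x. x \<bullet> v)"
  and smooth_add [intro]: "smooth f \<Longrightarrow> smooth g \<Longrightarrow> smooth (\<lambda>x. f x + g x)"
  and smooth_mult [intro]: "smooth f \<Longrightarrow> smooth g \<Longrightarrow> smooth (\<lambda>x. f x * g x)"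
  and smooth_powr: "smooth f \<Longrightarrow> (\<And>x. f x > 0) \<Longrightarrow> smooth (\<lambda>x. f x powr a)"
  and smooth_compose_real: "smooth h \<Longrightarrow> smooth f \<Longrightarrow> smooth (\<lambda>x. h (f x))"
  by (auto simp: smooth_def intro: C_k_const C_k_inner C_k_add C_k_mult C_k_powr C_k_compose_real)

lemma smooth_minus [intro]: "smooth f \<Longrightarrow> smooth (\<lambda>x. - f x)"
  using smooth_mult[OF smooth_const[of "-1"]] by simp

lemma smooth_diff: "smooth f \<Longrightarrow> smooth g \<Longrightarrow> smooth (\<lambda>x. f x - g x)"
  using smooth_add[OF _ smooth_minus] by simp

lemma smooth_sum [intro]: "(\<And>i. i \<in> I \<Longrightarrow> smooth (f i)) \<Longrightarrow> smooth (\<lambda>x. \<Sum>i\<in>I. f i x)"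
  by (induction I rule: infinite_finite_induct) auto

lemma smooth_prod [intro]: "(\<And>i. i \<in> I \<Longrightarrow> smooth (f i)) \<Longrightarrow> smooth (\<lambda>x. \<Prod>i\<in>I. f i x)"
  by (induction I rule: infinite_finite_induct) auto

lemma smooth_power [intro]: "smooth f \<Longrightarrow> smooth (\<lambda>x. f x ^ k)"
  by (induction k) auto

lemma smooth_differentiable: "smooth f \<Longrightarrow> (f has_derivative frechet_derivative f (at x)) (at x)"
  using C_k_SucD(1)[of 0 f] by (simp add: smooth_def del: C_k.simps)

lemma smooth_partial: "smooth f \<Longrightarrow> e \<in> Basis \<Longrightarrow> smooth (\<lambda>x. frechet_derivative f (at x) e)"
  unfolding smooth_def using C_k_SucD(2) by blast

lemma smooth_continuous: "smooth f \<Longrightarrow> continuous_on S f"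
  using continuous_on_subset[of UNIV f S] by (auto simp: smooth_def dest: spec[of _ 0])

text \<open>The functions \<open>P(1/x) exp(-1/x)\<close>, extended by \<open>0\<close> to \<open>x \<le> 0\<close>, are closed under differentiation.\<close>

definition expflat :: "real poly \<Rightarrow> real \<Rightarrow> real" where
  "expflat P x = (if x > 0 then poly P (1 / x) * exp (- (1 / x)) else 0)"

lemma poly_exp_tendsto_0: "((\<lambda>y::real. poly P y * exp (- y)) \<longlongrightarrow> 0) at_top"
proof -
  have "((\<lambda>y::real. \<Sum>i\<le>degree P. coeff P i * (y ^ i / exp y)) \<longlongrightarrow> (\<Sum>i\<le>degree P. coeff P i * 0)) at_top"
    by (intro tendsto_sum tendsto_mult tendsto_const tendsto_power_div_exp_0)
  then show ?thesis
    by (simp add: poly_altdef sum_distrib_right exp_minus divide_inverse mult.assoc)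
qed

lemma expflat_tendsto_0: "(expflat P \<longlongrightarrow> 0) (at 0)"
proof -
  have "filterlim (\<lambda>x::real. 1 / x) at_top (at_right 0)"
    using filterlim_inverse_at_top_right by (simp add: inverse_eq_divide)
  then have "((\<lambda>x. poly P (1 / x) * exp (- (1 / x))) \<longlongrightarrow> 0) (at_right 0)"
    by (rule filterlim_compose[OF poly_exp_tendsto_0])
  moreover have "\<forall>\<^sub>F x in at_right 0. poly P (1 / x) * exp (- (1 / x)) = expflat P x"
    by (rule eventually_mono[OF eventually_at_right_less]) (simp add: expflat_def)
  ultimately have r: "(expflat P \<longlongrightarrow> 0) (at_right 0)" by (rule Lim_transform_eventually)
  have "\<forall>\<^sub>F x in at_left 0. 0 = expflat P x"
    by (rule eventually_mono[OF eventually_at_left_real[of "-1" 0]]) (auto simp: expflat_def)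
  then have "(expflat P \<longlongrightarrow> 0) (at_left 0)" by (rule Lim_transform_eventually[OF tendsto_const])
  with r show ?thesis using filterlim_split_at by blast
qed

lemma expflat_derivative:
  "(expflat P has_real_derivative expflat ([:0, 0, 1:] * (P - pderiv P)) x) (at x)"
proof -
  consider "x < 0" | "x = 0" | "x > 0" by linarith
  then show ?thesis
  proof cases
    case 1
    have "((\<lambda>x. 0) has_real_derivative 0) (at x)" by simp
    then have "(expflat P has_real_derivative 0) (at x)"
      by (rule has_field_derivative_transform_within_open[of _ _ _ "{..<0}"]) (use 1 in \<open>auto simp: expflat_def\<close>)
    then show ?thesis using 1 by (simp add: expflat_def)
  next
    case 2
    have "(\<lambda>y. (expflat P y - expflat P 0) / (y - 0)) = expflat ([:0, 1:] * P)"
      by (auto simp: expflat_def)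
    then have "((\<lambda>y. (expflat P y - expflat P 0) / (y - 0)) \<longlongrightarrow> 0) (at 0)"
      using expflat_tendsto_0[of "[:0, 1:] * P"] by simp
    then show ?thesis unfolding 2 has_field_derivative_iff by (simp add: expflat_def)
  next
    case 3
    have "((\<lambda>x. poly P (1 / x) * exp (- (1 / x))) has_real_derivative
        poly (pderiv P) (1 / x) * (- (1 / x\<^sup>2)) * exp (- (1 / x)) + exp (- (1 / x)) * (1 / x\<^sup>2) * poly P (1 / x)) (at x)"
    proof (rule DERIV_mult)
      have I: "((\<lambda>x. 1 / x) has_real_derivative - (1 / x\<^sup>2)) (at x)"
        using 3 by (auto intro!: derivative_eq_intros simp: power2_eq_square)
      show "((\<lambda>x. poly P (1 / x)) has_real_derivative poly (pderiv P) (1 / x) * - (1 / x\<^sup>2)) (at x)"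
        by (rule DERIV_chain2[OF poly_DERIV I])
      have "((\<lambda>x. - (1 / x)) has_real_derivative 1 / x\<^sup>2) (at x)" using DERIV_minus[OF I] by simp
      then show "((\<lambda>x. exp (- (1 / x))) has_real_derivative exp (- (1 / x)) * (1 / x\<^sup>2)) (at x)" by (rule DERIV_fun_exp)
    qed
    then have "(expflat P has_real_derivative
        poly (pderiv P) (1 / x) * (- (1 / x\<^sup>2)) * exp (- (1 / x)) + exp (- (1 / x)) * (1 / x\<^sup>2) * poly P (1 / x)) (at x)"
      by (rule has_field_derivative_transform_within_open[of _ _ _ "{0<..}"]) (use 3 in \<open>auto simp: expflat_def\<close>)
    moreover have "poly (pderiv P) (1 / x) * (- (1 / x\<^sup>2)) * exp (- (1 / x)) + exp (- (1 / x)) * (1 / x\<^sup>2) * poly P (1 / x)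
        = expflat ([:0, 0, 1:] * (P - pderiv P)) x"
      using 3 by (simp add: expflat_def algebra_simps power2_eq_square)
    ultimately show ?thesis by simp
  qed
qed

lemma smooth_expflat: "smooth (expflat P)"
  unfolding smooth_def
proof
  fix k
  show "C_k k (expflat P)"
  proof (induction k arbitrary: P)
    case 0
    then show ?case
      by (auto intro!: continuous_at_imp_continuous_on DERIV_isCont[OF expflat_derivative])
  next
    case (Suc k)
    have D: "(expflat P has_derivative (\<lambda>h. expflat ([:0, 0, 1:] * (P - pderiv P)) x * h)) (at x)" for x
      using expflat_derivative unfolding has_field_derivative_def .
    show ?case by (rule C_k_SucI[OF D]) (use Suc.IH in simp)
  qed
qed

text \<open>The reciprocal is written as a power because real powers of positive functions are
  already known to be smooth; the two summands of the base are never both zero.\<close>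

definition cutoff :: "real \<Rightarrow> real" where
  "cutoff x = expflat 1 (x - 1) * (expflat 1 (x - 1) + expflat 1 (2 - x)) powr (- 1)"

lemma cutoff_smooth: "smooth cutoff"
proof -
  have id: "smooth (\<lambda>x::real. x)" using smooth_inner[of "1::real"] by simp
  have "expflat 1 (x - 1) + expflat 1 (2 - x) > 0" for x
    by (auto simp: expflat_def intro: add_pos_nonneg add_nonneg_pos)
  moreover have "smooth (\<lambda>x. expflat 1 (x - 1))" "smooth (\<lambda>x. expflat 1 (2 - x))"
    by (rule smooth_compose_real[OF smooth_expflat smooth_diff[OF id smooth_const]],
        rule smooth_compose_real[OF smooth_expflat smooth_diff[OF smooth_const id]])
  ultimately show ?thesis
    unfolding cutoff_def[abs_def] by (intro smooth_mult smooth_powr smooth_add) auto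
qed

lemma cutoff_0: "x \<le> 1 \<Longrightarrow> cutoff x = 0" by (simp add: cutoff_def expflat_def)

lemma cutoff_1: "x \<ge> 2 \<Longrightarrow> cutoff x = 1" by (simp add: cutoff_def expflat_def powr_minus_divide)

lemma cutoff_01: "0 \<le> cutoff x" "cutoff x \<le> 1"
  by (auto simp: cutoff_def expflat_def powr_minus_divide divide_le_eq_1 add_pos_pos)

definition cutoff' :: "real \<Rightarrow> real" where "cutoff' x = frechet_derivative cutoff (at x) 1"

lemma cutoff_deriv: "(cutoff has_real_derivative cutoff' x) (at x)"
proof -
  have D: "(cutoff has_derivative frechet_derivative cutoff (at x)) (at x)" by (rule smooth_differentiable[OF cutoff_smooth])
  have "frechet_derivative cutoff (at x) h = cutoff' x * h" for h
    using linear_cmul[OF has_derivative_linear[OF D], of h 1] by (simp add: cutoff'_def)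
  then show ?thesis using D unfolding has_field_derivative_def by (metis (no_types, lifting) ext)
qed

lemma cutoff'_0: "x < 1 \<or> 2 < x \<Longrightarrow> cutoff' x = 0"
proof (elim disjE)
  assume x: "x < 1"
  have "((\<lambda>x. 0) has_real_derivative 0) (at x)" by simp
  then have "(cutoff has_real_derivative 0) (at x)"
    by (rule has_field_derivative_transform_within_open[of _ _ _ "{..<1}"]) (use x in \<open>auto simp: cutoff_0\<close>)
  then show ?thesis using cutoff_deriv DERIV_unique by blast
next
  assume x: "2 < x"
  have "((\<lambda>x. 1) has_real_derivative 0) (at x)" by simp
  then have "(cutoff has_real_derivative 0) (at x)"
    by (rule has_field_derivative_transform_within_open[of _ _ _ "{2<..}"]) (use x in \<open>auto simp: cutoff_1\<close>)
  then show ?thesis using cutoff_deriv DERIV_unique by blast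
qed

lemma cutoff'_bounded: obtains C where "C > 0" "\<And>x. \<bar>cutoff' x\<bar> \<le> C"
proof -
  have "continuous_on {1..2} cutoff'"
    unfolding cutoff'_def[abs_def] using smooth_continuous[OF smooth_partial[OF cutoff_smooth, of 1]] by simp
  then have "bounded (cutoff' ` {1..2})" by (intro compact_imp_bounded compact_continuous_image) auto
  then obtain B where B: "\<And>x. x \<in> {1..2} \<Longrightarrow> \<bar>cutoff' x\<bar> \<le> B" unfolding bounded_iff real_norm_def by blast
  have "\<bar>cutoff' x\<bar> \<le> \<bar>B\<bar> + 1" for x
    using B[of x] cutoff'_0[of x] by (cases "x \<in> {1..2}") auto
  then show ?thesis using that[of "\<bar>B\<bar> + 1"] by auto
qed

text \<open>Dominated by a sum of multiples of indicators of dyadic balls. The integrals of the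
  summands form a geometric series with ratio 2^{d - 2\<beta>}, where d is the dimension.\<close>

lemma integrable_bracket:
  fixes a :: "'a::euclidean_space"
  assumes \<beta>: "2 * \<beta> > real DIM('a)"
  shows "integrable lborel (\<lambda>x. (1 + (norm (x - a))\<^sup>2) powr (- \<beta>))"
proof (rule integrableI_bounded)
  have \<beta>0: "\<beta> > 0" using \<beta> by (smt (verit) of_nat_0_le_iff)
  show "(\<lambda>x. (1 + (norm (x - a))\<^sup>2) powr (- \<beta>)) \<in> borel_measurable lborel" by measurable
  \<comment> \<open>Chosen so that \<open>c * r ^ Suc j\<close> is
    \<open>(4 ^ j) powr (- \<beta>)\<close>, the bound outside the ball of radius
    \<open>2 ^ j\<close>; a point that first enters the ball of index \<open>Suc j\<close> lies
    outside the one of index \<open>j\<close>.\<close>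
  define c :: real where "c = 4 powr \<beta>"
  define r :: real where "r = 4 powr (- \<beta>)"
  define v where "v = unit_ball_vol (real DIM('a))"
  have c: "c \<ge> 1" using \<beta>0 by (simp add: c_def ge_one_powr_ge_zero)
  have r0: "r > 0" by (simp add: r_def)
  have rj: "c * r ^ Suc j = (4 ^ j) powr (- \<beta>)" for j
  proof -
    have "r ^ j = (4 ^ j) powr (- \<beta>)"
      unfolding r_def by (simp add: powr_powr mult.commute flip: powr_realpow)
    moreover have "c * r = 1" by (simp add: c_def r_def flip: powr_add)
    ultimately show ?thesis by (simp add: mult.assoc[symmetric])
  qed
  have pt: "ennreal (norm ((1 + (norm (x - a))\<^sup>2) powr (- \<beta>))) \<le> (\<Sum>j. ennreal (c * r ^ j) * indicator (ball a (2 ^ j)) x)" for x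
  proof -
    define P where "P j \<longleftrightarrow> norm (x - a) < 2 ^ j" for j :: nat
    have "\<exists>j. P j" unfolding P_def by (rule real_arch_pow) simp
    then have Pj: "P (LEAST j. P j)" by (rule LeastI_ex)
    define j where "j = (LEAST j. P j)"
    have in_ball: "x \<in> ball a (2 ^ j)" using Pj by (simp add: j_def P_def dist_norm norm_minus_commute)
    have "(1 + (norm (x - a))\<^sup>2) powr (- \<beta>) \<le> c * r ^ j"
    proof (cases j)
      case 0
      have "(1 + (norm (x - a))\<^sup>2) powr (- \<beta>) \<le> 1 powr (- \<beta>)" using \<beta>0 by (intro powr_mono2') auto
      then show ?thesis using c 0 by simp
    next
      case (Suc i)
      then have "\<not> P i" unfolding j_def by (metis lessI not_less_Least)
      then have "2 ^ i \<le> norm (x - a)" by (simp add: P_def)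
      then have "(2 ^ i)\<^sup>2 \<le> (norm (x - a))\<^sup>2" by (intro power_mono) auto
      then have "4 ^ i \<le> 1 + (norm (x - a))\<^sup>2" by (simp add: power_even_eq[symmetric] power_mult[symmetric] mult.commute power2_eq_square flip: power_mult_distrib)
      then have "(1 + (norm (x - a))\<^sup>2) powr (- \<beta>) \<le> (4 ^ i) powr (- \<beta>)" using \<beta>0 by (intro powr_mono2') auto
      then show ?thesis unfolding Suc rj .
    qed
    then have le: "ennreal (norm ((1 + (norm (x - a))\<^sup>2) powr (- \<beta>))) \<le> ennreal (c * r ^ j) * indicator (ball a (2 ^ j)) x"
      using in_ball by (simp add: ennreal_leI)
    define T where "T i = ennreal (c * r ^ i) * indicator (ball a (2 ^ i)) x" for i
    have "T j = (\<Sum>i\<in>{j}. T i)" by simp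
    also have "\<dots> \<le> (\<Sum>j. T j)" by (rule sum_le_suminf) auto
    finally show ?thesis using le unfolding T_def by (rule order_trans[rotated])
  qed
  have "(\<integral>\<^sup>+ x. ennreal (norm ((1 + (norm (x - a))\<^sup>2) powr (- \<beta>))) \<partial>lborel)
      \<le> (\<integral>\<^sup>+ x. (\<Sum>j. ennreal (c * r ^ j) * indicator (ball a (2 ^ j)) x) \<partial>lborel)"
    by (intro nn_integral_mono pt)
  also have "\<dots> = (\<Sum>j. \<integral>\<^sup>+ x. ennreal (c * r ^ j) * indicator (ball a (2 ^ j)) x \<partial>lborel)"
    by (rule nn_integral_suminf) (auto intro!: borel_measurable_times_ennreal borel_measurable_indicator)
  also have "\<dots> = (\<Sum>j. ennreal (c * v * (r * 2 ^ DIM('a)) ^ j))"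
  proof (rule suminf_cong)
    fix j
    have "(\<integral>\<^sup>+ x. ennreal (c * r ^ j) * indicator (ball a (2 ^ j)) x \<partial>lborel) = ennreal (c * r ^ j) * emeasure lborel (ball a (2 ^ j))"
      by (rule nn_integral_cmult_indicator) simp
    also have "\<dots> = ennreal (c * r ^ j) * ennreal (v * (2 ^ j) ^ DIM('a))" unfolding v_def by (subst emeasure_ball) simp_all
    also have "\<dots> = ennreal (c * v * (r * 2 ^ DIM('a)) ^ j)"
      using c r0 by (subst ennreal_mult'[symmetric]) (simp_all add: power_mult_distrib power_mult[symmetric] mult_ac)
    finally show "(\<integral>\<^sup>+ x. ennreal (c * r ^ j) * indicator (ball a (2 ^ j)) x \<partial>lborel) = ennreal (c * v * (r * 2 ^ DIM('a)) ^ j)" .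
  qed
  also have "\<dots> < \<infinity>"
  proof -
    have v: "v \<ge> 0" unfolding v_def by simp
    have "r * 2 ^ DIM('a) = 2 powr (real DIM('a) - 2 * \<beta>)"
    proof -
      have "(4::real) powr (- \<beta>) = 2 powr (- (2 * \<beta>))" using powr_powr[of "2::real" 2 "- \<beta>"] by simp
      then show ?thesis unfolding r_def by (simp add: powr_diff powr_minus_divide powr_realpow)
    qed
    also have "\<dots> < 1" using \<beta> powr_less_mono[of "real DIM('a) - 2 * \<beta>" 0 2] by simp
    finally have lt: "r * 2 ^ DIM('a) < 1" .
    have "summable (\<lambda>j. c * v * (r * 2 ^ DIM('a)) ^ j)" using lt r0 by (intro summable_mult summable_geometric) simp
    then have "(\<Sum>j. ennreal (c * v * (r * 2 ^ DIM('a)) ^ j)) \<noteq> top"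
      using c v r0 by (intro ennreal_suminf_neq_top) auto
    then show ?thesis by (simp add: less_top)
  qed
  finally show "(\<integral>\<^sup>+ x. ennreal (norm ((1 + (norm (x - a))\<^sup>2) powr (- \<beta>))) \<partial>lborel) < \<infinity>" .
qed

text \<open>Open boxes are closed under intersection and generate the Borel sets, so Dynkin's
  argument extends the vanishing of the integral to all Borel sets.\<close>

lemma AE_zero_of_box_integrals:
  fixes f :: "'a::euclidean_space \<Rightarrow> real"
  assumes f: "integrable lebesgue f" and box: "\<And>a b. (LINT x:box a b|lebesgue. f x) = 0"
  shows "AE x in lebesgue. f x = 0"
proof -
  have si: "set_integrable lebesgue A f" if "A \<in> sets lebesgue" for A
    unfolding set_integrable_def by (rule integrable_mult_indicator[OF that f])
  have U: "(LINT x:UNIV|lebesgue. f x) = 0"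
  proof -
    have "(\<lambda>i. LINT x:(box (- (real i *\<^sub>R One)) (real i *\<^sub>R One))|lebesgue. f x) \<longlonglongrightarrow>
        (LINT x:(\<Union>i::nat. box (- (real i *\<^sub>R One)) (real i *\<^sub>R One :: 'a))|lebesgue. f x)"
    proof (rule set_integral_cont_up)
      show "incseq (\<lambda>i. box (- (real i *\<^sub>R One)) (real i *\<^sub>R One :: 'a))"
        unfolding incseq_def
      proof (intro allI impI subsetI)
        fix m n :: nat and x :: 'a
        assume "m \<le> n" and x: "x \<in> box (- (real m *\<^sub>R One)) (real m *\<^sub>R One)"
        then have mn: "real m \<le> real n" by simp
        have "- real n < x \<bullet> i \<and> x \<bullet> i < real n" if "i \<in> Basis" for i
        proof -
          have "- real m < x \<bullet> i \<and> x \<bullet> i < real m" using x that by (auto simp: mem_box)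
          then show ?thesis using mn by linarith
        qed
        then show "x \<in> box (- (real n *\<^sub>R One)) (real n *\<^sub>R One)" by (auto simp: mem_box)
      qed
      show "set_integrable lebesgue (\<Union>i::nat. box (- (real i *\<^sub>R One)) (real i *\<^sub>R One :: 'a)) f"
        by (rule si) simp
    qed auto
    moreover have "(\<Union>i::nat. box (- (real i *\<^sub>R One)) (real i *\<^sub>R One :: 'a)) = UNIV"
      by (rule UN_box_eq_UNIV)
    ultimately show ?thesis unfolding box using LIMSEQ_unique tendsto_const by metis
  qed
  have borel: "(LINT x:A|lebesgue. f x) = 0" if A: "A \<in> sets borel" for A :: "'a set"
  proof -
    have "A \<in> sigma_sets UNIV (range (\<lambda>(a, b). box a b))"
      using A unfolding borel_eq_box by (simp add: sets_measure_of)
    moreover have "Int_stable (range (\<lambda>(a, b). box a b :: 'a set))"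
      by (auto simp: Int_stable_def box_Int_box)
    moreover have "range (\<lambda>(a, b). box a b :: 'a set) \<subseteq> Pow UNIV" by simp
    ultimately have "A \<in> sigma_sets UNIV (range (\<lambda>(a, b). box a b))"
      "Int_stable (range (\<lambda>(a, b). box a b :: 'a set))" "range (\<lambda>(a, b). box a b :: 'a set) \<subseteq> Pow UNIV"
      by blast+
    from this(2,3,1) show ?thesis
    proof (induction rule: sigma_sets_induct_disjoint)
      case (basic A)
      then show ?case using box by auto
    next
      case (compl A)
      then have "A \<in> sets lebesgue" using borel_eq_box sets_completionI_sets[of A lborel] by (simp add: borel_eq_box sets_measure_of)
      then have "(LINT x:(UNIV - A) \<union> A|lebesgue. f x) = (LINT x:UNIV - A|lebesgue. f x) + (LINT x:A|lebesgue. f x)"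
        by (intro set_integral_Un si) auto
      then show ?case using compl U by simp
    next
      case (union A)
      have m: "A i \<in> sets lebesgue" for i
      proof -
        have "A i \<in> sets borel" using union(2) unfolding borel_eq_box by (auto simp: sets_measure_of)
        then show ?thesis by simp
      qed
      have "(LINT x:(\<Union>i. A i)|lebesgue. f x) = (\<Sum>i. (LINT x:(A i)|lebesgue. f x))"
        using union(1) m by (intro lebesgue_integral_countable_add si) (auto simp: disjoint_family_on_def)
      then show ?case using union(3) by simp
    qed (auto simp: set_lebesgue_integral_def)
  qed
  \<comment> \<open>The final criterion lives on \<open>lborel\<close>, where the vanishing
    integrals over Borel sets are available; \<open>f\<close> is exchanged for a Borel function
    equal to it almost everywhere.\<close>
  obtain f' where f': "f' \<in> borel_measurable lborel" "AE x in lborel. f x = f' x"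
    using completion_ex_borel_measurable_real[of f lborel] f by auto
  have ae: "AE x in lebesgue. f x = f' x" using f'(2) by (rule AE_completion)
  have f'm: "f' \<in> borel_measurable lebesgue" using f'(1) by (rule measurable_completion)
  have "integrable lebesgue f'" using integrable_cong_AE[OF _ f'm ae] f by auto
  then have f'i: "integrable lborel f'" using f'(1) by (simp add: integrable_completion)
  have "AE x in lborel. f' x = 0"
  proof (rule sigma_finite_measure.density_zero[OF lborel.sigma_finite_measure_axioms f'i])
    fix A :: "'a set" assume A: "A \<in> sets lborel"
    have "(LINT x:A|lborel. f' x) = (LINT x:A|lebesgue. f' x)"
      unfolding set_lebesgue_integral_def using A f'(1) by (intro integral_completion[symmetric] borel_measurable_scaleR borel_measurable_indicator) auto
    also have "\<dots> = (LINT x:A|lebesgue. f x)"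
      unfolding set_lebesgue_integral_def
    proof (rule integral_cong_AE)
      show "AE x in lebesgue. indicat_real A x *\<^sub>R f' x = indicat_real A x *\<^sub>R f x"
        using ae by eventually_elim simp
      show "(\<lambda>x. indicat_real A x *\<^sub>R f' x) \<in> borel_measurable lebesgue"
        using si[of A] A f'm by (intro borel_measurable_scaleR borel_measurable_indicator) auto
      show "(\<lambda>x. indicat_real A x *\<^sub>R f x) \<in> borel_measurable lebesgue"
        using si[of A] A unfolding set_integrable_def by auto
    qed
    also have "\<dots> = 0" using borel A by simp
    finally show "(LINT x:A|lborel. f' x) = 0" .
  qed
  then have "AE x in lebesgue. f' x = 0" by (rule AE_completion)
  with ae show ?thesis by eventually_elim simp
qed

section \<open>Test functions and uniqueness of weak gradients\<close>

lemma test_functions_bounded: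
  assumes "\<phi> \<in> test_functions S"
  obtains K B where "compact K" "K \<subseteq> S" "\<And>x. x \<notin> K \<Longrightarrow> \<phi> x = 0" "B > 0" "\<And>x. \<bar>\<phi> x\<bar> \<le> B"
proof -
  obtain K where K: "compact K" "K \<subseteq> S" "\<And>x. x \<notin> K \<Longrightarrow> \<phi> x = 0" and s: "smooth \<phi>"
    using assms unfolding test_functions_def smooth_def by auto
  have "bounded (\<phi> ` K)" by (intro compact_imp_bounded compact_continuous_image smooth_continuous s K)
  then obtain B where "\<And>x. x \<in> K \<Longrightarrow> \<bar>\<phi> x\<bar> \<le> B" unfolding bounded_iff real_norm_def by blast
  then have "\<bar>\<phi> x\<bar> \<le> \<bar>B\<bar> + 1" for x using K(3)[of x] by (cases "x \<in> K") force+
  then show ?thesis using that[OF K, of "\<bar>B\<bar> + 1"] by auto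
qed

lemma test_functions_smooth: "\<phi> \<in> test_functions S \<Longrightarrow> smooth \<phi>"
  unfolding test_functions_def smooth_def by auto

lemma integrable_mult_test:
  fixes g :: "'a::euclidean_space \<Rightarrow> real"
  assumes g: "locally_integrable_on g S" and \<phi>: "\<phi> \<in> test_functions S" and S: "S \<in> sets lebesgue"
  shows "integrable (lebesgue_on S) (\<lambda>x. g x * \<phi> x)"
proof -
  obtain K B where K: "compact K" "K \<subseteq> S" "\<And>x. x \<notin> K \<Longrightarrow> \<phi> x = 0" "B > 0" "\<And>x. \<bar>\<phi> x\<bar> \<le> B"
  proof (rule test_functions_bounded[OF \<phi>], goal_cases)
    case (1 K B)
    from 1(2-) show ?case by (rule 1(1))
  qed
  have gK: "integrable (lebesgue_on K) g" using g K(1,2) unfolding locally_integrable_on_def by blast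
  have Kl: "K \<in> sets lebesgue" by (rule fmeasurableD[OF lmeasurable_compact[OF K(1)]])
  have \<phi>m: "\<phi> \<in> borel_measurable (lebesgue_on K)"
    by (rule continuous_imp_measurable_on_sets_lebesgue[OF smooth_continuous[OF test_functions_smooth[OF \<phi>]] Kl])
  have "integrable (lebesgue_on K) (\<lambda>x. g x * \<phi> x)"
  proof (rule Bochner_Integration.integrable_bound)
    show "integrable (lebesgue_on K) (\<lambda>x. B * g x)" using gK by simp
    show "(\<lambda>x. g x * \<phi> x) \<in> borel_measurable (lebesgue_on K)"
      by (rule borel_measurable_times[OF borel_measurable_integrable[OF gK] \<phi>m])
    have "norm (g x * \<phi> x) \<le> norm (B * g x)" for x
      using mult_left_mono[OF K(5)[of x], of "\<bar>g x\<bar>"] K(4) by (simp add: abs_mult mult.commute)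
    then show "AE x in lebesgue_on K. norm (g x * \<phi> x) \<le> norm (B * g x)" by simp
  qed
  then have "integrable lebesgue (\<lambda>x. indicator K x *\<^sub>R (g x * \<phi> x))"
    using Kl by (subst (asm) integrable_restrict_space) auto
  also have "(\<lambda>x. indicator K x *\<^sub>R (g x * \<phi> x)) = (\<lambda>x. indicator S x *\<^sub>R (g x * \<phi> x))"
    using K(2,3) by (auto simp: indicator_def fun_eq_iff)
  finally show ?thesis using S by (simp add: integrable_restrict_space)
qed

text \<open>The fundamental lemma of the calculus of variations. Smooth functions with values
  between 0 and 1 approximate indicators of open boxes; on a compact box inside \<open>S\<close> the
  function itself is an integrable majorant, and countably many such boxes cover
  \<open>S\<close>.\<close>

lemma test_orthogonal_imp_AE_zero:
  fixes g :: "'a::euclidean_space \<Rightarrow> real"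
  assumes S: "open S" and g: "locally_integrable_on g S"
    and orth: "\<And>\<phi>. \<phi> \<in> test_functions S \<Longrightarrow> (\<integral>x. g x * \<phi> x \<partial>lebesgue_on S) = 0"
  shows "AE x in lebesgue_on S. g x = 0"
proof -
  have Sl: "S \<in> sets lebesgue" using S by simp
  have box0: "(\<integral>x. indicator (box a b) x *\<^sub>R g x \<partial>lebesgue) = 0"
    if cd: "cbox c d \<subseteq> S" and sub: "box a b \<subseteq> cbox c d" for a b c d
  proof -
    \<comment> \<open>Each factor vanishes within \<open>1 / j\<close> of the corresponding face and
      equals 1 beyond \<open>2 / j\<close>, so the products tend pointwise to the indicator of the
      open box.\<close>
    define \<phi> where "\<phi> j x = (\<Prod>e\<in>Basis. cutoff (real j * ((x - a) \<bullet> e)) * cutoff (real j * ((b - x) \<bullet> e)))" for j :: nat and x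
    have supp: "\<phi> j x = 0" if nx: "x \<notin> box a b" for j x
    proof -
      obtain e where e: "e \<in> Basis" "(x - a) \<bullet> e \<le> 0 \<or> (b - x) \<bullet> e \<le> 0"
        using nx unfolding mem_box not_less inner_diff_left by (auto simp: not_less)
      then have "real j * ((x - a) \<bullet> e) \<le> 0 \<or> real j * ((b - x) \<bullet> e) \<le> 0" by (auto simp: mult_nonneg_nonpos)
      then have "cutoff (real j * ((x - a) \<bullet> e)) * cutoff (real j * ((b - x) \<bullet> e)) = 0" using cutoff_0 by force
      then show ?thesis unfolding \<phi>_def using e(1) by (meson finite_Basis prod_zero)
    qed
    have \<phi>01: "0 \<le> \<phi> j x" "\<phi> j x \<le> 1" for j x
      unfolding \<phi>_def by (auto intro!: prod_nonneg prod_le_1 mult_nonneg_nonneg mult_le_one cutoff_01)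
    have sm: "smooth (\<phi> j)" for j
      unfolding \<phi>_def[abs_def] inner_diff_left
      by (intro smooth_prod smooth_mult smooth_compose_real[OF cutoff_smooth] smooth_diff smooth_const smooth_inner)
    have test: "\<phi> j \<in> test_functions S" for j
      unfolding test_functions_def using sm[of j] supp sub cd
      by (auto simp: smooth_def intro!: exI[of _ "cbox c d"])
    have ind_c: "integrable lebesgue (\<lambda>x. indicator (cbox c d) x *\<^sub>R g x)"
    proof -
      have "integrable (lebesgue_on (cbox c d)) g" using g cd unfolding locally_integrable_on_def by (meson compact_cbox)
      then show ?thesis by (subst (asm) integrable_restrict_space) auto
    qed
    have lim: "(\<lambda>j. \<phi> j x) \<longlonglongrightarrow> indicator (box a b) x" for x
    proof (cases "x \<in> box a b")
      case False
      then show ?thesis using supp by simp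
    next
      case True
      have one: "(\<lambda>j. cutoff (real j * s)) \<longlonglongrightarrow> 1" if "s > 0" for s
      proof -
        obtain N :: nat where N: "real N > 2 / s" using reals_Archimedean2 by blast
        have "cutoff (real j * s) = 1" if "j \<ge> N" for j
        proof -
          have "real N * s \<le> real j * s" using that \<open>s > 0\<close> by (intro mult_right_mono) auto
          moreover have "2 < real N * s" using N \<open>s > 0\<close> by (simp add: pos_divide_less_eq)
          ultimately have "real j * s \<ge> 2" by linarith
          then show ?thesis by (rule cutoff_1)
        qed
        then show ?thesis by (intro tendsto_eventually eventually_sequentiallyI[of N])
      qed
      have "(\<lambda>j. \<phi> j x) \<longlonglongrightarrow> (\<Prod>e\<in>(Basis::'a set). 1 * 1)"
        unfolding \<phi>_def using True
        by (intro tendsto_prod tendsto_mult one) (auto simp: mem_box inner_diff_left)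
      then show ?thesis using True by simp
    qed
    have z: "(\<integral>x. \<phi> j x * (indicator (cbox c d) x *\<^sub>R g x) \<partial>lebesgue) = 0" for j
    proof -
      have "(\<integral>x. g x * \<phi> j x \<partial>lebesgue_on S) = (\<integral>x. indicator S x *\<^sub>R (g x * \<phi> j x) \<partial>lebesgue)"
        using Sl by (intro integral_restrict_space) simp
      also have "\<dots> = (\<integral>x. \<phi> j x * (indicator (cbox c d) x *\<^sub>R g x) \<partial>lebesgue)"
        using supp[of _ j] sub cd by (intro Bochner_Integration.integral_cong) (auto simp: indicator_def)
      finally show ?thesis using orth[OF test] by simp
    qed
    have "(\<lambda>j. \<integral>x. \<phi> j x * (indicator (cbox c d) x *\<^sub>R g x) \<partial>lebesgue) \<longlonglongrightarrow>
        (\<integral>x. indicator (box a b) x * (indicator (cbox c d) x *\<^sub>R g x) \<partial>lebesgue)"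
    proof (rule integral_dominated_convergence)
      have gm: "(\<lambda>x. indicator (cbox c d) x *\<^sub>R g x) \<in> borel_measurable lebesgue" using ind_c by simp
      have "\<phi> j \<in> borel_measurable lebesgue" for j
        by (rule measurable_completion, simp, rule borel_measurable_continuous_onI, rule smooth_continuous[OF sm])
      then show "(\<lambda>x. \<phi> j x * (indicator (cbox c d) x *\<^sub>R g x)) \<in> borel_measurable lebesgue" for j
        using gm by (intro borel_measurable_times)
      have "(indicator (box a b) :: 'a \<Rightarrow> real) \<in> borel_measurable lebesgue" by (rule borel_measurable_indicator) simp
      then show "(\<lambda>x. indicator (box a b) x * (indicator (cbox c d) x *\<^sub>R g x)) \<in> borel_measurable lebesgue"
        using gm by (intro borel_measurable_times)
      show "integrable lebesgue (\<lambda>x. norm (indicator (cbox c d) x *\<^sub>R g x))" using ind_c by (rule integrable_norm)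
      show "AE x in lebesgue. (\<lambda>j. \<phi> j x * (indicator (cbox c d) x *\<^sub>R g x)) \<longlonglongrightarrow> indicator (box a b) x * (indicator (cbox c d) x *\<^sub>R g x)"
        by (intro AE_I2 tendsto_mult lim tendsto_const)
      show "AE x in lebesgue. norm (\<phi> j x * (indicator (cbox c d) x *\<^sub>R g x)) \<le> norm (indicator (cbox c d) x *\<^sub>R g x)" for j
        using \<phi>01[of j] by (intro AE_I2) (auto simp: abs_mult intro!: mult_left_le_one_le)
    qed
    then have "(\<integral>x. indicator (box a b) x * (indicator (cbox c d) x *\<^sub>R g x) \<partial>lebesgue) = 0"
      unfolding z using LIMSEQ_unique tendsto_const by metis
    moreover have "(\<lambda>x. indicator (box a b) x * (indicator (cbox c d) x *\<^sub>R g x)) = (\<lambda>x. indicator (box a b) x *\<^sub>R g x)"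
      using sub by (auto simp: indicator_def fun_eq_iff)
    ultimately show ?thesis by (simp only:)
  qed
  have loc: "AE x in lebesgue. x \<in> cbox c d \<longrightarrow> g x = 0" if cd: "cbox c d \<subseteq> S" for c d
  proof -
    have "AE x in lebesgue. indicator (box c d) x *\<^sub>R g x = 0"
    proof (rule AE_zero_of_box_integrals)
      have "integrable (lebesgue_on (cbox c d)) g" using g cd unfolding locally_integrable_on_def by (meson compact_cbox)
      then have i: "integrable lebesgue (\<lambda>x. indicator (cbox c d) x *\<^sub>R g x)" by (subst (asm) integrable_restrict_space) auto
      have "integrable lebesgue (\<lambda>x. indicator (box c d) x *\<^sub>R (indicator (cbox c d) x *\<^sub>R g x))"
        by (rule integrable_mult_indicator[OF _ i]) simp
      moreover have "(\<lambda>x. indicator (box c d) x *\<^sub>R (indicator (cbox c d) x *\<^sub>R g x)) = (\<lambda>x. indicator (box c d) x *\<^sub>R g x)"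
        using box_subset_cbox[of c d] by (auto simp: indicator_def fun_eq_iff)
      ultimately show "integrable lebesgue (\<lambda>x. indicator (box c d) x *\<^sub>R g x)" by (simp only:)
      fix a b
      obtain a' b' where ab: "box a b \<inter> box c d = box a' b'" using box_Int_box by blast
      have "(\<integral>x. indicator (box a' b') x *\<^sub>R g x \<partial>lebesgue) = 0"
        by (rule box0[OF cd]) (use ab box_subset_cbox[of c d] in auto)
      moreover have "(\<lambda>x. indicator (box a b) x *\<^sub>R (indicator (box c d) x *\<^sub>R g x)) = (\<lambda>x. indicator (box a' b') x *\<^sub>R g x)"
        unfolding ab[symmetric] by (auto simp: indicator_def fun_eq_iff)
      ultimately show "(LINT x:box a b|lebesgue. indicator (box c d) x *\<^sub>R g x) = 0"
        unfolding set_lebesgue_integral_def by (simp only:)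
    qed
    moreover have "AE x in lebesgue. x \<notin> cbox c d - box c d"
      using negligible_frontier_interval[of c d] by (intro AE_not_in) (simp add: negligible_iff_null_sets)
    ultimately show ?thesis by eventually_elim (auto simp: indicator_def split: if_splits)
  qed
  obtain \<D> where D: "countable \<D>" "\<And>X. X \<in> \<D> \<Longrightarrow> X \<subseteq> S \<and> (\<exists>a b. X = cbox a b)" "\<Union>\<D> = S"
    using open_countable_Union_open_cbox[OF S] by (metis Pow_iff subsetD)
  have "AE x in lebesgue. \<forall>X\<in>\<D>. x \<in> X \<longrightarrow> g x = 0"
    using D(2) loc by (subst AE_ball_countable[OF D(1)]) metis
  then have "AE x in lebesgue. x \<in> S \<longrightarrow> g x = 0" by eventually_elim (use D(3) in blast)
  then show ?thesis using Sl by (subst AE_restrict_space_iff) auto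
qed

text \<open>Allows the unspecified choice in \<open>weak_grad\<close> to be replaced by an explicit
  gradient under integrals.\<close>

lemma weak_gradient_unique:
  fixes u :: "'a::euclidean_space \<Rightarrow> real"
  assumes S: "open S" and G: "is_weak_gradient S u G" and G': "is_weak_gradient S u G'"
  shows "AE x in lebesgue_on S. G x = G' x"
proof -
  have Sl: "S \<in> sets lebesgue" using S by simp
  have l: "locally_integrable_on (\<lambda>x. G x \<bullet> e) S" "locally_integrable_on (\<lambda>x. G' x \<bullet> e) S" for e
    using G G' unfolding is_weak_gradient_def locally_integrable_on_def by auto
  have "AE x in lebesgue_on S. (G x - G' x) \<bullet> e = 0" if e: "e \<in> Basis" for e
  proof (rule test_orthogonal_imp_AE_zero[OF S])
    show "locally_integrable_on (\<lambda>x. (G x - G' x) \<bullet> e) S"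
      using l[of e] unfolding locally_integrable_on_def inner_diff_left by auto
    fix \<phi> assume \<phi>: "\<phi> \<in> test_functions S"
    have "(\<integral>x. (G x - G' x) \<bullet> e * \<phi> x \<partial>lebesgue_on S) = (\<integral>x. (G x \<bullet> e) * \<phi> x - (G' x \<bullet> e) * \<phi> x \<partial>lebesgue_on S)"
      by (simp add: inner_diff_left left_diff_distrib)
    also have "\<dots> = (\<integral>x. (G x \<bullet> e) * \<phi> x \<partial>lebesgue_on S) - (\<integral>x. (G' x \<bullet> e) * \<phi> x \<partial>lebesgue_on S)"
      by (intro Bochner_Integration.integral_diff integrable_mult_test l \<phi> Sl)
    also have "\<dots> = 0"
    proof -
      have "(\<integral>x. u x * (grad \<phi> x \<bullet> e) \<partial>lebesgue_on S) = - (\<integral>x. (G x \<bullet> e) * \<phi> x \<partial>lebesgue_on S)"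
        using G \<phi> e unfolding is_weak_gradient_def by blast
      moreover have "(\<integral>x. u x * (grad \<phi> x \<bullet> e) \<partial>lebesgue_on S) = - (\<integral>x. (G' x \<bullet> e) * \<phi> x \<partial>lebesgue_on S)"
        using G' \<phi> e unfolding is_weak_gradient_def by blast
      ultimately show ?thesis by linarith
    qed
    finally show "(\<integral>x. (G x - G' x) \<bullet> e * \<phi> x \<partial>lebesgue_on S) = 0" .
  qed
  from AE_finite_allI[OF finite_Basis this]
  have "AE x in lebesgue_on S. \<forall>e\<in>Basis. (G x - G' x) \<bullet> e = 0" .
  then show ?thesis
  proof eventually_elim
    case (elim x)
    then have "G x - G' x = 0" by (simp only: euclidean_all_zero_iff)
    then show ?case by simp
  qed
qed

subsection \<open>Conformally invariant profiles\<close>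

text \<open>The centre \<open>a\<close> lies on the boundary hyperplane and \<open>B\<close> omits
  the normal direction \<open>en\<close>, so \<open>D\<close> and \<open>Q\<close> are even in the
  normal coordinate.\<close>

locale profile =
  fixes a en :: "'a::euclidean_space" and B :: "'a set"
  assumes en: "en \<in> Basis" and a_en: "a \<bullet> en = 0" and B: "B \<subseteq> Basis" "en \<notin> B" "card B = 3"
    and dim: "DIM('a) \<ge> 5"
begin

definition n :: real where "n = real DIM('a)"
definition N :: real where "N = (n - 2) / 2"
definition H :: "'a set" where "H = {x. x \<bullet> en > 0}"
definition D :: "'a \<Rightarrow> real" where "D x = 1 + (norm (x - a))\<^sup>2"
definition Q :: "'a \<Rightarrow> real" where "Q x = (\<Sum>b\<in>B. ((x - a) \<bullet> b)\<^sup>2)"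
definition \<sigma> :: "'a \<Rightarrow> real" where "\<sigma> x = 4 * Q x / (D x)\<^sup>2"
definition \<iota> :: "'a \<Rightarrow> real" where "\<iota> e = (if e \<in> B then 1 else 0)"
definition T :: "'a \<Rightarrow> 'a" where "T x = (\<Sum>b\<in>B. ((x - a) \<bullet> b) *\<^sub>R b)"
definition gs :: "'a \<Rightarrow> 'a" where "gs x = (8 / (D x)\<^sup>2) *\<^sub>R T x - (16 * Q x / (D x)^3) *\<^sub>R (x - a)"
definition U :: "(real \<Rightarrow> real) \<Rightarrow> 'a \<Rightarrow> real" where "U f x = D x powr (- N) * f (\<sigma> x)"
definition Gr :: "(real \<Rightarrow> real) \<Rightarrow> (real \<Rightarrow> real) \<Rightarrow> 'a \<Rightarrow> 'a" where
  "Gr f f1 x = (D x powr (- N) * f1 (\<sigma> x)) *\<^sub>R gs x - (2 * N * D x powr (- N - 1) * f (\<sigma> x)) *\<^sub>R (x - a)"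
text \<open>The decay rate of the gradient of \<open>D x powr (- N)\<close>, since
  \<open>norm (x - a)\<close> is at most the square root of \<open>D x\<close>. It also dominates
  the Laplacian and is the common majorant of all limits below.\<close>

definition w0 :: "'a \<Rightarrow> real" where "w0 x = D x powr (- N - 1/2)"
definition L :: "(real \<Rightarrow> real) \<Rightarrow> (real \<Rightarrow> real) \<Rightarrow> (real \<Rightarrow> real) \<Rightarrow> real \<Rightarrow> real" where
  "L f f1 f2 s = 4 * (s * (1 - s) * f2 s) + (6 - 2 * (n + 1) * s) * f1 s - n * (n - 2) / 4 * f s"
text \<open>The Laplacian of \<open>U f\<close>. The form, a power of the conformal factor times an
  ordinary differential operator at \<open>\<sigma> x\<close>, is the conformal covariance of the
  Laplacian; it is verified in \<open>sum_S\<close>.\<close>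

definition Lap :: "(real \<Rightarrow> real) \<Rightarrow> (real \<Rightarrow> real) \<Rightarrow> (real \<Rightarrow> real) \<Rightarrow> 'a \<Rightarrow> real" where
  "Lap f f1 f2 x = 4 * D x powr (- N - 2) * L f f1 f2 (\<sigma> x)"

lemma finB: "finite B" using B finite_Basis finite_subset by blast

lemma n5: "n \<ge> 5" using dim by (simp add: n_def)

lemma N_pos: "N \<ge> 3/2" using n5 by (simp add: N_def)

lemma D_ge_1: "D x \<ge> 1" by (simp add: D_def)

lemma D_pos: "D x > 0" using D_ge_1[of x] by linarith

lemma norm_sq: "(norm (x - a))\<^sup>2 = D x - 1" by (simp add: D_def)

lemma sum_sq: "(\<Sum>e\<in>Basis. ((x - a) \<bullet> e)\<^sup>2) = D x - 1"
  unfolding norm_sq[symmetric] power2_norm_eq_inner euclidean_inner[of "x - a" "x - a"] by (simp add: power2_eq_square)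

lemma T_inner: "e \<in> Basis \<Longrightarrow> T x \<bullet> e = \<iota> e * ((x - a) \<bullet> e)"
proof -
  assume e: "e \<in> Basis"
  have "T x \<bullet> e = (\<Sum>b\<in>B. if b = e then (x - a) \<bullet> e else 0)"
    unfolding T_def inner_sum_left using e B by (intro sum.cong) (auto simp: inner_Basis)
  then show ?thesis using finB by (simp add: \<iota>_def sum.delta)
qed

lemma Q_sum: "Q x = (\<Sum>e\<in>Basis. \<iota> e * ((x - a) \<bullet> e)\<^sup>2)"
proof -
  have "(\<Sum>e\<in>Basis. \<iota> e * ((x - a) \<bullet> e)\<^sup>2) = (\<Sum>e\<in>B. \<iota> e * ((x - a) \<bullet> e)\<^sup>2)"
    using B by (intro sum.mono_neutral_right) (auto simp: \<iota>_def)
  then show ?thesis by (simp add: Q_def \<iota>_def)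
qed

lemma chi_sum: "(\<Sum>e\<in>Basis. \<iota> e) = 3"
proof -
  have "(\<Sum>e\<in>Basis. \<iota> e) = (\<Sum>e\<in>B. \<iota> e)"
    using B by (intro sum.mono_neutral_right) (auto simp: \<iota>_def)
  then show ?thesis using B by (simp add: \<iota>_def)
qed

lemma Q_nonneg: "Q x \<ge> 0" unfolding Q_def by (intro sum_nonneg) auto

lemma Q_le: "Q x \<le> D x - 1 - (x \<bullet> en)\<^sup>2"
proof -
  have "Q x + ((x - a) \<bullet> en)\<^sup>2 = (\<Sum>e\<in>insert en B. ((x - a) \<bullet> e)\<^sup>2)"
    unfolding Q_def using finB B by simp
  also have "\<dots> \<le> (\<Sum>e\<in>Basis. ((x - a) \<bullet> e)\<^sup>2)"
    using B en by (intro sum_mono2) auto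
  finally show ?thesis unfolding sum_sq by (simp add: inner_diff_left a_en)
qed

lemma Q_le': "4 * Q x \<le> 4 * (D x - 1)" "x \<in> H \<Longrightarrow> 4 * Q x < 4 * (D x - 1)"
proof -
  have "Q x \<le> D x - 1" by (rule order_trans[OF Q_le]) simp
  then show "4 * Q x \<le> 4 * (D x - 1)" by simp
  assume "x \<in> H"
  then have "D x - 1 - (x \<bullet> en)\<^sup>2 < D x - 1" by (simp add: H_def)
  then have "Q x < D x - 1" by (rule order_le_less_trans[OF Q_le])
  then show "4 * Q x < 4 * (D x - 1)" by simp
qed

lemma sigma_nonneg: "\<sigma> x \<ge> 0" unfolding \<sigma>_def using Q_nonneg by simp

lemma sigma_le: "\<sigma> x \<le> 1"
proof -
  have "(D x)\<^sup>2 - 4 * (D x - 1) = (D x - 2)\<^sup>2" by (simp add: power2_eq_square algebra_simps)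
  moreover have "(D x - 2)\<^sup>2 \<ge> 0" by simp
  moreover note Q_le'(1)[of x]
  ultimately have "4 * Q x \<le> (D x)\<^sup>2" by linarith
  then show ?thesis unfolding \<sigma>_def using D_pos[of x] by (simp add: divide_le_eq)
qed

lemma sigma_less: "x \<in> H \<Longrightarrow> \<sigma> x < 1"
proof -
  assume x: "x \<in> H"
  have "(D x)\<^sup>2 - 4 * (D x - 1) = (D x - 2)\<^sup>2" by (simp add: power2_eq_square algebra_simps)
  moreover have "(D x - 2)\<^sup>2 \<ge> 0" by simp
  moreover note Q_le'(2)[OF x]
  ultimately have "4 * Q x < (D x)\<^sup>2" by linarith
  then show ?thesis unfolding \<sigma>_def using D_pos[of x] by (simp add: divide_less_eq)
qed

lemma has_derivative_D: "(D has_derivative (\<lambda>h. 2 * ((x - a) \<bullet> h))) (at x)"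
  unfolding D_def[abs_def] power2_norm_eq_inner
  by (auto intro!: derivative_eq_intros simp: inner_commute)

lemma has_derivative_Q: "(Q has_derivative (\<lambda>h. 2 * (T x \<bullet> h))) (at x)"
  unfolding Q_def[abs_def] T_def inner_sum_left sum_distrib_left power2_eq_square
  by (auto intro!: derivative_eq_intros sum.cong simp: inner_commute algebra_simps)

lemma has_derivative_sigma: "(\<sigma> has_derivative (\<lambda>h. gs x \<bullet> h)) (at x)"
proof -
  have "(\<sigma> has_derivative (\<lambda>h. (4 * (2 * (T x \<bullet> h)) * (D x)\<^sup>2 - 4 * Q x * (2 * (2 * ((x - a) \<bullet> h)) * D x)) / ((D x)\<^sup>2 * (D x)\<^sup>2))) (at x)"
    unfolding \<sigma>_def[abs_def] using D_pos[of x]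
    by (auto intro!: derivative_eq_intros has_derivative_D has_derivative_Q simp: fun_eq_iff divide_simps)
  moreover have "(\<lambda>h. (4 * (2 * (T x \<bullet> h)) * (D x)\<^sup>2 - 4 * Q x * (2 * (2 * ((x - a) \<bullet> h)) * D x)) / ((D x)\<^sup>2 * (D x)\<^sup>2)) = (\<lambda>h. gs x \<bullet> h)"
  proof
    fix h
    have "(4 * (2 * t) * d\<^sup>2 - 4 * q * (2 * (2 * r) * d)) / (d\<^sup>2 * d\<^sup>2) = (8 / d\<^sup>2) * t - (16 * q / d^3) * r"
      if "d > 0" for d q r t :: real
      using that by (simp add: field_simps eval_nat_numeral)
    from this[OF D_pos[of x]]
    show "(4 * (2 * (T x \<bullet> h)) * (D x)\<^sup>2 - 4 * Q x * (2 * (2 * ((x - a) \<bullet> h)) * D x)) / ((D x)\<^sup>2 * (D x)\<^sup>2) = gs x \<bullet> h"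
      unfolding gs_def inner_diff_left[of "(8 / (D x)\<^sup>2) *\<^sub>R T x"] inner_scaleR_left .
  qed
  ultimately show ?thesis by simp
qed

lemma has_derivative_D_powr: "((\<lambda>x. D x powr s) has_derivative (\<lambda>h. s * D x powr (s - 1) * (2 * ((x - a) \<bullet> h)))) (at x)"
proof -
  have "((\<lambda>y. y powr s) has_derivative (\<lambda>h. s * D x powr (s - 1) * h)) (at (D x))"
    using has_real_derivative_powr[OF D_pos] by (simp add: has_field_derivative_def)
  from has_derivative_compose[OF has_derivative_D this] show ?thesis .
qed

lemma has_derivative_comp_sigma:
  assumes "(f has_real_derivative f1) (at (\<sigma> x))"
  shows "((\<lambda>x. f (\<sigma> x)) has_derivative (\<lambda>h. f1 * (gs x \<bullet> h))) (at x)"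
  using has_derivative_compose[OF has_derivative_sigma] assms unfolding has_field_derivative_def by blast

lemma has_derivative_U:
  assumes "(f has_real_derivative f1 (\<sigma> x)) (at (\<sigma> x))"
  shows "(U f has_derivative (\<lambda>h. Gr f f1 x \<bullet> h)) (at x)"
proof -
  have "(U f has_derivative (\<lambda>h. D x powr (- N) * (f1 (\<sigma> x) * (gs x \<bullet> h)) + (- N * D x powr (- N - 1) * (2 * ((x - a) \<bullet> h))) * f (\<sigma> x))) (at x)"
    unfolding U_def[abs_def] by (rule has_derivative_mult[OF has_derivative_D_powr has_derivative_comp_sigma[OF assms]])
  then show ?thesis by (simp add: Gr_def inner_diff_left algebra_simps)
qed

text \<open>Along a basis vector the gradients of \<open>\<sigma>\<close> and of \<open>U f\<close>
  contain the factor \<open>(x - a) \<bullet> e\<close>; \<open>k\<close> and \<open>we\<close> are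
  the cofactors. For \<open>e = en\<close> the factor is \<open>x \<bullet> en\<close>, which is the
  source of the Neumann condition.\<close>

definition k :: "'a \<Rightarrow> 'a \<Rightarrow> real" where "k e x = 8 * \<iota> e / (D x)\<^sup>2 - 16 * Q x / (D x)^3"

definition we :: "(real \<Rightarrow> real) \<Rightarrow> (real \<Rightarrow> real) \<Rightarrow> 'a \<Rightarrow> 'a \<Rightarrow> real" where
  "we f f1 e x = D x powr (- N) * f1 (\<sigma> x) * k e x - 2 * N * (D x powr (- N - 1) * f (\<sigma> x))"

lemma gs_inner: "e \<in> Basis \<Longrightarrow> gs x \<bullet> e = ((x - a) \<bullet> e) * k e x"
  unfolding gs_def inner_diff_left[of _ _ e] inner_scaleR_left T_inner k_def
  by (simp add: left_diff_distrib right_diff_distrib diff_divide_distrib mult_ac inner_diff_left)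

lemma Gr_inner: "e \<in> Basis \<Longrightarrow> Gr f f1 x \<bullet> e = ((x - a) \<bullet> e) * we f f1 e x"
  unfolding Gr_def we_def inner_diff_left[of "_ *\<^sub>R _" _ e] inner_scaleR_left gs_inner
  by (simp add: right_diff_distrib mult_ac)

lemma second_partial:
  assumes f: "(f has_real_derivative f1 (\<sigma> x)) (at (\<sigma> x))" and f1: "(f1 has_real_derivative f2 (\<sigma> x)) (at (\<sigma> x))"
    and e: "e \<in> Basis"
  obtains F where "((\<lambda>x. Gr f f1 x \<bullet> e) has_derivative F) (at x)"
    "F e = we f f1 e x + ((x - a) \<bullet> e)\<^sup>2 * (D x powr (- N) *
       (- 4 * N / D x * f1 (\<sigma> x) * k e x + f2 (\<sigma> x) * (k e x)\<^sup>2
        + f1 (\<sigma> x) * (- 64 * \<iota> e / (D x)^3 + 96 * Q x / (D x)^4) + 4 * N * (N + 1) / (D x)\<^sup>2 * f (\<sigma> x)))"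
proof -
  define r where "r = (x - a) \<bullet> e"
  have Dp: "D x > 0" by (rule D_pos)
  have d2: "((\<lambda>x. k e x) has_derivative (\<lambda>h. 8 * \<iota> e * (-2 * D x powr (-2 - 1) * (2 * ((x - a) \<bullet> h)))
      - 16 * (Q x * (-3 * D x powr (-3 - 1) * (2 * ((x - a) \<bullet> h))) + 2 * (T x \<bullet> h) * D x powr (-3)))) (at x)"
  proof -
    have eq: "k e y = 8 * \<iota> e * D y powr (-2) - 16 * (Q y * D y powr (-3))" for y
      using D_pos[of y] by (simp add: k_def powr_minus_divide powr_realpow[symmetric] flip: powr_numeral)
    show ?thesis unfolding eq
      by (intro has_derivative_diff has_derivative_mult_right has_derivative_mult has_derivative_D_powr has_derivative_Q)
  qed
  have d1: "((\<lambda>x. (x - a) \<bullet> e) has_derivative (\<lambda>h. h \<bullet> e)) (at x)"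
    by (auto intro!: derivative_eq_intros)
  have dE: "((\<lambda>x. D x powr (- N)) has_derivative (\<lambda>h. - N * D x powr (- N - 1) * (2 * ((x - a) \<bullet> h)))) (at x)"
    and dE1: "((\<lambda>x. D x powr (- N - 1)) has_derivative (\<lambda>h. (- N - 1) * D x powr (- N - 1 - 1) * (2 * ((x - a) \<bullet> h)))) (at x)"
    by (rule has_derivative_D_powr)+
  note df = has_derivative_comp_sigma[OF f] and df1 = has_derivative_comp_sigma[OF f1]
  define F1 where "F1 = (\<lambda>h. D x powr (- N) * f1 (\<sigma> x) * (8 * \<iota> e * (-2 * D x powr (-2 - 1) * (2 * ((x - a) \<bullet> h)))
      - 16 * (Q x * (-3 * D x powr (-3 - 1) * (2 * ((x - a) \<bullet> h))) + 2 * (T x \<bullet> h) * D x powr (-3)))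
     + (D x powr (- N) * (f2 (\<sigma> x) * (gs x \<bullet> h)) + - N * D x powr (- N - 1) * (2 * ((x - a) \<bullet> h)) * f1 (\<sigma> x)) * k e x
     - 2 * N * (D x powr (- N - 1) * (f1 (\<sigma> x) * (gs x \<bullet> h)) + (- N - 1) * D x powr (- N - 1 - 1) * (2 * ((x - a) \<bullet> h)) * f (\<sigma> x)))"
  have dw: "((\<lambda>x. we f f1 e x) has_derivative F1) (at x)"
    unfolding we_def[abs_def] F1_def
    by (rule has_derivative_diff[OF has_derivative_mult[OF has_derivative_mult[OF dE df1] d2]
          has_derivative_mult_right[OF has_derivative_mult[OF dE1 df]]])
  have "((\<lambda>x. Gr f f1 x \<bullet> e) has_derivative (\<lambda>h. (x - a) \<bullet> e * F1 h + h \<bullet> e * we f f1 e x)) (at x)"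
    unfolding Gr_inner[OF e] by (rule has_derivative_mult[OF d1 dw])
  moreover have "(x - a) \<bullet> e * F1 e + e \<bullet> e * we f f1 e x = we f f1 e x + ((x - a) \<bullet> e)\<^sup>2 * (D x powr (- N) *
       (- 4 * N / D x * f1 (\<sigma> x) * k e x + f2 (\<sigma> x) * (k e x)\<^sup>2
        + f1 (\<sigma> x) * (- 64 * \<iota> e / (D x)^3 + 96 * Q x / (D x)^4) + 4 * N * (N + 1) / (D x)\<^sup>2 * f (\<sigma> x)))"
  proof -
    have p1: "D x powr (- N - 1) = D x powr (- N) / D x" unfolding powr_diff using Dp by simp
    have "- N - 1 - 1 = - N - 2" by simp
    then have "D x powr (- N - 1 - 1) = D x powr (- N) / D x powr 2" by (simp only: powr_diff)
    then have p: "D x powr (- N - 1) = D x powr (- N) / D x" "D x powr (- N - 1 - 1) = D x powr (- N) / (D x)\<^sup>2"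
      using Dp p1 by simp_all
    have p2: "D x powr (-2 - 1) = 1 / (D x)^3" "D x powr (-3 - 1) = 1 / (D x)^4" "D x powr (-3) = 1 / (D x)^3"
      using Dp by (simp_all add: powr_minus_divide powr_numeral)
    have ee: "e \<bullet> e = 1" using e by simp
    define E where "E = D x powr (- N)"
    define K where "K = k e x"
    have "F1 e = r * (E * (- 4 * N / D x * f1 (\<sigma> x) * K + f2 (\<sigma> x) * K\<^sup>2
        + f1 (\<sigma> x) * (- 64 * \<iota> e / (D x)^3 + 96 * Q x / (D x)^4) + 4 * N * (N + 1) / (D x)\<^sup>2 * f (\<sigma> x)))"
      unfolding F1_def p p2 gs_inner[OF e] T_inner[OF e] r_def[symmetric] E_def[symmetric] K_def[symmetric]
      by (simp add: algebra_simps power2_eq_square add_divide_distrib diff_divide_distrib)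
    then show ?thesis unfolding ee r_def[symmetric] E_def[symmetric] K_def[symmetric]
      by (simp add: power2_eq_square)
  qed
  ultimately show ?thesis using that by blast
qed

text \<open>The left-hand side is the sum over the basis found in \<open>sum_S\<close>, with
  \<open>q\<close> for \<open>Q x\<close> and \<open>d\<close> for \<open>D x\<close>, so that
  \<sigma> is \<open>4 * q / d\<^sup>2\<close>. In terms of \<open>i = 1 / d\<close> both sides are
  polynomials once \<open>d - 1\<close> has been absorbed into a power of \<open>i\<close>.\<close>

lemma laplacian_identity:
  fixes E d q f f1 f2 :: real
  assumes d: "d > 0"
  shows "n * (- 16 * E * f1 * q / d^3 - 2 * N * E / d * f) + 3 * (8 * E * f1 / d\<^sup>2)
     + (d - 1) * (E * (64 * N * f1 * q / d^4 + 256 * f2 * q\<^sup>2 / d^6 + 96 * f1 * q / d^4 + 4 * N * (N + 1) / d\<^sup>2 * f))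
     + q * (E * (- 32 * N * f1 / d^3 + f2 * (64 / d^4 - 256 * q / d^5) - 64 * f1 / d^3))
   = 4 * E / d\<^sup>2 * (4 * (4 * q / d\<^sup>2 * (1 - 4 * q / d\<^sup>2) * f2) + (6 - 2 * (n + 1) * (4 * q / d\<^sup>2)) * f1 - n * (n - 2) / 4 * f)"
proof -
  define i where "i = 1 / d"
  have pw: "1 / d^2 = i^2" "1 / d^3 = i^3" "1 / d^4 = i^4" "1 / d^5 = i^5" "1 / d^6 = i^6" "1 / d = i" for m :: nat
    by (simp_all add: i_def power_one_over)
  have dv: "x / d = x * i" "x / d^2 = x * i^2" "x / d^3 = x * i^3" "x / d^4 = x * i^4" "x / d^5 = x * i^5" "x / d^6 = x * i^6" for x :: real
    using pw by (metis mult.right_neutral times_divide_eq_right)+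
  have d1: "d - 1 = (1 - i) * d" using d by (simp add: i_def algebra_simps)
  have di: "d * i = 1" using d by (simp add: i_def)
  have c: "(d - 1) * i ^ Suc j = (1 - i) * i ^ j" for j
    unfolding d1 using di by (simp add: mult.assoc mult.left_commute)
  have c2: "(d - 1) * i^2 = (1 - i) * i" "(d - 1) * i^4 = (1 - i) * i^3" "(d - 1) * i^6 = (1 - i) * i^5"
    using c[of 1] c[of 3] c[of 5] by (simp_all add: numeral_eq_Suc)
  have nN: "n = 2 * N + 2" by (simp add: N_def field_simps)
  have n4: "n * (n - 2) / 4 = N * (N + 1)" by (simp add: nN algebra_simps)
  have e1: "(d - 1) * (E * (64 * N * f1 * q * i^4 + 256 * f2 * q\<^sup>2 * i^6 + 96 * f1 * q * i^4 + 4 * N * (N + 1) * i^2 * f))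
     = E * (64 * N * f1 * q * ((d - 1) * i^4) + 256 * f2 * q\<^sup>2 * ((d - 1) * i^6) + 96 * f1 * q * ((d - 1) * i^4) + 4 * N * (N + 1) * ((d - 1) * i^2) * f)"
    by (simp add: algebra_simps)
  show ?thesis unfolding n4 dv e1 c2 unfolding nN
    by (simp add: algebra_simps power2_eq_square eval_nat_numeral)
qed

end

context profile
begin

definition S :: "(real \<Rightarrow> real) \<Rightarrow> (real \<Rightarrow> real) \<Rightarrow> (real \<Rightarrow> real) \<Rightarrow> 'a \<Rightarrow> 'a \<Rightarrow> real" where
  "S f f1 f2 e x = we f f1 e x + ((x - a) \<bullet> e)\<^sup>2 * (D x powr (- N) *
       (- 4 * N / D x * f1 (\<sigma> x) * k e x + f2 (\<sigma> x) * (k e x)\<^sup>2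
        + f1 (\<sigma> x) * (- 64 * \<iota> e / (D x)^3 + 96 * Q x / (D x)^4) + 4 * N * (N + 1) / (D x)\<^sup>2 * f (\<sigma> x)))"

lemma D_powr_N1: "D x powr (- N - 1) = D x powr (- N) / D x"
  unfolding powr_diff using D_pos[of x] by simp

lemma D_powr_N2: "D x powr (- N - 2) = D x powr (- N) / (D x)\<^sup>2"
  unfolding powr_diff using D_pos[of x] by simp

text \<open>Each pure second derivative is a combination of 1, \<open>\<iota> e\<close>, the square
  of \<open>(x - a) \<bullet> e\<close>, and the product of the last two, with coefficients
  independent of \<open>e\<close>. Their sums over the basis are \<open>n\<close>, 3,
  \<open>D x - 1\<close> and \<open>Q x\<close>; the number three of coordinates enters
  here.\<close>

lemma sum_S: "(\<Sum>e\<in>Basis. S f f1 f2 e x) = Lap f f1 f2 x"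
proof -
  define d q y0 y1 y2 where "d = D x" and "q = Q x" and "y0 = f (\<sigma> x)" and "y1 = f1 (\<sigma> x)" and "y2 = f2 (\<sigma> x)"
  define E where "E = d powr (- N)"
  have d: "d > 0" unfolding d_def by (rule D_pos)
  define \<alpha> where "\<alpha> = - 16 * E * y1 * q / d^3 - 2 * N * E / d * y0"
  define \<beta> where "\<beta> = 8 * E * y1 / d\<^sup>2"
  define \<gamma> where "\<gamma> = E * (64 * N * y1 * q / d^4 + 256 * y2 * q\<^sup>2 / d^6 + 96 * y1 * q / d^4 + 4 * N * (N + 1) / d\<^sup>2 * y0)"
  define \<delta> where "\<delta> = E * (- 32 * N * y1 / d^3 + y2 * (64 / d^4 - 256 * q / d^5) - 64 * y1 / d^3)"
  have form: "S f f1 f2 e x = \<alpha> + \<beta> * \<iota> e + \<gamma> * ((x - a) \<bullet> e)\<^sup>2 + \<delta> * (\<iota> e * ((x - a) \<bullet> e)\<^sup>2)" for e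
  proof -
    define r where "r = ((x - a) \<bullet> e)\<^sup>2"
    have i: "\<iota> e = 0 \<or> \<iota> e = 1" by (simp add: \<iota>_def)
    show ?thesis
      unfolding S_def we_def k_def D_powr_N1 unfolding d_def[symmetric] unfolding E_def[symmetric] q_def[symmetric] y0_def[symmetric]
        y1_def[symmetric] y2_def[symmetric] r_def[symmetric] \<alpha>_def \<beta>_def \<gamma>_def \<delta>_def
      using i d by (elim disjE) (simp_all add: field_simps eval_nat_numeral)
  qed
  have "(\<Sum>e\<in>Basis. S f f1 f2 e x) = n * \<alpha> + \<beta> * 3 + \<gamma> * (D x - 1) + \<delta> * Q x"
    unfolding form sum.distrib sum_distrib_left[symmetric] chi_sum sum_sq Q_sum[symmetric] by (simp add: n_def)
  also have "\<dots> = Lap f f1 f2 x"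
    using laplacian_identity[OF d, of E y1 q y0 y2]
    unfolding Lap_def L_def D_powr_N2 \<sigma>_def[of x] \<alpha>_def \<beta>_def \<gamma>_def \<delta>_def
    by (simp add: E_def d_def q_def y0_def y1_def y2_def \<sigma>_def mult_ac)
  finally show ?thesis .
qed

lemma smooth_D: "smooth D"
proof -
  have "D = (\<lambda>x. 1 + (\<Sum>e\<in>Basis. (x \<bullet> e - a \<bullet> e)\<^sup>2))"
    using sum_sq by (auto simp: fun_eq_iff inner_diff_left)
  then show ?thesis
    by (simp only:) (intro smooth_add smooth_const smooth_sum smooth_power smooth_diff smooth_inner)
qed

lemma smooth_Q: "smooth Q"
  unfolding Q_def[abs_def] inner_diff_left by (intro smooth_sum smooth_power smooth_diff smooth_inner smooth_const)

lemma smooth_sigma: "smooth \<sigma>"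
proof -
  have "\<sigma> = (\<lambda>x. 4 * Q x * D x powr (-2))"
    using D_pos by (auto simp: fun_eq_iff \<sigma>_def powr_minus_divide less_imp_le)
  then show ?thesis
    by (simp only:) (intro smooth_mult smooth_const smooth_Q smooth_powr smooth_D D_pos)
qed

lemma smooth_poly: "smooth g \<Longrightarrow> smooth (\<lambda>x. poly P (g x))"
  by (induction P) (auto intro: smooth_const smooth_add smooth_mult)

lemma smooth_U: "smooth (U (poly P))"
  unfolding U_def[abs_def] by (intro smooth_mult smooth_powr smooth_D D_pos smooth_poly smooth_sigma)

lemma has_derivative_U_poly: "(U (poly P) has_derivative (\<lambda>h. Gr (poly P) (poly (pderiv P)) x \<bullet> h)) (at x)"
  by (rule has_derivative_U[where f = "poly P" and ?f1.0 = "poly (pderiv P)", OF poly_DERIV])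

lemma smooth_Gr: "e \<in> Basis \<Longrightarrow> smooth (\<lambda>x. Gr (poly P) (poly (pderiv P)) x \<bullet> e)"
  using smooth_partial[OF smooth_U, of e P] frechet_derivative_at[OF has_derivative_U_poly, symmetric] by simp

lemma norm_T: "norm (T x) \<le> norm (x - a)"
proof -
  have "(norm (T x))\<^sup>2 = (\<Sum>e\<in>Basis. (T x \<bullet> e)\<^sup>2)"
    unfolding power2_norm_eq_inner euclidean_inner[of "T x" "T x"] by (simp add: power2_eq_square)
  also have "\<dots> = Q x" unfolding Q_sum by (intro sum.cong) (auto simp: T_inner \<iota>_def)
  also have "\<dots> \<le> (norm (x - a))\<^sup>2" unfolding norm_sq using Q_le'(1)[of x] by simp
  finally show ?thesis by simp
qed

lemma root_D: obtains s where "s \<ge> 1" "D x = s\<^sup>2" "norm (x - a) \<le> s" "w0 x = D x powr (- N) / s"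
proof
  show "sqrt (D x) \<ge> 1" using D_ge_1[of x] by simp
  show "D x = (sqrt (D x))\<^sup>2" using D_pos[of x] by simp
  show "norm (x - a) \<le> sqrt (D x)" by (rule real_le_rsqrt) (simp add: D_def)
  show "w0 x = D x powr (- N) / sqrt (D x)"
    unfolding w0_def powr_diff using D_pos[of x] by (simp add: powr_half_sqrt)
qed

lemma w0_pos: "w0 x > 0" unfolding w0_def using D_pos[of x] by simp

lemma D_powr_le_w0: "s \<ge> N + 1/2 \<Longrightarrow> D x powr (- s) \<le> w0 x"
  unfolding w0_def using D_ge_1[of x] by (intro powr_mono) auto

lemma Q_over: "16 * Q x / (D x)^3 \<le> 16 / (D x)\<^sup>2" "0 \<le> 16 * Q x / (D x)^3"
proof -
  have "Q x \<le> D x" using Q_le'(1)[of x] by simp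
  then have "16 * Q x / (D x)^3 \<le> 16 * D x / (D x)^3" using D_pos[of x] by (intro divide_right_mono) auto
  also have "\<dots> = 16 / (D x)\<^sup>2" using D_pos[of x] by (simp add: power3_eq_cube power2_eq_square)
  finally show "16 * Q x / (D x)^3 \<le> 16 / (D x)\<^sup>2" .
  show "0 \<le> 16 * Q x / (D x)^3" using Q_nonneg[of x] D_pos[of x] by simp
qed

text \<open>The constant 24 is 8 + 16 from the two terms of \<open>gs\<close>. The bound for the
  cofactor \<open>we\<close> at \<open>en\<close> is needed as well, because near the boundary the
  gradient of the cutoff is compensated by the factor \<open>x \<bullet> en\<close>.\<close>

lemma Gr_bound:
  assumes F: "\<bar>f (\<sigma> x)\<bar> \<le> F0" "\<bar>f1 (\<sigma> x)\<bar> \<le> F1"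
  shows "norm (Gr f f1 x) \<le> (24 * F1 + 2 * N * F0) * w0 x" "\<bar>we f f1 en x\<bar> \<le> (24 * F1 + 2 * N * F0) * w0 x"
proof -
  obtain s where s: "s \<ge> 1" "D x = s\<^sup>2" "norm (x - a) \<le> s" "w0 x = D x powr (- N) / s" by (rule root_D)
  define E where "E = D x powr (- N)"
  have E: "E > 0" using D_pos[of x] by (simp add: E_def)
  have F01: "0 \<le> F0" "0 \<le> F1" using F by linarith+
  have N: "N \<ge> 0" using N_pos by simp
  have "1 * 1 \<le> s * s" using s(1) by (intro mult_mono) auto
  then have s2: "s / s\<^sup>2 = 1 / s" "1 / s\<^sup>2 \<le> 1" "1 / s\<^sup>2 \<le> 1 / s" using s(1) by (simp_all add: power2_eq_square divide_simps)
  have s4: "s / (s\<^sup>2)\<^sup>2 \<le> 1 / s" "1 / (s\<^sup>2)\<^sup>2 \<le> 1 / s"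
  proof -
    have "s / (s\<^sup>2)\<^sup>2 = (1 / s) * (1 / s\<^sup>2)" using s(1) by (simp add: power2_eq_square)
    also have "\<dots> \<le> (1 / s) * 1" using s2 s(1) by (intro mult_left_mono) auto
    finally show "s / (s\<^sup>2)\<^sup>2 \<le> 1 / s" by simp
    have "1 / (s\<^sup>2)\<^sup>2 = (1 / s\<^sup>2) * (1 / s\<^sup>2)" by (simp add: power2_eq_square)
    also have "\<dots> \<le> (1 / s) * 1" using s2 s(1) by (intro mult_mono) auto
    finally show "1 / (s\<^sup>2)\<^sup>2 \<le> 1 / s" by simp
  qed
  have "norm (gs x) \<le> 8 / (D x)\<^sup>2 * norm (T x) + (16 * Q x / (D x)^3) * norm (x - a)"
    unfolding gs_def using norm_triangle_ineq4[of "(8 / (D x)\<^sup>2) *\<^sub>R T x" "(16 * Q x / (D x)^3) *\<^sub>R (x - a)"] Q_over(2)[of x] D_pos[of x]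
    by (simp add: abs_of_nonneg less_imp_le Q_nonneg)
  also have "\<dots> \<le> 8 / (D x)\<^sup>2 * s + 16 / (D x)\<^sup>2 * s"
    using norm_T[of x] s(1,3) Q_over[of x] by (intro add_mono mult_mono) auto
  also have "\<dots> = 24 * (s / (s\<^sup>2)\<^sup>2)" using s(2) by simp
  also have "\<dots> \<le> 24 * (1 / s)" using s4 by simp
  finally have gs: "norm (gs x) \<le> 24 / s" by simp
  have "norm (Gr f f1 x) \<le> E * \<bar>f1 (\<sigma> x)\<bar> * norm (gs x) + 2 * N * (E / D x) * \<bar>f (\<sigma> x)\<bar> * norm (x - a)"
    unfolding Gr_def D_powr_N1 E_def[symmetric]
    using norm_triangle_ineq4[of "(E * f1 (\<sigma> x)) *\<^sub>R gs x" "(2 * N * (E / D x) * f (\<sigma> x)) *\<^sub>R (x - a)"] E N D_pos[of x]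
    by (simp add: abs_mult abs_divide)
  also have "\<dots> \<le> E * F1 * (24 / s) + 2 * N * (E / D x) * F0 * s"
    using gs s(1,3) F E N D_pos[of x] F01 by (intro add_mono mult_mono mult_nonneg_nonneg) auto
  also have "2 * N * (E / D x) * F0 * s = 2 * N * E * F0 * (s / s\<^sup>2)" using s(2) by simp
  also have "E * F1 * (24 / s) + 2 * N * E * F0 * (s / s\<^sup>2) = (24 * F1 + 2 * N * F0) * w0 x"
    unfolding s2(1) s(4) E_def[symmetric] using s(1) by (simp add: field_simps)
  finally show "norm (Gr f f1 x) \<le> (24 * F1 + 2 * N * F0) * w0 x" .
  have ken: "k en x = - (16 * Q x / (D x)^3)" using B by (simp add: k_def \<iota>_def)
  have "\<bar>we f f1 en x\<bar> \<le> \<bar>E * f1 (\<sigma> x) * k en x\<bar> + \<bar>2 * N * (E / D x * f (\<sigma> x))\<bar>"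
    unfolding we_def D_powr_N1 E_def[symmetric] by (rule abs_triangle_ineq4)
  also have "\<dots> = E * \<bar>f1 (\<sigma> x)\<bar> * (16 * Q x / (D x)^3) + 2 * N * (E / D x * \<bar>f (\<sigma> x)\<bar>)"
    unfolding ken using E N Q_over(2)[of x] D_pos[of x] by (simp add: abs_mult abs_divide Q_nonneg)
  also have "\<dots> \<le> E * F1 * (16 * (1 / s)) + 2 * N * (E * (1 / s) * F0)"
  proof (intro add_mono mult_mono mult_left_mono)
    have "16 * Q x / (D x)^3 \<le> 16 * (1 / (s\<^sup>2)\<^sup>2)" using Q_over(1)[of x] s(2) by simp
    also have "\<dots> \<le> 16 * (1 / s)" using s4(2) by simp
    finally show "16 * Q x / (D x)^3 \<le> 16 * (1 / s)" .
    have "E / D x = E * (1 / s\<^sup>2)" using s(2) by simp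
    also have "\<dots> \<le> E * (1 / s)" using s2(3) E by (intro mult_left_mono) auto
    finally show "E / D x \<le> E * (1 / s)" .
  qed (use E N F F01 s(1) Q_over(2)[of x] D_pos[of x] in auto)
  also have "\<dots> \<le> E * F1 * (24 * (1 / s)) + 2 * N * (E * (1 / s) * F0)"
    using E F01 s(1) N by (intro add_mono mult_left_mono) (auto intro!: divide_right_mono)
  also have "\<dots> = (24 * F1 + 2 * N * F0) * w0 x"
    unfolding s(4) E_def[symmetric] using s(1) by (simp add: field_simps)
  finally show "\<bar>we f f1 en x\<bar> \<le> (24 * F1 + 2 * N * F0) * w0 x" .
qed

lemma Lap_bound:
  assumes "\<bar>L f f1 f2 (\<sigma> x)\<bar> \<le> Lb"
  shows "\<bar>Lap f f1 f2 x\<bar> \<le> 4 * Lb * w0 x"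
proof -
  have "D x powr (- N - 2) \<le> w0 x" using D_powr_le_w0[of "N + 2" x] by (simp add: algebra_simps)
  then have "D x powr (- N - 2) * \<bar>L f f1 f2 (\<sigma> x)\<bar> \<le> w0 x * Lb"
    using assms w0_pos[of x] by (intro mult_mono) auto
  then show ?thesis unfolding Lap_def by (simp add: abs_mult mult_ac)
qed

section \<open>Integrability on the half-space\<close>

abbreviation "M \<equiv> lebesgue_on H"

lemma H_open: "open H"
  unfolding H_def by (rule open_halfspace_component_gt)

lemma H_sets: "H \<in> sets lebesgue" using H_open by simp

lemma integrable_M_of_lborel:
  fixes f :: "'a \<Rightarrow> real"
  assumes "integrable lborel f"
  shows "integrable M f"
proof -
  have "integrable lebesgue f" using assms borel_measurable_integrable[OF assms] by (simp add: integrable_completion)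
  then have "integrable lebesgue (\<lambda>x. indicator H x *\<^sub>R f x)" by (rule integrable_mult_indicator[OF H_sets])
  then show ?thesis using H_sets by (simp add: integrable_restrict_space)
qed

lemma integrable_D_powr: "2 * s > n \<Longrightarrow> integrable M (\<lambda>x. D x powr (- s))"
  using integrable_M_of_lborel[OF integrable_bracket[of s a]] by (simp add: D_def n_def)

lemma measurable_M: "continuous_on UNIV f \<Longrightarrow> f \<in> borel_measurable M"
  by (rule continuous_imp_measurable_on_sets_lebesgue[OF continuous_on_subset H_sets]) auto

lemma w0_cont: "continuous_on UNIV w0"
  unfolding w0_def[abs_def] by (rule smooth_continuous[OF smooth_powr[OF smooth_D D_pos]])

lemma integrable_w0_sq: "integrable M (\<lambda>x. (w0 x)\<^sup>2)"
proof -
  have eq: "(w0 x)\<^sup>2 = D x powr (- (2 * N + 1))" for x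
  proof -
    have "- N - 1/2 + (- N - 1/2) = - (2 * N + 1)" by simp
    then show ?thesis unfolding w0_def power2_eq_square powr_add[symmetric] by (simp only:)
  qed
  have "n = 2 * N + 2" by (simp add: N_def field_simps)
  then have "integrable M (\<lambda>x. D x powr (- (2 * N + 1)))" using N_pos by (intro integrable_D_powr) simp
  then show ?thesis by (simp only: eq)
qed

text \<open>Young's inequality with the exponent 2n/(n-2) and its conjugate 2n/(n+2). The power of
  \<open>w0\<close> is integrable iff 2(n-1) > n+2, that is n > 4.\<close>

lemma integrable_mult_w0:
  assumes v: "v \<in> Lr (2 * n / (n - 2)) H"
  shows "integrable M (\<lambda>x. \<bar>v x\<bar> * w0 x)"
proof (rule Bochner_Integration.integrable_bound)
  define p where "p = 2 * n / (n - 2)"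
  define p' where "p' = 2 * n / (n + 2)"
  have p: "p > 1" "p' > 1" "1 / p + 1 / p' = 1" using n5 by (simp_all add: p_def p'_def field_simps)
  have vm: "v \<in> borel_measurable M" and vi: "integrable M (\<lambda>x. \<bar>v x\<bar> powr p)"
    using v unfolding Lr_def p_def by auto
  have w: "w0 x powr p' = D x powr (- ((N + 1/2) * p'))" for x
    unfolding w0_def powr_powr by (simp add: algebra_simps)
  have "2 * ((N + 1/2) * p') > n"
  proof -
    have "N + 1/2 = (n - 1) / 2" by (simp add: N_def field_simps)
    then have "2 * ((N + 1/2) * p') = (n - 1) * (2 * n) / (n + 2)" by (simp add: p'_def)
    moreover have "n * (n + 2) < n * (2 * (n - 1))" using n5 by (intro mult_strict_left_mono) auto
    ultimately show ?thesis using n5 by (simp add: less_divide_eq mult_ac)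
  qed
  then have wi: "integrable M (\<lambda>x. w0 x powr p')" unfolding w by (rule integrable_D_powr)
  show "integrable M (\<lambda>x. \<bar>v x\<bar> powr p + w0 x powr p')" using vi wi by (rule Bochner_Integration.integrable_add)
  show "(\<lambda>x. \<bar>v x\<bar> * w0 x) \<in> borel_measurable M"
    by (rule borel_measurable_times[OF borel_measurable_abs[OF vm] measurable_M[OF w0_cont]])
  have "\<bar>v x\<bar> * w0 x \<le> \<bar>v x\<bar> powr p + w0 x powr p'" for x
  proof -
    have "\<bar>v x\<bar> * w0 x \<le> \<bar>v x\<bar> powr p / p + w0 x powr p' / p'"
      using w0_pos[of x] p by (intro Youngs_inequality) auto
    also have "\<dots> \<le> \<bar>v x\<bar> powr p / 1 + w0 x powr p' / 1"
      using p by (intro add_mono divide_left_mono) auto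
    finally show ?thesis by simp
  qed
  then show "AE x in M. norm (\<bar>v x\<bar> * w0 x) \<le> norm (\<bar>v x\<bar> powr p + w0 x powr p')"
    using w0_pos by (intro AE_I2) (simp add: abs_mult less_imp_le)
qed

lemma integrable_norm_w0:
  fixes G :: "'a \<Rightarrow> 'a"
  assumes G: "G \<in> Lr 2 H"
  shows "integrable M (\<lambda>x. norm (G x) * w0 x)"
proof (rule Bochner_Integration.integrable_bound)
  have Gm: "G \<in> borel_measurable M" and Gi: "integrable M (\<lambda>x. norm (G x) powr 2)"
    using G unfolding Lr_def by auto
  show "integrable M (\<lambda>x. norm (G x) powr 2 + (w0 x)\<^sup>2)"
    using Gi integrable_w0_sq by (rule Bochner_Integration.integrable_add)
  show "(\<lambda>x. norm (G x) * w0 x) \<in> borel_measurable M"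
    by (rule borel_measurable_times[OF measurable_compose[OF Gm borel_measurable_norm] measurable_M[OF w0_cont]])
  have "norm (G x) * w0 x \<le> norm (G x) powr 2 + (w0 x)\<^sup>2" for x
  proof -
    have "0 \<le> (norm (G x) - w0 x)\<^sup>2" by simp
    then have "2 * (norm (G x) * w0 x) \<le> (norm (G x))\<^sup>2 + (w0 x)\<^sup>2" by (simp add: power2_diff)
    moreover have "norm (G x) * w0 x \<ge> 0" using w0_pos[of x] by simp
    ultimately show ?thesis by simp
  qed
  then show "AE x in M. norm (norm (G x) * w0 x) \<le> norm (norm (G x) powr 2 + (w0 x)\<^sup>2)"
    using w0_pos by (intro AE_I2) (simp add: abs_mult less_imp_le)
qed

end

text \<open>Integration by translation invariance: the difference quotients of \<open>\<psi>\<close> have integral \<open>0\<close>.\<close>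

lemma integral_partial_eq_0:
  fixes \<psi> :: "'a::euclidean_space \<Rightarrow> real"
  assumes s: "smooth \<psi>" and K: "compact K" "\<And>x. x \<notin> K \<Longrightarrow> \<psi> x = 0" and e: "e \<in> Basis"
  shows "(\<integral>x. frechet_derivative \<psi> (at x) e \<partial>lborel) = 0"
proof -
  define \<psi>' where "\<psi>' x = frechet_derivative \<psi> (at x) e" for x
  have D: "(\<psi> has_derivative frechet_derivative \<psi> (at x)) (at x)" for x by (rule smooth_differentiable[OF s])
  have c: "continuous_on UNIV \<psi>" and c': "continuous_on UNIV \<psi>'"
    unfolding \<psi>'_def[abs_def] by (rule smooth_continuous[OF s], rule smooth_continuous[OF smooth_partial[OF s e]])
  have dl: "((\<lambda>t. \<psi> (x + t *\<^sub>R e)) has_real_derivative \<psi>' (x + t *\<^sub>R e)) (at t)" for x t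
  proof -
    have 1: "((\<lambda>t. x + t *\<^sub>R e) has_derivative (\<lambda>h. h *\<^sub>R e)) (at t)" by (auto intro!: derivative_eq_intros)
    have "((\<lambda>t. \<psi> (x + t *\<^sub>R e)) has_derivative (\<lambda>h. frechet_derivative \<psi> (at (x + t *\<^sub>R e)) (h *\<^sub>R e))) (at t)"
      by (rule has_derivative_compose[OF 1 D])
    moreover have "frechet_derivative \<psi> (at y) (h *\<^sub>R e) = \<psi>' y * h" for y h
      using linear_cmul[OF has_derivative_linear[OF D], of y h e] by (simp add: \<psi>'_def)
    ultimately show ?thesis unfolding has_field_derivative_def by simp
  qed
  have out: "\<psi>' x = 0" if "x \<notin> K" for x
  proof -
    have "open (- K)" using K(1) by (simp add: compact_imp_closed open_Compl)
    moreover have "((\<lambda>x. 0) has_derivative (\<lambda>h. 0)) (at x)" by simp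
    ultimately have "(\<psi> has_derivative (\<lambda>h. 0)) (at x)"
      using has_derivative_transform_within_open[of "\<lambda>x. 0" "\<lambda>h. 0" x UNIV "- K" \<psi>] that K(2) by auto
    then show ?thesis unfolding \<psi>'_def using has_derivative_unique[OF D] by metis
  qed
  have "bounded (\<psi>' ` K)" by (intro compact_imp_bounded compact_continuous_image continuous_on_subset[OF c'] K(1)) simp
  then obtain L where "\<And>x. x \<in> K \<Longrightarrow> \<bar>\<psi>' x\<bar> \<le> L" unfolding bounded_iff real_norm_def by blast
  then have L: "\<bar>\<psi>' x\<bar> \<le> \<bar>L\<bar>" for x using out[of x] by (cases "x \<in> K") force+
  obtain R where R: "\<And>x. x \<in> K \<Longrightarrow> norm x \<le> R" using compact_imp_bounded[OF K(1)] unfolding bounded_iff by blast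
  define f where "f j x = (\<psi> (x + (1 / real (Suc j)) *\<^sub>R e) - \<psi> x) * real (Suc j)" for j x
  have int: "integrable lborel \<psi>"
  proof -
    have "integrable lborel (\<lambda>x. indicator K x *\<^sub>R \<psi> x)"
      using borel_integrable_compact[OF K(1) continuous_on_subset[OF c]] by simp
    moreover have "(\<lambda>x. indicator K x *\<^sub>R \<psi> x) = \<psi>" using K(2) by (auto simp: fun_eq_iff indicator_def)
    ultimately show ?thesis by simp
  qed
  have z: "(\<integral>x. f j x \<partial>lborel) = 0" for j
  proof -
    define c where "c = (1 / real (Suc j)) *\<^sub>R e"
    have d: "lborel = distr lborel borel ((+) c)" by (rule lborel_distr_plus[symmetric])
    have "integrable (distr lborel borel ((+) c)) \<psi>" using int d by simp
    then have i: "integrable lborel (\<lambda>x. \<psi> (c + x))" by (subst (asm) integrable_distr_eq) (use int in auto)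
    have "(\<integral>x. \<psi> x \<partial>lborel) = (\<integral>x. \<psi> x \<partial>distr lborel borel ((+) c))" using d by simp
    also have "\<dots> = (\<integral>x. \<psi> (c + x) \<partial>lborel)" by (rule integral_distr) (use int in auto)
    finally have "(\<integral>x. \<psi> (c + x) - \<psi> x \<partial>lborel) = 0" using i int by simp
    then show ?thesis unfolding f_def c_def[symmetric] by (simp add: add.commute)
  qed
  have "(\<lambda>j. \<integral>x. f j x \<partial>lborel) \<longlonglongrightarrow> (\<integral>x. \<psi>' x \<partial>lborel)"
  proof (rule integral_dominated_convergence)
    show "\<psi>' \<in> borel_measurable lborel" using c' by (simp add: borel_measurable_continuous_onI)
    have "continuous_on UNIV (f j)" for j
      unfolding f_def by (intro continuous_intros continuous_on_compose2[OF c]) auto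
    then show "f j \<in> borel_measurable lborel" for j by (simp add: borel_measurable_continuous_onI)
    show "integrable lborel (\<lambda>x. \<bar>L\<bar> * indicator (cball 0 (R + norm e)) x)"
      by (rule integrable_mult_right[OF integrable_real_indicator[OF _ emeasure_bounded_finite[OF bounded_cball]]]) simp
    show "AE x in lborel. (\<lambda>j. f j x) \<longlonglongrightarrow> \<psi>' x"
    proof (intro AE_I2)
      fix x
      have "((\<lambda>t. (\<psi> (x + t *\<^sub>R e) - \<psi> (x + 0 *\<^sub>R e)) / (t - 0)) \<longlongrightarrow> \<psi>' (x + 0 *\<^sub>R e)) (at 0)"
        using dl[of x 0] unfolding has_field_derivative_iff .
      moreover have "filterlim (\<lambda>j. 1 / real (Suc j)) (at 0) sequentially"
        using LIMSEQ_Suc[OF lim_1_over_n] by (intro filterlim_atI) auto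
      ultimately have "(\<lambda>j. (\<psi> (x + (1 / real (Suc j)) *\<^sub>R e) - \<psi> (x + 0 *\<^sub>R e)) / (1 / real (Suc j) - 0)) \<longlonglongrightarrow> \<psi>' (x + 0 *\<^sub>R e)"
        by (rule filterlim_compose)
      then show "(\<lambda>j. f j x) \<longlonglongrightarrow> \<psi>' x" by (simp add: f_def)
    qed
    show "AE x in lborel. norm (f j x) \<le> \<bar>L\<bar> * indicator (cball 0 (R + norm e)) x" for j
    proof (intro AE_I2)
      fix x
      define h where "h = 1 / real (Suc j)"
      have h: "0 < h" "h \<le> 1" by (auto simp: h_def)
      show "norm (f j x) \<le> \<bar>L\<bar> * indicator (cball 0 (R + norm e)) x"
      proof (cases "x \<in> cball 0 (R + norm e)")
        case True
        obtain t where "\<psi> (x + h *\<^sub>R e) - \<psi> (x + 0 *\<^sub>R e) = (h - 0) * \<psi>' (x + t *\<^sub>R e)"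
          using MVT2[OF h(1), of "\<lambda>t. \<psi> (x + t *\<^sub>R e)" "\<lambda>t. \<psi>' (x + t *\<^sub>R e)"] dl by blast
        then have "f j x = \<psi>' (x + t *\<^sub>R e)" unfolding f_def h_def[symmetric] using h by (simp add: h_def)
        then show ?thesis using L True by simp
      next
        case False
        have "norm (h *\<^sub>R e) \<le> norm e" using h by (simp add: mult_left_le_one_le)
        then have ge: "norm (x + h *\<^sub>R e) \<ge> norm x - norm e" using norm_diff_ineq[of x "h *\<^sub>R e"] by linarith
        have "norm x > R + norm e" using False by simp
        then have "norm (x + h *\<^sub>R e) > R" "norm x > R" using ge norm_ge_zero[of e] by linarith+
        then have "\<psi> (x + h *\<^sub>R e) = 0" "\<psi> x = 0" using K(2) R by force+
        then have "f j x = 0" unfolding f_def h_def[symmetric] by simp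
        then show ?thesis by simp
      qed
    qed
  qed
  then show ?thesis unfolding z \<psi>'_def using LIMSEQ_unique tendsto_const by metis
qed

lemma grad_inner: "e \<in> Basis \<Longrightarrow> grad f x \<bullet> e = frechet_derivative f (at x) e"
  unfolding grad_def by (simp add: inner_sum_left inner_Basis if_distrib cong: if_cong)

lemma partial_mult:
  fixes f g :: "'a::euclidean_space \<Rightarrow> real"
  assumes "(f has_derivative f') (at x)" "(g has_derivative g') (at x)"
  shows "frechet_derivative (\<lambda>x. f x * g x) (at x) e = f x * g' e + f' e * g x"
  using frechet_derivative_at[OF has_derivative_mult[OF assms]] by (metis (no_types, lifting))

section \<open>Integration by parts for polynomial profiles\<close>

context profile
begin

lemma smooth_weak_gradient_identity:
  assumes \<phi>: "\<phi> \<in> test_functions H" and e: "e \<in> Basis"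
  shows "(\<integral>x. U (poly P) x * (grad \<phi> x \<bullet> e) \<partial>M) = - (\<integral>x. (Gr (poly P) (poly (pderiv P)) x \<bullet> e) * \<phi> x \<partial>M)"
proof -
  obtain K Bd where K: "compact K" "K \<subseteq> H" "\<And>x. x \<notin> K \<Longrightarrow> \<phi> x = 0"
  proof (rule test_functions_bounded[OF \<phi>], goal_cases)
    case (1 K B)
    from 1(2-4) show ?case by (rule 1(1))
  qed
  have s\<phi>: "smooth \<phi>" by (rule test_functions_smooth[OF \<phi>])
  define u where "u = U (poly P)"
  define g where "g x = Gr (poly P) (poly (pderiv P)) x \<bullet> e" for x
  have su: "smooth u" unfolding u_def by (rule smooth_U)
  have sg: "smooth g" unfolding g_def[abs_def] by (rule smooth_Gr[OF e])
  have du: "(u has_derivative (\<lambda>h. Gr (poly P) (poly (pderiv P)) x \<bullet> h)) (at x)" for x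
    unfolding u_def by (rule has_derivative_U_poly)
  define d where "d x = frechet_derivative \<phi> (at x) e" for x
  have sd: "smooth d" unfolding d_def[abs_def] by (rule smooth_partial[OF s\<phi> e])
  have dK: "d x = 0" if "x \<notin> K" for x
  proof -
    have "open (- K)" using K(1) by (simp add: compact_imp_closed open_Compl)
    moreover have "((\<lambda>x. 0) has_derivative (\<lambda>h. 0)) (at x)" by simp
    ultimately have "(\<phi> has_derivative (\<lambda>h. 0)) (at x)"
      using has_derivative_transform_within_open[of "\<lambda>x. 0" "\<lambda>h. 0" x UNIV "- K" \<phi>] that K(3) by auto
    then show ?thesis unfolding d_def using has_derivative_unique[OF smooth_differentiable[OF s\<phi>]] by metis
  qed
  have i: "integrable lborel h" if "smooth h" "\<And>x. x \<notin> K \<Longrightarrow> h x = 0" for h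
  proof -
    have "integrable lborel (\<lambda>x. indicator K x *\<^sub>R h x)"
      using borel_integrable_compact[OF K(1) smooth_continuous[OF that(1)]] by simp
    moreover have "(\<lambda>x. indicator K x *\<^sub>R h x) = h" using that(2) by (auto simp: fun_eq_iff indicator_def)
    ultimately show ?thesis by simp
  qed
  have toM: "(\<integral>x. h x \<partial>M) = (\<integral>x. h x \<partial>lborel)" if "smooth h" "\<And>x. x \<notin> K \<Longrightarrow> h x = 0" for h
  proof -
    have "(\<integral>x. h x \<partial>M) = (\<integral>x. indicator H x *\<^sub>R h x \<partial>lebesgue)"
      using H_sets by (intro integral_restrict_space) simp
    also have "(\<lambda>x. indicator H x *\<^sub>R h x) = h" using that(2) K(2) by (auto simp: fun_eq_iff indicator_def)
    also have "(\<integral>x. h x \<partial>lebesgue) = (\<integral>x. h x \<partial>lborel)"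
      by (rule integral_completion) (use smooth_continuous[OF that(1)] in \<open>simp add: borel_measurable_continuous_onI\<close>)
    finally show ?thesis .
  qed
  have eq: "frechet_derivative (\<lambda>x. u x * \<phi> x) (at x) e = u x * d x + g x * \<phi> x" for x
    unfolding d_def g_def by (rule partial_mult[OF du smooth_differentiable[OF s\<phi>]])
  have "(\<integral>x. frechet_derivative (\<lambda>x. u x * \<phi> x) (at x) e \<partial>lborel) = 0"
    by (rule integral_partial_eq_0[OF smooth_mult[OF su s\<phi>] K(1) _ e]) (simp add: K(3))
  then have "(\<integral>x. u x * d x \<partial>lborel) + (\<integral>x. g x * \<phi> x \<partial>lborel) = 0"
    unfolding eq using dK K(3)
    by (subst (asm) Bochner_Integration.integral_add) (auto intro!: i smooth_mult su sd sg s\<phi>)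
  moreover have "(\<integral>x. u x * d x \<partial>M) = (\<integral>x. u x * d x \<partial>lborel)" by (rule toM[OF smooth_mult[OF su sd]]) (simp add: dK)
  moreover have "(\<integral>x. g x * \<phi> x \<partial>M) = (\<integral>x. g x * \<phi> x \<partial>lborel)" by (rule toM[OF smooth_mult[OF sg s\<phi>]]) (simp add: K(3))
  ultimately show ?thesis unfolding grad_inner[OF e] u_def[symmetric] g_def[symmetric] d_def[symmetric] by linarith
qed

lemma poly_bounded_01:
  fixes P :: "real poly"
  obtains F0 where "\<And>s. 0 \<le> s \<Longrightarrow> s \<le> 1 \<Longrightarrow> \<bar>poly P s\<bar> \<le> F0"
proof -
  have "bounded (poly P ` {0..1})" by (intro compact_imp_bounded compact_continuous_image continuous_intros) auto
  then obtain b where "\<forall>s\<in>{0..1}. \<bar>poly P s\<bar> \<le> b" unfolding bounded_iff real_norm_def by auto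
  then show ?thesis by (intro that[of b]) simp
qed

text \<open>The normal component of the gradient vanishes to first order on the boundary, which compensates the
  factor \<open>j\<close> produced by the cutoff \<open>cutoff (j (x \<bullet> en))\<close>.\<close>

lemma integration_by_parts_poly:
  fixes v :: "'a \<Rightarrow> real" and G :: "'a \<Rightarrow> 'a"
  assumes w: "is_weak_gradient H v G" and v: "v \<in> Lr (2 * n / (n - 2)) H" and G: "G \<in> Lr 2 H"
  shows "(\<integral>x. Gr (poly P) (poly (pderiv P)) x \<bullet> G x \<partial>M) =
     - (\<integral>x. v x * Lap (poly P) (poly (pderiv P)) (poly (pderiv (pderiv P))) x \<partial>M)"
proof -
  define gr where "gr = Gr (poly P) (poly (pderiv P))"
  define la where "la = Lap (poly P) (poly (pderiv P)) (poly (pderiv (pderiv P)))"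
  define st where "st = S (poly P) (poly (pderiv P)) (poly (pderiv (pderiv P)))"
  obtain F0 where F0: "\<And>s. 0 \<le> s \<Longrightarrow> s \<le> 1 \<Longrightarrow> \<bar>poly P s\<bar> \<le> F0" by (rule poly_bounded_01[of P]) blast
  obtain F1 where F1: "\<And>s. 0 \<le> s \<Longrightarrow> s \<le> 1 \<Longrightarrow> \<bar>poly (pderiv P) s\<bar> \<le> F1" by (rule poly_bounded_01[of "pderiv P"]) blast
  obtain Lb where Lb: "\<And>s. 0 \<le> s \<Longrightarrow> s \<le> 1 \<Longrightarrow> \<bar>L (poly P) (poly (pderiv P)) (poly (pderiv (pderiv P))) s\<bar> \<le> Lb"
  proof -
    have "bounded ((\<lambda>s. L (poly P) (poly (pderiv P)) (poly (pderiv (pderiv P))) s) ` {0..1})"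
      unfolding L_def by (intro compact_imp_bounded compact_continuous_image continuous_intros) auto
    then obtain b where "\<forall>s\<in>{0..1}. \<bar>L (poly P) (poly (pderiv P)) (poly (pderiv (pderiv P))) s\<bar> \<le> b"
      unfolding bounded_iff real_norm_def by auto
    then show ?thesis by (intro that[of b]) simp
  qed
  define C where "C = 24 * F1 + 2 * N * F0"
  have grb: "norm (gr x) \<le> C * w0 x" and web: "\<bar>we (poly P) (poly (pderiv P)) en x\<bar> \<le> C * w0 x" for x
    unfolding gr_def C_def using Gr_bound[of "poly P" x F0 "poly (pderiv P)" F1] F0 F1 sigma_nonneg[of x] sigma_le[of x] by auto
  have lab: "\<bar>la x\<bar> \<le> 4 * Lb * w0 x" for x
    unfolding la_def by (rule Lap_bound) (use Lb sigma_nonneg sigma_le in auto)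
  obtain Cc where Cc: "Cc > 0" "\<And>x. \<bar>cutoff' x\<bar> \<le> Cc" by (rule cutoff'_bounded) blast
  have C0: "C \<ge> 0" using grb[of a] w0_pos[of a] norm_ge_zero[of "gr a"] by (meson mult_less_0_iff not_le order_less_le_trans order_trans)
  define m :: "nat \<Rightarrow> real" where "m j = real (Suc j)" for j
  have m1: "m j \<ge> 1" for j by (simp add: m_def)
  define \<rho> where "\<rho> j x = (norm (x - a))\<^sup>2 / (m j)\<^sup>2" for j x
  \<comment> \<open>One factor cuts off at distances of order \<open>m j\<close> from
    \<open>a\<close>, the other at distance of order \<open>1 / m j\<close> from the boundary.
    \<open>Y j\<close> is the gradient of \<open>X j\<close>.\<close>
  define X where "X j x = (1 - cutoff (\<rho> j x)) * cutoff (m j * (x \<bullet> en))" for j x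
  define Y where "Y j x = (- (cutoff' (\<rho> j x) * (2 / (m j)\<^sup>2)) * cutoff (m j * (x \<bullet> en))) *\<^sub>R (x - a)
     + ((1 - cutoff (\<rho> j x)) * (cutoff' (m j * (x \<bullet> en)) * m j)) *\<^sub>R en" for j x
  have s\<rho>: "smooth (\<rho> j)" for j
  proof -
    have "\<rho> j = (\<lambda>x. (D x - 1) * (1 / (m j)\<^sup>2))" by (auto simp: \<rho>_def fun_eq_iff norm_sq)
    then show ?thesis by (simp only:) (intro smooth_mult smooth_diff smooth_D smooth_const)
  qed
  have sX: "smooth (X j)" for j
    unfolding X_def[abs_def]
    by (intro smooth_mult smooth_diff smooth_const smooth_compose_real[OF cutoff_smooth] s\<rho> smooth_inner)
  have dX: "(X j has_derivative (\<lambda>h. Y j x \<bullet> h)) (at x)" for j x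
  proof -
    have d\<rho>: "(\<rho> j has_derivative (\<lambda>h. (2 / (m j)\<^sup>2) * ((x - a) \<bullet> h))) (at x)"
    proof -
      have eq: "\<rho> j = (\<lambda>x. (D x - 1) * (1 / (m j)\<^sup>2))" by (auto simp: \<rho>_def fun_eq_iff norm_sq)
      show ?thesis unfolding eq
        by (rule has_derivative_eq_rhs[OF has_derivative_mult_left[OF has_derivative_diff[OF has_derivative_D has_derivative_const]]])
           (simp add: fun_eq_iff)
    qed
    have dt: "((\<lambda>x. m j * (x \<bullet> en)) has_derivative (\<lambda>h. m j * (h \<bullet> en))) (at x)"
      by (auto intro!: derivative_eq_intros)
    have c: "(cutoff has_derivative (\<lambda>h. cutoff' y * h)) (at y)" for y
      using cutoff_deriv unfolding has_field_derivative_def .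
    have 1: "((\<lambda>x. 1 - cutoff (\<rho> j x)) has_derivative (\<lambda>h. 0 - cutoff' (\<rho> j x) * ((2 / (m j)\<^sup>2) * ((x - a) \<bullet> h)))) (at x)"
      by (rule has_derivative_diff[OF has_derivative_const has_derivative_compose[OF d\<rho> c]])
    have "(X j has_derivative (\<lambda>h. (1 - cutoff (\<rho> j x)) * (cutoff' (m j * (x \<bullet> en)) * (m j * (h \<bullet> en)))
        + (0 - cutoff' (\<rho> j x) * ((2 / (m j)\<^sup>2) * ((x - a) \<bullet> h))) * cutoff (m j * (x \<bullet> en)))) (at x)"
      unfolding X_def[abs_def] by (rule has_derivative_mult[OF 1 has_derivative_compose[OF dt c]])
    then show ?thesis
    proof (rule has_derivative_eq_rhs, intro ext)
      fix h
      show "(1 - cutoff (\<rho> j x)) * (cutoff' (m j * (x \<bullet> en)) * (m j * (h \<bullet> en)))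
        + (0 - cutoff' (\<rho> j x) * ((2 / (m j)\<^sup>2) * ((x - a) \<bullet> h))) * cutoff (m j * (x \<bullet> en)) = Y j x \<bullet> h"
        unfolding Y_def inner_add_left inner_scaleR_left inner_commute[of en h] by (simp add: mult_ac)
    qed
  qed
  have X01: "0 \<le> X j x" "X j x \<le> 1" for j x
    unfolding X_def using cutoff_01 by (auto intro!: mult_nonneg_nonneg mult_le_one)
  \<comment> \<open>The weak gradient of \<open>v\<close> is tested in direction \<open>e\<close>
    with the component of the gradient of \<open>U\<close> in that direction, times the cutoff.
    Summing over \<open>e\<close> produces the Laplacian and the error term
    \<open>Y j x \<bullet> gr x\<close>.\<close>
  define \<phi> where "\<phi> j e x = X j x * (gr x \<bullet> e)" for j e x
  have test: "\<phi> j e \<in> test_functions H" if e: "e \<in> Basis" for j e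
  proof -
    have "smooth (\<phi> j e)" unfolding \<phi>_def[abs_def] gr_def by (rule smooth_mult[OF sX smooth_Gr[OF e]])
    moreover define K where "K = cball a (2 * m j) \<inter> {x. x \<bullet> en \<ge> 1 / m j}"
    have "compact K" unfolding K_def
      by (intro compact_Int_closed compact_cball closed_halfspace_component_ge)
    moreover have "K \<subseteq> H"
    proof
      fix x assume "x \<in> K"
      then have "1 / m j \<le> x \<bullet> en" by (simp add: K_def)
      moreover have "0 < 1 / m j" using m1[of j] by simp
      ultimately have "0 < x \<bullet> en" by (rule order_less_le_trans[rotated])
      then show "x \<in> H" unfolding H_def by simp
    qed
    moreover have "\<phi> j e x = 0" if x: "x \<notin> K" for x
    proof (cases "x \<bullet> en \<ge> 1 / m j")
      case True
      then have "2 * m j \<le> norm (x - a)" using x unfolding K_def by (simp add: dist_norm norm_minus_commute)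
      then have "(2 * m j)\<^sup>2 \<le> (norm (x - a))\<^sup>2" using m1[of j] by (intro power_mono) auto
      then have "4 * (m j)\<^sup>2 \<le> (norm (x - a))\<^sup>2" by (simp add: power_mult_distrib)
      moreover have "2 * (m j)\<^sup>2 \<le> 4 * (m j)\<^sup>2" by simp
      ultimately have "2 * (m j)\<^sup>2 \<le> (norm (x - a))\<^sup>2" by (rule order_trans[rotated])
      then have "\<rho> j x \<ge> 2" unfolding \<rho>_def using m1[of j] by (simp add: le_divide_eq)
      then show ?thesis unfolding \<phi>_def X_def using cutoff_1 by simp
    next
      case False
      then have "m j * (x \<bullet> en) \<le> 1" using m1[of j] by (simp add: field_simps)
      then show ?thesis unfolding \<phi>_def X_def using cutoff_0 by simp
    qed
    ultimately show ?thesis unfolding test_functions_def smooth_def by blast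
  qed
  have part: "grad (\<phi> j e) x \<bullet> e = X j x * st e x + (Y j x \<bullet> e) * (gr x \<bullet> e)" if e: "e \<in> Basis" for j e x
  proof -
    obtain Fd where Fd: "((\<lambda>x. Gr (poly P) (poly (pderiv P)) x \<bullet> e) has_derivative Fd) (at x)" "Fd e = st e x"
    proof (rule second_partial[where f = "poly P" and ?f1.0 = "poly (pderiv P)" and ?f2.0 = "poly (pderiv (pderiv P))" and x = x,
          OF poly_DERIV poly_DERIV e], goal_cases)
      case (1 F)
      show ?case by (rule 1(1)[OF 1(2)]) (use 1(3) in \<open>simp add: st_def S_def\<close>)
    qed
    have "frechet_derivative (\<phi> j e) (at x) e = X j x * Fd e + (Y j x \<bullet> e) * (gr x \<bullet> e)"
      unfolding \<phi>_def[abs_def] by (rule partial_mult[OF dX]) (use Fd(1) in \<open>simp add: gr_def\<close>)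
    then show ?thesis unfolding grad_inner[OF e] Fd(2) .
  qed
  have lv: "locally_integrable_on v H" and lG: "locally_integrable_on (\<lambda>x. G x \<bullet> e) H" for e
    using w unfolding is_weak_gradient_def locally_integrable_on_def by auto
  have sum_eq: "(\<integral>x. v x * (X j x * la x + Y j x \<bullet> gr x) \<partial>M) = - (\<integral>x. X j x * (gr x \<bullet> G x) \<partial>M)" for j
  proof -
    have i1: "integrable M (\<lambda>x. v x * (grad (\<phi> j e) x \<bullet> e))" if e: "e \<in> Basis" for e
    proof -
      have "(\<lambda>x. grad (\<phi> j e) x \<bullet> e) \<in> test_functions H"
      proof -
        obtain K where K: "compact K" "K \<subseteq> H" "\<And>x. x \<notin> K \<Longrightarrow> \<phi> j e x = 0"
          using test[OF e, of j] unfolding test_functions_def by auto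
        have "frechet_derivative (\<phi> j e) (at x) e = 0" if "x \<notin> K" for x
        proof -
          have "open (- K)" using K(1) by (simp add: compact_imp_closed open_Compl)
          moreover have "((\<lambda>x. 0) has_derivative (\<lambda>h. 0)) (at x)" by simp
          ultimately have "(\<phi> j e has_derivative (\<lambda>h. 0)) (at x)"
            using has_derivative_transform_within_open[of "\<lambda>x. 0" "\<lambda>h. 0" x UNIV "- K" "\<phi> j e"] that K(3) by auto
          then show ?thesis using frechet_derivative_at by metis
        qed
        moreover have "smooth (\<lambda>x. frechet_derivative (\<phi> j e) (at x) e)"
          by (rule smooth_partial[OF test_functions_smooth[OF test[OF e]] e])
        ultimately show ?thesis unfolding grad_inner[OF e] test_functions_def smooth_def using K(1,2) by blast
      qed
      then show ?thesis by (rule integrable_mult_test[OF lv _ H_sets])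
    qed
    have i2: "integrable M (\<lambda>x. (G x \<bullet> e) * \<phi> j e x)" if e: "e \<in> Basis" for e
      by (rule integrable_mult_test[OF lG test[OF e] H_sets])
    have eq1: "v x * (X j x * la x + Y j x \<bullet> gr x) = (\<Sum>e\<in>Basis. v x * (grad (\<phi> j e) x \<bullet> e))" for x
    proof -
      have "(\<Sum>e\<in>Basis. v x * (grad (\<phi> j e) x \<bullet> e)) = (\<Sum>e\<in>Basis. v x * (X j x * st e x + (Y j x \<bullet> e) * (gr x \<bullet> e)))"
        by (intro sum.cong refl arg_cong2[where f = "(*)"] part)
      also have "\<dots> = v x * (X j x * (\<Sum>e\<in>Basis. st e x) + (\<Sum>e\<in>Basis. (Y j x \<bullet> e) * (gr x \<bullet> e)))"
        by (simp only: sum_distrib_left[symmetric] sum.distrib)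
      finally show ?thesis unfolding st_def sum_S euclidean_inner[symmetric] la_def ..
    qed
    have eq2: "X j x * (gr x \<bullet> G x) = (\<Sum>e\<in>Basis. (G x \<bullet> e) * \<phi> j e x)" for x
      unfolding \<phi>_def euclidean_inner[of "gr x" "G x"] sum_distrib_left by (intro sum.cong) (auto simp: mult_ac)
    have "(\<integral>x. v x * (X j x * la x + Y j x \<bullet> gr x) \<partial>M) = (\<Sum>e\<in>Basis. \<integral>x. v x * (grad (\<phi> j e) x \<bullet> e) \<partial>M)"
      unfolding eq1 by (rule Bochner_Integration.integral_sum) (rule i1)
    also have "\<dots> = (\<Sum>e\<in>Basis. - (\<integral>x. (G x \<bullet> e) * \<phi> j e x \<partial>M))"
      using w test unfolding is_weak_gradient_def by (intro sum.cong) auto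
    also have "\<dots> = - (\<integral>x. X j x * (gr x \<bullet> G x) \<partial>M)"
      unfolding eq2 sum_negf by (subst Bochner_Integration.integral_sum) (auto intro: i2)
    finally show ?thesis .
  qed
  have ev: "\<forall>\<^sub>F j in sequentially. X j x = 1 \<and> Y j x = 0" if x: "x \<in> H" for x
  proof -
    have t: "x \<bullet> en > 0" using x by (simp add: H_def)
    obtain J :: nat where J: "real J > max (norm (x - a) + 1) (3 / (x \<bullet> en))" using reals_Archimedean2 by blast
    have "X j x = 1 \<and> Y j x = 0" if "j \<ge> J" for j
    proof -
      have mj: "m j > norm (x - a) + 1" "m j > 3 / (x \<bullet> en)" using J that by (auto simp: m_def)
      have "(norm (x - a))\<^sup>2 < (m j)\<^sup>2" using mj(1) by (intro power_strict_mono) auto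
      then have r: "\<rho> j x < 1" unfolding \<rho>_def using m1[of j] by (simp add: divide_less_eq)
      have "m j * (x \<bullet> en) > 3" using mj(2) t by (simp add: pos_divide_less_eq)
      then have s: "m j * (x \<bullet> en) > 2" by simp
      have "cutoff (\<rho> j x) = 0" "cutoff' (\<rho> j x) = 0" using r cutoff_0[of "\<rho> j x"] cutoff'_0[of "\<rho> j x"] by auto
      moreover have "cutoff (m j * (x \<bullet> en)) = 1" "cutoff' (m j * (x \<bullet> en)) = 0"
        using s cutoff_1[of "m j * (x \<bullet> en)"] cutoff'_0[of "m j * (x \<bullet> en)"] by auto
      ultimately show ?thesis unfolding X_def Y_def by simp
    qed
    then show ?thesis unfolding eventually_sequentially by blast
  qed
  have Yb: "\<bar>Y j x \<bullet> gr x\<bar> \<le> 6 * Cc * C * w0 x" if x: "x \<in> H" for j x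
  proof -
    have t: "x \<bullet> en > 0" using x by (simp add: H_def)
    \<comment> \<open>The far cutoff varies only where \<open>norm (x - a)\<close> is of order
      \<open>m j\<close>, and its gradient has the factor \<open>1 / (m j)\<^sup>2\<close>; together
      they stay bounded.\<close>
    have A: "\<bar>cutoff' (\<rho> j x)\<bar> * (2 / (m j)\<^sup>2) * norm (x - a) \<le> 4 * Cc"
    proof (cases "\<rho> j x \<le> 2")
      case True
      then have "(norm (x - a))\<^sup>2 \<le> 2 * (m j)\<^sup>2" unfolding \<rho>_def using m1[of j] by (simp add: divide_le_eq)
      also have "\<dots> \<le> (2 * m j)\<^sup>2" by (simp add: power_mult_distrib)
      finally have "norm (x - a) \<le> 2 * m j" by (rule power2_le_imp_le) (use m1[of j] in simp)
      then have "\<bar>cutoff' (\<rho> j x)\<bar> * (2 / (m j)\<^sup>2) * norm (x - a) \<le> Cc * (2 / (m j)\<^sup>2) * (2 * m j)"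
        using Cc by (intro mult_mono) auto
      also have "\<dots> = 4 * Cc / m j" using m1[of j] by (simp add: power2_eq_square)
      also have "\<dots> \<le> 4 * Cc / 1" using m1[of j] Cc(1) by (intro divide_left_mono) auto
      finally show ?thesis by simp
    next
      case False
      then show ?thesis using cutoff'_0[of "\<rho> j x"] Cc(1) by simp
    qed
    have Bb: "\<bar>cutoff' (m j * (x \<bullet> en))\<bar> * m j * (x \<bullet> en) \<le> 2 * Cc"
    proof (cases "m j * (x \<bullet> en) \<le> 2")
      case True
      have "\<bar>cutoff' (m j * (x \<bullet> en))\<bar> * (m j * (x \<bullet> en)) \<le> Cc * 2"
        using Cc True t m1[of j] by (intro mult_mono) auto
      then show ?thesis by (simp add: mult_ac)
    next
      case False
      then show ?thesis using cutoff'_0[of "m j * (x \<bullet> en)"] Cc(1) by simp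
    qed
    have gen: "gr x \<bullet> en = (x \<bullet> en) * we (poly P) (poly (pderiv P)) en x"
      unfolding gr_def Gr_inner[OF en] by (simp add: inner_diff_left a_en)
    have "Y j x \<bullet> gr x = (- (cutoff' (\<rho> j x) * (2 / (m j)\<^sup>2)) * cutoff (m j * (x \<bullet> en))) * ((x - a) \<bullet> gr x)
       + ((1 - cutoff (\<rho> j x)) * (cutoff' (m j * (x \<bullet> en)) * m j)) * (gr x \<bullet> en)"
      unfolding Y_def inner_add_left inner_scaleR_left by (simp add: inner_commute)
    also have "\<bar>\<dots>\<bar> \<le> \<bar>(- (cutoff' (\<rho> j x) * (2 / (m j)\<^sup>2)) * cutoff (m j * (x \<bullet> en))) * ((x - a) \<bullet> gr x)\<bar>
       + \<bar>((1 - cutoff (\<rho> j x)) * (cutoff' (m j * (x \<bullet> en)) * m j)) * (gr x \<bullet> en)\<bar>" by (rule abs_triangle_ineq)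
    also have "\<dots> \<le> 4 * Cc * (C * w0 x) + 2 * Cc * (C * w0 x)"
    proof (rule add_mono)
      have "\<bar>(- (cutoff' (\<rho> j x) * (2 / (m j)\<^sup>2)) * cutoff (m j * (x \<bullet> en))) * ((x - a) \<bullet> gr x)\<bar>
          = (\<bar>cutoff' (\<rho> j x)\<bar> * (2 / (m j)\<^sup>2)) * cutoff (m j * (x \<bullet> en)) * \<bar>(x - a) \<bullet> gr x\<bar>"
        using cutoff_01 by (simp add: abs_mult)
      also have "\<dots> \<le> (\<bar>cutoff' (\<rho> j x)\<bar> * (2 / (m j)\<^sup>2)) * 1 * (norm (x - a) * norm (gr x))"
        using cutoff_01 by (intro mult_mono Cauchy_Schwarz_ineq2) auto
      also have "\<dots> = (\<bar>cutoff' (\<rho> j x)\<bar> * (2 / (m j)\<^sup>2) * norm (x - a)) * norm (gr x)" by simp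
      also have "\<dots> \<le> (4 * Cc) * (C * w0 x)" by (rule mult_mono[OF A grb]) (use Cc(1) in auto)
      finally show "\<bar>(- (cutoff' (\<rho> j x) * (2 / (m j)\<^sup>2)) * cutoff (m j * (x \<bullet> en))) * ((x - a) \<bullet> gr x)\<bar> \<le> 4 * Cc * (C * w0 x)" .
      have "\<bar>((1 - cutoff (\<rho> j x)) * (cutoff' (m j * (x \<bullet> en)) * m j)) * (gr x \<bullet> en)\<bar>
         = (1 - cutoff (\<rho> j x)) * ((\<bar>cutoff' (m j * (x \<bullet> en))\<bar> * m j * (x \<bullet> en)) * \<bar>we (poly P) (poly (pderiv P)) en x\<bar>)"
        unfolding gen using cutoff_01(2)[of "\<rho> j x"] t m1[of j] by (simp add: abs_mult)
      also have "\<dots> \<le> 1 * ((2 * Cc) * (C * w0 x))"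
        by (rule mult_mono[OF _ mult_mono[OF Bb web]]) (use cutoff_01[of "\<rho> j x"] Cc(1) t m1[of j] in auto)
      finally show "\<bar>((1 - cutoff (\<rho> j x)) * (cutoff' (m j * (x \<bullet> en)) * m j)) * (gr x \<bullet> en)\<bar> \<le> 2 * Cc * (C * w0 x)" by simp
    qed
    also have "\<dots> = 6 * Cc * C * w0 x" by simp
    finally show ?thesis by simp
  qed
  have Hsp: "space M = H" by simp
  have vm: "v \<in> borel_measurable M" and Gm: "G \<in> borel_measurable M" using v G unfolding Lr_def by auto
  have grm: "gr \<in> borel_measurable M"
  proof -
    have "(\<lambda>x. gr x \<bullet> e) \<in> borel_measurable M" if "e \<in> Basis" for e
      unfolding gr_def by (rule measurable_M[OF smooth_continuous[OF smooth_Gr[OF that]]])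
    then show ?thesis by (simp add: borel_measurable_euclidean_space[of gr])
  qed
  have lam: "la \<in> borel_measurable M"
  proof -
    have "continuous_on UNIV la"
      unfolding la_def Lap_def L_def
      by (intro continuous_intros smooth_continuous[OF smooth_powr[OF smooth_D D_pos]] smooth_continuous[OF smooth_sigma] continuous_on_poly)
    then show ?thesis by (rule measurable_M)
  qed
  have Xm: "X j \<in> borel_measurable M" for j by (rule measurable_M[OF smooth_continuous[OF sX]])
  have Ym: "(\<lambda>x. Y j x \<bullet> gr x) \<in> borel_measurable M" for j
  proof -
    have "(\<lambda>x. Y j x \<bullet> e) \<in> borel_measurable M" if "e \<in> Basis" for e
    proof -
      have "(\<lambda>x. Y j x \<bullet> e) = (\<lambda>x. frechet_derivative (X j) (at x) e)"
        using frechet_derivative_at[OF dX] by (metis (no_types, lifting))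
      then show ?thesis using measurable_M[OF smooth_continuous[OF smooth_partial[OF sX that]]] by simp
    qed
    then have "Y j \<in> borel_measurable M" by (simp add: borel_measurable_euclidean_space[of "Y j"])
    then show ?thesis using grm by (rule borel_measurable_inner)
  qed
  have "(\<lambda>j. \<integral>x. v x * (X j x * la x + Y j x \<bullet> gr x) \<partial>M) \<longlonglongrightarrow> (\<integral>x. v x * la x \<partial>M)"
  proof (rule integral_dominated_convergence)
    show "(\<lambda>x. v x * la x) \<in> borel_measurable M" by (rule borel_measurable_times[OF vm lam])
    show "(\<lambda>x. v x * (X j x * la x + Y j x \<bullet> gr x)) \<in> borel_measurable M" for j
      by (intro borel_measurable_times[OF vm] borel_measurable_add borel_measurable_times[OF Xm lam] Ym)
    show "integrable M (\<lambda>x. (4 * Lb + 6 * Cc * C) * (\<bar>v x\<bar> * w0 x))"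
      by (rule integrable_mult_right[OF integrable_mult_w0[OF v]])
    show "AE x in M. (\<lambda>j. v x * (X j x * la x + Y j x \<bullet> gr x)) \<longlonglongrightarrow> v x * la x"
    proof (rule AE_I2)
      fix x assume "x \<in> space M"
      then have x: "x \<in> H" by simp
      from ev[OF x] have "\<forall>\<^sub>F j in sequentially. v x * (X j x * la x + Y j x \<bullet> gr x) = v x * la x"
        by eventually_elim simp
      then show "(\<lambda>j. v x * (X j x * la x + Y j x \<bullet> gr x)) \<longlonglongrightarrow> v x * la x" by (rule tendsto_eventually)
    qed
    show "AE x in M. norm (v x * (X j x * la x + Y j x \<bullet> gr x)) \<le> (4 * Lb + 6 * Cc * C) * (\<bar>v x\<bar> * w0 x)" for j
    proof (rule AE_I2)
      fix x assume "x \<in> space M"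
      then have x: "x \<in> H" by simp
      have "\<bar>X j x * la x + Y j x \<bullet> gr x\<bar> \<le> \<bar>X j x * la x\<bar> + \<bar>Y j x \<bullet> gr x\<bar>" by (rule abs_triangle_ineq)
      also have "\<bar>X j x * la x\<bar> \<le> 1 * \<bar>la x\<bar>" unfolding abs_mult using X01[of j x] by (intro mult_right_mono) auto
      also have "1 * \<bar>la x\<bar> + \<bar>Y j x \<bullet> gr x\<bar> \<le> 4 * Lb * w0 x + 6 * Cc * C * w0 x" using lab[of x] Yb[OF x, of j] by simp
      finally have "\<bar>v x\<bar> * \<bar>X j x * la x + Y j x \<bullet> gr x\<bar> \<le> \<bar>v x\<bar> * (4 * Lb * w0 x + 6 * Cc * C * w0 x)"
        by (intro mult_left_mono) auto
      also have "\<bar>v x\<bar> * (4 * Lb * w0 x + 6 * Cc * C * w0 x) = (4 * Lb + 6 * Cc * C) * (\<bar>v x\<bar> * w0 x)"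
        by (simp add: algebra_simps)
      finally show "norm (v x * (X j x * la x + Y j x \<bullet> gr x)) \<le> (4 * Lb + 6 * Cc * C) * (\<bar>v x\<bar> * w0 x)"
        unfolding real_norm_def abs_mult[of "v x"] .
    qed
  qed
  moreover have "(\<lambda>j. \<integral>x. X j x * (gr x \<bullet> G x) \<partial>M) \<longlonglongrightarrow> (\<integral>x. gr x \<bullet> G x \<partial>M)"
  proof (rule integral_dominated_convergence)
    show gGm: "(\<lambda>x. gr x \<bullet> G x) \<in> borel_measurable M" by (rule borel_measurable_inner[OF grm Gm])
    show "(\<lambda>x. X j x * (gr x \<bullet> G x)) \<in> borel_measurable M" for j by (rule borel_measurable_times[OF Xm gGm])
    show "integrable M (\<lambda>x. C * (norm (G x) * w0 x))" by (rule integrable_mult_right[OF integrable_norm_w0[OF G]])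
    show "AE x in M. (\<lambda>j. X j x * (gr x \<bullet> G x)) \<longlonglongrightarrow> gr x \<bullet> G x"
    proof (rule AE_I2)
      fix x assume "x \<in> space M"
      then have x: "x \<in> H" by simp
      from ev[OF x] have "\<forall>\<^sub>F j in sequentially. X j x * (gr x \<bullet> G x) = gr x \<bullet> G x"
        by eventually_elim simp
      then show "(\<lambda>j. X j x * (gr x \<bullet> G x)) \<longlonglongrightarrow> gr x \<bullet> G x" by (rule tendsto_eventually)
    qed
    show "AE x in M. norm (X j x * (gr x \<bullet> G x)) \<le> C * (norm (G x) * w0 x)" for j
    proof (rule AE_I2)
      fix x
      have "norm (X j x * (gr x \<bullet> G x)) \<le> 1 * (norm (gr x) * norm (G x))"
        unfolding norm_mult using X01[of j x] by (intro mult_mono) (auto simp: Cauchy_Schwarz_ineq2)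
      also have "\<dots> \<le> 1 * ((C * w0 x) * norm (G x))" using grb[of x] by (intro mult_left_mono mult_right_mono) auto
      finally show "norm (X j x * (gr x \<bullet> G x)) \<le> C * (norm (G x) * w0 x)" by (simp add: mult_ac)
    qed
  qed
  ultimately have "(\<integral>x. v x * la x \<partial>M) = - (\<integral>x. gr x \<bullet> G x \<partial>M)"
    unfolding sum_eq using LIMSEQ_unique tendsto_minus by blast
  then show ?thesis unfolding gr_def la_def by linarith
qed

end

section \<open>Polynomial approximation of profiles and bounds from the flux\<close>

lemma poly_antiderivative:
  fixes Q :: "real poly"
  obtains R where "pderiv R = Q" "poly R s0 = y"
proof -
  define R0 where "R0 = (\<Sum>i\<le>degree Q. monom (coeff Q i / of_nat (Suc i)) (Suc i))"
  have ps: "pderiv (\<Sum>i\<in>A. h i) = (\<Sum>i\<in>A. pderiv (h i))" if "finite A" for A :: "nat set" and h :: "nat \<Rightarrow> real poly"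
    using that by induction (simp_all add: pderiv_add)
  have "pderiv R0 = (\<Sum>i\<le>degree Q. monom (coeff Q i) i)"
    unfolding R0_def ps[OF finite_atMost] pderiv_monom by (intro sum.cong) (auto simp del: of_nat_Suc)
  then have "pderiv R0 = Q" by (simp add: poly_as_sum_of_monoms)
  then show ?thesis
    by (intro that[of "R0 + [:y - poly R0 s0:]"]) (simp_all add: pderiv_add pderiv_pCons)
qed

lemma poly_approximation:
  fixes h :: "real \<Rightarrow> real"
  assumes "continuous_on {0..1} h" "e > 0"
  obtains Q :: "real poly" where "\<And>s. 0 \<le> s \<Longrightarrow> s \<le> 1 \<Longrightarrow> \<bar>h s - poly Q s\<bar> < e"
proof -
  obtain g where g: "real_polynomial_function g" "\<And>s. s \<in> {0..1} \<Longrightarrow> \<bar>h s - g s\<bar> < e"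
    using Stone_Weierstrass_real_polynomial_function[OF compact_Icc assms] by auto
  from g(1) obtain c m where c: "g = (\<lambda>x. \<Sum>i\<le>m. c i * x ^ i)" unfolding real_polynomial_function_iff_sum by auto
  have "g s = poly (\<Sum>i\<le>m. monom (c i) i) s" for s unfolding c by (simp add: poly_sum poly_monom)
  with g(2) show ?thesis using that[of "\<Sum>i\<le>m. monom (c i) i"] by auto
qed

lemma deviation_bound:
  fixes g :: "real \<Rightarrow> real"
  assumes "\<And>s. 0 \<le> s \<Longrightarrow> s \<le> 1 \<Longrightarrow> (g has_real_derivative g' s) (at s)" "\<And>s. 0 \<le> s \<Longrightarrow> s \<le> 1 \<Longrightarrow> \<bar>g' s\<bar> \<le> e"
    and "g (1/2) = 0" "0 \<le> s" "s \<le> 1"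
  shows "\<bar>g s\<bar> \<le> e"
proof -
  have e: "e \<ge> 0" using assms(2)[of 0] by linarith
  have "norm (g s - g (1/2)) \<le> e * norm (s - 1/2)"
    by (rule field_differentiable_bound[of "{0..1}" g g'])
      (use assms in \<open>auto intro: DERIV_subset\<close>)
  also have "\<dots> \<le> e * 1" using e assms(4,5) by (intro mult_left_mono) auto
  finally show ?thesis using assms(3) by simp
qed

text \<open>The approximants are obtained by contracting the interval slightly towards its centre, which makes
  the second derivative continuous up to the end points, and integrating a Weierstrass approximation twice.\<close>

lemma polynomial_approximants:
  fixes f f1 f2 :: "real \<Rightarrow> real"
  assumes d: "\<And>s. 0 < s \<Longrightarrow> s < 1 \<Longrightarrow> (f has_real_derivative f1 s) (at s)"
      "\<And>s. 0 < s \<Longrightarrow> s < 1 \<Longrightarrow> (f1 has_real_derivative f2 s) (at s)"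
    and c: "continuous_on {0<..<1} f2"
    and bd: "\<And>s. 0 < s \<Longrightarrow> s < 1 \<Longrightarrow> \<bar>f s\<bar> \<le> F" "\<And>s. 0 < s \<Longrightarrow> s < 1 \<Longrightarrow> \<bar>f1 s\<bar> \<le> F"
      "\<And>s. 0 < s \<Longrightarrow> s < 1 \<Longrightarrow> s * (1 - s) * \<bar>f2 s\<bar> \<le> F"
  obtains P :: "nat \<Rightarrow> real poly" where
    "\<And>s. 0 < s \<Longrightarrow> s < 1 \<Longrightarrow> (\<lambda>j. poly (P j) s) \<longlonglongrightarrow> f s"
    "\<And>s. 0 < s \<Longrightarrow> s < 1 \<Longrightarrow> (\<lambda>j. poly (pderiv (P j)) s) \<longlonglongrightarrow> f1 s"
    "\<And>s. 0 < s \<Longrightarrow> s < 1 \<Longrightarrow> (\<lambda>j. poly (pderiv (pderiv (P j))) s) \<longlonglongrightarrow> f2 s"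
    "\<And>j s. 0 \<le> s \<Longrightarrow> s \<le> 1 \<Longrightarrow> \<bar>poly (P j) s\<bar> \<le> F + 1"
    "\<And>j s. 0 \<le> s \<Longrightarrow> s \<le> 1 \<Longrightarrow> \<bar>poly (pderiv (P j)) s\<bar> \<le> F + 1"
    "\<And>j s. 0 \<le> s \<Longrightarrow> s \<le> 1 \<Longrightarrow> s * (1 - s) * \<bar>poly (pderiv (pderiv (P j))) s\<bar> \<le> F + 1"
proof -
  define e where "e j = inverse (real (Suc j))" for j
  define r where "r j = 1 - e j / 2" for j
  define g where "g j s = 1/2 + r j * (s - 1/2)" for j s
  have e: "0 < e j" "e j \<le> 1" for j unfolding e_def by (auto simp: divide_simps)
  have r: "1/2 \<le> r j" "r j < 1" for j using e[of j] by (auto simp: r_def)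
  \<comment> \<open>The contraction increases \<open>s * (1 - s)\<close>, so the weighted bound on
    \<open>f2\<close> is inherited by the contracted function.\<close>
  have g: "0 < g j s" "g j s < 1" "s * (1 - s) \<le> g j s * (1 - g j s)" if s: "0 \<le> s" "s \<le> 1" for j s
  proof -
    have "\<bar>s - 1/2\<bar> \<le> 1/2" using s unfolding abs_le_iff by linarith
    then have "r j * \<bar>s - 1/2\<bar> \<le> r j * (1/2)" using r[of j] by (intro mult_left_mono) auto
    then have "\<bar>r j * (s - 1/2)\<bar> < 1/2" unfolding abs_mult using r[of j] by linarith
    then show "0 < g j s" "g j s < 1" unfolding g_def by linarith+
    have "g j s * (1 - g j s) = 1/4 - (r j)\<^sup>2 * (s - 1/2)\<^sup>2" by (simp add: g_def power2_eq_square field_simps)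
    moreover have "(r j)\<^sup>2 * (s - 1/2)\<^sup>2 \<le> 1 * (s - 1/2)\<^sup>2" using r[of j] by (intro mult_right_mono) (auto simp: power_le_one)
    moreover have "s * (1 - s) = 1/4 - (s - 1/2)\<^sup>2" by (simp add: power2_eq_square field_simps)
    ultimately show "s * (1 - s) \<le> g j s * (1 - g j s)" by linarith
  qed
  have F: "F \<ge> 0" using bd(1)[of "1/2"] by simp
  have ex: "\<exists>P. \<forall>s. 0 \<le> s \<and> s \<le> 1 \<longrightarrow> \<bar>poly P s - f (g j s)\<bar> \<le> e j \<and> \<bar>poly (pderiv P) s - r j * f1 (g j s)\<bar> \<le> e j
      \<and> \<bar>poly (pderiv (pderiv P)) s - (r j)\<^sup>2 * f2 (g j s)\<bar> \<le> e j" for j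
  proof -
    have gc: "continuous_on {0..1} (g j)" unfolding g_def by (intro continuous_intros)
    have "continuous_on {0..1} (\<lambda>s. (r j)\<^sup>2 * f2 (g j s))"
      by (intro continuous_intros continuous_on_compose2[OF c gc]) (use g in auto)
    then obtain Q where Q: "\<And>s. 0 \<le> s \<Longrightarrow> s \<le> 1 \<Longrightarrow> \<bar>(r j)\<^sup>2 * f2 (g j s) - poly Q s\<bar> < e j"
      by (rule poly_approximation[OF _ e(1)[of j]]) blast
    obtain Q1 where Q1: "pderiv Q1 = Q" "poly Q1 (1/2) = r j * f1 (1/2)" by (rule poly_antiderivative)
    obtain P where P: "pderiv P = Q1" "poly P (1/2) = f (1/2)" by (rule poly_antiderivative)
    have g2: "g j (1/2) = 1/2" by (simp add: g_def)
    have dg: "(g j has_real_derivative r j) (at s)" for s unfolding g_def by (auto intro!: derivative_eq_intros)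
    have 1: "\<bar>poly Q1 s - r j * f1 (g j s)\<bar> \<le> e j" if s: "0 \<le> s" "s \<le> 1" for s
    proof (rule deviation_bound[OF _ _ _ s])
      fix s :: real assume s: "0 \<le> s" "s \<le> 1"
      have "((\<lambda>s. f1 (g j s)) has_real_derivative f2 (g j s) * r j) (at s)"
        by (rule DERIV_chain2[OF d(2)[OF g(1,2)[OF s]] dg])
      then have "((\<lambda>s. poly Q1 s - r j * f1 (g j s)) has_real_derivative poly (pderiv Q1) s - r j * (f2 (g j s) * r j)) (at s)"
        by (intro DERIV_diff poly_DERIV DERIV_cmult)
      then show "((\<lambda>s. poly Q1 s - r j * f1 (g j s)) has_real_derivative poly Q s - (r j)\<^sup>2 * f2 (g j s)) (at s)"
        using Q1(1) by (simp add: power2_eq_square mult_ac)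
      show "\<bar>poly Q s - (r j)\<^sup>2 * f2 (g j s)\<bar> \<le> e j" using Q[OF s] by linarith
    qed (simp add: g2 Q1)
    have 2: "\<bar>poly P s - f (g j s)\<bar> \<le> e j" if s: "0 \<le> s" "s \<le> 1" for s
    proof (rule deviation_bound[OF _ 1 _ s])
      fix s :: real assume s: "0 \<le> s" "s \<le> 1"
      have "((\<lambda>s. f (g j s)) has_real_derivative f1 (g j s) * r j) (at s)"
        by (rule DERIV_chain2[OF d(1)[OF g(1,2)[OF s]] dg])
      then have "((\<lambda>s. poly P s - f (g j s)) has_real_derivative poly (pderiv P) s - f1 (g j s) * r j) (at s)"
        by (intro DERIV_diff poly_DERIV)
      then show "((\<lambda>s. poly P s - f (g j s)) has_real_derivative poly Q1 s - r j * f1 (g j s)) (at s)"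
        using P(1) by (simp add: mult_ac)
    qed (simp_all add: g2 P)
    show ?thesis using 1 2 Q P(1) Q1(1) by (intro exI[of _ P]) (auto simp: abs_minus_commute less_imp_le)
  qed
  then obtain P where P: "\<And>j s. 0 \<le> s \<Longrightarrow> s \<le> 1 \<Longrightarrow> \<bar>poly (P j) s - f (g j s)\<bar> \<le> e j"
      "\<And>j s. 0 \<le> s \<Longrightarrow> s \<le> 1 \<Longrightarrow> \<bar>poly (pderiv (P j)) s - r j * f1 (g j s)\<bar> \<le> e j"
      "\<And>j s. 0 \<le> s \<Longrightarrow> s \<le> 1 \<Longrightarrow> \<bar>poly (pderiv (pderiv (P j))) s - (r j)\<^sup>2 * f2 (g j s)\<bar> \<le> e j"
    by metis
  have e0: "e \<longlonglongrightarrow> 0" unfolding e_def by (rule LIMSEQ_inverse_real_of_nat)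
  have r1: "r \<longlonglongrightarrow> 1" unfolding r_def using tendsto_diff[OF tendsto_const[of 1] tendsto_divide[OF e0 tendsto_const[of 2]]] by simp
  have gl: "(\<lambda>j. g j s) \<longlonglongrightarrow> s" for s
    unfolding g_def using tendsto_add[OF tendsto_const[of "1/2"] tendsto_mult[OF r1 tendsto_const[of "s - 1/2"]]] by simp
  have lim: "q \<longlonglongrightarrow> l" if "\<And>j. \<bar>q j - w j\<bar> \<le> e j" "w \<longlonglongrightarrow> l" for q w :: "nat \<Rightarrow> real" and l
  proof -
    have "(\<lambda>j. q j - w j) \<longlonglongrightarrow> 0" by (rule Lim_null_comparison[OF _ e0]) (simp add: that(1))
    from tendsto_add[OF this that(2)] show ?thesis by simp
  qed
  show ?thesis
  proof (rule that[of P])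
    fix s :: real assume s: "0 < s" "s < 1"
    then have s': "0 \<le> s" "s \<le> 1" by auto
    have "isCont f s" "isCont f1 s" using d[OF s] DERIV_isCont by blast+
    moreover have "isCont f2 s" using c s by (simp add: continuous_on_eq_continuous_at)
    ultimately have l: "(\<lambda>j. f (g j s)) \<longlonglongrightarrow> f s" "(\<lambda>j. f1 (g j s)) \<longlonglongrightarrow> f1 s" "(\<lambda>j. f2 (g j s)) \<longlonglongrightarrow> f2 s"
      using isCont_tendsto_compose[OF _ gl] by blast+
    show "(\<lambda>j. poly (P j) s) \<longlonglongrightarrow> f s" by (rule lim[OF P(1)[OF s'] l(1)])
    show "(\<lambda>j. poly (pderiv (P j)) s) \<longlonglongrightarrow> f1 s"
      by (rule lim[OF P(2)[OF s']]) (use tendsto_mult[OF r1 l(2)] in simp)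
    show "(\<lambda>j. poly (pderiv (pderiv (P j))) s) \<longlonglongrightarrow> f2 s"
      by (rule lim[OF P(3)[OF s']]) (use tendsto_mult[OF tendsto_power[OF r1, of 2] l(3)] in simp)
  next
    fix j and s :: real assume s: "0 \<le> s" "s \<le> 1"
    show "\<bar>poly (P j) s\<bar> \<le> F + 1" using P(1)[OF s, of j] bd(1)[OF g(1,2)[OF s], of j] e[of j] by linarith
    have "\<bar>r j * f1 (g j s)\<bar> \<le> 1 * F" unfolding abs_mult using r[of j] bd(2)[OF g(1,2)[OF s], of j] by (intro mult_mono) auto
    then show "\<bar>poly (pderiv (P j)) s\<bar> \<le> F + 1" using P(2)[OF s, of j] e[of j] by linarith
    have "\<bar>poly (pderiv (pderiv (P j))) s\<bar> \<le> 1 * \<bar>f2 (g j s)\<bar> + 1"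
    proof -
      have "\<bar>(r j)\<^sup>2 * f2 (g j s)\<bar> \<le> 1 * \<bar>f2 (g j s)\<bar>" unfolding abs_mult using r[of j] by (intro mult_right_mono) (auto simp: power_le_one)
      then show ?thesis using P(3)[OF s, of j] e[of j] by linarith
    qed
    then have "s * (1 - s) * \<bar>poly (pderiv (pderiv (P j))) s\<bar> \<le> s * (1 - s) * (1 * \<bar>f2 (g j s)\<bar> + 1)"
      using s by (intro mult_left_mono) auto
    also have "\<dots> = s * (1 - s) * \<bar>f2 (g j s)\<bar> + s * (1 - s)" by (simp add: algebra_simps)
    also have "\<dots> \<le> g j s * (1 - g j s) * \<bar>f2 (g j s)\<bar> + 1 * 1"
    proof (rule add_mono)
      show "s * (1 - s) * \<bar>f2 (g j s)\<bar> \<le> g j s * (1 - g j s) * \<bar>f2 (g j s)\<bar>"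
        by (rule mult_right_mono[OF g(3)[OF s]]) simp
      show "s * (1 - s) \<le> 1 * 1" by (rule mult_mono) (use s in auto)
    qed
    also have "\<dots> \<le> F + 1" using bd(3)[OF g(1,2)[OF s], of j] by simp
    finally show "s * (1 - s) * \<bar>poly (pderiv (pderiv (P j))) s\<bar> \<le> F + 1" .
  qed
qed

text \<open>If the flux \<open>M = y\<^sup>\<kappa> f'\<close> did not vanish at \<open>0\<close> to order \<open>\<kappa>\<close>, then \<open>f'\<close> would be at least of
  size \<open>1/y\<close> and \<open>f\<close> unbounded.\<close>

lemma derivative_bounded_of_flux:
  fixes f f1 M M1 :: "real \<Rightarrow> real"
  assumes b: "0 < b" "b \<le> 1" and \<kappa>: "\<kappa> \<ge> 1"
    and f: "\<And>y. 0 < y \<Longrightarrow> y < b \<Longrightarrow> (f has_real_derivative f1 y) (at y)" "\<And>y. 0 < y \<Longrightarrow> y < b \<Longrightarrow> \<bar>f y\<bar> \<le> F0"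
    and M: "\<And>y. 0 < y \<Longrightarrow> y < b \<Longrightarrow> (M has_real_derivative M1 y) (at y)"
      "\<And>y. 0 < y \<Longrightarrow> y < b \<Longrightarrow> \<bar>M1 y\<bar> \<le> C * y powr (\<kappa> - 1)"
    and rel: "\<And>y. 0 < y \<Longrightarrow> y < b \<Longrightarrow> \<bar>M y\<bar> \<le> A * y powr \<kappa> * \<bar>f1 y\<bar>"
      "\<And>y. 0 < y \<Longrightarrow> y < b \<Longrightarrow> y powr \<kappa> * \<bar>f1 y\<bar> \<le> A * \<bar>M y\<bar>"
      "\<And>y. 0 < y \<Longrightarrow> y < b \<Longrightarrow> M y * f1 y \<ge> 0" and A: "A > 0" and C: "C \<ge> 0"
  shows "\<And>y. 0 < y \<Longrightarrow> y < b \<Longrightarrow> \<bar>f1 y\<bar> \<le> A * (2 * C / \<kappa>)"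
proof -
  have Mdiff: "\<bar>M y - M t\<bar> \<le> C / \<kappa> * y powr \<kappa>" if ty: "0 < t" "t \<le> y" "y < b" for t y
  proof -
    have p: "((\<lambda>y. C / \<kappa> * y powr \<kappa>) has_real_derivative C * x powr (\<kappa> - 1)) (at x)" if "0 < x" for x
      using that \<kappa> by (auto intro!: derivative_eq_intros simp: powr_diff)
    have "M y - C / \<kappa> * y powr \<kappa> \<le> M t - C / \<kappa> * t powr \<kappa>"
    proof (rule DERIV_nonpos_imp_nonincreasing[OF ty(2)])
      fix x assume "t \<le> x" "x \<le> y"
      then have x: "0 < x" "x < b" using ty by auto
      then show "\<exists>d. ((\<lambda>y. M y - C / \<kappa> * y powr \<kappa>) has_real_derivative d) (at x) \<and> d \<le> 0"
        using DERIV_diff[OF M(1)[OF x] p[OF x(1)]] M(2)[OF x] by (intro exI conjI) auto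
    qed
    moreover have "M t + C / \<kappa> * t powr \<kappa> \<le> M y + C / \<kappa> * y powr \<kappa>"
    proof (rule DERIV_nonneg_imp_nondecreasing[OF ty(2)])
      fix x assume "t \<le> x" "x \<le> y"
      then have x: "0 < x" "x < b" using ty by auto
      then show "\<exists>d. ((\<lambda>y. M y + C / \<kappa> * y powr \<kappa>) has_real_derivative d) (at x) \<and> d \<ge> 0"
        using DERIV_add[OF M(1)[OF x] p[OF x(1)]] M(2)[OF x] by (intro exI conjI) auto
    qed
    moreover have "0 \<le> C / \<kappa> * t powr \<kappa>" using C \<kappa> by simp
    ultimately show ?thesis by linarith
  qed
  \<comment> \<open>Twice the oscillation bound \<open>C / \<kappa> * y powr \<kappa>\<close>: if it
    fails at \<open>y\<close>, then on the whole interval up to \<open>y\<close> the flux keeps its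
    sign and at least half of its size at \<open>y\<close>.\<close>
  have Mb: "\<bar>M y\<bar> \<le> 2 * C / \<kappa> * y powr \<kappa>" if y: "0 < y" "y < b" for y
  proof (rule ccontr)
    assume "\<not> ?thesis"
    then have big: "2 * C / \<kappa> * y powr \<kappa> < \<bar>M y\<bar>" by simp
    then have My: "\<bar>M y\<bar> > 0" using C \<kappa> by (smt (verit) divide_nonneg_nonneg mult_nonneg_nonneg powr_ge_zero)
    define c where "c = \<bar>M y\<bar> / (2 * A)"
    have c: "c > 0" using My A by (simp add: c_def)
    define sg where "sg = sgn (M y)"
    have sg: "sg = 1 \<or> sg = - 1" "sg * M y = \<bar>M y\<bar>" using My by (auto simp: sg_def sgn_if)
    have low: "sg * f1 t \<ge> c / t" if t: "0 < t" "t \<le> y" for t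
    proof -
      have tb: "t < b" using t y by simp
      have "\<bar>M y - M t\<bar> < \<bar>M y\<bar> / 2" using Mdiff[OF t y(2)] big by simp
      then have sgM: "sg * M t > \<bar>M y\<bar> / 2" using sg by (auto simp: abs_if split: if_splits)
      have "sg * f1 t \<ge> 0"
      proof -
        have e: "(sg * M t) * (sg * f1 t) = M t * f1 t" using sg(1) by auto
        have "(sg * M t) * (sg * f1 t) \<ge> 0" unfolding e by (rule rel(3)[OF t(1) tb])
        then show ?thesis using sgM My by (simp add: zero_le_mult_iff)
      qed
      then have eq: "sg * f1 t = \<bar>f1 t\<bar>" using sg(1) by auto
      have "\<bar>M y\<bar> / 2 \<le> \<bar>M t\<bar>" using sgM sg(1) by auto
      also have "\<dots> \<le> A * t powr \<kappa> * \<bar>f1 t\<bar>" by (rule rel(1)[OF t(1) tb])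
      \<comment> \<open>As \<open>\<kappa> \<ge> 1\<close> and \<open>t \<le> 1\<close>, the power
        is at most \<open>t\<close>; this is where the lower bound \<open>c / t\<close>, not
        integrable at 0, comes from.\<close>
      also have "\<dots> \<le> A * t * \<bar>f1 t\<bar>"
      proof (intro mult_right_mono mult_left_mono)
        have "t powr \<kappa> \<le> t powr 1" using t tb b \<kappa> by (intro powr_mono') auto
        then show "t powr \<kappa> \<le> t" using t by simp
      qed (use A in auto)
      finally have "c \<le> t * \<bar>f1 t\<bar>" unfolding c_def using A by (simp add: divide_le_eq mult_ac)
      then show ?thesis unfolding eq using t by (simp add: divide_le_eq mult.commute)
    qed
    have "c * (ln y - ln t) \<le> 2 * F0" if t: "0 < t" "t \<le> y" for t
    proof -
      have "sg * f t - c * ln t \<le> sg * f y - c * ln y"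
      proof (rule DERIV_nonneg_imp_nondecreasing[OF t(2)])
        fix x assume "t \<le> x" "x \<le> y"
        then have x: "0 < x" "x \<le> y" "x < b" using t y by auto
        have "((\<lambda>x. sg * f x - c * ln x) has_real_derivative sg * f1 x - c / x) (at x)"
          using x by (auto intro!: derivative_eq_intros f(1))
        then show "\<exists>d. ((\<lambda>x. sg * f x - c * ln x) has_real_derivative d) (at x) \<and> d \<ge> 0"
          using low[OF x(1,2)] by (intro exI conjI) auto
      qed
      moreover have "sg * f y \<le> F0" "- (sg * f t) \<le> F0" using f(2)[of y] f(2)[of t] t y sg(1) by auto
      ultimately show ?thesis by (simp add: right_diff_distrib)
    qed
    \<comment> \<open>Chosen so that the logarithmic growth between \<open>t0\<close> and
      \<open>y\<close> equals \<open>2 * \<bar>F0\<bar> + 1\<close>, more than the oscillation of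
      \<open>f\<close> allows.\<close>
    moreover define t0 where "t0 = y * exp (- ((2 * \<bar>F0\<bar> + 1) / c))"
    moreover have "exp (- ((2 * \<bar>F0\<bar> + 1) / c)) \<le> 1" using c by simp
    then have "t0 \<le> y" unfolding t0_def using y(1) by (simp add: mult_le_cancel_left1)
    moreover have "t0 > 0" unfolding t0_def using y(1) by simp
    ultimately have "c * (ln y - ln t0) \<le> 2 * F0" by blast
    also have "ln t0 = ln y - (2 * \<bar>F0\<bar> + 1) / c"
      unfolding t0_def using y(1) by (simp add: ln_mult)
    finally show False using c by simp
  qed
  fix y assume y: "0 < y" "y < b"
  have "y powr \<kappa> * \<bar>f1 y\<bar> \<le> A * \<bar>M y\<bar>" by (rule rel(2)[OF y])
  also have "\<dots> \<le> A * (2 * C / \<kappa> * y powr \<kappa>)" using Mb[OF y] A by (intro mult_left_mono) auto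
  finally have "y powr \<kappa> * \<bar>f1 y\<bar> \<le> y powr \<kappa> * (A * (2 * C / \<kappa>))" by (simp add: mult_ac)
  then show "\<bar>f1 y\<bar> \<le> A * (2 * C / \<kappa>)" using y by (simp only: mult_le_cancel_left_pos powr_gt_zero)
qed

section \<open>From bounded profiles to weak solutions\<close>

lemma test_functions_partial:
  assumes "\<phi> \<in> test_functions S" "e \<in> Basis"
  shows "(\<lambda>x. grad \<phi> x \<bullet> e) \<in> test_functions S"
proof -
  obtain K where K: "compact K" "K \<subseteq> S" "\<And>x. x \<notin> K \<Longrightarrow> \<phi> x = 0"
    using assms(1) unfolding test_functions_def by auto
  have s: "smooth \<phi>" by (rule test_functions_smooth[OF assms(1)])
  have "frechet_derivative \<phi> (at x) e = 0" if "x \<notin> K" for x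
  proof -
    have "open (- K)" using K(1) by (simp add: compact_imp_closed open_Compl)
    moreover have "((\<lambda>x. 0) has_derivative (\<lambda>h. 0)) (at x)" by simp
    ultimately have "(\<phi> has_derivative (\<lambda>h. 0)) (at x)"
      using has_derivative_transform_within_open[of "\<lambda>x. 0" "\<lambda>h. 0" x UNIV "- K" \<phi>] that K(3) by auto
    then show ?thesis using has_derivative_unique[OF smooth_differentiable[OF s]] by metis
  qed
  then show ?thesis
    using K(1,2) smooth_partial[OF s assms(2)] unfolding test_functions_def smooth_def grad_inner[OF assms(2)] by blast
qed

lemma locally_integrable_onI_bounded:
  fixes f :: "'a::euclidean_space \<Rightarrow> 'b::euclidean_space"
  assumes "f \<in> borel_measurable borel" "\<And>x. norm (f x) \<le> C"
  shows "locally_integrable_on f S"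
  unfolding locally_integrable_on_def
proof (intro allI impI)
  fix K :: "'a set"
  assume "compact K \<and> K \<subseteq> S"
  then have K: "compact K" by simp
  have "emeasure lborel K < \<infinity>" by (rule emeasure_compact_finite[OF K])
  then have fin: "emeasure lebesgue K < \<infinity>" using K by (simp add: borel_compact)
  interpret finite_measure "lebesgue_on K"
    by (rule finite_measureI) (use fin K in \<open>simp add: emeasure_restrict_space lmeasurable_compact fmeasurableD\<close>)
  show "integrable (lebesgue_on K) f"
  proof (rule integrable_const_bound)
    show "AE x in lebesgue_on K. norm (f x) \<le> C" by (simp add: assms(2))
    show "f \<in> borel_measurable (lebesgue_on K)"
      using assms(1) by (intro measurable_restrict_space1 measurable_completion) simp
  qed
qed

context profile
begin

lemma H_measurable_borel: "f \<in> borel_measurable borel \<Longrightarrow> f \<in> borel_measurable M"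
  by (intro measurable_restrict_space1 measurable_completion) simp

text \<open>The profile equation is available only in the open interval. The value 0 of
  \<open>\<sigma>\<close> is confined to a hyperplane, and the value 1 is excluded by the positive
  normal coordinate.\<close>

lemma AE_sigma: "AE x in M. 0 < \<sigma> x \<and> \<sigma> x < 1"
proof -
  obtain b where b: "b \<in> B" using B(3) by fastforce
  have "negligible {x. x \<bullet> b = a \<bullet> b}" using b B(1) by (intro negligible_standard_hyperplane) auto
  then have "AE x in lebesgue. x \<notin> {x. x \<bullet> b = a \<bullet> b}" by (intro AE_not_in) (simp add: negligible_iff_null_sets)
  then have "AE x in M. x \<notin> {x. x \<bullet> b = a \<bullet> b}"
    using H_sets by (subst AE_restrict_space_iff) auto
  moreover have "AE x in M. x \<in> H" by (rule AE_I2) simp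
  ultimately show ?thesis
  proof eventually_elim
    case (elim x)
    have "Q x \<noteq> 0"
    proof
      assume "Q x = 0"
      then have "((x - a) \<bullet> b)\<^sup>2 = 0" using b finB unfolding Q_def by (subst (asm) sum_nonneg_eq_0_iff) auto
      then show False using elim(1) by (simp add: inner_diff_left)
    qed
    then have "\<sigma> x \<noteq> 0" unfolding \<sigma>_def using D_pos[of x] by simp
    then show ?case using sigma_nonneg[of x] sigma_less[OF elim(2)] by simp
  qed
qed

end

text \<open>The second derivative may be unbounded at both ends; only its product with
  \<open>s * (1 - s)\<close> is controlled, and this is the combination that occurs in
  \<open>L\<close>. Extending by 0 outside the interval makes all three functions Borel measurable
  on the line.\<close>

locale bounded_profile = profile +
  fixes f f1 f2 :: "real \<Rightarrow> real" and F :: real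
  assumes f_deriv: "\<And>s. 0 < s \<Longrightarrow> s < 1 \<Longrightarrow> (f has_real_derivative f1 s) (at s)"
      "\<And>s. 0 < s \<Longrightarrow> s < 1 \<Longrightarrow> (f1 has_real_derivative f2 s) (at s)"
    and f2_cont: "continuous_on {0<..<1} f2"
    and f_bound: "\<And>s. 0 < s \<Longrightarrow> s < 1 \<Longrightarrow> \<bar>f s\<bar> \<le> F" "\<And>s. 0 < s \<Longrightarrow> s < 1 \<Longrightarrow> \<bar>f1 s\<bar> \<le> F"
      "\<And>s. 0 < s \<Longrightarrow> s < 1 \<Longrightarrow> s * (1 - s) * \<bar>f2 s\<bar> \<le> F"
    and f_0: "\<And>s. s \<notin> {0<..<1} \<Longrightarrow> f s = 0" "\<And>s. s \<notin> {0<..<1} \<Longrightarrow> f1 s = 0" "\<And>s. s \<notin> {0<..<1} \<Longrightarrow> f2 s = 0"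
begin

lemma F_nonneg: "F \<ge> 0" using f_bound(1)[of "1/2"] by simp

lemma f_bound': "\<bar>f s\<bar> \<le> F" "\<bar>f1 s\<bar> \<le> F" "s * (1 - s) * \<bar>f2 s\<bar> \<le> F"
  using f_bound[of s] f_0[of s] F_nonneg by (cases "s \<in> {0<..<1}"; simp)+

lemma f_borel: "f \<in> borel_measurable borel" "f1 \<in> borel_measurable borel" "f2 \<in> borel_measurable borel"
proof -
  have gen: "h \<in> borel_measurable borel" if "continuous_on {0<..<1} h" "\<And>s. s \<notin> {0<..<1} \<Longrightarrow> h s = 0" for h :: "real \<Rightarrow> real"
  proof -
    have "(\<lambda>s. if s \<in> {0<..<1} then h s else 0) \<in> borel_measurable borel"
      by (rule borel_measurable_continuous_on_if) (use that(1) in auto)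
    moreover have "(\<lambda>s. if s \<in> {0<..<1} then h s else 0) = h" using that(2) by auto
    ultimately show ?thesis by simp
  qed
  have "continuous_on {0<..<1} f" "continuous_on {0<..<1} f1"
    using DERIV_isCont[OF f_deriv(1)] DERIV_isCont[OF f_deriv(2)] by (auto intro!: continuous_at_imp_continuous_on)
  then show "f \<in> borel_measurable borel" "f1 \<in> borel_measurable borel" "f2 \<in> borel_measurable borel"
    using gen f2_cont f_0 by auto
qed

lemma sigma_borel: "\<sigma> \<in> borel_measurable borel"
  by (rule borel_measurable_continuous_onI[OF smooth_continuous[OF smooth_sigma]])

lemma D_borel: "D \<in> borel_measurable borel"
  by (rule borel_measurable_continuous_onI[OF smooth_continuous[OF smooth_D]])

lemma f_sigma_borel: "(\<lambda>x. f (\<sigma> x)) \<in> borel_measurable borel" "(\<lambda>x. f1 (\<sigma> x)) \<in> borel_measurable borel"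
    "(\<lambda>x. f2 (\<sigma> x)) \<in> borel_measurable borel"
  using f_borel by (auto intro: measurable_compose[OF sigma_borel])

lemma U_borel: "U f \<in> borel_measurable borel"
  unfolding U_def[abs_def] using f_sigma_borel(1) D_borel by measurable

lemma Lap_borel: "Lap f f1 f2 \<in> borel_measurable borel"
  unfolding Lap_def[abs_def] L_def using f_sigma_borel D_borel sigma_borel by measurable

lemma gs_borel: "gs \<in> borel_measurable borel"
proof -
  have "(\<lambda>x. gs x \<bullet> e) \<in> borel_measurable borel" if "e \<in> Basis" for e
  proof -
    have "Q \<in> borel_measurable borel" by (rule borel_measurable_continuous_onI[OF smooth_continuous[OF smooth_Q]])
    then show ?thesis unfolding gs_inner[OF that] k_def[abs_def] using D_borel by measurable
  qed
  then show ?thesis by (simp add: borel_measurable_euclidean_space[of gs])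
qed

lemma Gr_borel: "Gr f f1 \<in> borel_measurable borel"
  unfolding Gr_def[abs_def] using f_sigma_borel D_borel gs_borel by measurable

lemma L_bound: "\<bar>L h h1 h2 s\<bar> \<le> (4 + (6 + 2 * (n + 1)) + n * (n - 2) / 4) * F'"
  if s: "0 \<le> s" "s \<le> 1" and b: "\<bar>h s\<bar> \<le> F'" "\<bar>h1 s\<bar> \<le> F'" "s * (1 - s) * \<bar>h2 s\<bar> \<le> F'" for h h1 h2 :: "real \<Rightarrow> real" and s F'
proof -
  have "\<bar>s * (1 - s) * h2 s\<bar> \<le> F'" using s b(3) by (simp add: abs_mult)
  then have 1: "\<bar>4 * (s * (1 - s) * h2 s)\<bar> \<le> 4 * F'" by simp
  have "(n + 1) * s \<le> (n + 1) * 1" using n5 s by (intro mult_left_mono) auto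
  moreover have "0 \<le> (n + 1) * s" using n5 s by simp
  moreover have "6 - 2 * (n + 1) * s = 6 - 2 * ((n + 1) * s)" by simp
  ultimately have "\<bar>6 - 2 * (n + 1) * s\<bar> \<le> 6 + 2 * (n + 1)" using n5 unfolding abs_le_iff by linarith
  then have 2: "\<bar>(6 - 2 * (n + 1) * s) * h1 s\<bar> \<le> (6 + 2 * (n + 1)) * F'"
    unfolding abs_mult using b(2) n5 by (intro mult_mono) auto
  have "0 \<le> n * (n - 2) / 4" using n5 by simp
  then have 3: "\<bar>n * (n - 2) / 4 * h s\<bar> \<le> n * (n - 2) / 4 * F'"
    unfolding abs_mult using b(1) by (metis abs_of_nonneg mult_left_mono)
  have "\<bar>L h h1 h2 s\<bar> \<le> \<bar>4 * (s * (1 - s) * h2 s)\<bar> + \<bar>(6 - 2 * (n + 1) * s) * h1 s\<bar> + \<bar>n * (n - 2) / 4 * h s\<bar>"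
    unfolding L_def by (rule order_trans[OF abs_triangle_ineq4 add_right_mono[OF abs_triangle_ineq]])
  then show ?thesis using 1 2 3 unfolding distrib_right by simp
qed

lemma U_bound: "\<bar>U h x\<bar> \<le> D x powr (- N) * C" if "\<bar>h (\<sigma> x)\<bar> \<le> C" for h C
  unfolding U_def abs_mult using that by (auto intro: mult_left_mono)

lemma D_powr_le_1: "D x powr (- N) \<le> 1" "w0 x \<le> 1"
proof -
  have "D x powr s \<le> D x powr 0" if "s \<le> 0" for s using D_ge_1[of x] that by (intro powr_mono) auto
  then have "D x powr s \<le> 1" if "s \<le> 0" for s using that D_pos[of x] by simp
  then show "D x powr (- N) \<le> 1" "w0 x \<le> 1" unfolding w0_def using N_pos by auto
qed

lemma Gr_bound': "norm (Gr h h1 x) \<le> (24 + 2 * N) * C * w0 x" if "\<bar>h (\<sigma> x)\<bar> \<le> C" "\<bar>h1 (\<sigma> x)\<bar> \<le> C" for h h1 C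
  using Gr_bound(1)[where f = h and ?f1.0 = h1, OF that] by (simp add: algebra_simps)

lemma loc_int: "locally_integrable_on (U f) H" "locally_integrable_on (Gr f f1) H"
proof -
  show "locally_integrable_on (U f) H"
  proof (rule locally_integrable_onI_bounded[OF U_borel])
    fix x
    have "\<bar>U f x\<bar> \<le> D x powr (- N) * F" by (rule U_bound[OF f_bound'(1)])
    also have "\<dots> \<le> 1 * F" by (rule mult_right_mono[OF D_powr_le_1(1) F_nonneg])
    finally show "norm (U f x) \<le> F" by simp
  qed
  show "locally_integrable_on (Gr f f1) H"
  proof (rule locally_integrable_onI_bounded[OF Gr_borel])
    fix x
    have "norm (Gr f f1 x) \<le> (24 + 2 * N) * F * w0 x" by (rule Gr_bound'[OF f_bound'(1,2)])
    also have "\<dots> \<le> (24 + 2 * N) * F * 1" using N_pos F_nonneg by (intro mult_left_mono D_powr_le_1(2)) auto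
    finally show "norm (Gr f f1 x) \<le> (24 + 2 * N) * F" by simp
  qed
qed

lemma U_Lr: "U f \<in> Lr (2 * n / (n - 2)) H"
proof -
  have um: "U f \<in> borel_measurable M" by (rule H_measurable_borel[OF U_borel])
  define p where "p = 2 * n / (n - 2)"
  have p: "p > 0" "- N * p = - n" using n5 by (auto simp: p_def N_def field_simps)
  have "integrable M (\<lambda>x. \<bar>U f x\<bar> powr p)"
  proof (rule Bochner_Integration.integrable_bound)
    have "integrable M (\<lambda>x. D x powr (- n))" by (rule integrable_D_powr) (use n5 in simp)
    then show "integrable M (\<lambda>x. F powr p * D x powr (- n))" by (rule integrable_mult_right)
    show "(\<lambda>x. \<bar>U f x\<bar> powr p) \<in> borel_measurable M" using um by measurable
    have "\<bar>U f x\<bar> powr p \<le> F powr p * D x powr (- n)" for x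
    proof -
      have "\<bar>U f x\<bar> powr p \<le> (D x powr (- N) * F) powr p"
        using p by (intro powr_mono2 U_bound f_bound') auto
      also have "\<dots> = D x powr (- N * p) * F powr p" using F_nonneg by (simp add: powr_mult powr_powr)
      finally show ?thesis unfolding p(2) by (simp add: mult_ac)
    qed
    then show "AE x in M. norm (\<bar>U f x\<bar> powr p) \<le> norm (F powr p * D x powr (- n))" by (intro AE_I2) simp
  qed
  then show ?thesis using um unfolding Lr_def p_def by simp
qed

lemma Gr_Lr: "Gr f f1 \<in> Lr 2 H"
proof -
  have gm: "Gr f f1 \<in> borel_measurable M" by (rule H_measurable_borel[OF Gr_borel])
  have "integrable M (\<lambda>x. norm (Gr f f1 x) powr 2)"
  proof (rule Bochner_Integration.integrable_bound)
    show "integrable M (\<lambda>x. ((24 + 2 * N) * F)\<^sup>2 * (w0 x)\<^sup>2)" by (rule integrable_mult_right[OF integrable_w0_sq])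
    show "(\<lambda>x. norm (Gr f f1 x) powr 2) \<in> borel_measurable M" using gm by measurable
    have "norm (Gr f f1 x) powr 2 \<le> ((24 + 2 * N) * F)\<^sup>2 * (w0 x)\<^sup>2" for x
    proof -
      have "(norm (Gr f f1 x))\<^sup>2 \<le> ((24 + 2 * N) * F * w0 x)\<^sup>2" by (intro power_mono Gr_bound' f_bound') auto
      then show ?thesis by (simp add: power_mult_distrib)
    qed
    then show "AE x in M. norm (norm (Gr f f1 x) powr 2) \<le> norm (((24 + 2 * N) * F)\<^sup>2 * (w0 x)\<^sup>2)"
      by (intro AE_I2) simp
  qed
  then show ?thesis using gm unfolding Lr_def by simp
qed

text \<open>The bounds are uniform in \<open>j\<close> and hold everywhere, while convergence holds
  almost everywhere by \<open>AE_sigma\<close>, so every identity for polynomial profiles passes to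
  the limit by dominated convergence.\<close>

lemma approximants:
  obtains P :: "nat \<Rightarrow> real poly" where
    "AE x in M. (\<lambda>j. U (poly (P j)) x) \<longlonglongrightarrow> U f x"
    "AE x in M. (\<lambda>j. Gr (poly (P j)) (poly (pderiv (P j))) x) \<longlonglongrightarrow> Gr f f1 x"
    "AE x in M. (\<lambda>j. Lap (poly (P j)) (poly (pderiv (P j))) (poly (pderiv (pderiv (P j)))) x) \<longlonglongrightarrow> Lap f f1 f2 x"
    "\<And>j x. \<bar>U (poly (P j)) x\<bar> \<le> F + 1"
    "\<And>j x. norm (Gr (poly (P j)) (poly (pderiv (P j))) x) \<le> (24 + 2 * N) * (F + 1) * w0 x"
    "\<And>j x. \<bar>Lap (poly (P j)) (poly (pderiv (P j))) (poly (pderiv (pderiv (P j)))) x\<bar>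
        \<le> 4 * ((4 + (6 + 2 * (n + 1)) + n * (n - 2) / 4) * (F + 1)) * w0 x"
proof (rule polynomial_approximants[OF f_deriv f2_cont f_bound], goal_cases)
  case (11 P)
  note P = 11(2-)
  note s = sigma_nonneg sigma_le
  show ?case
  proof (rule 11(1))
    show "AE x in M. (\<lambda>j. U (poly (P j)) x) \<longlonglongrightarrow> U f x"
      using AE_sigma by eventually_elim (auto simp: U_def intro!: tendsto_intros P)
    show "AE x in M. (\<lambda>j. Gr (poly (P j)) (poly (pderiv (P j))) x) \<longlonglongrightarrow> Gr f f1 x"
      using AE_sigma by eventually_elim (auto simp: Gr_def intro!: tendsto_intros P)
    show "AE x in M. (\<lambda>j. Lap (poly (P j)) (poly (pderiv (P j))) (poly (pderiv (pderiv (P j)))) x) \<longlonglongrightarrow> Lap f f1 f2 x"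
      using AE_sigma by eventually_elim (auto simp: Lap_def L_def intro!: tendsto_intros P)
    fix j x
    have "\<bar>U (poly (P j)) x\<bar> \<le> D x powr (- N) * (F + 1)" by (rule U_bound[where h = "poly (P j)", OF P(4)[OF s]])
    also have "\<dots> \<le> 1 * (F + 1)" using F_nonneg by (intro mult_right_mono D_powr_le_1) auto
    finally show "\<bar>U (poly (P j)) x\<bar> \<le> F + 1" by simp
    show "norm (Gr (poly (P j)) (poly (pderiv (P j))) x) \<le> (24 + 2 * N) * (F + 1) * w0 x"
      by (rule Gr_bound'[where h = "poly (P j)" and ?h1.0 = "poly (pderiv (P j))", OF P(4)[OF s] P(5)[OF s]])
    show "\<bar>Lap (poly (P j)) (poly (pderiv (P j))) (poly (pderiv (pderiv (P j)))) x\<bar>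
        \<le> 4 * ((4 + (6 + 2 * (n + 1)) + n * (n - 2) / 4) * (F + 1)) * w0 x"
      by (rule Lap_bound[OF L_bound[where h = "poly (P j)" and ?h1.0 = "poly (pderiv (P j))" and ?h2.0 = "poly (pderiv (pderiv (P j)))", OF s P(4)[OF s] P(5)[OF s] P(6)[OF s]]])
  qed
qed auto

lemma integral_test_limit:
  assumes "\<And>j. u j \<in> borel_measurable M" "h \<in> borel_measurable M" "AE x in M. (\<lambda>j. u j x) \<longlonglongrightarrow> h x"
    and "\<And>j x. \<bar>u j x\<bar> \<le> C" and \<psi>: "\<psi> \<in> test_functions H"
  shows "(\<lambda>j. \<integral>x. u j x * \<psi> x \<partial>M) \<longlonglongrightarrow> (\<integral>x. h x * \<psi> x \<partial>M)"
proof (rule integral_dominated_convergence)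
  have \<psi>m: "\<psi> \<in> borel_measurable M" by (rule measurable_M[OF smooth_continuous[OF test_functions_smooth[OF \<psi>]]])
  show "(\<lambda>x. h x * \<psi> x) \<in> borel_measurable M" "(\<lambda>x. u j x * \<psi> x) \<in> borel_measurable M" for j
    using assms(1,2) \<psi>m by auto
  have "locally_integrable_on (\<lambda>x. C) H" by (rule locally_integrable_onI_bounded[of _ "\<bar>C\<bar>"]) auto
  from integrable_norm[OF integrable_mult_test[OF this \<psi> H_sets]]
  show "integrable M (\<lambda>x. norm (C * \<psi> x))" .
  show "AE x in M. (\<lambda>j. u j x * \<psi> x) \<longlonglongrightarrow> h x * \<psi> x"
    using assms(3) by eventually_elim (intro tendsto_intros)
  show "AE x in M. norm (u j x * \<psi> x) \<le> norm (C * \<psi> x)" for j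
  proof (rule AE_I2)
    fix x
    have "\<bar>u j x\<bar> \<le> \<bar>C\<bar>" using assms(4)[of j x] by linarith
    then show "norm (u j x * \<psi> x) \<le> norm (C * \<psi> x)" by (simp add: abs_mult mult_right_mono)
  qed
qed

lemma smooth_Gr_measurable: "Gr (poly P) (poly (pderiv P)) \<in> borel_measurable M"
proof -
  have "(\<lambda>x. Gr (poly P) (poly (pderiv P)) x \<bullet> e) \<in> borel_measurable M" if "e \<in> Basis" for e
    by (rule measurable_M[OF smooth_continuous[OF smooth_Gr[OF that]]])
  then show ?thesis by (simp add: borel_measurable_euclidean_space[of "Gr (poly P) (poly (pderiv P))"])
qed

lemma Lap_measurable: "Lap (poly P) (poly P1) (poly P2) \<in> borel_measurable M"
proof -
  have "continuous_on UNIV (Lap (poly P) (poly P1) (poly P2))"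
    unfolding Lap_def[abs_def] L_def
    by (intro continuous_intros smooth_continuous[OF smooth_powr[OF smooth_D D_pos]] smooth_continuous[OF smooth_sigma] continuous_on_poly)
  then show ?thesis by (rule measurable_M)
qed

lemma weak_gradient_U: "is_weak_gradient H (U f) (Gr f f1)"
  unfolding is_weak_gradient_def
proof (intro conjI loc_int ballI)
  fix \<phi> :: "'a \<Rightarrow> real" and e :: 'a
  assume \<phi>: "\<phi> \<in> test_functions H" and e: "e \<in> Basis"
  show "(\<integral>x. U f x * (grad \<phi> x \<bullet> e) \<partial>M) = - (\<integral>x. (Gr f f1 x \<bullet> e) * \<phi> x \<partial>M)"
  proof (rule approximants, goal_cases)
    case (1 P)
    note P = 1
    have "(\<lambda>j. \<integral>x. U (poly (P j)) x * (grad \<phi> x \<bullet> e) \<partial>M) \<longlonglongrightarrow> (\<integral>x. U f x * (grad \<phi> x \<bullet> e) \<partial>M)"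
      by (rule integral_test_limit[OF _ _ P(1) P(4) test_functions_partial[OF \<phi> e]])
        (auto intro: measurable_M smooth_continuous smooth_U H_measurable_borel U_borel)
    moreover have "(\<lambda>j. \<integral>x. (Gr (poly (P j)) (poly (pderiv (P j))) x \<bullet> e) * \<phi> x \<partial>M) \<longlonglongrightarrow> (\<integral>x. (Gr f f1 x \<bullet> e) * \<phi> x \<partial>M)"
    proof (rule integral_test_limit[OF _ _ _ _ \<phi>])
      show "(\<lambda>x. Gr (poly (P j)) (poly (pderiv (P j))) x \<bullet> e) \<in> borel_measurable M" for j
        by (rule measurable_M[OF smooth_continuous[OF smooth_Gr[OF e]]])
      show "(\<lambda>x. Gr f f1 x \<bullet> e) \<in> borel_measurable M"
        using H_measurable_borel[OF Gr_borel] by measurable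
      show "AE x in M. (\<lambda>j. Gr (poly (P j)) (poly (pderiv (P j))) x \<bullet> e) \<longlonglongrightarrow> Gr f f1 x \<bullet> e"
        using P(2) by eventually_elim (intro tendsto_intros)
      fix j x
      have "\<bar>Gr (poly (P j)) (poly (pderiv (P j))) x \<bullet> e\<bar> \<le> norm (Gr (poly (P j)) (poly (pderiv (P j))) x)"
        using e by (simp add: Basis_le_norm)
      also have "\<dots> \<le> (24 + 2 * N) * (F + 1) * w0 x" by (rule P(5))
      also have "\<dots> \<le> (24 + 2 * N) * (F + 1) * 1" using N_pos F_nonneg by (intro mult_left_mono D_powr_le_1(2)) auto
      finally show "\<bar>Gr (poly (P j)) (poly (pderiv (P j))) x \<bullet> e\<bar> \<le> (24 + 2 * N) * (F + 1)" by simp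
    qed
    ultimately show ?case
      unfolding smooth_weak_gradient_identity[OF \<phi> e] using LIMSEQ_unique tendsto_minus by blast
  qed
qed

text \<open>The limit of \<open>integration_by_parts_poly\<close>; both integrands are dominated
  through \<open>w0\<close>, independently of the approximation.\<close>

lemma integration_by_parts:
  fixes v :: "'a \<Rightarrow> real" and G :: "'a \<Rightarrow> 'a"
  assumes w: "is_weak_gradient H v G" and v: "v \<in> Lr (2 * n / (n - 2)) H" and G: "G \<in> Lr 2 H"
  shows "(\<integral>x. Gr f f1 x \<bullet> G x \<partial>M) = - (\<integral>x. v x * Lap f f1 f2 x \<partial>M)"
proof (rule approximants, goal_cases)
  case (1 P)
  note P = 1
  have vm: "v \<in> borel_measurable M" and Gm: "G \<in> borel_measurable M" using v G unfolding Lr_def by auto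
  define La where "La j = Lap (poly (P j)) (poly (pderiv (P j))) (poly (pderiv (pderiv (P j))))" for j
  define Gj where "Gj j = Gr (poly (P j)) (poly (pderiv (P j)))" for j
  define C where "C = 4 * ((4 + (6 + 2 * (n + 1)) + n * (n - 2) / 4) * (F + 1))"
  have "(\<lambda>j. \<integral>x. Gj j x \<bullet> G x \<partial>M) \<longlonglongrightarrow> (\<integral>x. Gr f f1 x \<bullet> G x \<partial>M)"
  proof (rule integral_dominated_convergence)
    show "(\<lambda>x. Gr f f1 x \<bullet> G x) \<in> borel_measurable M" by (rule borel_measurable_inner[OF H_measurable_borel[OF Gr_borel] Gm])
    show "(\<lambda>x. Gj j x \<bullet> G x) \<in> borel_measurable M" for j unfolding Gj_def by (rule borel_measurable_inner[OF smooth_Gr_measurable Gm])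
    show "integrable M (\<lambda>x. (24 + 2 * N) * (F + 1) * (norm (G x) * w0 x))" by (rule integrable_mult_right[OF integrable_norm_w0[OF G]])
    show "AE x in M. (\<lambda>j. Gj j x \<bullet> G x) \<longlonglongrightarrow> Gr f f1 x \<bullet> G x"
      unfolding Gj_def using P(2) by eventually_elim (intro tendsto_intros)
    show "AE x in M. norm (Gj j x \<bullet> G x) \<le> (24 + 2 * N) * (F + 1) * (norm (G x) * w0 x)" for j
    proof (rule AE_I2)
      fix x
      have "norm (Gj j x \<bullet> G x) \<le> norm (Gj j x) * norm (G x)" by (simp add: Cauchy_Schwarz_ineq2)
      also have "\<dots> \<le> ((24 + 2 * N) * (F + 1) * w0 x) * norm (G x)" unfolding Gj_def by (intro mult_right_mono P(5)) auto
      finally show "norm (Gj j x \<bullet> G x) \<le> (24 + 2 * N) * (F + 1) * (norm (G x) * w0 x)" by (simp add: mult_ac)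
    qed
  qed
  moreover have "(\<lambda>j. \<integral>x. v x * La j x \<partial>M) \<longlonglongrightarrow> (\<integral>x. v x * Lap f f1 f2 x \<partial>M)"
  proof (rule integral_dominated_convergence)
    show "(\<lambda>x. v x * Lap f f1 f2 x) \<in> borel_measurable M" by (rule borel_measurable_times[OF vm H_measurable_borel[OF Lap_borel]])
    show "(\<lambda>x. v x * La j x) \<in> borel_measurable M" for j unfolding La_def by (rule borel_measurable_times[OF vm Lap_measurable])
    show "integrable M (\<lambda>x. C * (\<bar>v x\<bar> * w0 x))" by (rule integrable_mult_right[OF integrable_mult_w0[OF v]])
    show "AE x in M. (\<lambda>j. v x * La j x) \<longlonglongrightarrow> v x * Lap f f1 f2 x"
      unfolding La_def using P(3) by eventually_elim (intro tendsto_intros)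
    show "AE x in M. norm (v x * La j x) \<le> C * (\<bar>v x\<bar> * w0 x)" for j
    proof (rule AE_I2)
      fix x
      have "norm (v x * La j x) = \<bar>v x\<bar> * \<bar>La j x\<bar>" by (simp add: abs_mult)
      also have "\<dots> \<le> \<bar>v x\<bar> * (C * w0 x)" unfolding La_def C_def by (intro mult_left_mono P(6)) auto
      finally show "norm (v x * La j x) \<le> C * (\<bar>v x\<bar> * w0 x)" by (simp add: mult_ac)
    qed
  qed
  ultimately show ?case
    unfolding Gj_def La_def integration_by_parts_poly[OF w v G] using LIMSEQ_unique tendsto_minus by blast
qed

end

subsection \<open>The profile equation\<close>

lemma powr_divide_minus: "(x / y) powr (- r) = y powr r * x powr (- r)" for x y r :: real
proof -
  have "(x / y) powr (- r) = x powr (- r) / y powr (- r)" by (rule powr_divide)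
  then show ?thesis by (simp only: powr_minus[of y] divide_inverse inverse_inverse_eq mult.commute)
qed

lemma b_derivative_identity: "k * a/d * uu + v * (2 * k * y/e) * a = a * (k * uu/d + 2 * k * y * v/e)" for a k uu d y v e::real
  by (simp add: algebra_simps)
lemma exponent_identity: "4/((k+2) * k) = 2/k+1-(k+4)/(k+2)" if "k>0" for k::real
  using that by (simp add: divide_simps) (simp add: algebra_simps)

text \<open>The left-hand side is the derivative of \<open>b1\<close> in \<open>exists_b\<close> as
  the product and quotient rules deliver it, with \<open>g\<close>, \<open>h\<close> for
  \<open>1 - z\<close>, \<open>1 + z\<close>, \<open>k\<close> for \<open>\<nu>\<close>,
  \<open>y\<close> for \<open>Y z\<close>, and \<open>v\<close>, \<open>v1\<close> for the solution
  and its derivative at \<open>1 - Y z\<close>.\<close>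

lemma b_second_derivative_identity:
  fixes g h k a v v1 y z V W :: real
  assumes "g \<noteq> 0" "h \<noteq> 0"
  shows "k * a/g * (k * v/g + 2 * k * y * v1/(g * h)) + ((k * (v1 * (2 * k * y/(g * h))) * g - k * v * (-1))/(g * g) + ((2 * k * (-(2 * k * y/(g * h))) * v1 + -(V * W) * (2 * k * y/(g * h)) * (2 * k * y)) * (g * h) - 2 * k * y * v1 * (-(2 * z)))/((g * h) * (g * h))) * a
   = a * (k * (k+1) * v/(g * g) + 4 * k * k * y * v1/(g * g * h) - 4 * k * k * y * v1/(g * g * h * h) + 4 * k * y * v1 * z/(g * g * h * h) - V * (y * y) * (4 * k * k) * W/(g * g * h * h))"
  using assms by (simp add: divide_simps) (simp add: algebra_simps)

text \<open>Brings that derivative into the form of the equation for \<open>b\<close>. By the choice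
  of \<open>V\<close>, the product of the weight with the square of \<open>Y\<close> has become
  \<open>C * (g * h)\<close>.\<close>

lemma b_equation_identity:
  fixes g h k a v v1 y z C W :: real
  assumes "g \<noteq> 0" "h \<noteq> 0" and z: "z = 1 - g" and h: "h = 2 - g"
  shows "a * (k * (k+1) * v/(g * g) + 4 * k * k * y * v1/(g * g * h) - 4 * k * k * y * v1/(g * g * h * h) + 4 * k * y * v1 * z/(g * g * h * h) - C * (g * h) * W/(g * g * h * h))
    = ((2 * k+2) * z * (a * (k * v/g + 2 * k * y * v1/(g * h))) + k * (k+1) * (a * v) - C * W * a)/(g * h)"
proof -
  have "a * (k * (k+1) * v/(g * g) + 4 * k * k * y * v1/(g * g * h) - 4 * k * k * y * v1/(g * g * h * h) + 4 * k * y * v1 * z/(g * g * h * h) - C * (g * h) * W/(g * g * h * h))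
     = a * (k * (k+1) * v * h * h + 4 * k * k * y * v1 * h - 4 * k * k * y * v1 + 4 * k * y * v1 * z - C * (g * h) * W)/(g * g * h * h)"
    using assms(1,2) by (simp add: divide_simps) (simp add: algebra_simps)
  also have "a * (k * (k+1) * v * h * h + 4 * k * k * y * v1 * h - 4 * k * k * y * v1 + 4 * k * y * v1 * z - C * (g * h) * W)
     = (2 * k+2) * z * (a * (k * v * h + 2 * k * y * v1)) + k * (k+1) * (a * v) * g * h - C * W * a * g * h"
    unfolding z h by (simp add: algebra_simps)
  also have "\<dots>/(g * g * h * h) = ((2 * k+2) * z * (a * (k * v/g + 2 * k * y * v1/(g * h))) + k * (k+1) * (a * v) - C * W * a)/(g * h)"
    using assms(1,2) by (simp add: divide_simps)
  finally show ?thesis .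
qed

text \<open>The substitution \<open>b z = z * f (z\<^sup>2)\<close>, with \<open>g\<close> for f' at
  \<open>z\<^sup>2\<close> and \<open>k\<close> for \<open>\<nu>\<close>. As for radial functions in
  three dimensions, the factor \<open>z\<close> absorbs the singular first order term.\<close>

lemma profile_equation_identity:
  fixes f g k W z :: real
  assumes nz: "1 - z * z \<noteq> 0" "z \<noteq> 0"
  shows "((((2 * k+2) * z * (f+2 * (z * z) * g) + k * (k+1) * (z * f) - W * (z * f))/(1-z * z) * (inverse z/2) - g) * (2 * (z * z)) - (f + 2 * (z * z) * g - f)*2)/((2 * (z * z)) * (2 * (z * z)))
    = ((k+1) * (k+2) * f - W * f - (6 - 2 * (2 * k+4+1) * (z * z)) * g)/(4 * (z * z) * (1-z * z))"
proof -
  define e where "e = 1 - z * z"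
  have e: "e \<noteq> 0" "z * z = 1 - e" using nz by (auto simp: e_def)
  define B where "B = (2 * k+2) * (f+2 * (z * z) * g) + k * (k+1) * f - W * f"
  have l: "(2 * k+2) * z * (f+2 * (z * z) * g) + k * (k+1) * (z * f) - W * (z * f) = z * B"
    by (simp add: B_def algebra_simps)
  have r: "z * B / e * (inverse z / 2) = B / e / 2" using nz(2) by (simp add: field_simps)
  have q: "(f + 2 * (z * z) * g - f) * 2 = 4 * (z * z) * g" "(2 * (z * z)) * (2 * (z * z)) = 4 * (z * z) * (z * z)" by simp_all
  have "((((2 * k+2) * z * (f+2 * (z * z) * g) + k * (k+1) * (z * f) - W * (z * f))/(1-z * z) * (inverse z/2) - g) * (2 * (z * z)) - (f + 2 * (z * z) * g - f) * 2)/((2 * (z * z)) * (2 * (z * z)))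
     = ((B / e / 2 - g) * (2 * (z * z)) - 4 * (z * z) * g) / (4 * (z * z) * (z * z))"
    unfolding l e_def[symmetric] r q by (rule refl)
  also have "\<dots> = (B - 6 * e * g) / (4 * (z * z) * e)" using nz(2) e(1) by (simp add: divide_simps) (simp add: algebra_simps)
  also have "B - 6 * e * g = (k+1) * (k+2) * f - W * f - (6 - 2 * (2 * k+4+1) * (z * z)) * g"
    unfolding B_def e_def by (simp add: algebra_simps)
  finally show ?thesis unfolding e_def by simp
qed

section \<open>Reduction of the profile equation to the boundary value problem\<close>

locale radial_ode =
  fixes n :: real
  assumes n5: "n \<ge> 5"
begin

definition \<nu> :: real where "\<nu> = (n - 4) / 2"
definition p :: real where "p = 2 * n / (n - 2)"
definition c :: real where "c = n * (n - 2) / 4"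
text \<open>The quotient of the two solutions (1+z)^{-\<nu>} and (1-z)^{-\<nu>} of the linear part.
  With \<open>1 - Y z\<close> as new variable, after division by the second of them, the linear
  solutions become affine; \<open>Z\<close> is the inverse change of variable.\<close>

definition Y :: "real \<Rightarrow> real" where "Y z = ((1 - z) / (1 + z)) powr \<nu>"
definition Z :: "real \<Rightarrow> real" where "Z x = (1 - (1 - x) powr (1 / \<nu>)) / (1 + (1 - x) powr (1 / \<nu>))"
text \<open>The coefficient \<open>c\<close> times the power of (1-z)^{-\<nu>}/z from the
  nonlinearity, divided by \<open>1 - z\<^sup>2\<close> and by the square of the derivative
  \<open>2 * \<nu> * Y z / (1 - z\<^sup>2)\<close> of the new variable, with \<open>Y z\<close>
  written as \<open>1 - x\<close>.\<close>

definition V :: "real \<Rightarrow> real" where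
  "V x = c / (4 * \<nu>\<^sup>2) * (1 - Z x) powr (- \<nu> * (p - 2)) * Z x powr (- (p - 2)) * (1 - (Z x)\<^sup>2) / (1 - x)\<^sup>2"
definition m :: real where "m = real (nat \<lceil>\<nu>\<rceil>)"

lemma \<nu>_pos: "\<nu> > 0" using n5 by (simp add: \<nu>_def)

lemma c_pos: "c > 0" using n5 by (simp add: c_def)

lemma p_gt: "p > 2" and p2: "p - 2 = 4 / (n - 2)" using n5 by (simp_all add: p_def field_simps)

lemma m_ge: "m \<ge> \<nu>" "m \<ge> 1" 
proof -
  have "1 \<le> \<lceil>\<nu>\<rceil>" using \<nu>_pos by simp
  then show "m \<ge> 1" unfolding m_def by simp
  show "m \<ge> \<nu>" unfolding m_def by (rule real_nat_ceiling_ge)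
qed

lemma ratio: "0 < z \<Longrightarrow> z < 1 \<Longrightarrow> 0 < (1 - z) / (1 + z) \<and> (1 - z) / (1 + z) < (1::real)"
  by (simp add: divide_less_eq)

lemma Y_bounds: assumes "0 < z" "z < 1" shows "0 < Y z" "Y z < 1"
proof -
  show "0 < Y z" unfolding Y_def powr_gt_zero using ratio[OF assms] by (metis less_irrefl)
  have "((1 - z) / (1 + z)) powr \<nu> < 1 powr \<nu>" using ratio[OF assms] \<nu>_pos by (intro powr_less_mono2) auto
  then show "Y z < 1" by (simp add: Y_def)
qed

lemma Z_Y: assumes "0 < z" "z < 1" shows "Z (1 - Y z) = z"
proof -
  have q: "(1 - (1 - Y z)) powr (1 / \<nu>) = (1 - z) / (1 + z)"
    unfolding Y_def diff_diff_eq2 using ratio[OF assms] \<nu>_pos by (simp add: powr_powr del: abs_divide)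
  show ?thesis unfolding Z_def q using assms by (simp add: field_simps)
qed

lemma Z_bounds: assumes "0 < x" "x < 1" shows "0 < Z x" "Z x < 1" "Y (Z x) = 1 - x"
proof -
  define q where "q = (1 - x) powr (1 / \<nu>)"
  have "q < 1 powr (1 / \<nu>)" unfolding q_def using assms \<nu>_pos by (intro powr_less_mono2) auto
  then have q: "0 < q" "q < 1" using assms by (auto simp: q_def)
  have Z: "Z x = (1 - q) / (1 + q)" by (simp add: Z_def q_def)
  show "0 < Z x" "Z x < 1" unfolding Z using q by (auto simp: field_simps)
  have "(1 - Z x) / (1 + Z x) = q" unfolding Z using q by (simp add: field_simps)
  then show "Y (Z x) = 1 - x" unfolding Y_def using assms \<nu>_pos by (simp add: q_def powr_powr)
qed

lemma Y_deriv: assumes "0 < z" "z < 1" shows "(Y has_real_derivative - (2 * \<nu> * Y z / (1 - z\<^sup>2))) (at z)"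
proof -
  define r where "r = (1 - z) / (1 + z)"
  have r: "r > 0" using ratio[OF assms] by (simp add: r_def)
  have "((\<lambda>z. (1 - z) / (1 + z)) has_real_derivative - 2 / (1 + z)\<^sup>2) (at z)"
    using assms by (auto intro!: derivative_eq_intros simp: power2_eq_square)
  from DERIV_chain2[OF has_real_derivative_powr[OF r, of \<nu>, unfolded r_def] this]
  have "(Y has_real_derivative \<nu> * r powr (\<nu> - 1) * (- 2 / (1 + z)\<^sup>2)) (at z)"
    unfolding Y_def[abs_def] r_def .
  moreover have "\<nu> * r powr (\<nu> - 1) * (- 2 / (1 + z)\<^sup>2) = - (2 * \<nu> * Y z / (1 - z\<^sup>2))"
  proof -
    have pr: "r powr (\<nu> - 1) = Y z / r" unfolding powr_diff Y_def r_def[symmetric] using r by simp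
    have zz: "1 - z\<^sup>2 = (1 - z) * (1 + z)" by (simp add: power2_eq_square algebra_simps)
    show ?thesis unfolding pr zz unfolding r_def using assms by (simp add: divide_simps power2_eq_square)
  qed
  ultimately show ?thesis by simp
qed

text \<open>Bernoulli's inequality for the integer \<open>m \<ge> \<nu>\<close>; raising the
  exponent from \<open>\<nu>\<close> to \<open>m\<close> only lowers a power of
  \<open>1 - t\<close>.\<close>

lemma Y_low: assumes "0 < z" "z < 1" shows "1 - Y z \<le> 2 * m * z"
proof -
  define t where "t = 2 * z / (1 + z)"
  have t: "0 < t" "t < 1" "t \<le> 2 * z" using assms by (auto simp: t_def field_simps)
  have "(1 - z) / (1 + z) = 1 - t" unfolding t_def using assms by (simp add: field_simps)
  then have Y: "Y z = (1 - t) powr \<nu>" by (simp add: Y_def)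
  have "1 - m * t \<le> (1 - t) ^ nat \<lceil>\<nu>\<rceil>" using Bernoulli_inequality[of "- t" "nat \<lceil>\<nu>\<rceil>"] t by (simp add: m_def)
  also have "\<dots> = (1 - t) powr m" unfolding m_def using t by (simp add: powr_realpow)
  also have "\<dots> \<le> (1 - t) powr \<nu>" using t m_ge by (intro powr_mono') auto
  finally have "1 - Y z \<le> m * t" unfolding Y by simp
  also have "\<dots> \<le> m * (2 * z)" using t m_ge by (intro mult_left_mono) auto
  finally show ?thesis by simp
qed

text \<open>The second entry is \<open>1 / \<nu> + 1 - p / 2\<close>, the margin left at
  \<open>x = 1\<close>, where \<open>V\<close> is of order
  \<open>(1 - x) powr (1 / \<nu> - p)\<close>. At \<open>x = 0\<close> the margin is
  \<open>3 - p / 2\<close>, which exceeds 1 for \<open>n \<ge> 5\<close>, so the cap at 1 covers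
  that end.\<close>

definition \<delta> :: real where "\<delta> = min 1 (4 / ((n - 2) * (n - 4)))"

lemma V_bound:
  assumes x: "0 < x" "x < 1"
  shows "V x \<le> (c / \<nu>\<^sup>2 * (2 * m) powr (p - 2)) * (x * (1 - x)) powr (\<delta> - 1 - p / 2)"
proof -
  define z y where "z = Z x" and "y = 1 - x"
  have z: "0 < z" "z < 1" and Y: "Y z = y" using Z_bounds[OF x] by (auto simp: z_def y_def)
  have y: "0 < y" "y < 1" using x by (auto simp: y_def)
  have r: "y powr (1 / \<nu>) = (1 - z) / (1 + z)"
    unfolding Y[symmetric] Y_def using ratio[OF z] \<nu>_pos by (simp add: powr_powr del: abs_divide)
  have "(1 - z) / (1 + z) \<le> (1 - z) / 1" using z by (intro divide_left_mono) auto
  \<comment> \<open>By \<open>r\<close>, the number \<open>1 - z\<close> is comparable to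
    \<open>y powr (1 / \<nu>)\<close>, which translates powers of \<open>1 - z\<close> into powers
    of \<open>1 - x\<close>.\<close>
  then have lo: "y powr (1 / \<nu>) \<le> 1 - z" using r by simp
  have hi: "1 - z\<^sup>2 \<le> 4 * y powr (1 / \<nu>)"
  proof -
    have "1 - z\<^sup>2 = (1 + z)\<^sup>2 * y powr (1 / \<nu>)" unfolding r using z by (simp add: power2_eq_square field_simps)
    also have "\<dots> \<le> 2\<^sup>2 * y powr (1 / \<nu>)" using z by (intro mult_right_mono power_mono) auto
    finally show ?thesis by simp
  qed
  have pp: "p - 2 > 0" using p_gt by simp
  have 1: "(1 - z) powr (- \<nu> * (p - 2)) \<le> y powr (- (p - 2))"
  proof -
    have "(1 - z) powr (- \<nu> * (p - 2)) \<le> (y powr (1 / \<nu>)) powr (- \<nu> * (p - 2))"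
      using lo y pp \<nu>_pos by (intro powr_mono2') (auto simp: mult_nonpos_nonneg)
    also have "\<dots> = y powr (- (p - 2))" unfolding powr_powr using \<nu>_pos by simp
    finally show ?thesis .
  qed
  have 2: "z powr (- (p - 2)) \<le> (2 * m) powr (p - 2) * x powr (- (p - 2))"
  proof -
    have "x \<le> 2 * m * z" using Y_low[OF z] unfolding Y y_def by simp
    moreover have m0: "2 * m > 0" using m_ge(2) by simp
    ultimately have l: "x / (2 * m) \<le> z" by (simp add: pos_divide_le_eq mult.commute)
    have "0 < x / (2 * m)" using x(1) m0 by (rule divide_pos_pos)
    then have "z powr (- (p - 2)) \<le> (x / (2 * m)) powr (- (p - 2))" by (rule powr_mono2'[rotated, OF _ l]) (use pp in simp)
    then show ?thesis by (simp only: powr_divide_minus)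
  qed
  have e1: "x powr (- (p - 2)) \<le> x powr (\<delta> - 1 - p / 2)"
  proof (rule powr_mono')
    have "p / 2 \<le> 5 / 3" using n5 by (simp add: p_def field_simps)
    then show "\<delta> - 1 - p / 2 \<le> - (p - 2)" by (simp add: \<delta>_def)
  qed (use x in auto)
  have e2: "y powr (1 / \<nu> - p) \<le> y powr (\<delta> - 1 - p / 2)"
  proof (rule powr_mono')
    have "2 * n / k / 2 = n / k" "1 / (k / 2) = 2 / k" for k :: real by simp_all
    then have a: "1 / \<nu> = 2 / (n - 4)" "p / 2 = n / (n - 2)" unfolding \<nu>_def p_def by blast+
    have "4 / ((n - 2) * (n - 4)) = 1 / \<nu> + 1 - p / 2"
      using exponent_identity[of "n - 4"] n5 unfolding a by simp
    then show "\<delta> - 1 - p / 2 \<le> 1 / \<nu> - p" by (simp add: \<delta>_def)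
  qed (use y in auto)
  have nn: "0 \<le> 1 - z\<^sup>2" using z by (simp add: power_le_one)
  have "V x = c / (4 * \<nu>\<^sup>2) * ((1 - z) powr (- \<nu> * (p - 2)) * z powr (- (p - 2)) * (1 - z\<^sup>2)) / y\<^sup>2"
    unfolding V_def z_def y_def by simp
  also have "\<dots> \<le> c / (4 * \<nu>\<^sup>2) * (y powr (- (p - 2)) * ((2 * m) powr (p - 2) * x powr (- (p - 2))) * (4 * y powr (1 / \<nu>))) / y\<^sup>2"
    using c_pos nn by (intro divide_right_mono mult_left_mono mult_mono 1 2 hi) auto
  also have "\<dots> = (c / \<nu>\<^sup>2 * (2 * m) powr (p - 2)) * (x powr (- (p - 2)) * (y powr (- (p - 2)) * y powr (1 / \<nu>) * y powr (- 2)))"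
    using y by (simp add: powr_minus powr_numeral field_simps)
  also have "y powr (- (p - 2)) * y powr (1 / \<nu>) * y powr (- 2) = y powr (1 / \<nu> - p)"
    unfolding powr_add[symmetric] by (simp add: algebra_simps)
  also have "(c / \<nu>\<^sup>2 * (2 * m) powr (p - 2)) * (x powr (- (p - 2)) * y powr (1 / \<nu> - p))
      \<le> (c / \<nu>\<^sup>2 * (2 * m) powr (p - 2)) * (x powr (\<delta> - 1 - p / 2) * y powr (\<delta> - 1 - p / 2))"
    using c_pos by (intro mult_left_mono mult_mono e1 e2) auto
  also have "x powr (\<delta> - 1 - p / 2) * y powr (\<delta> - 1 - p / 2) = (x * (1 - x)) powr (\<delta> - 1 - p / 2)"
    unfolding y_def using x by (simp add: powr_mult)
  finally show ?thesis .
qed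

lemma V_pos: assumes "0 < x" "x < 1" shows "V x > 0"
proof -
  note z = Z_bounds(1,2)[OF assms]
  have "(Z x)\<^sup>2 < 1" using z by (simp add: power_less_one_iff)
  then show ?thesis unfolding V_def using z assms c_pos \<nu>_pos by (intro divide_pos_pos mult_pos_pos) auto
qed

lemma V_cont: "continuous_on {0<..<1} V"
proof -
  have Zc: "continuous_on {0<..<1} Z"
    unfolding Z_def by (intro continuous_intros) (auto simp: add_pos_nonneg[THEN less_imp_neq, THEN not_sym])
  show ?thesis
    unfolding V_def using Z_bounds(1,2) by (intro continuous_intros Zc) (auto simp: less_imp_neq[THEN not_sym])
qed

text \<open>The substitution \<open>b z = (1 - z) powr -\<nu> * u (1 - Y z)\<close>, where \<open>(1 - z) powr -\<nu>\<close> and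
  \<open>(1 + z) powr -\<nu>\<close> solve the linear equation, removes the first order term.\<close>

lemma exists_b:
  obtains b b1 :: "real \<Rightarrow> real" and K :: real where
    "\<And>z. 0 < z \<Longrightarrow> z < 1 \<Longrightarrow> (b has_real_derivative b1 z) (at z)"
    "\<And>z. 0 < z \<Longrightarrow> z < 1 \<Longrightarrow> (b1 has_real_derivative
        ((2 * \<nu> + 2) * z * b1 z + \<nu> * (\<nu> + 1) * b z - c * (\<bar>b z / z\<bar> powr (p - 2) * b z)) / (1 - z\<^sup>2)) (at z)"
    "\<And>z. 0 < z \<Longrightarrow> z < 1 \<Longrightarrow> \<bar>b z\<bar> \<le> K * z"
    "\<exists>z. 0 < z \<and> z < 1 \<and> b z > 0" "\<exists>z. 0 < z \<and> z < 1 \<and> b z < 0"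
proof -
  interpret bvp_weight V p "c / \<nu>\<^sup>2 * (2 * m) powr (p - 2)" \<delta>
  proof
    show "\<delta> > 0" using n5 by (simp add: \<delta>_def)
  qed (use p_gt V_cont V_pos V_bound in auto)
  show ?thesis
  proof (rule exists_nodal, goal_cases)
    case (1 u u1 M)
    note u = 1
    define A where "A z = (1 - z) powr (- \<nu>)" for z
    define b where "b z = A z * u (1 - Y z)" for z
    define b1 where "b1 z = A z * (\<nu> * u (1 - Y z) / (1 - z) + 2 * \<nu> * Y z * u1 (1 - Y z) / (1 - z\<^sup>2))" for z
    have zz: "1 - z\<^sup>2 = (1 - z) * (1 + z)" for z :: real by (simp add: power2_eq_square algebra_simps)
    have Ad: "(A has_real_derivative \<nu> * A z / (1 - z)) (at z)" if z: "0 < z" "z < 1" for z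
    proof -
      have "((\<lambda>z. (1 - z) powr (- \<nu>)) has_real_derivative - \<nu> * (1 - z) powr (- \<nu> - 1) * (- 1)) (at z)"
        by (rule DERIV_chain2[OF has_real_derivative_powr]) (use z in \<open>auto intro!: derivative_eq_intros\<close>)
      then show ?thesis unfolding A_def[abs_def] powr_diff using z by simp
    qed
    have Xd: "((\<lambda>z. 1 - Y z) has_real_derivative 2 * \<nu> * Y z / (1 - z\<^sup>2)) (at z)" if z: "0 < z" "z < 1" for z
      using DERIV_diff[OF DERIV_const[of 1] Y_deriv[OF z]] by simp
    have X: "0 < 1 - Y z" "1 - Y z < 1" if z: "0 < z" "z < 1" for z using Y_bounds[OF z] by auto
    have ud: "((\<lambda>z. u (1 - Y z)) has_real_derivative u1 (1 - Y z) * (2 * \<nu> * Y z / (1 - z\<^sup>2))) (at z)" if z: "0 < z" "z < 1" for z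
      by (rule DERIV_chain2[OF u(1)[OF X[OF z]] Xd[OF z]])
    have u1d: "((\<lambda>z. u1 (1 - Y z)) has_real_derivative
        - (V (1 - Y z) * (\<bar>u (1 - Y z)\<bar> powr (p - 2) * u (1 - Y z))) * (2 * \<nu> * Y z / (1 - z\<^sup>2))) (at z)" if z: "0 < z" "z < 1" for z
      by (rule DERIV_chain2[OF u(2)[OF X[OF z]] Xd[OF z]])
    show ?thesis
    proof (rule that)
      fix z :: real assume z: "0 < z" "z < 1"
      have z2: "1 - z \<noteq> 0" "1 + z \<noteq> 0" "1 - z > 0" "1 - z\<^sup>2 \<noteq> 0" using z unfolding zz by auto
      have "(b has_real_derivative \<nu> * A z / (1 - z) * u (1 - Y z) + u1 (1 - Y z) * (2 * \<nu> * Y z / (1 - z\<^sup>2)) * A z) (at z)"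
        unfolding b_def[abs_def] by (rule DERIV_mult[OF Ad[OF z] ud[OF z]])
      then show "(b has_real_derivative b1 z) (at z)" by (simp only: b1_def b_derivative_identity)
      define W where "W = \<bar>u (1 - Y z)\<bar> powr (p - 2) * u (1 - Y z)"
      define v v1 where "v = u (1 - Y z)" and "v1 = u1 (1 - Y z)"
      have VY: "V (1 - Y z) = c / (4 * \<nu>\<^sup>2) * (A z powr (p - 2) * z powr (- (p - 2))) * (1 - z\<^sup>2) / (Y z)\<^sup>2"
        unfolding V_def Z_Y[OF z] A_def powr_powr using z by simp
      define R where "R = A z powr (p - 2) * z powr (- (p - 2))"
      have A0: "A z > 0" using z by (simp add: A_def)
      have bz: "c * (\<bar>b z / z\<bar> powr (p - 2) * b z) = c * (R * W * A z)"
      proof -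
        have "\<bar>b z / z\<bar> = A z * inverse z * \<bar>u (1 - Y z)\<bar>"
          using A0 z by (simp add: b_def abs_mult divide_inverse)
        then have "\<bar>b z / z\<bar> powr (p - 2) = A z powr (p - 2) * inverse z powr (p - 2) * \<bar>u (1 - Y z)\<bar> powr (p - 2)"
          using A0 z by (simp add: powr_mult)
        moreover have "inverse z powr (p - 2) = z powr (- (p - 2))"
          unfolding powr_minus by (rule inverse_powr)
        ultimately show ?thesis unfolding b_def R_def W_def by simp
      qed
      have n1: "((\<lambda>z. \<nu> * u (1 - Y z) / (1 - z)) has_real_derivative
          (\<nu> * (v1 * (2 * \<nu> * Y z / (1 - z\<^sup>2))) * (1 - z) - \<nu> * v * (- 1)) / ((1 - z) * (1 - z))) (at z)"
        unfolding v_def v1_def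
        by (rule DERIV_divide[OF DERIV_cmult[OF ud[OF z]]]) (use z2 in \<open>auto intro!: derivative_eq_intros\<close>)
      have n2: "((\<lambda>z. 2 * \<nu> * Y z * u1 (1 - Y z) / (1 - z\<^sup>2)) has_real_derivative
          ((2 * \<nu> * (- (2 * \<nu> * Y z / (1 - z\<^sup>2))) * v1 + - (V (1 - Y z) * W) * (2 * \<nu> * Y z / (1 - z\<^sup>2)) * (2 * \<nu> * Y z)) * (1 - z\<^sup>2)
            - 2 * \<nu> * Y z * v1 * (- (2 * z))) / ((1 - z\<^sup>2) * (1 - z\<^sup>2))) (at z)"
        unfolding v_def v1_def W_def
        by (rule DERIV_divide[OF DERIV_mult[OF DERIV_cmult[OF Y_deriv[OF z]] u1d[OF z]]]) (use z2 in \<open>auto intro!: derivative_eq_intros\<close>)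
      have d: "(b1 has_real_derivative
          \<nu> * A z / (1 - z) * (\<nu> * u (1 - Y z) / (1 - z) + 2 * \<nu> * Y z * u1 (1 - Y z) / (1 - z\<^sup>2)) +
          ((\<nu> * (v1 * (2 * \<nu> * Y z / (1 - z\<^sup>2))) * (1 - z) - \<nu> * v * (- 1)) / ((1 - z) * (1 - z)) +
           ((2 * \<nu> * (- (2 * \<nu> * Y z / (1 - z\<^sup>2))) * v1 + - (V (1 - Y z) * W) * (2 * \<nu> * Y z / (1 - z\<^sup>2)) * (2 * \<nu> * Y z)) * (1 - z\<^sup>2)
            - 2 * \<nu> * Y z * v1 * (- (2 * z))) / ((1 - z\<^sup>2) * (1 - z\<^sup>2))) * A z) (at z)"
        unfolding b1_def[abs_def] by (rule DERIV_mult[OF Ad[OF z] DERIV_add[OF n1 n2]])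
      define g where "g = 1 - z"
      define h where "h = 1 + z"
      define y where "y = Y z"
      have gh: "g \<noteq> 0" "h \<noteq> 0" "z = 1 - g" "h = 2 - g" using z2 by (auto simp: g_def h_def)
      have y0: "y \<noteq> 0" using Y_bounds[OF z] by (simp add: y_def)
      define VV where "VV = V (1 - Y z)"
      have Vy: "VV * (y * y) * (4 * \<nu> * \<nu>) = (c * R) * (g * h)"
      proof -
        have "V (1 - Y z) = c / (4 * (\<nu> * \<nu>)) * R * (g * h) / (y * y)"
          unfolding VY R_def zz g_def h_def y_def power2_eq_square[of \<nu>] power2_eq_square[of "Y z"] by simp
        then show ?thesis unfolding VV_def using y0 \<nu>_pos by simp
      qed
      have "\<nu> * A z / (1 - z) * (\<nu> * u (1 - Y z) / (1 - z) + 2 * \<nu> * Y z * u1 (1 - Y z) / (1 - z\<^sup>2)) +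
          ((\<nu> * (v1 * (2 * \<nu> * Y z / (1 - z\<^sup>2))) * (1 - z) - \<nu> * v * (- 1)) / ((1 - z) * (1 - z)) +
           ((2 * \<nu> * (- (2 * \<nu> * Y z / (1 - z\<^sup>2))) * v1 + - (V (1 - Y z) * W) * (2 * \<nu> * Y z / (1 - z\<^sup>2)) * (2 * \<nu> * Y z)) * (1 - z\<^sup>2)
            - 2 * \<nu> * Y z * v1 * (- (2 * z))) / ((1 - z\<^sup>2) * (1 - z\<^sup>2))) * A z
        = A z * (\<nu> * (\<nu> + 1) * v / (g * g) + 4 * \<nu> * \<nu> * y * v1 / (g * g * h) - 4 * \<nu> * \<nu> * y * v1 / (g * g * h * h)
           + 4 * \<nu> * y * v1 * z / (g * g * h * h) - VV * (y * y) * (4 * \<nu> * \<nu>) * W / (g * g * h * h))"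
        unfolding v_def[symmetric] v1_def[symmetric] VV_def[symmetric] unfolding zz g_def[symmetric] h_def[symmetric] y_def[symmetric]
        by (rule b_second_derivative_identity[OF gh(1,2)])
      also have "\<dots> = ((2 * \<nu> + 2) * z * (A z * (\<nu> * v / g + 2 * \<nu> * y * v1 / (g * h))) + \<nu> * (\<nu> + 1) * (A z * v) - (c * R) * W * A z) / (g * h)"
        unfolding Vy by (rule b_equation_identity[OF gh])
      also have "\<dots> = ((2 * \<nu> + 2) * z * b1 z + \<nu> * (\<nu> + 1) * b z - c * (R * W * A z)) / (1 - z\<^sup>2)"
        unfolding b1_def b_def v_def[symmetric] v1_def[symmetric] unfolding zz g_def[symmetric] h_def[symmetric] y_def[symmetric]
        by (simp only: mult.assoc)
      finally show "(b1 has_real_derivative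
        ((2 * \<nu> + 2) * z * b1 z + \<nu> * (\<nu> + 1) * b z - c * (\<bar>b z / z\<bar> powr (p - 2) * b z)) / (1 - z\<^sup>2)) (at z)"
        using d unfolding bz by simp
      have M0: "M \<ge> 0"
      proof -
        have "0 \<le> \<bar>u (1 / 2)\<bar>" by simp
        also have "\<dots> \<le> M * ((1/2) * (1 - 1/2))" by (rule u(3)) auto
        finally show ?thesis by simp
      qed
      have "\<bar>b z\<bar> = A z * \<bar>u (1 - Y z)\<bar>" unfolding b_def using A0 by (simp add: abs_mult)
      also have "\<dots> \<le> A z * (M * ((1 - Y z) * (1 - (1 - Y z))))" using A0 by (intro mult_left_mono u(3) X z) auto
      \<comment> \<open>\<open>A z\<close> blows up at \<open>z = 1\<close>, but its product with
        \<open>Y z\<close> is (1+z)^{-\<nu>}, at most 1. So the linear decay of \<open>u\<close> at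
        1 keeps \<open>b\<close> bounded there, while its linear decay at 0 gives the factor
        \<open>z\<close>.\<close>
      also have "\<dots> = (A z * Y z) * (M * (1 - Y z))" by simp
      also have "\<dots> \<le> 1 * (M * (2 * m * z))"
      proof (rule mult_mono)
        have "A z * Y z = 1 / (1 + z) powr \<nu>" unfolding A_def Y_def using z2 by (simp add: powr_divide powr_minus)
        moreover have "(1 + z) powr \<nu> \<ge> 1" using z \<nu>_pos by (intro ge_one_powr_ge_zero) auto
        then have "1 / (1 + z) powr \<nu> \<le> 1 / 1" by (intro divide_left_mono) auto
        ultimately show "A z * Y z \<le> 1" by simp
        show "M * (1 - Y z) \<le> M * (2 * m * z)" by (intro mult_left_mono Y_low z M0)
      qed (use M0 X[OF z] in auto)
      finally show "\<bar>b z\<bar> \<le> (2 * M * m) * z" by simp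
    next
      obtain t where t: "0 < t" "t < 1" "u t > 0" using u(4) by auto
      then show "\<exists>z. 0 < z \<and> z < 1 \<and> b z > 0"
        using Z_bounds[OF t(1,2)] by (intro exI[of _ "Z t"]) (auto simp: b_def A_def)
    next
      obtain t where t: "0 < t" "t < 1" "u t < 0" using u(5) by auto
      then show "\<exists>z. 0 < z \<and> z < 1 \<and> b z < 0"
        using Z_bounds[OF t(1,2)] by (intro exI[of _ "Z t"]) (auto simp: b_def A_def mult_pos_neg)
    qed
  qed
qed

text \<open>The estimate of \<open>b\<close> by a multiple of \<open>z\<close> says that
  \<open>f\<close> is bounded. This excludes the singular solutions at both ends, so the flux
  argument bounds f', and the equation itself then bounds \<open>s * (1 - s)\<close> times
  f''.\<close>

lemma exists_profile:
  obtains f f1 f2 :: "real \<Rightarrow> real" and F :: real where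
    "\<And>s. 0 < s \<Longrightarrow> s < 1 \<Longrightarrow> (f has_real_derivative f1 s) (at s)"
    "\<And>s. 0 < s \<Longrightarrow> s < 1 \<Longrightarrow> (f1 has_real_derivative f2 s) (at s)"
    "continuous_on {0<..<1} f2"
    "\<And>s. 0 < s \<Longrightarrow> s < 1 \<Longrightarrow> \<bar>f s\<bar> \<le> F"
    "\<And>s. 0 < s \<Longrightarrow> s < 1 \<Longrightarrow> \<bar>f1 s\<bar> \<le> F"
    "\<And>s. 0 < s \<Longrightarrow> s < 1 \<Longrightarrow> s * (1 - s) * \<bar>f2 s\<bar> \<le> F"
    "\<And>s. 0 < s \<Longrightarrow> s < 1 \<Longrightarrow>
       4 * (s * (1 - s) * f2 s) + (6 - 2 * (n + 1) * s) * f1 s - c * f s = - c * (\<bar>f s\<bar> powr (p - 2) * f s)"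
    "\<exists>s. 0 < s \<and> s < 1 \<and> f s > 0" "\<exists>s. 0 < s \<and> s < 1 \<and> f s < 0"
proof (rule exists_b, goal_cases)
  case (1 b b1 K)
  note b = 1(2-)
  define f where "f s = b (sqrt s) / sqrt s" for s
  define w where "w s = \<bar>f s\<bar> powr (p - 2)" for s
  define f1 where "f1 s = (b1 (sqrt s) - f s) / (2 * s)" for s
  \<comment> \<open>Defined by solving the equation for f''; the work is to show that it is the
    derivative of \<open>f1\<close>.\<close>
  define f2 where "f2 s = (c * f s - c * (w s * f s) - (6 - 2 * (n + 1) * s) * f1 s) / (4 * s * (1 - s))" for s
  have c\<nu>: "c = (\<nu> + 1) * (\<nu> + 2)" and n\<nu>: "n = 2 * \<nu> + 4" by (simp_all add: c_def \<nu>_def field_simps)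
  have df: "(f has_real_derivative f1 s) (at s)" and df1: "(f1 has_real_derivative f2 s) (at s)" if s: "0 < s" "s < 1" for s
  proof -
    define z where "z = sqrt s"
    have z: "0 < z" "z < 1" "s = z * z" using s by (auto simp: z_def)
    have sq: "(sqrt has_real_derivative inverse z / 2) (at s)" unfolding z_def by (rule DERIV_real_sqrt[OF s(1)])
    define B2 where "B2 = ((2 * \<nu> + 2) * z * b1 z + \<nu> * (\<nu> + 1) * b z - c * (\<bar>b z / z\<bar> powr (p - 2) * b z)) / (1 - z\<^sup>2)"
    have c1: "((\<lambda>s. b (sqrt s)) has_real_derivative b1 z * (inverse z / 2)) (at s)"
      by (rule DERIV_chain2[where f = b and g = sqrt, OF _ sq]) (use b(1)[OF z(1,2)] in \<open>simp add: z_def\<close>)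
    have c2: "((\<lambda>s. b1 (sqrt s)) has_real_derivative B2 * (inverse z / 2)) (at s)"
      by (rule DERIV_chain2[where f = b1 and g = sqrt, OF _ sq]) (use b(2)[OF z(1,2)] in \<open>simp add: z_def B2_def\<close>)
    have "(f has_real_derivative (b1 z * (inverse z / 2) * z - b z * (inverse z / 2)) / (z * z)) (at s)"
      unfolding f_def[abs_def] using DERIV_divide[OF c1 sq] s by (simp add: z_def)
    moreover have "(b1 z * (inverse z / 2) * z - b z * (inverse z / 2)) / (z * z) = f1 s"
      unfolding f1_def f_def z_def[symmetric] z(3) using z(1) by (simp add: field_simps)
    ultimately show d: "(f has_real_derivative f1 s) (at s)" by simp
    have two: "((\<lambda>s. 2 * s) has_real_derivative 2) (at s)" by (auto intro!: derivative_eq_intros)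
    have "(f1 has_real_derivative ((B2 * (inverse z / 2) - f1 s) * (2 * s) - (b1 z - f s) * 2) / ((2 * s) * (2 * s))) (at s)"
      unfolding f1_def[abs_def] using DERIV_divide[OF DERIV_diff[OF c2 d] two] s by (simp add: z_def f1_def)
    moreover have "((B2 * (inverse z / 2) - f1 s) * (2 * s) - (b1 z - f s) * 2) / ((2 * s) * (2 * s)) = f2 s"
    proof -
      define g W where "g = f1 s" and "W = c * w s"
      have e: "b z = z * f s" "b1 z = f s + 2 * s * g" using z(1) s(1)
        by (simp_all add: f_def g_def f1_def z_def[symmetric])
      have ab: "\<bar>b z / z\<bar> = \<bar>f s\<bar>" by (simp add: f_def z_def)
      have B2: "B2 = ((2 * \<nu> + 2) * z * (f s + 2 * s * g) + \<nu> * (\<nu> + 1) * (z * f s) - W * (z * f s)) / (1 - s)"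
        unfolding B2_def ab w_def[symmetric] unfolding e W_def power2_eq_square z(3)[symmetric] by (simp only: mult.assoc)
      have F2: "f2 s = ((\<nu> + 1) * (\<nu> + 2) * f s - W * f s - (6 - 2 * (2 * \<nu> + 4 + 1) * s) * g) / (4 * s * (1 - s))"
        unfolding f2_def g_def W_def n\<nu>[symmetric] c\<nu>[symmetric] by (simp only: mult.assoc)
      have nz: "1 - z * z \<noteq> 0" "z \<noteq> 0" using z s by auto
      show ?thesis unfolding F2 g_def[symmetric] B2 e(2)
        by (rule profile_equation_identity[OF nz, unfolded z(3)[symmetric]])
    qed
    ultimately show "(f1 has_real_derivative f2 s) (at s)" by simp
  qed
  have fb: "\<bar>f s\<bar> \<le> K" if s: "0 < s" "s < 1" for s
    unfolding f_def using b(3)[of "sqrt s"] s by (simp add: abs_divide divide_le_eq)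
  have K0: "K \<ge> 0" using fb[of "1/2"] by simp
  define R where "R = K powr (p - 2) * K"
  have wf: "\<bar>w s * f s\<bar> \<le> R" if s: "0 < s" "s < 1" for s
    unfolding w_def R_def abs_mult using fb[OF s] K0 p_gt powr_mono2[of "p - 2" "\<bar>f s\<bar>" K]
    by (intro mult_mono) auto
  have ode: "4 * (s * (1 - s) * f2 s) = c * f s - c * (w s * f s) - (6 - 2 * (n + 1) * s) * f1 s" if "0 < s" "s < 1" for s
  proof -
    have nz: "4 * s * (1 - s) \<noteq> 0" using that by simp
    have "4 * (s * (1 - s) * f2 s) = (4 * s * (1 - s)) * f2 s" by (simp only: mult.assoc)
    also have "\<dots> = c * f s - c * (w s * f s) - (6 - 2 * (n + 1) * s) * f1 s"
      unfolding f2_def by (simp only: times_divide_eq_right nonzero_mult_div_cancel_left[OF nz])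
    finally show ?thesis .
  qed
  have fc: "continuous_on {0<..<1} f" "continuous_on {0<..<1} f1"
    using DERIV_isCont[OF df] DERIV_isCont[OF df1] by (auto intro!: continuous_at_imp_continuous_on)
  have wc: "continuous_on {0<..<1} w"
    unfolding w_def using p_gt by (intro continuous_on_powr' continuous_intros fc) auto
  have f2c: "continuous_on {0<..<1} f2" unfolding f2_def[abs_def] by (intro continuous_intros fc wc) auto
  \<comment> \<open>The integrating factor \<open>s powr (3/2) * (1 - s) powr \<mu>\<close> puts the
    equation into self-adjoint form: the flux \<open>Mf\<close> has a derivative \<open>M1\<close>
    that contains no f' any more.\<close>
  define \<mu> where "\<mu> = n / 2 - 1"
  have l: "\<mu> \<ge> 3/2" using n5 by (simp add: \<mu>_def)
  define Mf where "Mf s = s powr (3/2) * (1 - s) powr \<mu> * f1 s" for s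
  define M1 where "M1 s = s powr (1/2) * (1 - s) powr (\<mu> - 1) * ((c * f s - c * (w s * f s)) / 4)" for s
  define C where "C = (c * K + c * R) / 4"
  have C0: "C \<ge> 0" unfolding C_def R_def using c_pos K0 by simp
  have dM: "(Mf has_real_derivative M1 s) (at s)" if s: "0 < s" "s < 1" for s
  proof -
    define e g where "e = s powr (1/2)" and "g = (1 - s) powr (\<mu> - 1)"
    have e: "s powr (3/2) = s * e"
      using s powr_add[of s 1 "1/2"] by (simp add: e_def)
    have g: "(1 - s) powr \<mu> = (1 - s) * g"
      using s powr_add[of "1 - s" 1 "\<mu> - 1"] by (simp add: g_def)
    have 1: "((\<lambda>s. s powr (3/2)) has_real_derivative 3/2 * e) (at s)"
      using has_real_derivative_powr[OF s(1), of "3/2"] by (simp add: e_def)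
    have 2: "((\<lambda>s. (1 - s) powr \<mu>) has_real_derivative \<mu> * g * (- 1)) (at s)"
      unfolding g_def by (rule DERIV_chain2[OF has_real_derivative_powr]) (use s in \<open>auto intro!: derivative_eq_intros\<close>)
    have "(Mf has_real_derivative (3/2 * e * (1 - s) powr \<mu> + \<mu> * g * (- 1) * s powr (3/2)) * f1 s + f2 s * (s powr (3/2) * (1 - s) powr \<mu>)) (at s)"
      unfolding Mf_def[abs_def] by (rule DERIV_mult[OF DERIV_mult[OF 1 2] df1[OF s]])
    moreover have "(3/2 * e * (1 - s) powr \<mu> + \<mu> * g * (- 1) * s powr (3/2)) * f1 s + f2 s * (s powr (3/2) * (1 - s) powr \<mu>)
        = e * g * ((6 - 2 * (n + 1) * s) * f1 s + 4 * (s * (1 - s) * f2 s)) / 4"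
      unfolding e g unfolding \<mu>_def by (simp add: field_simps)
    moreover have "(6 - 2 * (n + 1) * s) * f1 s + 4 * (s * (1 - s) * f2 s) = c * f s - c * (w s * f s)"
      unfolding ode[OF s] by simp
    ultimately have "(Mf has_real_derivative e * g * (c * f s - c * (w s * f s)) / 4) (at s)" by (simp only:)
    then show ?thesis unfolding M1_def e_def[symmetric] g_def[symmetric] by (simp only: times_divide_eq_right)
  qed
  have src: "\<bar>(c * f s - c * (w s * f s)) / 4\<bar> \<le> C" if s: "0 < s" "s < 1" for s
  proof -
    have "\<bar>c * f s\<bar> \<le> c * K" "\<bar>c * (w s * f s)\<bar> \<le> c * R"
      using fb[OF s] wf[OF s] c_pos by (auto simp: abs_mult)
    then have "\<bar>c * f s - c * (w s * f s)\<bar> \<le> c * K + c * R"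
      by (rule order_trans[OF abs_triangle_ineq4 add_mono])
    then have "\<bar>c * f s - c * (w s * f s)\<bar> / 4 \<le> (c * K + c * R) / 4" by (rule divide_right_mono) simp
    then show ?thesis unfolding C_def abs_divide by simp
  qed
  have pw1: "t powr r \<le> 1" if "0 < t" "t < 1" "r \<ge> 0" for t r :: real using that by (intro powr_le1) auto
  have pw2: "1 \<le> 4 powr r * t powr r" if "1/4 \<le> t" "r \<ge> 0" for t r :: real
  proof -
    have "1 \<le> (4 * t) powr r" using that by (intro ge_one_powr_ge_zero) auto
    then show ?thesis using that by (simp add: powr_mult)
  qed
  \<comment> \<open>Each end is treated on three quarters of the interval, so the two ranges cover
    it. At distance at least 1/4 from the other end, the factor belonging to that end costs at most
    a power of 4.\<close>
  have near0: "\<bar>f1 y\<bar> \<le> 4 powr \<mu> * (2 * C / (3/2))" if "0 < y" "y < 3/4" for y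
  proof (rule derivative_bounded_of_flux[where f = f and M = Mf and ?M1.0 = M1 and b = "3/4" and ?F0.0 = K, OF _ _ _ _ _ _ _ _ _ _ _ C0 that])
    fix y :: real assume "0 < y" "y < 3/4"
    then have y: "0 < y" "y < 1" "y < 3/4" by auto
    show "(f has_real_derivative f1 y) (at y)" "(Mf has_real_derivative M1 y) (at y)" "\<bar>f y\<bar> \<le> K"
      using df dM fb y by auto
    have "\<bar>M1 y\<bar> \<le> y powr (1/2) * 1 * C"
      unfolding M1_def abs_mult using y l by (intro mult_mono src pw1) (auto simp: pw1)
    then show "\<bar>M1 y\<bar> \<le> C * y powr (3/2 - 1)" by (simp add: mult_ac)
    have "(1 - y) powr \<mu> \<le> 1" using y l by (intro pw1) auto
    moreover have "1 \<le> 4 powr \<mu>" using l by (intro ge_one_powr_ge_zero) auto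
    ultimately have "(1 - y) powr \<mu> * (y powr (3/2) * \<bar>f1 y\<bar>) \<le> 4 powr \<mu> * (y powr (3/2) * \<bar>f1 y\<bar>)"
      by (intro mult_right_mono) auto
    then show "\<bar>Mf y\<bar> \<le> 4 powr \<mu> * y powr (3/2) * \<bar>f1 y\<bar>" unfolding Mf_def abs_mult by (simp add: mult_ac)
    have "1 * (y powr (3/2) * \<bar>f1 y\<bar>) \<le> (4 powr \<mu> * (1 - y) powr \<mu>) * (y powr (3/2) * \<bar>f1 y\<bar>)"
      using y l by (intro mult_right_mono pw2) auto
    then show "y powr (3/2) * \<bar>f1 y\<bar> \<le> 4 powr \<mu> * \<bar>Mf y\<bar>" unfolding Mf_def abs_mult by (simp add: mult_ac)
    have "Mf y * f1 y = y powr (3/2) * (1 - y) powr \<mu> * (f1 y * f1 y)" by (simp add: Mf_def)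
    then show "Mf y * f1 y \<ge> 0" by (simp only:) (rule mult_nonneg_nonneg; simp)
  qed auto
  \<comment> \<open>After reflection the function is \<open>f (1 - y)\<close> with derivative
    \<open>- f1 (1 - y)\<close>, so the flux changes sign too and its derivative is
    \<open>M1 (1 - y)\<close>.\<close>
  have near1: "\<bar>- f1 (1 - y)\<bar> \<le> 4 powr (3/2) * (2 * C / \<mu>)" if "0 < y" "y < 3/4" for y
  proof (rule derivative_bounded_of_flux[where f = "\<lambda>y. f (1 - y)" and M = "\<lambda>y. - Mf (1 - y)" and ?M1.0 = "\<lambda>y. M1 (1 - y)" and b = "3/4" and ?F0.0 = K,
        OF _ _ _ _ _ _ _ _ _ _ _ C0 that])
    fix y :: real assume "0 < y" "y < 3/4"
    then have y: "0 < 1 - y" "1 - y < 1" "1/4 < 1 - y" "0 < y" "y < 1" by auto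
    have d: "((\<lambda>y. 1 - y) has_real_derivative - 1) (at y)" by (auto intro!: derivative_eq_intros)
    show "((\<lambda>y. f (1 - y)) has_real_derivative - f1 (1 - y)) (at y)" using DERIV_chain2[OF df[OF y(1,2)] d] by simp
    show "((\<lambda>y. - Mf (1 - y)) has_real_derivative M1 (1 - y)) (at y)" using DERIV_minus[OF DERIV_chain2[OF dM[OF y(1,2)] d]] by simp
    show "\<bar>f (1 - y)\<bar> \<le> K" by (rule fb[OF y(1,2)])
    have "\<bar>M1 (1 - y)\<bar> \<le> 1 * (1 - (1 - y)) powr (\<mu> - 1) * C"
      unfolding M1_def abs_mult using y l by (intro mult_mono src pw1) (auto simp: pw1)
    then show "\<bar>M1 (1 - y)\<bar> \<le> C * y powr (\<mu> - 1)" by (simp add: mult_ac)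
    have "(1 - y) powr (3/2) \<le> 1" using y by (intro pw1) auto
    moreover have "1 \<le> 4 powr (3/2 :: real)" by (intro ge_one_powr_ge_zero) auto
    ultimately have "(1 - y) powr (3/2) * (y powr \<mu> * \<bar>f1 (1 - y)\<bar>) \<le> 4 powr (3/2) * (y powr \<mu> * \<bar>f1 (1 - y)\<bar>)"
      by (intro mult_right_mono) auto
    then show "\<bar>- Mf (1 - y)\<bar> \<le> 4 powr (3/2) * y powr \<mu> * \<bar>- f1 (1 - y)\<bar>" unfolding Mf_def abs_mult abs_minus_cancel by (simp add: mult_ac)
    have "1 * (y powr \<mu> * \<bar>f1 (1 - y)\<bar>) \<le> (4 powr (3/2) * (1 - y) powr (3/2)) * (y powr \<mu> * \<bar>f1 (1 - y)\<bar>)"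
      using y by (intro mult_right_mono pw2) auto
    then show "y powr \<mu> * \<bar>- f1 (1 - y)\<bar> \<le> 4 powr (3/2) * \<bar>- Mf (1 - y)\<bar>" unfolding Mf_def abs_mult abs_minus_cancel by (simp add: mult_ac)
    have "- Mf (1 - y) * - f1 (1 - y) = (1 - y) powr (3/2) * y powr \<mu> * (f1 (1 - y) * f1 (1 - y))" by (simp add: Mf_def)
    then show "- Mf (1 - y) * - f1 (1 - y) \<ge> 0" by (simp only:) (rule mult_nonneg_nonneg; simp)
  qed (use l in auto)
  define F1 where "F1 = 4 powr \<mu> * (2 * C / (3/2)) + 4 powr (3/2) * (2 * C / \<mu>)"
  have f1b: "\<bar>f1 s\<bar> \<le> F1" if s: "0 < s" "s < 1" for s
  proof -
    have nn: "0 \<le> 4 powr \<mu> * (2 * C / (3/2))" "0 \<le> 4 powr (3/2) * (2 * C / \<mu>)" using C0 l by auto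
    show ?thesis
    proof (cases "s < 3/4")
      case True
      then show ?thesis using near0[OF s(1) True] nn unfolding F1_def by linarith
    next
      case False
      have "\<bar>- f1 (1 - (1 - s))\<bar> \<le> 4 powr (3/2) * (2 * C / \<mu>)" by (rule near1) (use s False in auto)
      then have "\<bar>f1 s\<bar> \<le> 4 powr (3/2) * (2 * C / \<mu>)" by simp
      then show ?thesis using nn unfolding F1_def by linarith
    qed
  qed
  have F10: "F1 \<ge> 0" using f1b[of "1/2"] by simp
  define F where "F = K + F1 + C + (6 + 2 * (n + 1)) * F1"
  have f2b: "s * (1 - s) * \<bar>f2 s\<bar> \<le> F" if s: "0 < s" "s < 1" for s
  proof -
    have "(n + 1) * s \<le> (n + 1) * 1" "(n + 1) * s \<ge> 0" using n5 s by (auto intro!: mult_left_mono)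
    moreover have "6 - 2 * (n + 1) * s = 6 - 2 * ((n + 1) * s)" by simp
    ultimately have "\<bar>6 - 2 * (n + 1) * s\<bar> \<le> 6 + 2 * (n + 1)" using n5 unfolding abs_le_iff by linarith
    then have "\<bar>(6 - 2 * (n + 1) * s) * f1 s\<bar> \<le> (6 + 2 * (n + 1)) * F1"
      unfolding abs_mult using f1b[OF s] n5 by (intro mult_mono) auto
    moreover have "(6 + 2 * (n + 1)) * F1 \<ge> 0" using n5 F10 by simp
    moreover have "\<bar>X\<bar> \<le> K + F1 + C + P" if "\<bar>T\<bar> \<le> P" "0 \<le> P" "\<bar>W / 4\<bar> \<le> C" "4 * X = W - T" for X T W P :: real
      using that K0 F10 unfolding abs_le_iff by linarith
    ultimately have "\<bar>s * (1 - s) * f2 s\<bar> \<le> F" unfolding F_def using src[OF s] ode[OF s] by blast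
    then show ?thesis using s by (simp add: abs_mult)
  qed
  show ?case
  proof (rule 1(1)[OF _ _ f2c])
    have nn: "(6 + 2 * (n + 1)) * F1 \<ge> 0" using n5 F10 by simp
    fix s :: real assume s: "0 < s" "s < 1"
    show "(f has_real_derivative f1 s) (at s)" "(f1 has_real_derivative f2 s) (at s)" "s * (1 - s) * \<bar>f2 s\<bar> \<le> F"
      by (rule df[OF s], rule df1[OF s], rule f2b[OF s])
    show "\<bar>f s\<bar> \<le> F" unfolding F_def using fb[OF s] F10 C0 nn by linarith
    show "\<bar>f1 s\<bar> \<le> F" unfolding F_def using f1b[OF s] K0 C0 nn by linarith
    show "4 * (s * (1 - s) * f2 s) + (6 - 2 * (n + 1) * s) * f1 s - c * f s = - c * (\<bar>f s\<bar> powr (p - 2) * f s)"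
      unfolding ode[OF s] w_def by simp
  next
    obtain z where z: "0 < z" "z < 1" "b z > 0" using b(4) by auto
    then show "\<exists>s. 0 < s \<and> s < 1 \<and> f s > 0"
      by (intro exI[of _ "z\<^sup>2"]) (auto simp: f_def power_less_one_iff)
  next
    obtain z where z: "0 < z" "z < 1" "b z < 0" using b(5) by auto
    then show "\<exists>s. 0 < s \<and> s < 1 \<and> f s < 0"
      by (intro exI[of _ "z\<^sup>2"]) (auto simp: f_def power_less_one_iff divide_neg_pos)
  qed
qed

lemma exists_profile_extended:
  obtains f f1 f2 :: "real \<Rightarrow> real" and F :: real where
    "\<And>s. 0 < s \<Longrightarrow> s < 1 \<Longrightarrow> (f has_real_derivative f1 s) (at s)"
    "\<And>s. 0 < s \<Longrightarrow> s < 1 \<Longrightarrow> (f1 has_real_derivative f2 s) (at s)"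
    "continuous_on {0<..<1} f2"
    "\<And>s. 0 < s \<Longrightarrow> s < 1 \<Longrightarrow> \<bar>f s\<bar> \<le> F"
    "\<And>s. 0 < s \<Longrightarrow> s < 1 \<Longrightarrow> \<bar>f1 s\<bar> \<le> F"
    "\<And>s. 0 < s \<Longrightarrow> s < 1 \<Longrightarrow> s * (1 - s) * \<bar>f2 s\<bar> \<le> F"
    "\<And>s. 0 < s \<Longrightarrow> s < 1 \<Longrightarrow>
       4 * (s * (1 - s) * f2 s) + (6 - 2 * (n + 1) * s) * f1 s - c * f s = - c * (\<bar>f s\<bar> powr (p - 2) * f s)"
    "\<exists>s. 0 < s \<and> s < 1 \<and> f s > 0" "\<exists>s. 0 < s \<and> s < 1 \<and> f s < 0"
    "\<And>s. s \<notin> {0<..<1} \<Longrightarrow> f s = 0" "\<And>s. s \<notin> {0<..<1} \<Longrightarrow> f1 s = 0" "\<And>s. s \<notin> {0<..<1} \<Longrightarrow> f2 s = 0"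
proof (rule exists_profile, goal_cases)
  case (1 f f1 f2 F)
  note f = 1(2-)
  define e where "e h s = (if 0 < s \<and> s < 1 then h s else 0)" for h :: "real \<Rightarrow> real" and s :: real
  have e1: "e h s = h s" if "0 < s" "s < 1" for h s using that by (simp add: e_def)
  have e0: "e h s = 0" if "s \<notin> {0<..<1}" for h s using that by (auto simp: e_def)
  have d: "(e g has_real_derivative e g' s) (at s)" if "0 < s" "s < 1" "(g has_real_derivative g' s) (at s)" for g g' s
    unfolding e1[OF that(1,2)]
    by (rule has_field_derivative_transform_within_open[OF that(3), of "{0<..<1}"]) (use that e1 in auto)
  show ?case
  proof (rule 1(1)[of "e f" "e f1" "e f2" F])
    show "continuous_on {0<..<1} (e f2)" using f(3) by (rule continuous_on_eq) (simp add: e1)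
    show "\<exists>s. 0 < s \<and> s < 1 \<and> e f s > 0" "\<exists>s. 0 < s \<and> s < 1 \<and> e f s < 0"
      using f(8,9) e1 by metis+
    fix s :: real assume s: "0 < s" "s < 1"
    show "(e f has_real_derivative e f1 s) (at s)" "(e f1 has_real_derivative e f2 s) (at s)"
      by (rule d[where g = f and g' = f1, OF s f(1)[OF s]], rule d[where g = f1 and g' = f2, OF s f(2)[OF s]])
  qed (use f(4-7) in \<open>auto simp: e1 intro!: e0\<close>)
qed

end

text \<open>Completeness of Lebesgue measure. \<open>weak_grad\<close> is an arbitrary choice, and
  its measurability on the half-space is inherited from a gradient equal to it almost
  everywhere.\<close>

lemma borel_measurable_AE_eq:
  fixes f g :: "'a::euclidean_space \<Rightarrow> 'b::euclidean_space"
  assumes S: "S \<in> sets lebesgue" and g: "g \<in> borel_measurable (lebesgue_on S)"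
    and ae: "AE x in lebesgue_on S. f x = g x"
  shows "f \<in> borel_measurable (lebesgue_on S)"
proof (rule measurableI)
  fix A :: "'b set" assume A: "A \<in> sets borel"
  have "AE x in lebesgue. x \<in> S \<longrightarrow> f x = g x" using ae S by (subst (asm) AE_restrict_space_iff) auto
  then obtain K where K: "K \<in> null_sets lebesgue" "{x \<in> space lebesgue. \<not> (x \<in> S \<longrightarrow> f x = g x)} \<subseteq> K"
    unfolding eventually_ae_filter by blast
  have neg: "negligible T" if "T \<subseteq> {x \<in> S. f x \<noteq> g x}" for T
    using negligible_subset[of K T] K that by (auto simp: negligible_iff_null_sets)
  have ns: "T \<in> sets lebesgue" if "T \<subseteq> {x \<in> S. f x \<noteq> g x}" for T
    using neg[OF that] by (simp add: negligible_imp_sets)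
  have "g -` A \<inter> space (lebesgue_on S) \<in> sets (lebesgue_on S)" by (rule measurable_sets[OF g A])
  then have gA: "g -` A \<inter> S \<in> sets lebesgue" using S by (simp add: sets_restrict_space_iff)
  have "f -` A \<inter> S = (g -` A \<inter> S - {x \<in> S. f x \<noteq> g x}) \<union> (f -` A \<inter> {x \<in> S. f x \<noteq> g x})" by auto
  also have "\<dots> \<in> sets lebesgue" by (intro sets.Un sets.Diff gA ns) auto
  finally show "f -` A \<inter> space (lebesgue_on S) \<in> sets (lebesgue_on S)" using S by (simp add: sets_restrict_space_iff)
qed simp

section \<open>Sign change, decay, and infinitely many solutions\<close>

context profile
begin

text \<open>The preimage of an open set under the continuous map \<open>\<sigma>\<close> is open in
  the half-space, so one point in it makes it a set of positive measure.\<close>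

lemma sigma_attains:
  assumes W: "open W0" "s \<in> W0" and s: "0 < s" "s < 1"
  shows "\<not> (AE x in M. \<sigma> x \<notin> W0)"
proof
  assume "AE x in M. \<sigma> x \<notin> W0"
  then have "AE x in lebesgue. x \<in> H \<longrightarrow> \<sigma> x \<notin> W0" using H_sets by (subst (asm) AE_restrict_space_iff) auto
  then obtain K where K: "K \<in> null_sets lebesgue" "{x \<in> space lebesgue. \<not> (x \<in> H \<longrightarrow> \<sigma> x \<notin> W0)} \<subseteq> K"
    unfolding eventually_ae_filter by blast
  have neg: "negligible (H \<inter> \<sigma> -` W0)"
    using negligible_subset[of K "H \<inter> \<sigma> -` W0"] K by (auto simp: negligible_iff_null_sets)
  have op: "open (H \<inter> \<sigma> -` W0)"
    by (intro open_Int H_open open_vimage W(1) smooth_continuous[OF smooth_sigma])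
  obtain b where b: "b \<in> B" using B(3) by fastforce
  have bb: "b \<bullet> b = 1" "en \<bullet> en = 1" "b \<bullet> en = 0" "en \<bullet> b = 0"
    using b B en by (auto simp: inner_Basis)
  \<comment> \<open>At distance 1 from \<open>a\<close> one has \<open>D x = 2\<close>, so
    \<open>\<sigma> x\<close> equals \<open>Q x\<close>, and the component \<open>sqrt s\<close>
    along \<open>b\<close> prescribes its value; the rest of the unit vector points into the
    half-space.\<close>
  define x where "x = a + (sqrt s *\<^sub>R b + sqrt (1 - s) *\<^sub>R en)"
  have xa: "x - a = sqrt s *\<^sub>R b + sqrt (1 - s) *\<^sub>R en" by (simp add: x_def)
  have D2: "D x = 2"
    unfolding D_def xa power2_norm_eq_inner using s by (simp add: inner_add_left inner_add_right bb)
  have "Q x = (\<Sum>b'\<in>B. if b' = b then s else 0)"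
    unfolding Q_def
  proof (rule sum.cong)
    fix b' assume b': "b' \<in> B"
    have "b \<bullet> b' = (if b' = b then 1 else 0)" "en \<bullet> b' = 0"
      using inner_Basis[of b b'] inner_Basis[of en b'] subsetD[OF B(1) b] subsetD[OF B(1) b'] b' B(2) en by auto
    then show "((x - a) \<bullet> b')\<^sup>2 = (if b' = b then s else 0)"
      unfolding xa using s by (simp add: inner_add_left)
  qed simp
  then have "Q x = s" using b finB by (simp add: sum.delta)
  then have "\<sigma> x = s" unfolding \<sigma>_def D2 by simp
  moreover have "x \<in> H" unfolding H_def x_def using s by (simp add: inner_add_left a_en bb)
  ultimately have "x \<in> H \<inter> \<sigma> -` W0" using W(2) by simp
  then show False using neg op open_not_negligible by blast
qed

end

context bounded_profile
begin

lemma weak_equation: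
  fixes v :: "'a \<Rightarrow> real" and G :: "'a \<Rightarrow> 'a"
  assumes w: "is_weak_gradient H v G" and v: "v \<in> Lr (2 * n / (n - 2)) H" and G: "G \<in> Lr 2 H"
    and eq: "\<And>s. 0 < s \<Longrightarrow> s < 1 \<Longrightarrow> L f f1 f2 s = - (n * (n - 2) / 4) * (\<bar>f s\<bar> powr (2 * n / (n - 2) - 2) * f s)"
  shows "(\<integral>x. Gr f f1 x \<bullet> G x \<partial>M) = n * (n - 2) * (\<integral>x. \<bar>U f x\<bar> powr (2 * n / (n - 2) - 2) * U f x * v x \<partial>M)"
proof -
  define r where "r = 2 * n / (n - 2) - 2"
  \<comment> \<open>Criticality of the exponent: the nonlinearity produces the same power of
    \<open>D x\<close> as the conformal Laplacian.\<close>
  have Nr: "N * r = 2" using n5 by (simp add: N_def r_def field_simps)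
  have vm: "v \<in> borel_measurable M" using v unfolding Lr_def by auto
  have um: "U f \<in> borel_measurable M" by (rule H_measurable_borel[OF U_borel])
  have lm: "Lap f f1 f2 \<in> borel_measurable M" by (rule H_measurable_borel[OF Lap_borel])
  have pt: "Lap f f1 f2 x = - (n * (n - 2)) * (\<bar>U f x\<bar> powr r * U f x)" if s: "0 < \<sigma> x" "\<sigma> x < 1" for x
  proof -
    have "\<bar>U f x\<bar> powr r = (D x powr (- N)) powr r * \<bar>f (\<sigma> x)\<bar> powr r"
      unfolding U_def abs_mult using D_pos[of x] by (simp add: powr_mult)
    also have "(D x powr (- N)) powr r = D x powr (- 2)" unfolding powr_powr using Nr by simp
    finally have "\<bar>U f x\<bar> powr r * U f x = (D x powr (- 2) * D x powr (- N)) * (\<bar>f (\<sigma> x)\<bar> powr r * f (\<sigma> x))"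
      unfolding U_def by simp
    also have "D x powr (- 2) * D x powr (- N) = D x powr (- N - 2)"
      unfolding powr_add[symmetric] by (rule arg_cong[where f = "\<lambda>t. D x powr t"]) simp
    finally show ?thesis unfolding Lap_def eq[OF s] r_def[symmetric] by simp
  qed
  have "(\<integral>x. v x * Lap f f1 f2 x \<partial>M) = (\<integral>x. - (n * (n - 2)) * (\<bar>U f x\<bar> powr r * U f x * v x) \<partial>M)"
  proof (rule integral_cong_AE)
    show "AE x in M. v x * Lap f f1 f2 x = - (n * (n - 2)) * (\<bar>U f x\<bar> powr r * U f x * v x)"
      using AE_sigma by eventually_elim (simp add: pt)
  qed (use vm um lm in measurable)
  then show ?thesis unfolding integration_by_parts[OF w v G] r_def[symmetric] by simp
qed

text \<open>The true rate is \<open>D x powr (- N)\<close>; since \<open>N \<ge> 1\<close>, the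
  first power is a cruder bound. What matters is that \<open>F\<close> comes from the profile and is
  the same for every centre \<open>a\<close>.\<close>

lemma U_decay: "\<bar>U f x\<bar> * (1 + (norm (x - a))\<^sup>2) \<le> F"
proof -
  have "\<bar>U f x\<bar> \<le> D x powr (- N) * F" by (rule U_bound[OF f_bound'(1)])
  also have "\<dots> \<le> D x powr (- 1) * F" using D_ge_1[of x] N_pos F_nonneg by (intro mult_right_mono powr_mono) auto
  also have "\<dots> = F / D x" using D_pos[of x] by (simp add: powr_minus divide_inverse)
  finally show ?thesis unfolding D_def[symmetric] using D_pos[of x] by (simp add: pos_le_divide_eq)
qed

lemma U_changes_sign:
  assumes pos: "\<exists>s. 0 < s \<and> s < 1 \<and> f s > 0" and neg: "\<exists>s. 0 < s \<and> s < 1 \<and> f s < 0"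
  shows "\<not> (AE x in M. max (U f x) 0 = 0)" "\<not> (AE x in M. min (U f x) 0 = 0)"
proof -
  have c: "continuous_on {0<..<1} f"
    using DERIV_isCont[OF f_deriv(1)] by (auto intro!: continuous_at_imp_continuous_on)
  have sgn: "U f x > 0 \<longleftrightarrow> f (\<sigma> x) > 0" "U f x < 0 \<longleftrightarrow> f (\<sigma> x) < 0" for x
    unfolding U_def using D_pos[of x] by (auto simp: zero_less_mult_iff mult_less_0_iff)
  have op: "open ({0<..<1} \<inter> f -` {0<..})" "open ({0<..<1} \<inter> f -` {..<0})"
    by (intro continuous_open_preimage c open_greaterThanLessThan open_greaterThan open_lessThan)+
  show "\<not> (AE x in M. max (U f x) 0 = 0)"
  proof
    assume "AE x in M. max (U f x) 0 = 0"
    then have "AE x in M. \<sigma> x \<notin> {0<..<1} \<inter> f -` {0<..}" 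
    proof eventually_elim
      case (elim x)
      then have "\<not> 0 < U f x" by (metis max.cobounded1 not_less)
      then show ?case using sgn(1)[of x] by auto
    qed
    then show False using sigma_attains[OF op(1)] pos by auto
  qed
  show "\<not> (AE x in M. min (U f x) 0 = 0)"
  proof
    assume "AE x in M. min (U f x) 0 = 0"
    then have "AE x in M. \<sigma> x \<notin> {0<..<1} \<inter> f -` {..<0}" 
    proof eventually_elim
      case (elim x)
      then have "\<not> U f x < 0" by (metis min.cobounded1 not_less)
      then show ?case using sgn(2)[of x] by auto
    qed
    then show False using sigma_attains[OF op(2)] neg by auto
  qed
qed

end

lemma is_weak_gradient_weak_grad:
  assumes "is_weak_gradient half_space u G"
  shows "is_weak_gradient half_space u (weak_grad u)"
  unfolding weak_grad_def using assms by (rule someI[of "is_weak_gradient half_space u"])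

lemma exists_solution:
  fixes a :: "('m::finite) rn"
  assumes bp: "bounded_profile a (0, 1) B f f1 f2 F"
    and eq: "\<And>s. 0 < s \<Longrightarrow> s < 1 \<Longrightarrow> 4 * (s * (1 - s) * f2 s) + (6 - 2 * (real DIM('m rn) + 1) * s) * f1 s
        - real DIM('m rn) * (real DIM('m rn) - 2) / 4 * f s
        = - (real DIM('m rn) * (real DIM('m rn) - 2) / 4) * (\<bar>f s\<bar> powr (2 * real DIM('m rn) / (real DIM('m rn) - 2) - 2) * f s)"
    and pos: "\<exists>s. 0 < s \<and> s < 1 \<and> f s > 0" and neg: "\<exists>s. 0 < s \<and> s < 1 \<and> f s < 0"
  shows "\<exists>u. is_solution 0 u \<and> sign_changing u \<and> (\<forall>x. \<bar>u x\<bar> * (1 + (norm (x - a))\<^sup>2) \<le> F)"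
proof -
  interpret bounded_profile a "(0, 1)" B f f1 f2 F by (rule bp)
  have Hh: "H = half_space" unfolding H_def half_space_def by (auto simp: inner_prod_def)
  have pn: "p_exp DIM('m rn) = 2 * n / (n - 2)" and an: "a_const DIM('m rn) = n * (n - 2)"
    unfolding p_exp_def a_const_def n_def by simp_all
  have eqL: "L f f1 f2 s = - (n * (n - 2) / 4) * (\<bar>f s\<bar> powr (2 * n / (n - 2) - 2) * f s)" if "0 < s" "s < 1" for s
    unfolding L_def n_def by (rule eq[OF that])
  have wU: "is_weak_gradient half_space (U f) (Gr f f1)" using weak_gradient_U unfolding Hh .
  have UD: "U f \<in> D12" unfolding D12_def pn using U_Lr Gr_Lr wU unfolding Hh by blast
  \<comment> \<open>Lets both chosen gradients in the weak formulation be replaced by explicit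
    ones.\<close>
  have meas: "weak_grad u \<in> borel_measurable M \<and> (AE x in M. weak_grad u x = G x)"
    if "is_weak_gradient half_space u G" "G \<in> borel_measurable M" for u :: "'m rn \<Rightarrow> real" and G
  proof -
    have ae: "AE x in M. weak_grad u x = G x"
      using weak_gradient_unique[OF H_open, unfolded Hh, OF is_weak_gradient_weak_grad[OF that(1)] that(1)] unfolding Hh .
    from borel_measurable_AE_eq[OF H_sets that(2) ae] ae show ?thesis by simp
  qed
  have "is_solution 0 (U f)"
    unfolding is_solution_def
  proof (intro conjI UD ballI)
    fix v :: "'m rn \<Rightarrow> real" assume "v \<in> D12"
    then obtain G where v: "v \<in> Lr (2 * n / (n - 2)) H" and G: "G \<in> Lr 2 H" and w: "is_weak_gradient half_space v G"
      unfolding D12_def pn Hh by auto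
    have Gm: "G \<in> borel_measurable M" "Gr f f1 \<in> borel_measurable M" using G Gr_Lr unfolding Lr_def by auto
    note mU = meas[OF wU Gm(2)] and mv = meas[OF w Gm(1)]
    have "(\<integral>x. weak_grad (U f) x \<bullet> weak_grad v x \<partial>M) = (\<integral>x. Gr f f1 x \<bullet> G x \<partial>M)"
    proof (rule integral_cong_AE)
      show "AE x in M. weak_grad (U f) x \<bullet> weak_grad v x = Gr f f1 x \<bullet> G x"
        using mU[THEN conjunct2] mv[THEN conjunct2] by eventually_elim simp
    qed (use mU mv Gm in \<open>auto intro: borel_measurable_inner\<close>)
    also have "\<dots> = n * (n - 2) * (\<integral>x. \<bar>U f x\<bar> powr (2 * n / (n - 2) - 2) * U f x * v x \<partial>M)"
      by (rule weak_equation[OF w[folded Hh] v G eqL])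
    finally show "(\<integral>x. weak_grad (U f) x \<bullet> weak_grad v x \<partial>lebesgue_on half_space) =
          a_const DIM('m rn) *
            (\<integral>x. \<bar>U f x\<bar> powr (p_exp DIM('m rn) - 2) * U f x * v x \<partial>lebesgue_on half_space)
        + 0 * (\<integral>y. \<bar>trace_bd (U f) y\<bar> powr (q_exp DIM('m rn) - 2) * trace_bd (U f) y * trace_bd v y \<partial>lebesgue)"
      unfolding pn an Hh by simp
  qed
  moreover have "sign_changing (U f)"
    unfolding sign_changing_def using U_changes_sign[OF pos neg] unfolding Hh by simp
  ultimately show ?thesis using U_decay by blast
qed

theorem theorem1p2:
  fixes b :: real
  assumes "DIM(('m::finite) rn) \<ge> 5" and "b = 0"
  shows "infinite ({u :: 'm rn \<Rightarrow> real. is_solution b u \<and> sign_changing u} // ae_equal)"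
proof
  assume fin: "finite ({u :: 'm rn \<Rightarrow> real. is_solution b u \<and> sign_changing u} // ae_equal)"
  define n where "n = real DIM('m rn)"
  have n5: "n \<ge> 5" using assms(1) by (simp add: n_def)
  interpret ode: radial_ode n by standard (rule n5)
  obtain e0 :: "real ^ 'm" where e0: "e0 \<in> Basis" using nonempty_Basis by blast
  have "card (Basis :: (real ^ 'm) set) \<ge> 3" using assms(1) by simp
  then obtain B0 :: "(real ^ 'm) set" where B0: "B0 \<subseteq> Basis" "card B0 = 3" by (rule obtain_subset_with_card_n)
  define B :: "'m rn set" where "B = (\<lambda>b. (b, 0)) ` B0"
  have B: "B \<subseteq> Basis" "(0, 1) \<notin> B" "card B = 3"
    using B0 by (auto simp: B_def Basis_prod_def inj_on_def card_image)
  \<comment> \<open>Centres running to infinity along one tangential direction.\<close>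
  define a :: "nat \<Rightarrow> 'm rn" where "a j = (real j *\<^sub>R e0, 0)" for j
  have norm_a: "norm (a j) = real j" for j using e0 by (simp add: a_def norm_Pair)
  \<comment> \<open>The order of quantifiers matters: one profile serves all centres, hence one
    decay constant \<open>F\<close> for all \<open>j\<close>.\<close>
  have "\<exists>F. \<forall>j. \<exists>u. is_solution 0 u \<and> sign_changing u \<and> (\<forall>x. \<bar>u x\<bar> * (1 + (norm (x - a j))\<^sup>2) \<le> F)"
  proof (rule ode.exists_profile_extended, goal_cases)
    case (1 f f1 f2 F)
    have bp: "bounded_profile (a j) (0, 1) B f f1 f2 F" for j
    proof
      show "(0, 1) \<in> (Basis :: 'm rn set)" by (simp add: Basis_prod_def)
      show "a j \<bullet> (0, 1) = 0" by (simp add: a_def inner_prod_def)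
      show "DIM('m rn) \<ge> 5" by (rule assms(1))
    qed (use B 1 in auto)
    have "\<exists>u. is_solution 0 u \<and> sign_changing u \<and> (\<forall>x. \<bar>u x\<bar> * (1 + (norm (x - a j))\<^sup>2) \<le> F)" for j
      by (rule exists_solution[OF bp 1(7)[unfolded ode.c_def ode.p_def, unfolded n_def] 1(8,9)])
    then show ?case by blast
  qed
  then obtain F u where u: "\<And>j. is_solution 0 (u j)" "\<And>j. sign_changing (u j)"
      "\<And>j x. \<bar>u j x\<bar> * (1 + (norm (x - a j))\<^sup>2) \<le> F" by metis
  define cls where "cls j = ae_equal `` {u j}" for j
  have "cls ` UNIV \<subseteq> {u :: 'm rn \<Rightarrow> real. is_solution b u \<and> sign_changing u} // ae_equal"
    unfolding cls_def using u(1,2) assms(2) by (auto intro: quotientI)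
  then have "finite (cls ` UNIV)" using fin finite_subset by blast
  \<comment> \<open>With finitely many classes, one of them contains \<open>u j\<close> for
    infinitely many \<open>j\<close>.\<close>
  then obtain j0 where inf: "infinite {j \<in> UNIV. cls j = cls j0}"
    using pigeonhole_infinite[OF infinite_UNIV_nat] by blast
  have "AE x in lebesgue_on half_space. cls j = cls j0 \<longrightarrow> u j0 x = u j x" for j
  proof (cases "cls j = cls j0")
    case True
    have "u j \<in> cls j" unfolding cls_def ae_equal_def by simp
    then have "u j \<in> cls j0" using True by simp
    then show ?thesis unfolding cls_def ae_equal_def by simp
  qed simp
  \<comment> \<open>Countably many exceptional null sets are united, so that at almost every
    \<open>x\<close> the values \<open>u j x\<close> of the class are all equal.\<close>
  then have "AE x in lebesgue_on half_space. \<forall>j. cls j = cls j0 \<longrightarrow> u j0 x = u j x" by (simp add: AE_all_countable)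
  then have "AE x in lebesgue_on half_space. max (u j0 x) 0 = 0"
  proof eventually_elim
    case (elim x)
    have "u j0 x = 0"
    proof (rule ccontr)
      assume nz: "u j0 x \<noteq> 0"
      define \<epsilon> where "\<epsilon> = \<bar>u j0 x\<bar>"
      have \<epsilon>: "\<epsilon> > 0" using nz by (simp add: \<epsilon>_def)
      \<comment> \<open>For centres beyond \<open>k\<close> the distance \<open>t\<close> to
        \<open>x\<close> is at least \<open>\<bar>F\<bar> / \<epsilon>\<close> and at least 1, so
        the decay bound forces a value smaller than \<epsilon>. Thus \<open>u j0\<close> would
        vanish almost everywhere, against the change of sign.\<close>
      obtain k :: nat where k: "real k > norm x + \<bar>F\<bar> / \<epsilon> + 1" using reals_Archimedean2 by blast
      obtain j where j: "j > k" "cls j = cls j0" using inf unfolding infinite_nat_iff_unbounded by auto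
      define t where "t = norm (x - a j)"
      have "norm (a j) \<le> norm x + t" unfolding t_def using norm_triangle_sub[of "a j" x] by (simp add: norm_minus_commute)
      moreover have "0 \<le> \<bar>F\<bar> / \<epsilon>" using \<epsilon> by simp
      ultimately have t: "t \<ge> \<bar>F\<bar> / \<epsilon>" "t \<ge> 1" using k j(1) unfolding norm_a by linarith+
      have "t * 1 \<le> t * t" using t(2) by (intro mult_left_mono) auto
      then have "\<bar>F\<bar> / \<epsilon> < 1 + t\<^sup>2" using t(1) by (simp add: power2_eq_square)
      then have "\<bar>F\<bar> < \<epsilon> * (1 + t\<^sup>2)" using \<epsilon> by (simp add: divide_less_eq mult.commute)
      also have "\<dots> \<le> F" using u(3)[of j x] elim[rule_format, OF j(2)] unfolding \<epsilon>_def t_def by simp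
      finally show False by simp
    qed
    then show ?case by simp
  qed
  then show False using u(2)[of j0] unfolding sign_changing_def by blast
qed

end
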